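(* Let $d\ge3$ be an integer and let $q,r\ge2$ be real numbers with $\frac2q+\frac2r\le1$. Set $s=d\left(\frac12-\frac1q\right)-\frac3r$. Then there is a constant $C=C(d,q,r)$ such that $$\|U(t)u_0\|_{L^r_{t\in[0,1]}L^q(\mathbb{R}^d)}\le C\|u_0\|_{H^s(\mathbb{R}^d)}$$ for all $u_0\in\mathcal{S}(\mathbb{R}^d)$.
   Context: Frequencies in $\mathbb{R}^d$ are written $(\xi,\eta)$ with $\xi\in\mathbb{R}$, $\eta\in\mathbb{R}^{d-1}$. $\{U(t)\}_{t\in\mathbb{R}}$ is the unitary group of the linear equation $\partial_tu+\partial_x\Delta u=0$ on $\mathbb{R}^d\times\mathbb{R}$ (with $x$ the first space coordinate), given by $\widehat{U(t)u_0}(\xi,\eta)=e^{it\xi(\xi^2+|\eta|^2)}\widehat{u_0}(\xi,\eta)$, the Fourier transform being in the space variables. $\|F\|_{L^r_{t\in[0,1]}L^q(\mathbb{R}^d)}=\big(\int_0^1\|F(\cdot,t)\|_{L^q(\mathbb{R}^d)}^r\,dt\big)^{1/r}$, and $H^s(\mathbb{R}^d)$ is the inhomogeneous Sobolev space. *)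

theory Defs
  imports "HOL-Analysis.Analysis"
begin

text \<open>
  Iterated directional derivatives: \<open>iter_deriv [v1, ..., vm] f\<close> is
  \<open>\<partial>_v1 ... \<partial>_vm f\<close>.  It is only meaningful where the functions involved are
  (Frechet) differentiable, which \<open>schwartz\<close> requires at every stage.
\<close>

primrec iter_deriv ::
  "'a::euclidean_space list \<Rightarrow> ('a \<Rightarrow> complex) \<Rightarrow> 'a \<Rightarrow> complex" where
  "iter_deriv [] f = f"
| "iter_deriv (v # vs) f = (\<lambda>x. frechet_derivative (iter_deriv vs f) (at x) v)"

definition schwartz :: "('a::euclidean_space \<Rightarrow> complex) set" where
  "schwartz = {f. \<forall>vs. set vs \<subseteq> Basis \<longrightarrow>
     (\<forall>x. iter_deriv vs f differentiable (at x)) \<and>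
     (\<forall>k::nat. bounded (range (\<lambda>x. norm x ^ k *\<^sub>R iter_deriv vs f x)))}"

text \<open>
  The normalization is the one without \<open>2\<pi>\<close> in the exponent, so that differentiation
  becomes multiplication by \<open>\<i>\<close> times the frequency; this is what turns
  \<open>\<partial>_t u + \<partial>_x \<Delta> u = 0\<close> into the multiplier
  \<open>exp (\<i> t \<xi> (\<xi>^2 + |\<eta>|^2))\<close>.
\<close>

definition fourier :: "('a::euclidean_space \<Rightarrow> complex) \<Rightarrow> 'a \<Rightarrow> complex" where
  "fourier f \<zeta> = (LINT x|lborel. cis (- (x \<bullet> \<zeta>)) * f x)"

definition inv_fourier :: "('a::euclidean_space \<Rightarrow> complex) \<Rightarrow> 'a \<Rightarrow> complex" where
  "inv_fourier g x =
     complex_of_real (1 / (2 * pi) ^ DIM('a)) * (LINT \<zeta>|lborel. cis (x \<bullet> \<zeta>) * g \<zeta>)"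

text \<open>
  Physical space and frequency space are both \<open>real \<times> (real ^ 'm)\<close> (with the Euclidean
  norm), of dimension \<open>CARD('m) + 1\<close>.  For Schwartz data the multiplier times the
  Fourier transform is again Schwartz, so the inversion integral converges absolutely.
\<close>

definition U :: "real \<Rightarrow> (real \<times> (real ^ 'm) \<Rightarrow> complex) \<Rightarrow> real \<times> (real ^ 'm) \<Rightarrow> complex" where
  "U t u0 = inv_fourier (\<lambda>(\<xi>, \<eta>). cis (t * \<xi> * (\<xi>\<^sup>2 + (norm \<eta>)\<^sup>2)) * fourier u0 (\<xi>, \<eta>))"

text \<open>
  All norms take values in \<open>ennreal\<close>, so that a divergent integral yields \<open>\<infinity>\<close>.
  The power below is used for positive exponents only.
\<close>

definition ennreal_pow :: "ennreal \<Rightarrow> real \<Rightarrow> ennreal" where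
  "ennreal_pow a p = (if a = \<infinity> then \<infinity> else ennreal (enn2real a powr p))"

definition Lp_norm :: "real \<Rightarrow> ('a::euclidean_space \<Rightarrow> complex) \<Rightarrow> ennreal" where
  "Lp_norm q f = ennreal_pow (\<integral>\<^sup>+ x. ennreal (norm (f x) powr q) \<partial>lborel) (1 / q)"

definition mixed_norm ::
  "real \<Rightarrow> real \<Rightarrow> (real \<Rightarrow> 'a::euclidean_space \<Rightarrow> complex) \<Rightarrow> ennreal" where
  "mixed_norm r q F =
     ennreal_pow (\<integral>\<^sup>+ t \<in> {0..1}. ennreal_pow (Lp_norm q (F t)) r \<partial>lborel) (1 / r)"

definition sobolev_norm :: "real \<Rightarrow> ('a::euclidean_space \<Rightarrow> complex) \<Rightarrow> ennreal" where
  "sobolev_norm s f =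
     ennreal_pow (\<integral>\<^sup>+ \<zeta>. ennreal ((1 + (norm \<zeta>)\<^sup>2) powr s * (norm (fourier f \<zeta>))\<^sup>2) \<partial>lborel) (1 / 2)"

end

theory Submission
  imports Defs "HOL-Complex_Analysis.Complex_Analysis" "HOL-Probability.Probability"
begin

text \<open>
  Only \<open>g = fourier u0\<close> enters, and if \<open>g\<close> is not integrable then \<open>U t u0 = 0\<close>; so it suffices to
  bound \<open>\<integral> cis (x \<bullet> \<zeta> + t \<phi>(\<zeta>)) g(\<zeta>) d\<zeta>\<close> for \<open>g \<in> L\<^sup>1\<close>, which can even be done globally in time.
  The hypotheses force \<open>q, r > 2\<close>.

  In dimension three the transverse Gaussian integral reduces the kernel at time \<open>\<tau>\<close> to
  \<open>1/\<tau>\<close> times \<open>\<integral> sin (a\<xi> + b\<xi>\<^sup>3 + c/\<xi>) d\<xi>/\<xi>\<close>, which van der Corput's lemma bounds uniformly in \<open>a, b, c\<close>.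
  The \<open>TT\<^sup>*\<close> argument with Hardy-Littlewood-Sobolev then gives the estimate without loss of derivatives on
  the line \<open>1/q + 1/r = 1/2\<close>, uniformly for the phases \<open>\<phi> + \<theta>\<xi>\<close>. A further transverse
  variable with frequency \<open>\<kappa>\<close> only changes \<open>\<theta>\<close> into \<open>\<theta> + \<kappa>\<^sup>2\<close>, so one-dimensional Sobolev embedding and
  Minkowski's inequality add the remaining \<open>d - 3\<close> variables one at a time, at the cost of the weight
  \<open>\<bar>\<kappa>\<bar>\<close> to the power \<open>1 - 2/q\<close>. For \<open>1/q + 1/r < 1/2\<close> one estimates the level sets in time of the
  \<open>L\<^sup>q\<close> norm: frequencies below a threshold depending on the level are handled by
  \<open>d\<close>-dimensional Sobolev embedding, the others by the estimate on the line.
\<close>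

subsection \<open>Powers, Minkowski's inequality and level sets\<close>

text \<open>The phase is homogeneous of degree three, so in dimension three the decay
  \<open>1/|\<tau>|\<close> of the kernel is the scale-invariant one. Interpolated with
  \<open>L^2\<close> it becomes \<open>|\<tau>| powr (- (1 - 2/q))\<close>, and this is the exponent
  \<open>2/r\<close> of the Hardy-Littlewood-Sobolev kernel exactly when
  \<open>1/q + 1/r = 1/2\<close>. Hence \<open>s = 0\<close> on that line for \<open>d = 3\<close>.
  Each further transverse variable raises \<open>s\<close> by \<open>1/2 - 1/q\<close>, which is
  precisely what one-dimensional Sobolev embedding costs, so nothing is lost against scaling in any
  dimension.

  The obstacle is the kernel itself: its transverse integral converges only conditionally and leaves
  a factor \<open>1/\<xi>\<close>. Therefore a Gaussian with parameter \<open>\<epsilon>\<close> is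
  inserted and \<open>\<xi>\<close> is restricted to a symmetric band. The remaining phase is odd in
  \<open>\<xi>\<close>, so opposite frequencies combine to \<open>sin/\<xi>\<close>, which keeps the
  integrals bounded as the band grows. The dispersive bound is thus a statement about the limit
  \<open>\<epsilon> = 0\<close>, while the \<open>TT*\<close> identity is proved for
  \<open>\<epsilon> > 0\<close>; reconciling the two by limits inside inequalities is the main
  technical burden.\<close>

lemma ennreal_pow_ennreal: "0 \<le> x \<Longrightarrow> ennreal_pow (ennreal x) p = ennreal (x powr p)"
  by (simp add: ennreal_pow_def)

lemma ennreal_pow_top [simp]: "ennreal_pow \<infinity> p = \<infinity>" "ennreal_pow top p = top"
  by (simp_all add: ennreal_pow_def)

lemma ennreal_pow_0 [simp]: "ennreal_pow 0 p = 0"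
  by (simp add: ennreal_pow_def)

lemma ennreal_pow_1 [simp]: "ennreal_pow a 1 = a"
  by (cases a) (auto simp: ennreal_pow_def)

lemma ennreal_pow_one [simp]: "ennreal_pow 1 p = 1"
  by (simp add: ennreal_pow_def)

lemma ennreal_pow_mono: "a \<le> b \<Longrightarrow> 0 \<le> p \<Longrightarrow> ennreal_pow a p \<le> ennreal_pow b p"
  by (cases a; cases b) (auto simp: ennreal_pow_def top_unique powr_mono2)

lemma ennreal_pow_pow: "0 < r \<Longrightarrow> 0 < p \<Longrightarrow> ennreal_pow (ennreal_pow a p) r = ennreal_pow a (p * r)"
  by (cases a) (auto simp: ennreal_pow_def powr_powr)

lemma ennreal_pow_inverse [simp]:
  "0 < p \<Longrightarrow> ennreal_pow (ennreal_pow a p) (1 / p) = a"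
  "0 < p \<Longrightarrow> ennreal_pow (ennreal_pow a (1 / p)) p = a"
  by (simp_all add: ennreal_pow_pow)

lemma ennreal_pow_mult: "0 < p \<Longrightarrow> ennreal_pow (a * b) p = ennreal_pow a p * ennreal_pow b p"
proof (cases "a = top \<or> b = top")
  case True
  assume "0 < p"
  moreover have "a = 0 \<or> b = 0 \<or> ennreal_pow a p * ennreal_pow b p = top"
    using True by (cases a; cases b) (auto simp: ennreal_pow_ennreal ennreal_mult_top ennreal_top_mult)
  ultimately show ?thesis using True
    by (cases a; cases b) (auto simp: ennreal_mult_top ennreal_top_mult ennreal_pow_ennreal)
next
  case False
  then show ?thesis
    by (cases a; cases b) (auto simp: ennreal_pow_ennreal powr_mult simp flip: ennreal_mult)
qed

lemma ennreal_pow_add: "0 < p \<Longrightarrow> 0 < r \<Longrightarrow> ennreal_pow a (p + r) = ennreal_pow a p * ennreal_pow a r"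
  by (cases a) (auto simp: ennreal_pow_ennreal powr_add ennreal_mult ennreal_mult_top)

lemma ennreal_pow_le_iff: "0 < p \<Longrightarrow> ennreal_pow a p \<le> b \<longleftrightarrow> a \<le> ennreal_pow b (1 / p)"
  by (metis ennreal_pow_inverse ennreal_pow_mono less_eq_real_def zero_less_divide_1_iff)

lemma ennreal_pow_eq_0_iff [simp]: "ennreal_pow a p = 0 \<longleftrightarrow> a = 0"
  by (cases a) (auto simp: ennreal_pow_def)

lemma ennreal_pow_eq_top_iff [simp]: "ennreal_pow a p = top \<longleftrightarrow> a = top"
  by (cases a) (auto simp: ennreal_pow_def)

lemma measurable_ennreal_pow [measurable]:
  assumes [measurable]: "f \<in> borel_measurable M"
  shows "(\<lambda>x. ennreal_pow (f x) p) \<in> borel_measurable M"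
proof -
  have [measurable]: "{x \<in> space M. f x = \<infinity>} \<in> sets M"
    by (rule borel_measurable_eq) auto
  show ?thesis unfolding ennreal_pow_def by measurable
qed

text \<open>\<open>ennreal_pow_le_iff\<close> is a Galois connection, and left adjoints preserve
  suprema. This is the half that removes monotone truncations under a power.\<close>

lemma ennreal_pow_SUP_le: 
  fixes a :: "'i \<Rightarrow> ennreal"
  assumes "0 < p"
  shows "ennreal_pow (SUP i\<in>I. a i) p \<le> (SUP i\<in>I. ennreal_pow (a i) p)"
proof -
  have "a i \<le> ennreal_pow (SUP i\<in>I. ennreal_pow (a i) p) (1 / p)" if "i \<in> I" for i
    using SUP_upper[OF that, of "\<lambda>i. ennreal_pow (a i) p"] assms by (simp flip: ennreal_pow_le_iff)
  then have "(SUP i\<in>I. a i) \<le> ennreal_pow (SUP i\<in>I. ennreal_pow (a i) p) (1 / p)"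
    by (rule SUP_least)
  with assms show ?thesis by (simp add: ennreal_pow_le_iff)
qed

section \<open>Hoelder's and Minkowski's inequalities for functions with values in
  \<open>ennreal\<close>\<close>

lemma conjugate_exponent:
  fixes p q :: real
  assumes "1 < p" "1 / p + 1 / q = 1"
  shows "1 < q"
proof -
  have "1 / q = 1 - 1 / p" "0 < 1 / p" "1 / p < 1" using assms by auto
  then have "0 < 1 / q" "1 / q < 1" by auto
  then show ?thesis by (simp add: field_simps zero_less_divide_iff)
qed

text \<open>Convexity of \<open>exp\<close> at \<open>p * ln a\<close> and \<open>q * ln b\<close>
  with weights \<open>1/p\<close> and \<open>1/q\<close>.\<close>

lemma Young_powr:
  fixes a b :: real
  assumes "0 \<le> a" "0 \<le> b" "1 < p" "1 / p + 1 / q = 1"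
  shows "a * b \<le> a powr p / p + b powr q / q"
proof -
  have q: "q > 1" "q > 0" "0 < p" using conjugate_exponent[of p q] assms by auto
  show ?thesis
  proof (cases "a = 0 \<or> b = 0")
    case False
    then have ab: "0 < a" "0 < b" using assms by auto
    have "exp ((1 - 1 / q) *\<^sub>R (p * ln a) + (1 / q) *\<^sub>R (q * ln b))
        \<le> (1 - 1 / q) * exp (p * ln a) + (1 / q) * exp (q * ln b)"
      using q assms by (intro convex_onD[OF exp_convex, of "1 / q" "p * ln a" "q * ln b" ]) (auto simp: field_simps)
    moreover have "1 - 1 / q = 1 / p" using assms by simp
    ultimately show ?thesis using ab q by (simp add: exp_add powr_def)
  qed (use q assms in auto)
qed

lemma nn_integral_Holder:
  assumes [measurable]: "f \<in> borel_measurable M" "g \<in> borel_measurable M"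
    and p: "1 < p" "1 / p + 1 / q = 1"
  shows "(\<integral>\<^sup>+x. f x * g x \<partial>M) \<le> ennreal_pow (\<integral>\<^sup>+x. ennreal_pow (f x) p \<partial>M) (1 / p)
    * ennreal_pow (\<integral>\<^sup>+x. ennreal_pow (g x) q \<partial>M) (1 / q)"
    (is "_ \<le> ennreal_pow ?A _ * ennreal_pow ?B _")
proof -
  have q: "q > 1" "0 < p" "0 < q"
    using p conjugate_exponent[of p q] by auto
  consider "?A = 0" | "?B = 0" | "?A \<noteq> 0" "?B \<noteq> 0" "?A = top \<or> ?B = top" 
    | "?A \<noteq> 0" "?B \<noteq> 0" "?A \<noteq> top" "?B \<noteq> top" by blast
  then show ?thesis
  proof cases
    case 1
    then have "AE x in M. f x = 0" by (subst (asm) nn_integral_0_iff_AE) auto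
    then have "(\<integral>\<^sup>+x. f x * g x \<partial>M) = 0" by (subst nn_integral_0_iff_AE) auto
    then show ?thesis by simp
  next
    case 2
    then have "AE x in M. g x = 0" by (subst (asm) nn_integral_0_iff_AE) auto
    then have "(\<integral>\<^sup>+x. f x * g x \<partial>M) = 0" by (subst nn_integral_0_iff_AE) auto
    then show ?thesis by simp
  next
    case 3
    then have "ennreal_pow ?A (1/p) * ennreal_pow ?B (1/q) = top"
      by (auto simp: ennreal_mult_eq_top_iff)
    then show ?thesis by simp
  next
    case 4
    then obtain A B where A: "?A = ennreal A" "0 < A" and B: "?B = ennreal B" "0 < B"
      by (metis ennreal_cases ennreal_less_zero_iff gr_zeroI infinity_ennreal_def)
    \<comment> \<open>\<open>c\<close> is the bound to be proved. Young's inequality for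
      \<open>f / A powr (1/p)\<close> and \<open>g / B powr (1/q)\<close>, multiplied by
      \<open>c\<close> and integrated, gives \<open>c/p + c/q = c\<close>.\<close>
    define c where "c = A powr (1/p) * B powr (1/q)"
    have c: "c > 0" using A B by (simp add: c_def)
    have *: "f x * g x \<le> ennreal (c / (p * A)) * ennreal_pow (f x) p + ennreal (c / (q * B)) * ennreal_pow (g x) q" for x
    proof (cases "f x = top \<or> g x = top")
      case True
      then show ?thesis using c q A B by (auto simp: ennreal_mult_eq_top_iff ennreal_mult_top)
    next
      case False
      then obtain a b where ab: "f x = ennreal a" "0 \<le> a" "g x = ennreal b" "0 \<le> b"
        by (metis ennreal_cases infinity_ennreal_def)
      have "(a / A powr (1/p)) * (b / B powr (1/q)) \<le> (a / A powr (1/p)) powr p / p + (b / B powr (1/q)) powr q / q"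
        using ab A B p by (intro Young_powr) auto
      also have "(a / A powr (1/p)) powr p = a powr p / A" using A ab q by (simp add: powr_divide powr_powr)
      also have "(b / B powr (1/q)) powr q = b powr q / B" using B ab q by (simp add: powr_divide powr_powr)
      finally have "a * b / c \<le> a powr p / A / p + b powr q / B / q" by (simp add: c_def)
      then have "a * b \<le> c * (a powr p / A / p + b powr q / B / q)" using c by (simp add: field_simps)
      also have "\<dots> = c / (p * A) * a powr p + c / (q * B) * b powr q" by (simp add: field_simps)
      finally show ?thesis using ab c q A B
        by (simp add: ennreal_pow_ennreal flip: ennreal_mult ennreal_plus)
    qed
    have "(\<integral>\<^sup>+x. f x * g x \<partial>M) \<le> (\<integral>\<^sup>+x. ennreal (c / (p * A)) * ennreal_pow (f x) p + ennreal (c / (q * B)) * ennreal_pow (g x) q \<partial>M)"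
      by (intro nn_integral_mono *)
    also have "\<dots> = ennreal (c / (p * A)) * ennreal A + ennreal (c / (q * B)) * ennreal B"
      by (simp add: nn_integral_add nn_integral_cmult A B)
    also have "\<dots> = ennreal (c / p + c / q)" using A B c q
      by (simp flip: ennreal_mult ennreal_plus)
    also have "c / p + c / q = c" using p by (metis distrib_left mult.right_neutral times_divide_eq_right)
    also have "ennreal c = ennreal_pow ?A (1/p) * ennreal_pow ?B (1/q)"
      using A B by (simp add: c_def ennreal_pow_ennreal flip: ennreal_mult)
    finally show ?thesis .
  qed
qed

text \<open>The power \<open>p\<close> is split as \<open>(p - 1) + 1\<close>, one factor is
  expanded as an integral over \<open>z\<close>, and Hoelder's inequality in \<open>y\<close> for
  fixed \<open>z\<close> reproduces the left side to the power \<open>1/p'\<close>, which is then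
  cancelled. Cancelling requires finiteness, so the argument is carried out for truncations of the
  inner integral.\<close>

lemma nn_integral_Minkowski:
  assumes "sigma_finite_measure M" "sigma_finite_measure N"
    and [measurable]: "case_prod G \<in> borel_measurable (M \<Otimes>\<^sub>M N)" and p: "1 \<le> p"
  shows "(\<integral>\<^sup>+y. ennreal_pow (\<integral>\<^sup>+z. G y z \<partial>N) p \<partial>M)
    \<le> ennreal_pow (\<integral>\<^sup>+z. ennreal_pow (\<integral>\<^sup>+y. ennreal_pow (G y z) p \<partial>M) (1 / p) \<partial>N) p"
proof -
  interpret M: sigma_finite_measure M by fact
  interpret N: sigma_finite_measure N by fact
  interpret MN: pair_sigma_finite M N ..
  have [measurable]: "(\<lambda>(z, y). G y z) \<in> borel_measurable (N \<Otimes>\<^sub>M M)"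
    using measurable_pair_swap[OF assms(3)] by (simp add: case_prod_beta')
  show ?thesis
  proof (cases "p = 1")
    case True
    then show ?thesis using MN.Fubini'[of G] by simp
  next
    case False
    with p have p1: "1 < p" "0 < p" by auto
    define p' where "p' = p / (p - 1)"
    have p': "1 / p + 1 / p' = 1" "0 < p'" "(p - 1) * p' = p" "1 - 1 / p' = 1 / p"
      using p1 by (auto simp: p'_def field_simps)
    define S where "S y = (\<integral>\<^sup>+z. G y z \<partial>N)" for y
    define A where "A = (\<integral>\<^sup>+z. ennreal_pow (\<integral>\<^sup>+y. ennreal_pow (G y z) p \<partial>M) (1 / p) \<partial>N)"
    have [measurable]: "S \<in> borel_measurable M" unfolding S_def by measurable
    obtain B where B: "range B \<subseteq> sets M" "(\<Union>i. B i) = space M" "\<And>i. emeasure M (B i) \<noteq> \<infinity>" "incseq B"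
      using M.sigma_finite_incseq by blast
    have [measurable]: "B n \<in> sets M" for n using B by auto
    \<comment> \<open>Bounded by \<open>n\<close> and supported on a set of finite measure, so that
      its power integral is finite and can be divided out.\<close>
    define h where "h n y = min (S y) (of_nat n) * indicator (B n) y" for n y
    have [measurable]: "h n \<in> borel_measurable M" for n unfolding h_def by measurable
    have hS: "h n y \<le> S y" for n y by (auto simp: h_def indicator_def)
    have bd: "(\<integral>\<^sup>+y. ennreal_pow (h n y) p \<partial>M) \<le> ennreal_pow A p" for n
    proof -
      let ?I = "\<integral>\<^sup>+y. ennreal_pow (h n y) p \<partial>M"
      have "?I \<le> (\<integral>\<^sup>+y. ennreal_pow (of_nat n) p * indicator (B n) y \<partial>M)"
        using p1 by (intro nn_integral_mono) (auto simp: h_def indicator_def intro!: ennreal_pow_mono)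
      also have "\<dots> = ennreal_pow (of_nat n) p * emeasure M (B n)"
        by (subst nn_integral_cmult_indicator) auto
      also have "\<dots> < top" using B(3)[of n]
        by (intro ennreal_mult_less_top[THEN iffD2] disjI2 conjI)
          (auto simp: less_top ennreal_of_nat_eq_real_of_nat ennreal_pow_ennreal)
      finally have fin: "?I < top" .
      have "?I = (\<integral>\<^sup>+y. ennreal_pow (h n y) (p - 1) * h n y \<partial>M)"
        using p1 ennreal_pow_add[of "p - 1" 1] by simp
      \<comment> \<open>Only one factor is enlarged to \<open>S\<close>, which is linear in
        \<open>G\<close>; the remaining power stays truncated so that the left side reappears after
        Hoelder.\<close>
      also have "\<dots> \<le> (\<integral>\<^sup>+y. ennreal_pow (h n y) (p - 1) * S y \<partial>M)"
        by (intro nn_integral_mono mult_left_mono hS) auto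
      also have "\<dots> = (\<integral>\<^sup>+y. \<integral>\<^sup>+z. ennreal_pow (h n y) (p - 1) * G y z \<partial>N \<partial>M)"
        unfolding S_def by (intro nn_integral_cong) (simp add: nn_integral_cmult)
      also have "\<dots> = (\<integral>\<^sup>+z. \<integral>\<^sup>+y. ennreal_pow (h n y) (p - 1) * G y z \<partial>M \<partial>N)"
        by (rule MN.Fubini'[symmetric]) measurable
      also have "\<dots> \<le> (\<integral>\<^sup>+z. ennreal_pow ?I (1 / p') * ennreal_pow (\<integral>\<^sup>+y. ennreal_pow (G y z) p \<partial>M) (1 / p) \<partial>N)"
      proof (intro nn_integral_mono)
        fix z assume [measurable]: "z \<in> space N"
        have "(\<integral>\<^sup>+y. G y z * ennreal_pow (h n y) (p - 1) \<partial>M)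
          \<le> ennreal_pow (\<integral>\<^sup>+y. ennreal_pow (G y z) p \<partial>M) (1 / p) * ennreal_pow (\<integral>\<^sup>+y. ennreal_pow (ennreal_pow (h n y) (p - 1)) p' \<partial>M) (1 / p')"
          using p' p1 by (intro nn_integral_Holder) auto
        also have "(\<integral>\<^sup>+y. ennreal_pow (ennreal_pow (h n y) (p - 1)) p' \<partial>M) = ?I"
          using p' p1 by (simp add: ennreal_pow_pow)
        finally show "(\<integral>\<^sup>+y. ennreal_pow (h n y) (p - 1) * G y z \<partial>M) \<le> ennreal_pow ?I (1 / p') * ennreal_pow (\<integral>\<^sup>+y. ennreal_pow (G y z) p \<partial>M) (1 / p)"
          by (simp add: mult.commute)
      qed
      also have "\<dots> = ennreal_pow ?I (1 / p') * A"
        unfolding A_def by (simp add: nn_integral_cmult)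
      finally have *: "?I \<le> ennreal_pow ?I (1 / p') * A" .
      have "ennreal_pow ?I (1 / p) \<le> A"
      proof (cases "?I = 0")
        case False
        have "ennreal_pow ?I (1 / p') * ennreal_pow ?I (1 / p) \<le> ennreal_pow ?I (1 / p') * A"
          using * ennreal_pow_add[of "1 / p'" "1 / p" ?I] p' p1 by (simp add: add.commute)
        moreover have "ennreal_pow ?I (1 / p') \<noteq> 0" "ennreal_pow ?I (1 / p') \<noteq> top"
          using False fin by auto
        ultimately show ?thesis by (simp add: ennreal_mult_le_mult_iff)
      qed simp
      then show ?thesis using p1 ennreal_pow_le_iff[of "1 / p" ?I A] by simp
    qed
    have inc: "incseq h"
    proof (intro incseq_SucI le_funI)
      fix n y
      have "B n \<subseteq> B (Suc n)" using B(4) by (simp add: incseq_SucD)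
      moreover have "min (S y) (of_nat n) \<le> min (S y) (of_nat (Suc n))"
        by (intro min.mono) (auto simp del: of_nat_Suc)
      ultimately show "h n y \<le> h (Suc n) y"
        unfolding h_def by (auto simp: indicator_def simp del: of_nat_Suc)
    qed
    have SUPh: "S y \<le> (SUP n. h n y)" if y: "y \<in> space M" for y
    proof (rule dense_le)
      fix x assume x: "x < S y"
      then have "x < top" by (rule order_less_le_trans) simp
      then obtain m where m: "x < of_nat m" using ennreal_Ex_less_of_nat by blast
      obtain k where k: "y \<in> B k" using B(2) y by blast
      have "y \<in> B (max m k)" using k B(4) by (meson incseqD in_mono max.cobounded2)
      moreover have "x \<le> min (S y) (of_nat (max m k))"
      proof -
        have "(of_nat m :: ennreal) \<le> of_nat (max m k)" by (simp only: of_nat_le_iff max.cobounded1)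
        with m have "x \<le> of_nat (max m k)" by (rule order_trans[OF less_imp_le])
        with x show ?thesis by (intro min.boundedI less_imp_le[of x "S y"])
      qed
      ultimately have "x \<le> h (max m k) y" by (simp add: h_def)
      then show "x \<le> (SUP n. h n y)" by (rule SUP_upper2[OF UNIV_I])
    qed
    have "(\<integral>\<^sup>+y. ennreal_pow (S y) p \<partial>M) \<le> (\<integral>\<^sup>+y. (SUP n. ennreal_pow (h n y) p) \<partial>M)"
    proof (intro nn_integral_mono)
      fix y assume "y \<in> space M"
      then have "ennreal_pow (S y) p \<le> ennreal_pow (SUP n. h n y) p"
        using p1 by (intro ennreal_pow_mono SUPh) auto
      also have "\<dots> \<le> (SUP n. ennreal_pow (h n y) p)" by (rule ennreal_pow_SUP_le[OF p1(2)])
      finally show "ennreal_pow (S y) p \<le> (SUP n. ennreal_pow (h n y) p)" .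
    qed
    also have "\<dots> = (SUP n. (\<integral>\<^sup>+y. ennreal_pow (h n y) p \<partial>M))"
      using inc p1 by (intro nn_integral_monotone_convergence_SUP)
         (auto simp: incseq_def le_fun_def intro!: ennreal_pow_mono)
    also have "\<dots> \<le> ennreal_pow A p" by (intro SUP_least bd)
    finally show ?thesis unfolding S_def A_def .
  qed
qed

section \<open>Power integrals and the layer cake formula\<close>

lemma nn_integral_powr_from_0:
  assumes "0 < s" "0 \<le> c"
  shows "(\<integral>\<^sup>+x. ennreal (x powr (s - 1)) * indicator {0..c} x \<partial>lborel) = ennreal (c powr s / s)"
  using has_integral_powr_from_0[of "s - 1" c] assms
  by (subst nn_integral_has_integral_lebesgue') auto

lemma nn_integral_powr_to_infinity:
  assumes "0 < s" "0 < c"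
  shows "(\<integral>\<^sup>+x. ennreal (x powr (- s - 1)) * indicator {c..} x \<partial>lborel) = ennreal (c powr (- s) / s)"
  using has_integral_powr_to_inf[of "- s - 1" c] assms
  by (subst nn_integral_has_integral_lebesgue') auto

lemma nn_integral_lborel_abs:
  fixes f :: "real \<Rightarrow> ennreal"
  assumes [measurable]: "f \<in> borel_measurable borel"
  shows "(\<integral>\<^sup>+x. f \<bar>x - s\<bar> \<partial>lborel) \<le> 2 * (\<integral>\<^sup>+x. f x * indicator {0..} x \<partial>lborel)"
proof -
  have "(\<integral>\<^sup>+x. f \<bar>x - s\<bar> \<partial>lborel) = (\<integral>\<^sup>+x. f \<bar>x\<bar> \<partial>lborel)"
    by (subst nn_integral_real_affine[where c = 1 and t = s]) auto
  also have "\<dots> \<le> (\<integral>\<^sup>+x. f x * indicator {0..} x + f (- x) * indicator {0..} (- x) \<partial>lborel)"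
    by (intro nn_integral_mono) (auto simp: indicator_def)
  also have "\<dots> = (\<integral>\<^sup>+x. f x * indicator {0..} x \<partial>lborel) + (\<integral>\<^sup>+x. f (- x) * indicator {0..} (- x) \<partial>lborel)"
    by (intro nn_integral_add) auto
  also have "(\<integral>\<^sup>+x. f (- x) * indicator {0..} (- x) \<partial>lborel) = (\<integral>\<^sup>+x. f x * indicator {0..} x \<partial>lborel)"
    by (subst nn_integral_real_affine[where c = "-1" and t = 0]) auto
  finally show ?thesis by (simp add: mult_2)
qed

lemma nn_integral_powr_greaterThanLessThan:
  assumes "0 < s" "0 \<le> c"
  shows "(\<integral>\<^sup>+x. ennreal (x powr (s - 1)) * indicator {0<..c} x \<partial>lborel) = ennreal (c powr s / s)"
    "(\<integral>\<^sup>+x. ennreal (x powr (s - 1)) * indicator {0<..<c} x \<partial>lborel) = ennreal (c powr s / s)"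
proof -
  have "AE x in lborel. x \<noteq> 0 \<and> x \<noteq> c"
    using AE_lborel_singleton[of 0] AE_lborel_singleton[of c] by eventually_elim auto
  then show "(\<integral>\<^sup>+x. ennreal (x powr (s - 1)) * indicator {0<..c} x \<partial>lborel) = ennreal (c powr s / s)"
    "(\<integral>\<^sup>+x. ennreal (x powr (s - 1)) * indicator {0<..<c} x \<partial>lborel) = ennreal (c powr s / s)"
    unfolding nn_integral_powr_from_0[OF assms, symmetric]
    by (intro nn_integral_cong_AE; eventually_elim; auto simp: indicator_def)+
qed

lemma ennreal_pow_layer_cake:
  assumes "0 < q"
  shows "ennreal_pow a q \<le> (\<integral>\<^sup>+l. ennreal (q * l powr (q - 1)) * indicator {l. 0 < l \<and> ennreal l < a} l \<partial>lborel)"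
proof -
  have *: "ennreal (c powr q) = (\<integral>\<^sup>+l. ennreal (q * l powr (q - 1)) * indicator {0<..<c} l \<partial>lborel)" if "0 \<le> c" for c
  proof -
    have "ennreal (c powr q) = ennreal q * ennreal (c powr q / q)"
      using assms by (simp flip: ennreal_mult)
    also have "\<dots> = ennreal q * (\<integral>\<^sup>+l. ennreal (l powr (q - 1)) * indicator {0<..<c} l \<partial>lborel)"
      by (subst nn_integral_powr_greaterThanLessThan(2)) (use assms that in auto)
    also have "\<dots> = (\<integral>\<^sup>+l. ennreal (q * l powr (q - 1)) * indicator {0<..<c} l \<partial>lborel)"
      using assms by (subst nn_integral_cmult[symmetric]) (auto simp: ennreal_mult mult.assoc)
    finally show ?thesis .
  qed
  show ?thesis
  proof (cases a)
    case (real c)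
    then have "{l. 0 < l \<and> ennreal l < a} = {0<..<c}" by (auto simp: ennreal_less_iff)
    then show ?thesis using real *[of c] by (simp add: ennreal_pow_ennreal)
  next
    case top
    let ?I = "\<integral>\<^sup>+l. ennreal (q * l powr (q - 1)) * indicator {l. 0 < l \<and> ennreal l < a} l \<partial>lborel"
    have le: "ennreal (c powr q) \<le> ?I" if "0 \<le> c" for c
      unfolding *[OF that] by (intro nn_integral_mono) (auto simp: indicator_def top)
    \<comment> \<open>By \<open>le\<close> the integral is at least \<open>c powr q\<close> for
      every \<open>c\<close>; if it were a finite \<open>r\<close>, the choice
      \<open>c powr q = r + 1\<close> would be a contradiction.\<close>
    have "?I = top"
    proof (rule ccontr)
      assume "?I \<noteq> top"
      then obtain r where r: "?I = ennreal r" "0 \<le> r" by (cases ?I) auto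
      with le[of "(r + 1) powr (1 / q)"] assms show False by (simp add: powr_powr)
    qed
    then show ?thesis by simp
  qed
qed

text \<open>
  The layer cake formula followed by Minkowski's inequality in \<open>L\<close>-\<open>p/2\<close>. The threshold \<open>b\<close> marks the
  frequencies \<open>z\<close> that contribute at level \<open>l\<close>; all real interpolation below is done with it.
\<close>

lemma nn_integral_level_sets:
  fixes f :: "'x \<Rightarrow> ennreal" and h :: "'z \<Rightarrow> ennreal" and b :: "'z \<Rightarrow> real"
  assumes M: "sigma_finite_measure M" and N: "sigma_finite_measure N"
    and [measurable]: "f \<in> borel_measurable M" "h \<in> borel_measurable N" "b \<in> borel_measurable N"
    and pq: "2 \<le> p" "p < q" and C: "0 \<le> C" and b: "\<And>z. 0 \<le> b z"
    and lev: "\<And>l. 0 < l \<Longrightarrow> emeasure M {x\<in>space M. ennreal l < f x}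
       \<le> ennreal (C * l powr (- p)) * ennreal_pow (\<integral>\<^sup>+z. h z * indicator {z. l \<le> b z} z \<partial>N) (p / 2)"
  shows "(\<integral>\<^sup>+x. ennreal_pow (f x) q \<partial>M)
    \<le> ennreal (C * q / (q - p)) * ennreal_pow (\<integral>\<^sup>+z. h z * ennreal (b z powr (2 * (q - p) / p)) \<partial>N) (p / 2)"
proof -
  interpret M: sigma_finite_measure M by fact
  interpret N: sigma_finite_measure N by fact
  interpret MLb: pair_sigma_finite M "lborel :: real measure" ..
  interpret NLb: pair_sigma_finite N "lborel :: real measure" ..
  \<comment> \<open>Raised to the power \<open>p/2\<close>, \<open>l powr e\<close> becomes
    \<open>l powr (q - p - 1)\<close>, the product of the layer cake weight and the factor
    \<open>l powr (- p)\<close> of \<open>lev\<close>. The weight can thus be moved inside the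
    integral over \<open>z\<close> before Minkowski's inequality is applied.\<close>
  define e where "e = (q - 1 - p) * (2 / p)"
  define w where "w l z = (ennreal (l powr e) * indicator {0<..} l) * (h z * indicator {z. l \<le> b z} z)" for l z
  have q: "0 < q" "0 < q - p" "0 < p" using pq by auto
  have ind: "indicator {z. l \<le> b z} z = indicator {z. (snd z::real) \<le> b (fst z)} (z, l)" for l z
    by (simp add: indicator_def)
  have [measurable]: "case_prod w \<in> borel_measurable (lborel \<Otimes>\<^sub>M N)"
    unfolding w_def case_prod_beta' indicator_def by measurable
  have "e * (p / 2) = q - p - 1" using q by (simp add: e_def)
  then have pw: "(l powr e) powr (p / 2) = l powr (q - p - 1)" for l
    by (simp only: powr_powr)
  have wp: "ennreal_pow (w l z) (p / 2) = ennreal (l powr ((q - p) - 1)) * indicator {0<..b z} l * ennreal_pow (h z) (p / 2)" for l z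
    using q unfolding w_def
    by (auto simp: ennreal_pow_mult ennreal_pow_ennreal pw indicator_def mult.commute)
  have "(\<integral>\<^sup>+x. ennreal_pow (f x) q \<partial>M)
     \<le> (\<integral>\<^sup>+x. \<integral>\<^sup>+l. ennreal (q * l powr (q - 1)) * indicator {l. 0 < l \<and> ennreal l < f x} l \<partial>lborel \<partial>M)"
    by (intro nn_integral_mono ennreal_pow_layer_cake q)
  also have "\<dots> = (\<integral>\<^sup>+l. \<integral>\<^sup>+x. ennreal (q * l powr (q - 1)) * indicator {l. 0 < l \<and> ennreal l < f x} l \<partial>M \<partial>lborel)"
    unfolding indicator_def by (rule MLb.Fubini'[symmetric]) measurable
  also have "\<dots> = (\<integral>\<^sup>+l. ennreal (q * l powr (q - 1)) * indicator {0<..} l * emeasure M {x\<in>space M. ennreal l < f x} \<partial>lborel)"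
  proof (intro nn_integral_cong)
    fix l :: real
    have "(\<integral>\<^sup>+x. ennreal (q * l powr (q - 1)) * indicator {l. 0 < l \<and> ennreal l < f x} l \<partial>M)
      = (\<integral>\<^sup>+x. ennreal (q * l powr (q - 1)) * indicator {0<..} l * indicator {x\<in>space M. ennreal l < f x} x \<partial>M)"
      by (intro nn_integral_cong) (auto simp: indicator_def)
    then show "(\<integral>\<^sup>+x. ennreal (q * l powr (q - 1)) * indicator {l. 0 < l \<and> ennreal l < f x} l \<partial>M)
      = ennreal (q * l powr (q - 1)) * indicator {0<..} l * emeasure M {x\<in>space M. ennreal l < f x}"
      by (simp add: nn_integral_cmult_indicator)
  qed
  also have "\<dots> \<le> (\<integral>\<^sup>+l. ennreal (C * q) * ennreal_pow (\<integral>\<^sup>+z. w l z \<partial>N) (p / 2) \<partial>lborel)"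
  proof (intro nn_integral_mono)
    fix l :: real
    show "ennreal (q * l powr (q - 1)) * indicator {0<..} l * emeasure M {x\<in>space M. ennreal l < f x}
       \<le> ennreal (C * q) * ennreal_pow (\<integral>\<^sup>+z. w l z \<partial>N) (p / 2)"
    proof (cases "0 < l")
      case True
      have "(\<integral>\<^sup>+z. w l z \<partial>N) = ennreal (l powr e) * (\<integral>\<^sup>+z. h z * indicator {z. l \<le> b z} z \<partial>N)"
        unfolding w_def indicator_def by (subst nn_integral_cmult) (use True in auto)
      then have "ennreal_pow (\<integral>\<^sup>+z. w l z \<partial>N) (p / 2)
         = ennreal (l powr (q - p - 1)) * ennreal_pow (\<integral>\<^sup>+z. h z * indicator {z. l \<le> b z} z \<partial>N) (p / 2)"
        using q by (simp add: ennreal_pow_mult ennreal_pow_ennreal pw)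
      moreover have "ennreal (q * l powr (q - 1)) * indicator {0<..} l * emeasure M {x\<in>space M. ennreal l < f x}
         \<le> ennreal (q * l powr (q - 1)) * (ennreal (C * l powr (- p)) * ennreal_pow (\<integral>\<^sup>+z. h z * indicator {z. l \<le> b z} z \<partial>N) (p / 2))"
        using True lev[OF True] by (simp add: mult_left_mono)
      moreover have "ennreal (q * l powr (q - 1)) * ennreal (C * l powr (- p)) = ennreal (C * q) * ennreal (l powr (q - p - 1))"
        using q C True powr_add[of l "q - 1" "- p"]
        by (simp flip: ennreal_mult add: mult_ac diff_diff_eq add.commute)
      ultimately show ?thesis by (simp add: mult.assoc[symmetric])
    qed simp
  qed
  also have "\<dots> = ennreal (C * q) * (\<integral>\<^sup>+l. ennreal_pow (\<integral>\<^sup>+z. w l z \<partial>N) (p / 2) \<partial>lborel)"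
    by (intro nn_integral_cmult) measurable
  also have "\<dots> \<le> ennreal (C * q) * ennreal_pow (\<integral>\<^sup>+z. ennreal_pow (\<integral>\<^sup>+l. ennreal_pow (w l z) (p / 2) \<partial>lborel) (1 / (p / 2)) \<partial>N) (p / 2)"
    using pq by (intro mult_left_mono nn_integral_Minkowski sigma_finite_lborel N) auto
  also have "(\<integral>\<^sup>+z. ennreal_pow (\<integral>\<^sup>+l. ennreal_pow (w l z) (p / 2) \<partial>lborel) (1 / (p / 2)) \<partial>N)
     = (\<integral>\<^sup>+z. ennreal ((1 / (q - p)) powr (2 / p)) * (h z * ennreal (b z powr (2 * (q - p) / p))) \<partial>N)"
  proof (intro nn_integral_cong)
    \<comment> \<open>For fixed \<open>z\<close> only the levels \<open>0 < l \<le> b z\<close>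
      contribute, and \<open>q > p\<close> makes the power of \<open>l\<close> integrable at
      0.\<close>
    fix z
    have "(\<integral>\<^sup>+l. ennreal_pow (w l z) (p / 2) \<partial>lborel) = ennreal (b z powr (q - p) / (q - p)) * ennreal_pow (h z) (p / 2)"
      unfolding wp by (subst nn_integral_multc) (simp_all add: nn_integral_powr_greaterThanLessThan pq b)
    then show "ennreal_pow (\<integral>\<^sup>+l. ennreal_pow (w l z) (p / 2) \<partial>lborel) (1 / (p / 2))
      = ennreal ((1 / (q - p)) powr (2 / p)) * (h z * ennreal (b z powr (2 * (q - p) / p)))"
      using q ennreal_pow_inverse(1)[of "p / 2" "h z"]
      by (simp add: ennreal_pow_mult ennreal_pow_ennreal powr_divide powr_powr mult_ac flip: ennreal_mult)
  qed
  also have "\<dots> = ennreal ((1 / (q - p)) powr (2 / p)) * (\<integral>\<^sup>+z. (h z * ennreal (b z powr (2 * (q - p) / p))) \<partial>N)"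
    by (intro nn_integral_cmult) measurable
  also have "ennreal (C * q) * ennreal_pow \<dots> (p / 2) = ennreal (C * q / (q - p)) * ennreal_pow (\<integral>\<^sup>+z. h z * ennreal (b z powr (2 * (q - p) / p)) \<partial>N) (p / 2)"
    using q C by (simp add: ennreal_pow_mult ennreal_pow_ennreal powr_powr mult.assoc[symmetric] flip: ennreal_mult)
  finally show ?thesis .
qed

text \<open>By symmetry it suffices to integrate over \<open>f t \<le> f s\<close>. For fixed
  \<open>s\<close>, times within a distance \<open>\<rho>\<close> of \<open>s\<close> are treated
  with \<open>f t \<le> f s\<close>, where \<open>r > 2\<close> makes the kernel integrable; times
  further away by Hoelder with exponents \<open>r\<close> and \<open>p\<close>, where the kernel to
  the power \<open>r\<close> is \<open>|t - s|\<close> to the power -2.\<close>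

lemma Hardy_Littlewood_Sobolev_diag:
  fixes f :: "real \<Rightarrow> real"
  assumes [measurable]: "f \<in> borel_measurable borel" and f: "\<And>x. 0 \<le> f x" and r: "2 < r"
    and p: "p = r / (r - 1)"
  shows "(\<integral>\<^sup>+s. \<integral>\<^sup>+t. ennreal (f s * f t * \<bar>t - s\<bar> powr (- 2 / r)) \<partial>lborel \<partial>lborel)
    \<le> ennreal (8 * r / (r - 2) + 8) * ennreal_pow (\<integral>\<^sup>+s. ennreal (f s powr p) \<partial>lborel) (2 / p)"
proof -
  have pr: "1 < p" "1 / p + 1 / r = 1" "p < 2" using r by (auto simp: p field_simps)
  define S where "S = (\<integral>\<^sup>+s. ennreal (f s powr p) \<partial>lborel)"
  define k where "k s t = f s * f t * \<bar>t - s\<bar> powr (- 2 / r)" for s t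
  have [measurable]: "case_prod k \<in> borel_measurable (borel \<Otimes>\<^sub>M borel)" unfolding k_def by measurable
  consider "S = 0" | "S = top" | s where "S = ennreal s" "0 < s"
    by (metis ennreal_cases ennreal_less_zero_iff gr_zeroI infinity_ennreal_def)
  then show ?thesis
  proof cases
    case 1
    then have "AE s in lborel. f s = 0" unfolding S_def
      using pr f by (subst (asm) nn_integral_0_iff_AE) (auto simp: powr_ge_zero elim!: eventually_mono dest!: antisym[OF _ powr_ge_zero])
    then have "(\<integral>\<^sup>+s. \<integral>\<^sup>+t. ennreal (k s t) \<partial>lborel \<partial>lborel) = (\<integral>\<^sup>+s. 0 \<partial>(lborel :: real measure))"
      by (intro nn_integral_cong_AE) (auto elim!: eventually_mono simp: k_def)
    then show ?thesis by (simp add: k_def)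
  next
    case 2
    then show ?thesis using r by (simp add: S_def[symmetric] ennreal_mult_top add_pos_pos divide_pos_pos)
  next
    case (3 S')
    \<comment> \<open>The near part gives \<open>2 / (1 - 2/r) = 2 * r / (r - 2)\<close>, the far
      part \<open>2 powr (1/r) \<le> 2\<close>.\<close>
    define K where "K = 2 * r / (r - 2) + 2"
    have inner: "(\<integral>\<^sup>+t. ennreal (\<bar>t - s\<bar> powr (- 2 / r) * f t) * indicator {t. f t \<le> f s} t \<partial>lborel)
         \<le> ennreal (K * f s powr (p - 1) * S' powr (1 - 2 / r))" if A: "0 < f s" for s
    proof -
      \<comment> \<open>This radius equates the near term \<open>f s * \<rho> powr (1 - 2/r)\<close>
        with the far term \<open>\<rho> powr (- 1/r) * S' powr (1/p)\<close>. Both become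
        \<open>f s powr (p - 1) * S' powr (1 - 2/r)\<close>, and the outer factor \<open>f s\<close>
        completes the integrable power \<open>f s powr p\<close>.\<close>
      define \<rho> where "\<rho> = S' * f s powr (- p)"
      have \<rho>: "0 < \<rho>" using A 3 by (simp add: \<rho>_def)
      have "(\<integral>\<^sup>+t. ennreal (\<bar>t - s\<bar> powr (- 2 / r) * f t) * indicator {t. f t \<le> f s} t \<partial>lborel)
        \<le> (\<integral>\<^sup>+t. ennreal (f s) * (ennreal (\<bar>t - s\<bar> powr (- 2 / r)) * indicator {0..\<rho>} \<bar>t - s\<bar>)
             + (ennreal (\<bar>t - s\<bar> powr (- 2 / r)) * indicator {\<rho>..} \<bar>t - s\<bar>) * ennreal (f t) \<partial>lborel)"
        using f by (intro nn_integral_mono)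
          (auto simp: indicator_def ennreal_mult' mult.commute intro!: mult_right_mono ennreal_leI)
      also have "\<dots> = ennreal (f s) * (\<integral>\<^sup>+t. ennreal (\<bar>t - s\<bar> powr (- 2 / r)) * indicator {0..\<rho>} \<bar>t - s\<bar> \<partial>lborel)
           + (\<integral>\<^sup>+t. (ennreal (\<bar>t - s\<bar> powr (- 2 / r)) * indicator {\<rho>..} \<bar>t - s\<bar>) * ennreal (f t) \<partial>lborel)"
        unfolding indicator_def by (subst nn_integral_add) (auto simp: nn_integral_cmult)
      also have "(\<integral>\<^sup>+t. ennreal (\<bar>t - s\<bar> powr (- 2 / r)) * indicator {0..\<rho>} \<bar>t - s\<bar> \<partial>lborel)
          \<le> 2 * (\<integral>\<^sup>+t. (ennreal (t powr (- 2 / r)) * indicator {0..\<rho>} t) * indicator {0..} t \<partial>lborel)"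
        by (rule nn_integral_lborel_abs) measurable
      also have "(\<integral>\<^sup>+t. (ennreal (t powr (- 2 / r)) * indicator {0..\<rho>} t) * indicator {0..} t \<partial>lborel)
          = (\<integral>\<^sup>+t. ennreal (t powr ((1 - 2 / r) - 1)) * indicator {0..\<rho>} t \<partial>lborel)"
        by (intro nn_integral_cong) (auto simp: indicator_def)
      also have "\<dots> = ennreal (\<rho> powr (1 - 2 / r) / (1 - 2 / r))"
        by (rule nn_integral_powr_from_0) (use \<rho> r in auto)
      also have "(\<integral>\<^sup>+t. (ennreal (\<bar>t - s\<bar> powr (- 2 / r)) * indicator {\<rho>..} \<bar>t - s\<bar>) * ennreal (f t) \<partial>lborel)
         \<le> ennreal_pow (\<integral>\<^sup>+t. ennreal_pow (ennreal (\<bar>t - s\<bar> powr (- 2 / r)) * indicator {\<rho>..} \<bar>t - s\<bar>) r \<partial>lborel) (1 / r)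
            * ennreal_pow (\<integral>\<^sup>+t. ennreal_pow (ennreal (f t)) p \<partial>lborel) (1 / p)"
        unfolding indicator_def using pr r by (intro nn_integral_Holder) (auto simp: add.commute)
      also have "(\<integral>\<^sup>+t. ennreal_pow (ennreal (f t)) p \<partial>lborel) = ennreal S'"
        using 3 f by (simp add: S_def ennreal_pow_ennreal)
      also have "(\<integral>\<^sup>+t. ennreal_pow (ennreal (\<bar>t - s\<bar> powr (- 2 / r)) * indicator {\<rho>..} \<bar>t - s\<bar>) r \<partial>lborel)
         = (\<integral>\<^sup>+t. ennreal (\<bar>t - s\<bar> powr (- 1 - 1)) * indicator {\<rho>..} \<bar>t - s\<bar> \<partial>lborel)"
        using r by (intro nn_integral_cong) (auto simp: indicator_def ennreal_pow_ennreal powr_powr)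
      also have "\<dots> \<le> 2 * (\<integral>\<^sup>+t. (ennreal (t powr (- 1 - 1)) * indicator {\<rho>..} t) * indicator {0..} t \<partial>lborel)"
        by (rule nn_integral_lborel_abs) measurable
      also have "(\<integral>\<^sup>+t. (ennreal (t powr (- 1 - 1)) * indicator {\<rho>..} t) * indicator {0..} t \<partial>lborel) = (\<integral>\<^sup>+t. ennreal (t powr (- 1 - 1)) * indicator {\<rho>..} t \<partial>lborel)"
        using \<rho> by (intro nn_integral_cong) (auto simp: indicator_def)
      also have "\<dots> = ennreal (\<rho> powr (- 1) / 1)"
        by (rule nn_integral_powr_to_infinity) (use \<rho> in auto)
      finally have "(\<integral>\<^sup>+t. ennreal (\<bar>t - s\<bar> powr (- 2 / r) * f t) * indicator {t. f t \<le> f s} t \<partial>lborel)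
         \<le> ennreal (f s) * (2 * ennreal (\<rho> powr (1 - 2 / r) / (1 - 2 / r)))
          + ennreal_pow (2 * ennreal (\<rho> powr (- 1) / 1)) (1 / r) * ennreal_pow (ennreal S') (1 / p)"
        using r by (auto simp: mult_left_mono add_mono mult_right_mono ennreal_pow_mono)
      also have "\<dots> = ennreal (2 / (1 - 2 / r) * (f s * \<rho> powr (1 - 2 / r)) + 2 powr (1 / r) * (\<rho> powr (- 1 / r) * S' powr (1 / p)))"
        using A r \<rho> 3
        by (simp add: ennreal_pow_mult ennreal_pow_ennreal powr_powr powr_mult powr_minus_divide powr_divide mult_ac ennreal_plus[symmetric] ennreal_mult[symmetric]
            flip: ennreal_numeral del: ennreal_plus)
      also have "f s * \<rho> powr (1 - 2 / r) = f s powr (p - 1) * S' powr (1 - 2 / r)"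
      proof -
        have "f s * \<rho> powr (1 - 2 / r) = f s powr 1 * f s powr (- p * (1 - 2 / r)) * S' powr (1 - 2 / r)"
          using A 3 by (simp add: \<rho>_def powr_mult powr_powr)
        also have "f s powr 1 * f s powr (- p * (1 - 2 / r)) = f s powr (1 + (- p * (1 - 2 / r)))"
          by (rule powr_add[symmetric])
        also have "1 + (- p * (1 - 2 / r)) = p - 1" using r by (simp add: p field_simps)
        finally show ?thesis .
      qed
      also have "\<rho> powr (- 1 / r) * S' powr (1 / p) = f s powr (p - 1) * S' powr (1 - 2 / r)"
      proof -
        have "\<rho> powr (- 1 / r) * S' powr (1 / p) = f s powr (- p * (- 1 / r)) * (S' powr (- 1 / r) * S' powr (1 / p))"
          using A 3 by (simp add: \<rho>_def powr_mult powr_powr)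
        also have "S' powr (- 1 / r) * S' powr (1 / p) = S' powr (- 1 / r + 1 / p)" by (rule powr_add[symmetric])
        also have "- 1 / r + 1 / p = 1 - 2 / r" using pr(2) by (simp add: field_simps)
        also have "- p * (- 1 / r) = p - 1" using r by (simp add: p field_simps)
        finally show ?thesis .
      qed
      also have "ennreal (2 / (1 - 2 / r) * (f s powr (p - 1) * S' powr (1 - 2 / r)) + 2 powr (1 / r) * (f s powr (p - 1) * S' powr (1 - 2 / r)))
         = ennreal ((2 / (1 - 2 / r) + 2 powr (1 / r)) * (f s powr (p - 1) * S' powr (1 - 2 / r)))"
        by (simp add: distrib_right)
      also have "\<dots> \<le> ennreal (K * (f s powr (p - 1) * S' powr (1 - 2 / r)))"
      proof (intro ennreal_leI mult_right_mono)
        have "2 powr (1 / r) \<le> 2 powr 1" using r by (intro powr_mono) auto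
        moreover have "2 / (1 - 2 / r) = 2 * r / (r - 2)" using r by (simp add: field_simps)
        ultimately show "2 / (1 - 2 / r) + 2 powr (1 / r) \<le> K" by (simp add: K_def)
      qed auto
      finally show ?thesis by (simp add: mult.assoc)
    qed
    have "(\<integral>\<^sup>+s. \<integral>\<^sup>+t. ennreal (k s t) \<partial>lborel \<partial>lborel)
      \<le> (\<integral>\<^sup>+s. \<integral>\<^sup>+t. ennreal (k s t) * indicator {t. f t \<le> f s} t + ennreal (k s t) * indicator {s. f s \<le> f t} s \<partial>lborel \<partial>lborel)"
      by (intro nn_integral_mono) (auto simp: indicator_def)
    also have "\<dots> = (\<integral>\<^sup>+s. (\<integral>\<^sup>+t. ennreal (k s t) * indicator {t. f t \<le> f s} t \<partial>lborel) + (\<integral>\<^sup>+t. ennreal (k s t) * indicator {s. f s \<le> f t} s \<partial>lborel) \<partial>lborel)"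
      unfolding indicator_def by (intro nn_integral_cong nn_integral_add) measurable
    also have "\<dots> = (\<integral>\<^sup>+s. \<integral>\<^sup>+t. ennreal (k s t) * indicator {t. f t \<le> f s} t \<partial>lborel \<partial>lborel)
       + (\<integral>\<^sup>+s. \<integral>\<^sup>+t. ennreal (k s t) * indicator {s. f s \<le> f t} s \<partial>lborel \<partial>lborel)"
      unfolding indicator_def by (intro nn_integral_add) measurable
    also have "(\<integral>\<^sup>+s. \<integral>\<^sup>+t. ennreal (k s t) * indicator {s. f s \<le> f t} s \<partial>lborel \<partial>lborel)
        = (\<integral>\<^sup>+t. \<integral>\<^sup>+s. ennreal (k s t) * indicator {s. f s \<le> f t} s \<partial>lborel \<partial>lborel)"
      unfolding indicator_def by (rule lborel_pair.Fubini'[symmetric]) measurable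
    also have "\<dots> = (\<integral>\<^sup>+s. \<integral>\<^sup>+t. ennreal (k s t) * indicator {t. f t \<le> f s} t \<partial>lborel \<partial>lborel)"
      by (intro nn_integral_cong) (simp add: k_def abs_minus_commute mult_ac)
    also have "(\<integral>\<^sup>+s. \<integral>\<^sup>+t. ennreal (k s t) * indicator {t. f t \<le> f s} t \<partial>lborel \<partial>lborel)
      \<le> (\<integral>\<^sup>+s. ennreal (K * S' powr (1 - 2 / r)) * ennreal (f s powr p) \<partial>lborel)"
    proof (intro nn_integral_mono)
      fix s
      show "(\<integral>\<^sup>+t. ennreal (k s t) * indicator {t. f t \<le> f s} t \<partial>lborel) \<le> ennreal (K * S' powr (1 - 2 / r)) * ennreal (f s powr p)"
      proof (cases "0 < f s")
        case True
        have "(\<integral>\<^sup>+t. ennreal (k s t) * indicator {t. f t \<le> f s} t \<partial>lborel)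
          = (\<integral>\<^sup>+t. ennreal (f s) * (ennreal (\<bar>t - s\<bar> powr (- 2 / r) * f t) * indicator {t. f t \<le> f s} t) \<partial>lborel)"
          using True f by (intro nn_integral_cong) (simp add: k_def mult_ac ennreal_mult)
        also have "\<dots> = ennreal (f s) * (\<integral>\<^sup>+t. (ennreal (\<bar>t - s\<bar> powr (- 2 / r) * f t) * indicator {t. f t \<le> f s} t) \<partial>lborel)"
          unfolding indicator_def by (intro nn_integral_cmult) measurable
        also have "\<dots> \<le> ennreal (f s) * ennreal (K * f s powr (p - 1) * S' powr (1 - 2 / r))"
          by (intro mult_left_mono inner True) auto
        also have "\<dots> = ennreal ((K * S' powr (1 - 2 / r)) * (f s * f s powr (p - 1)))"
          using True by (subst ennreal_mult'[symmetric]) (simp_all add: mult_ac)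
        also have "f s * f s powr (p - 1) = f s powr p" using powr_add[of "f s" 1 "p - 1"] True by simp
        also have "ennreal ((K * S' powr (1 - 2 / r)) * f s powr p) = ennreal (K * S' powr (1 - 2 / r)) * ennreal (f s powr p)"
          using r by (intro ennreal_mult) (auto simp: K_def)
        finally show ?thesis .
      next
        case False
        then have "f s = 0" using f[of s] by simp
        then show ?thesis by (simp add: k_def)
      qed
    qed
    also have "\<dots> = ennreal (K * S' powr (1 - 2 / r)) * ennreal S'"
      using 3 by (simp add: nn_integral_cmult S_def)
    also have "\<dots> + \<dots> = ennreal (2 * K * (S' powr (1 - 2 / r) * S'))"
      using r 3 by (simp add: K_def mult_ac flip: ennreal_mult ennreal_plus)
    also have "S' powr (1 - 2 / r) * S' = S' powr (1 - 2 / r + 1)" using 3 powr_add[of S' "1 - 2 / r" 1] by simp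
    also have "1 - 2 / r + 1 = 2 / p" using pr(2) by (simp add: field_simps)
    also have "ennreal (2 * K * S' powr (2 / p)) \<le> ennreal ((8 * r / (r - 2) + 8) * S' powr (2 / p))"
    proof (intro ennreal_leI mult_right_mono)
      have "0 \<le> r / (r - 2)" using r by simp
      then show "2 * K \<le> 8 * r / (r - 2) + 8" by (simp add: K_def)
    qed auto
    also have "\<dots> = ennreal (8 * r / (r - 2) + 8) * ennreal_pow S (2 / p)"
      using r 3 by (simp add: ennreal_pow_ennreal ennreal_mult)
    finally show ?thesis unfolding k_def S_def by (simp add: add_mono)
  qed
qed

subsection \<open>Gaussian integrals\<close>

lemma borel_measurable_cis [measurable]:
  "f \<in> borel_measurable M \<Longrightarrow> (\<lambda>x. cis (f x)) \<in> borel_measurable M"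
  by (rule measurable_compose[of f M borel cis]) (auto intro!: borel_measurable_continuous_onI continuous_intros)

lemma gaussian_fourier_real:
  fixes a y :: real
  assumes "0 < a"
  shows "(LINT x|lborel. complex_of_real (exp (- a * x\<^sup>2)) * cis (x * y)) = of_real (sqrt (pi / a) * exp (- y\<^sup>2 / (4 * a)))"
proof -
  \<comment> \<open>Scaling by \<open>c\<close> turns the exponent \<open>- x^2/2\<close> of the
    standard normal density into \<open>- a * x^2\<close>, so that its characteristic function gives
    the transform.\<close>
  define c where "c = sqrt (2 * a)"
  have c: "c > 0" "c\<^sup>2 = 2 * a" using assms by (auto simp: c_def)
  have "complex_of_real (exp (- (y / c)\<^sup>2 / 2)) = char std_normal_distribution (y / c)"
    by (simp add: char_std_normal_distribution)
  also have "\<dots> = (LINT x|lborel. std_normal_density x *\<^sub>R iexp (y / c * x))"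
    unfolding char_def by (subst integral_density) (auto simp: normal_density_nonneg)
  also have "\<dots> = c *\<^sub>R (LINT x|lborel. std_normal_density (0 + c * x) *\<^sub>R iexp (y / c * (0 + c * x)))"
    using c by (subst lborel_integral_real_affine[where c = c and t = 0]) auto
  also have "(\<lambda>x. std_normal_density (0 + c * x) *\<^sub>R iexp (y / c * (0 + c * x)))
     = (\<lambda>x. complex_of_real (1 / sqrt (2 * pi)) * (complex_of_real (exp (- a * x\<^sup>2)) * cis (x * y)))"
    using c by (auto simp: std_normal_density_def power_mult_distrib scaleR_conv_of_real cis_conv_exp mult_ac)
  also have "(LINT x|lborel. \<dots> x) = complex_of_real (1 / sqrt (2 * pi)) * (LINT x|lborel. complex_of_real (exp (- a * x\<^sup>2)) * cis (x * y))"
    by simp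
  finally have "complex_of_real (exp (- (y / c)\<^sup>2 / 2)) = complex_of_real (c / sqrt (2 * pi)) * (LINT x|lborel. complex_of_real (exp (- a * x\<^sup>2)) * cis (x * y))"
    by (simp add: scaleR_conv_of_real)
  moreover have "c / sqrt (2 * pi) = 1 / sqrt (pi / a)" 
    using assms by (simp add: c_def real_sqrt_mult real_sqrt_divide field_simps)
  moreover have "- (y / c)\<^sup>2 / 2 = - y\<^sup>2 / (4 * a)" using c by (simp add: power_divide)
  ultimately have "complex_of_real (exp (- y\<^sup>2 / (4 * a))) = complex_of_real (1 / sqrt (pi / a)) * (LINT x|lborel. complex_of_real (exp (- a * x\<^sup>2)) * cis (x * y))"
    by metis
  then show ?thesis using assms by (simp add: field_simps)
qed

text \<open>A function that is not integrable has Bochner integral 0, whereas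
  \<open>gaussian_fourier_real\<close> at \<open>y = 0\<close> gives the positive value
  \<open>sqrt (pi / a)\<close>.\<close>

lemma integrable_gaussian:
  fixes a :: real
  assumes "0 < a"
  shows "integrable lborel (\<lambda>x. exp (- a * x\<^sup>2))"
proof (rule ccontr)
  assume "\<not> ?thesis"
  then have "\<not> integrable lborel (\<lambda>x. complex_of_real (exp (- a * x\<^sup>2)) * cis (x * 0))"
    using complex_of_real_integrable_eq[of lborel "\<lambda>x. exp (- a * x\<^sup>2)"] by simp
  then have "(LINT x|lborel. complex_of_real (exp (- a * x\<^sup>2)) * cis (x * 0)) = 0"
    by (rule not_integrable_integral_eq)
  then show False unfolding gaussian_fourier_real[OF assms] using assms by simp
qed

lemma integrable_complex_gaussian:
  assumes "0 < Re z"
  shows "integrable lborel (\<lambda>x. exp (- z * (complex_of_real x)\<^sup>2) * cis (x * y))"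
  by (rule Bochner_Integration.integrable_bound[OF integrable_gaussian[OF assms]])
    (auto simp: norm_mult)

text \<open>A locally uniform limit of the integrals over \<open>[-n, n]\<close>, which are
  holomorphic by differentiation under the integral sign. The tails are dominated by those of a real
  Gaussian whose rate is the same on a whole disc.\<close>

lemma holomorphic_complex_gaussian:
  "(\<lambda>z. LINT x|lborel. exp (- z * (complex_of_real x)\<^sup>2) * cis (x * y)) holomorphic_on {z. 0 < Re z}"
proof -
  let ?f = "\<lambda>z x. exp (- z * (complex_of_real x)\<^sup>2) * cis (x * y)"
  let ?F = "\<lambda>n z. integral (cbox (- real n) (real n)) (?f z)"
  show ?thesis
  proof (rule holomorphic_uniform_sequence[where f = ?F])
    show "open {z. 0 < Re z}" by (rule open_halfspace_Re_gt)
    show "?F n holomorphic_on {z. 0 < Re z}" for n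
    proof (rule leibniz_rule_holomorphic[where fx = "\<lambda>z x. - (complex_of_real x)\<^sup>2 * ?f z x"])
      show "convex {z. 0 < Re z}" by (rule convex_halfspace_Re_gt)
      show "((\<lambda>z. ?f z x) has_field_derivative - (complex_of_real x)\<^sup>2 * ?f z x) (at z within {z. 0 < Re z})" for z x
        by (auto intro!: derivative_eq_intros)
      show "?f z integrable_on cbox (- real n) (real n)" for z
        by (intro integrable_continuous continuous_intros)
      show "continuous_on ({z. 0 < Re z} \<times> cbox (- real n) (real n)) (\<lambda>(z, x). - (complex_of_real x)\<^sup>2 * ?f z x)"
        unfolding case_prod_beta' by (intro continuous_intros)
    qed
    fix z0 :: complex assume "z0 \<in> {z. 0 < Re z}"
    then have z0: "0 < Re z0" by simp
    \<comment> \<open>On the closed disc of radius \<open>c\<close> about \<open>z0\<close> the real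
      part stays at least \<open>c\<close>.\<close>
    define c where "c = Re z0 / 2"
    have c: "0 < c" using z0 by (simp add: c_def)
    have ball: "c \<le> Re z" if "z \<in> cball z0 c" for z
      using that abs_Re_le_cmod[of "z0 - z"] by (auto simp: c_def dist_norm abs_le_iff field_simps)
    define T where "T n = (LINT x|lborel. indicator (- {- real n..real n}) x * exp (- c * x\<^sup>2))" for n
    have "T \<longlonglongrightarrow> (LINT x|(lborel :: real measure). (0 :: real))"
      unfolding T_def
    proof (rule integral_dominated_convergence[where w = "\<lambda>x. exp (- c * x\<^sup>2)" and M = lborel and f = "\<lambda>_. 0"
        and s = "\<lambda>n x. indicator (- {- real n..real n}) x * exp (- c * x\<^sup>2)"])
      show "integrable lborel (\<lambda>x. exp (- c * x\<^sup>2))" by (rule integrable_gaussian[OF c])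
      show "AE x in lborel. (\<lambda>n. indicator (- {- real n..real n}) x * exp (- c * x\<^sup>2)) \<longlonglongrightarrow> 0"
      proof (intro AE_I2 tendsto_eventually)
        fix x :: real
        obtain N where N: "\<bar>x\<bar> \<le> real N" using real_arch_simple by blast
        show "\<forall>\<^sub>F n in sequentially. indicator (- {- real n..real n}) x * exp (- c * x\<^sup>2) = 0"
          using eventually_ge_at_top[of N] by eventually_elim (use N in \<open>auto simp: indicator_def\<close>)
      qed
    qed (auto simp: indicator_def)
    then have T: "T \<longlonglongrightarrow> 0" by simp
    have le: "norm ((LINT x|lborel. ?f z x) - ?F n z) \<le> T n" if z: "z \<in> cball z0 c" for n z
    proof -
      have Re: "0 < Re z" "c \<le> Re z" using ball[OF z] c by auto
      note int = integrable_complex_gaussian[OF Re(1), of y]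
      have si: "set_integrable lborel {- real n..real n} (?f z)"
        unfolding set_integrable_def using int by (rule integrable_mult_indicator[rotated]) auto
      have "?F n z = (LINT x:{- real n..real n}|lborel. ?f z x)"
        using set_borel_integral_eq_integral(2)[OF si] by (simp add: cbox_interval)
      then have "(LINT x|lborel. ?f z x) - ?F n z = (LINT x|lborel. ?f z x - indicator {- real n..real n} x *\<^sub>R ?f z x)"
        using int si by (simp add: set_integrable_def set_lebesgue_integral_def)
      also have "norm \<dots> \<le> (LINT x|lborel. indicator (- {- real n..real n}) x * exp (- c * x\<^sup>2))"
      proof (rule Bochner_Integration.integral_norm_bound_integral)
        show "integrable lborel (\<lambda>x. ?f z x - indicator {- real n..real n} x *\<^sub>R ?f z x)"
          using int si by (simp add: set_integrable_def)
        show "integrable lborel (\<lambda>x. indicator (- {- real n..real n}) x * exp (- c * x\<^sup>2))"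
          by (rule integrable_real_mult_indicator[OF _ integrable_gaussian[OF c], of "- {- real n..real n}", simplified mult.commute]) auto
        show "norm (?f z x - indicator {- real n..real n} x *\<^sub>R ?f z x) \<le> indicator (- {- real n..real n}) x * exp (- c * x\<^sup>2)" for x
          using Re by (auto simp: indicator_def norm_mult mult_right_mono)
      qed
      finally show ?thesis by (simp add: T_def)
    qed
    have "uniform_limit (cball z0 c) ?F (\<lambda>z. LINT x|lborel. ?f z x) sequentially"
    proof (rule uniform_limitI)
      fix e :: real assume "0 < e"
      with T have "\<forall>\<^sub>F n in sequentially. T n < e" by (rule order_tendstoD)
      then show "\<forall>\<^sub>F n in sequentially. \<forall>z\<in>cball z0 c. dist (?F n z) (LINT x|lborel. ?f z x) < e"
      proof eventually_elim
        case (elim n)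
        show ?case
        proof
          fix z assume "z \<in> cball z0 c"
          from le_less_trans[OF le[OF this] elim] show "dist (?F n z) (LINT x|lborel. ?f z x) < e"
            by (subst dist_commute) (simp only: dist_norm)
        qed
      qed
    qed
    then show "\<exists>d>0. cball z0 d \<subseteq> {z. 0 < Re z} \<and> uniform_limit (cball z0 d) ?F (\<lambda>z. LINT x|lborel. ?f z x) sequentially"
      using c ball by (intro exI[of _ c] conjI subsetI) (auto intro: less_le_trans)
  qed
qed

text \<open>Stated for a product of two integrals, one for each transverse variable, so that two
  square roots of \<open>pi / z\<close> multiply to \<open>pi / z\<close> and no branch has to be
  chosen. Both sides are holomorphic in the right half-plane and agree on the positive
  reals.\<close>

lemma gaussian_fourier_complex:
  assumes "0 < Re z"
  shows "(LINT x|lborel. exp (- z * (complex_of_real x)\<^sup>2) * cis (x * y1)) * (LINT x|lborel. exp (- z * (complex_of_real x)\<^sup>2) * cis (x * y2))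
    = of_real pi / z * exp (- of_real (y1\<^sup>2 + y2\<^sup>2) / (4 * z))"
proof -
  let ?G = "\<lambda>y z. LINT x|lborel. exp (- z * (complex_of_real x)\<^sup>2) * cis (x * y)"
  let ?D = "\<lambda>z. ?G y1 z * ?G y2 z - of_real pi / z * exp (- of_real (y1\<^sup>2 + y2\<^sup>2) / (4 * z))"
  have "?D z = 0"
  proof (rule analytic_continuation[where f = ?D and S = "{z. 0 < Re z}" and U = "complex_of_real ` {0<..}" and \<xi> = 1])
    show "?D holomorphic_on {z. 0 < Re z}"
    proof (intro holomorphic_on_diff holomorphic_on_mult holomorphic_complex_gaussian)
      show "(\<lambda>z. of_real pi / z) holomorphic_on {z. 0 < Re z}"
        by (intro holomorphic_on_divide holomorphic_on_const holomorphic_on_ident) force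
      have "(\<lambda>z. - of_real (y1\<^sup>2 + y2\<^sup>2) / (4 * z)) holomorphic_on {z. 0 < Re z}"
        by (intro holomorphic_on_divide holomorphic_on_mult holomorphic_on_const holomorphic_on_ident) force
      then show "(\<lambda>z. exp (- of_real (y1\<^sup>2 + y2\<^sup>2) / (4 * z))) holomorphic_on {z. 0 < Re z}"
        by (rule holomorphic_on_exp')
    qed
    show "complex_of_real ` {0<..} \<subseteq> {z. 0 < Re z}" "1 \<in> {z. 0 < Re z}" "z \<in> {z. 0 < Re z}"
      using assms by auto
    show "open {z. 0 < Re z}" by (rule open_halfspace_Re_gt)
    show "connected {z. 0 < Re z}" by (intro convex_connected convex_halfspace_Re_gt)
    show "1 islimpt complex_of_real ` {0<..}"
      unfolding islimpt_sequential
    proof (intro exI[of _ "\<lambda>n. complex_of_real (1 + inverse (Suc n))"] conjI allI)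
      show "complex_of_real (1 + inverse (Suc n)) \<in> complex_of_real ` {0<..} - {1}" for n
      proof -
        have A: "complex_of_real r \<in> complex_of_real ` {0<..} - {1}" if "1 < r" for r using that by auto
        show ?thesis by (rule A) simp
      qed
      show "(\<lambda>n. complex_of_real (1 + inverse (Suc n))) \<longlonglongrightarrow> 1"
        using tendsto_of_real[OF LIMSEQ_inverse_real_of_nat_add[of 1], where 'a = complex] unfolding of_real_1 .
    qed
    fix w assume "w \<in> complex_of_real ` {0<..}"
    then obtain a where a: "w = of_real a" "0 < a" by auto
    have G: "?G y (of_real a) = of_real (sqrt (pi / a) * exp (- y\<^sup>2 / (4 * a)))" for y
      using gaussian_fourier_real[OF a(2), of y] by (simp add: exp_of_real[symmetric])
    have "complex_of_real (sqrt (pi / a) * exp (- y1\<^sup>2 / (4 * a))) * of_real (sqrt (pi / a) * exp (- y2\<^sup>2 / (4 * a)))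
      = of_real (pi / a * exp (- (y1\<^sup>2 + y2\<^sup>2) / (4 * a)))"
    proof -
      have 1: "sqrt (pi / a) * sqrt (pi / a) = pi / a" using a(2) by simp
      have 2: "exp (- y1\<^sup>2 / (4 * a)) * exp (- y2\<^sup>2 / (4 * a)) = exp (- (y1\<^sup>2 + y2\<^sup>2) / (4 * a))"
        unfolding exp_add[symmetric] add_divide_distrib[symmetric] by simp
      have "s * u * (s * v) = (s * s) * (u * v)" for s u v :: real by simp
      from this[of "sqrt (pi / a)" "exp (- y1\<^sup>2 / (4 * a))" "exp (- y2\<^sup>2 / (4 * a))", unfolded 1 2] show ?thesis by (simp only: of_real_mult[symmetric])
    qed
    also have "\<dots> = of_real pi / of_real a * exp (- of_real (y1\<^sup>2 + y2\<^sup>2) / (4 * of_real a))"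
      by (simp add: exp_of_real[symmetric])
    finally show "?D w = 0" unfolding a(1) G by simp
  qed
  then show ?thesis by (simp only: right_minus_eq)
qed

subsection \<open>The Plancherel inequality and Sobolev embedding\<close>

text \<open>Fatou's lemma: a bound that is uniform in a regularisation survives its removal.\<close>

lemma nn_integral_le_of_tendsto:
  fixes u :: "nat \<Rightarrow> 'a \<Rightarrow> ennreal"
  assumes [measurable]: "\<And>n. u n \<in> borel_measurable M"
    and le: "\<And>n. (\<integral>\<^sup>+x. u n x \<partial>M) \<le> B"
    and lim: "AE x in M. (\<lambda>n. u n x) \<longlonglongrightarrow> v x"
  shows "(\<integral>\<^sup>+x. v x \<partial>M) \<le> B"
proof -
  have "(\<integral>\<^sup>+x. v x \<partial>M) = (\<integral>\<^sup>+x. liminf (\<lambda>n. u n x) \<partial>M)"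
    using lim by (intro nn_integral_cong_AE) (auto elim!: eventually_mono simp: lim_imp_Liminf)
  also have "\<dots> \<le> liminf (\<lambda>n. \<integral>\<^sup>+x. u n x \<partial>M)" by (rule nn_integral_liminf) measurable
  also have "\<dots> \<le> liminf (\<lambda>n::nat. B)" by (intro Liminf_mono always_eventually allI le)
  finally show ?thesis by (simp add: Liminf_const)
qed

lemma borel_measurable_cnj [measurable]:
  "f \<in> borel_measurable M \<Longrightarrow> (\<lambda>x. cnj (f x)) \<in> borel_measurable M"
  by (rule measurable_compose[of f M borel cnj]) (auto intro!: borel_measurable_continuous_onI continuous_intros)

lemma cis_sum: "finite A \<Longrightarrow> cis (sum f A) = (\<Prod>a\<in>A. cis (f a))"
  by (induction rule: finite_induct) (auto simp flip: cis_mult)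

lemma lborel_integral_prod_Basis:
  fixes f :: "'a::euclidean_space \<Rightarrow> real \<Rightarrow> complex"
  assumes f: "\<And>b. b \<in> Basis \<Longrightarrow> integrable lborel (f b)"
  shows "integrable lborel (\<lambda>x::'a. \<Prod>b\<in>Basis. f b (x \<bullet> b))"
    and "(LINT x|(lborel :: 'a measure). (\<Prod>b\<in>Basis. f b (x \<bullet> b))) = (\<Prod>b\<in>Basis. (LINT x|lborel. f b x))"
proof -
  interpret product_sigma_finite "\<lambda>_::'a. lborel :: real measure" ..
  have [measurable]: "\<And>b. b \<in> Basis \<Longrightarrow> f b \<in> borel_measurable borel"
    using f borel_measurable_integrable by fastforce
  have m: "(\<lambda>x::'a. \<Prod>b\<in>Basis. f b (x \<bullet> b)) \<in> borel_measurable borel"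
    by measurable
  have m2: "(\<lambda>g. \<Sum>b\<in>Basis. g b *\<^sub>R b) \<in> (Pi\<^sub>M Basis (\<lambda>b::'a. lborel :: real measure)) \<rightarrow>\<^sub>M borel"
    by measurable
  have eq: "(\<Prod>b\<in>Basis. f b ((\<Sum>i\<in>Basis. g i *\<^sub>R i) \<bullet> b)) = (\<Prod>b\<in>Basis. f b (g b))" for g :: "'a \<Rightarrow> real"
    by (intro prod.cong) auto
  show "integrable lborel (\<lambda>x::'a. \<Prod>b\<in>Basis. f b (x \<bullet> b))"
    unfolding lborel_eq[where 'a = 'a] integrable_distr_eq[OF m2 m] eq
    by (rule product_integrable_prod) (auto intro: f)
  show "(LINT x|(lborel :: 'a measure). (\<Prod>b\<in>Basis. f b (x \<bullet> b))) = (\<Prod>b\<in>Basis. (LINT x|lborel. f b x))"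
    unfolding lborel_eq[where 'a = 'a] integral_distr[OF m2 m] eq
    by (rule product_integral_prod) (auto intro: f)
qed

lemma
  fixes v :: "'a::euclidean_space"
  assumes a: "0 < a"
  shows integrable_gaussian_euclidean: "integrable lborel (\<lambda>x::'a. exp (- a * (norm x)\<^sup>2))"
    and gaussian_fourier_euclidean: "(LINT x|lborel. complex_of_real (exp (- a * (norm x)\<^sup>2)) * cis (x \<bullet> v))
      = of_real (sqrt (pi / a) ^ DIM('a) * exp (- (norm v)\<^sup>2 / (4 * a)))"
proof -
  have sq: "(norm y)\<^sup>2 = (\<Sum>b\<in>Basis. (y \<bullet> b)\<^sup>2)" for y :: 'a
    unfolding power2_norm_eq_inner by (subst euclidean_inner) (simp add: power2_eq_square)
  define f where "f w b x = complex_of_real (exp (- a * x\<^sup>2)) * cis (x * (w \<bullet> b))" for w b :: 'a and x :: real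
  have int: "integrable lborel (f w b)" for w b
    unfolding f_def by (rule Bochner_Integration.integrable_bound[OF integrable_gaussian[OF a]]) (auto simp: norm_mult)
  have eq: "(\<Prod>b\<in>Basis. f w b (x \<bullet> b)) = complex_of_real (exp (- a * (norm x)\<^sup>2)) * cis (x \<bullet> w)" for w x :: 'a
    unfolding f_def prod.distrib sq euclidean_inner[of x w]
    by (simp add: exp_sum cis_sum sum_distrib_left flip: sum_negf)
  note I = lborel_integral_prod_Basis[of "f w" for w, OF int, unfolded eq]
  have "integrable lborel (\<lambda>x::'a. complex_of_real (exp (- a * (norm x)\<^sup>2)))"
    using I(1)[of 0] by simp
  then show "integrable lborel (\<lambda>x::'a. exp (- a * (norm x)\<^sup>2))" unfolding complex_of_real_integrable_eq .
  show "(LINT x|lborel. complex_of_real (exp (- a * (norm x)\<^sup>2)) * cis (x \<bullet> v))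
      = of_real (sqrt (pi / a) ^ DIM('a) * exp (- (norm v)\<^sup>2 / (4 * a)))"
  proof -
    have "(\<Prod>b\<in>Basis. exp (- (v \<bullet> b)\<^sup>2 / (4 * a))) = exp (- (norm v)\<^sup>2 / (4 * a))"
      by (simp add: exp_sum[symmetric] sq sum_negf sum_divide_distrib)
    then show ?thesis
      unfolding I(2) f_def gaussian_fourier_real[OF a] of_real_prod[symmetric] prod.distrib by simp
  qed
qed

lemma nn_integral_gaussian_euclidean:
  assumes a: "0 < a"
  shows "(\<integral>\<^sup>+(x::'a::euclidean_space). ennreal (exp (- (norm (x - y))\<^sup>2 / (4 * a))) \<partial>lborel) = ennreal (sqrt (4 * pi * a) ^ DIM('a))"
proof -
  have *: "exp (- (1 / (4 * a)) * (norm x)\<^sup>2) = exp (- (norm x)\<^sup>2 / (4 * a))" for x :: 'a by simp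
  have "complex_of_real (LINT x|lborel. exp (- (norm (x::'a))\<^sup>2 / (4 * a))) = of_real (sqrt (4 * pi * a) ^ DIM('a))"
    using gaussian_fourier_euclidean[of "1 / (4 * a)" "0::'a"] a unfolding * by (simp add: mult_ac)
  then have "(LINT x|lborel. exp (- (norm (x::'a))\<^sup>2 / (4 * a))) = sqrt (4 * pi * a) ^ DIM('a)"
    by (simp only: of_real_eq_iff)
  then have "(\<integral>\<^sup>+(x::'a). ennreal (exp (- (norm x)\<^sup>2 / (4 * a))) \<partial>lborel) = ennreal (sqrt (4 * pi * a) ^ DIM('a))"
    using integrable_gaussian_euclidean[of "1 / (4 * a)", where 'a = 'a] a unfolding *
    by (subst nn_integral_eq_integral) auto
  moreover have "(\<integral>\<^sup>+(x::'a). ennreal (exp (- (norm (x - y))\<^sup>2 / (4 * a))) \<partial>lborel) = (\<integral>\<^sup>+(x::'a). ennreal (exp (- (norm x)\<^sup>2 / (4 * a))) \<partial>lborel)"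
    by (subst lborel_distr_plus[of y, symmetric], subst nn_integral_distr) auto
  ultimately show ?thesis by simp
qed

lemma integrable_tensor_square:
  fixes g :: "'h \<Rightarrow> complex"
  assumes "sigma_finite_measure H" and g: "integrable H g"
  shows "integrable (H \<Otimes>\<^sub>M H) (\<lambda>w. g (fst w) * cnj (g (snd w)))"
proof -
  interpret H: sigma_finite_measure H by fact
  interpret HH: pair_sigma_finite H H ..
  have [measurable]: "g \<in> borel_measurable H" using g by auto
  show ?thesis
    using g by (intro HH.Fubini_integrable) (auto simp: norm_mult)
qed

text \<open>Expanding the square and exchanging integrals turns a weighted \<open>L^2\<close> norm
  into a quadratic form in \<open>g\<close>. The integrable weight \<open>m\<close> and the bound on
  \<open>e\<close> justify Fubini's theorem. It is used twice: with \<open>x\<close> a position and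
  a Gaussian weight for Plancherel, and with \<open>x\<close> a frequency and \<open>h\<close> a
  time for the \<open>TT*\<close> argument.\<close>

lemma integral_weighted_norm_square:
  fixes e :: "'x \<Rightarrow> 'h \<Rightarrow> complex"
  assumes X: "sigma_finite_measure X" and H: "sigma_finite_measure H"
    and [measurable]: "case_prod e \<in> borel_measurable (X \<Otimes>\<^sub>M H)" and e: "\<And>x h. norm (e x h) \<le> 1"
    and m: "integrable X m" "\<And>x. 0 \<le> m x" and g: "integrable H g"
  shows "complex_of_real (LINT x|X. m x * (norm (LINT h|H. e x h * g h))\<^sup>2)
    = (LINT w|(H \<Otimes>\<^sub>M H). (LINT x|X. of_real (m x) * (e x (fst w) * cnj (e x (snd w)))) * (g (fst w) * cnj (g (snd w))))"
    and "integrable X (\<lambda>x. m x * (norm (LINT h|H. e x h * g h))\<^sup>2)"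
proof -
  interpret X: sigma_finite_measure X by fact
  interpret H: sigma_finite_measure H by fact
  interpret HH: pair_sigma_finite H H ..
  interpret XHH: pair_sigma_finite X "H \<Otimes>\<^sub>M H" ..
  have [measurable]: "g \<in> borel_measurable H" "m \<in> borel_measurable X" using g m by auto
  define G where "G w = g (fst w) * cnj (g (snd w))" for w
  have G: "integrable (H \<Otimes>\<^sub>M H) G" unfolding G_def by (rule integrable_tensor_square[OF H g])
  then have [measurable]: "G \<in> borel_measurable (H \<Otimes>\<^sub>M H)" by auto
  define k where "k x w = of_real (m x) * ((e x (fst w) * cnj (e x (snd w))) * G w)" for x w
  have [measurable]: "case_prod k \<in> borel_measurable (X \<Otimes>\<^sub>M (H \<Otimes>\<^sub>M H))" unfolding k_def by measurable
  have e2: "norm (e x h * cnj (e x h')) \<le> 1" for x h h'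
    using mult_mono[OF e e, of x h x h'] by (simp add: norm_mult mult.commute)
  have "norm (e x h * cnj (e x h') * G (h, h')) \<le> norm (G (h, h'))" for x h h'
    using mult_right_mono[OF e2, of "norm (G (h, h'))"] by (simp add: norm_mult mult_ac)
  then have e3: "norm (e x (fst w) * cnj (e x (snd w)) * G w) \<le> norm (G w)" for x w by (cases w) auto
  have kint: "integrable (X \<Otimes>\<^sub>M (H \<Otimes>\<^sub>M H)) (case_prod k)"
  proof (rule Bochner_Integration.integrable_bound)
    show "integrable (X \<Otimes>\<^sub>M (H \<Otimes>\<^sub>M H)) (\<lambda>(x, w). m x * norm (G w))"
      using m G by (intro XHH.Fubini_integrable) (auto simp: abs_mult)
    show "AE z in X \<Otimes>\<^sub>M (H \<Otimes>\<^sub>M H). norm (case_prod k z) \<le> norm (case z of (x, w) \<Rightarrow> m x * norm (G w))"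
      using mult_left_mono[OF e3 m(2)] m(2) by (auto simp: k_def norm_mult abs_mult mult_ac)
  qed measurable
  have sq: "(LINT w|(H \<Otimes>\<^sub>M H). k x w) = complex_of_real (m x * (norm (LINT h|H. e x h * g h))\<^sup>2)" if [measurable]: "x \<in> space X" for x
  proof -
    have ie: "integrable (H \<Otimes>\<^sub>M H) (\<lambda>w. e x (fst w) * cnj (e x (snd w)) * G w)"
      by (rule Bochner_Integration.integrable_bound[OF G]) (use e3 in auto)
    have "(LINT w|(H \<Otimes>\<^sub>M H). k x w) = of_real (m x) * (LINT w|(H \<Otimes>\<^sub>M H). e x (fst w) * cnj (e x (snd w)) * G w)"
      unfolding k_def by simp
    also have "(LINT w|(H \<Otimes>\<^sub>M H). e x (fst w) * cnj (e x (snd w)) * G w)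
      = (LINT h|H. LINT h'|H. e x h * cnj (e x h') * G (h, h'))"
      using HH.integral_fst'[OF ie] by simp
    also have "\<dots> = (LINT h|H. (e x h * g h) * (LINT h'|H. cnj (e x h' * g h')))"
    proof (intro Bochner_Integration.integral_cong refl)
      fix h
      have "(LINT h'|H. e x h * cnj (e x h') * G (h, h')) = (LINT h'|H. (e x h * g h) * cnj (e x h' * g h'))"
        by (simp add: G_def mult_ac)
      then show "(LINT h'|H. e x h * cnj (e x h') * G (h, h')) = (e x h * g h) * (LINT h'|H. cnj (e x h' * g h'))"
        by (simp only: integral_mult_right_zero)
    qed
    also have "\<dots> = (LINT h|H. e x h * g h) * cnj (LINT h'|H. e x h' * g h')"
      by (simp only: integral_mult_left_zero Bochner_Integration.integral_cnj)
    finally show ?thesis by (simp only: of_real_mult complex_norm_square)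
  qed
  have "integrable X (\<lambda>x. LINT w|(H \<Otimes>\<^sub>M H). k x w)"
    using XHH.integrable_fst'[OF kint] by simp
  then have "integrable X (\<lambda>x. complex_of_real (m x * (norm (LINT h|H. e x h * g h))\<^sup>2))"
    by (rule Bochner_Integration.integrable_cong[THEN iffD1, rotated -1]) (auto simp: sq)
  then show "integrable X (\<lambda>x. m x * (norm (LINT h|H. e x h * g h))\<^sup>2)"
    unfolding complex_of_real_integrable_eq .
  have "complex_of_real (LINT x|X. m x * (norm (LINT h|H. e x h * g h))\<^sup>2) = (LINT x|X. LINT w|(H \<Otimes>\<^sub>M H). k x w)"
    unfolding integral_complex_of_real[symmetric] by (intro Bochner_Integration.integral_cong) (auto simp: sq)
  also have "\<dots> = (LINT w|(H \<Otimes>\<^sub>M H). LINT x|X. k x w)"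
    using XHH.Fubini_integral[OF kint] by simp
  also have "\<dots> = (LINT w|(H \<Otimes>\<^sub>M H). (LINT x|X. of_real (m x) * (e x (fst w) * cnj (e x (snd w)))) * (g (fst w) * cnj (g (snd w))))"
    unfolding k_def G_def by (simp add: mult.assoc[symmetric])
  finally show "complex_of_real (LINT x|X. m x * (norm (LINT h|H. e x h * g h))\<^sup>2) = \<dots>" .
qed

text \<open>\<open>inv_fourier\<close> without its normalising constant, which returns only in the
  final theorem.\<close>

definition osc :: "('a::euclidean_space \<Rightarrow> complex) \<Rightarrow> 'a \<Rightarrow> complex" where
  "osc g x = (LINT z|lborel. cis (x \<bullet> z) * g z)"

lemma borel_measurable_osc [measurable]:
  assumes [measurable]: "g \<in> borel_measurable borel"
  shows "osc g \<in> borel_measurable borel"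
  unfolding osc_def by measurable

lemma norm_integral_le_nn_integral:
  fixes f :: "'a \<Rightarrow> complex"
  shows "ennreal (norm (LINT x|M. f x)) \<le> (\<integral>\<^sup>+x. ennreal (norm (f x)) \<partial>M)"
proof (cases "integrable M f")
  case True
  then show ?thesis
    using ennreal_leI[OF integral_norm_bound[of M f]] by (simp add: nn_integral_eq_integral)
qed (simp add: not_integrable_integral_eq)

text \<open>Damping by a Gaussian in \<open>x\<close> turns the left side into a quadratic form
  whose kernel \<open>\<Gamma> (z - z')\<close> is a Gaussian of mass \<open>(2 pi)^n\<close> for
  every \<open>\<epsilon>\<close>. Schur's test bounds the form by that mass, and Fatou removes the
  damping. As \<open>g\<close> is merely integrable, the right side may be infinite.\<close>

theorem osc_L2_bound:
  fixes g :: "'a::euclidean_space \<Rightarrow> complex"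
  assumes g: "integrable lborel g"
  shows "(\<integral>\<^sup>+x. ennreal ((norm (osc g x))\<^sup>2) \<partial>lborel) \<le> ennreal ((2 * pi) ^ DIM('a)) * (\<integral>\<^sup>+z. ennreal ((norm (g z))\<^sup>2) \<partial>lborel)"
    (is "_ \<le> ?B")
proof -
  have [measurable]: "g \<in> borel_measurable borel" using g by auto
  define \<epsilon> where "\<epsilon> n = inverse (real (Suc n))" for n
  have \<epsilon>: "0 < \<epsilon> n" for n by (simp add: \<epsilon>_def)
  have bd: "(\<integral>\<^sup>+x. ennreal (exp (- \<epsilon> n * (norm x)\<^sup>2) * (norm (osc g x))\<^sup>2) \<partial>lborel) \<le> ?B" for n
  proof -
    define \<Gamma> where "\<Gamma> v = sqrt (pi / \<epsilon> n) ^ DIM('a) * exp (- (norm v)\<^sup>2 / (4 * \<epsilon> n))" for v :: 'a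
    have [measurable]: "\<Gamma> \<in> borel_measurable borel" unfolding \<Gamma>_def by measurable
    have \<Gamma>: "0 \<le> \<Gamma> v" for v using \<epsilon>[of n] by (simp add: \<Gamma>_def)
    \<comment> \<open>In each dimension the factors \<open>sqrt (pi / \<epsilon>)\<close> and
      \<open>sqrt (4 * pi * \<epsilon>)\<close> multiply to \<open>2 * pi\<close>, whatever
      \<open>\<epsilon>\<close> is.\<close>
    have \<Gamma>_int: "(\<integral>\<^sup>+z. ennreal (\<Gamma> (z - y)) \<partial>lborel) = ennreal ((2 * pi) ^ DIM('a))"
      "(\<integral>\<^sup>+z. ennreal (\<Gamma> (y - z)) \<partial>lborel) = ennreal ((2 * pi) ^ DIM('a))" for y
    proof -
      let ?c = "sqrt (pi / \<epsilon> n) ^ DIM('a)"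
      have "pi / \<epsilon> n * (4 * pi * \<epsilon> n) = (2 * pi)\<^sup>2"
        using \<epsilon>[of n] by (simp add: power2_eq_square)
      then have "sqrt (pi / \<epsilon> n) * sqrt (4 * pi * \<epsilon> n) = 2 * pi"
        unfolding real_sqrt_mult[symmetric] by (simp only: real_sqrt_abs) simp
      then have c: "?c * sqrt (4 * pi * \<epsilon> n) ^ DIM('a) = (2 * pi) ^ DIM('a)"
        unfolding power_mult_distrib[symmetric] by (rule arg_cong)
      have c0: "0 \<le> ?c" using \<epsilon>[of n] by simp
      have "(\<integral>\<^sup>+z. ennreal (\<Gamma> (z - y)) \<partial>lborel) = (\<integral>\<^sup>+z. ennreal ?c * ennreal (exp (- (norm (z - y))\<^sup>2 / (4 * \<epsilon> n))) \<partial>lborel)"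
        unfolding \<Gamma>_def by (intro nn_integral_cong ennreal_mult c0) simp
      also have "\<dots> = ennreal ?c * ennreal (sqrt (4 * pi * \<epsilon> n) ^ DIM('a))"
        by (subst nn_integral_cmult, measurable) (simp only: nn_integral_gaussian_euclidean[OF \<epsilon>])
      also have "\<dots> = ennreal ((2 * pi) ^ DIM('a))"
        unfolding c[symmetric] using \<epsilon>[of n] by (intro ennreal_mult[symmetric] c0) simp
      finally show "(\<integral>\<^sup>+z. ennreal (\<Gamma> (z - y)) \<partial>lborel) = ennreal ((2 * pi) ^ DIM('a))" .
      then show "(\<integral>\<^sup>+z. ennreal (\<Gamma> (y - z)) \<partial>lborel) = ennreal ((2 * pi) ^ DIM('a))"
        by (simp only: \<Gamma>_def norm_minus_commute[of y])
    qed
    have m: "integrable lborel (\<lambda>x::'a. exp (- \<epsilon> n * (norm x)\<^sup>2))" by (rule integrable_gaussian_euclidean[OF \<epsilon>])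
    have k: "(LINT x|lborel. of_real (exp (- \<epsilon> n * (norm x)\<^sup>2)) * (cis (x \<bullet> fst w) * cnj (cis (x \<bullet> snd w)))) = of_real (\<Gamma> (fst w - snd w))" for w :: "'a \<times> 'a"
      unfolding \<Gamma>_def gaussian_fourier_euclidean[OF \<epsilon>, symmetric]
      by (simp add: cis_cnj cis_mult inner_diff_right cis_divide divide_conv_cnj)
    have me: "(\<lambda>(x, z). cis (x \<bullet> z)) \<in> borel_measurable (lborel \<Otimes>\<^sub>M (lborel :: 'a measure))" by measurable
    note W = integral_weighted_norm_square[OF sigma_finite_lborel sigma_finite_lborel me eq_refl[OF norm_cis] m exp_ge_zero g, unfolded k, folded osc_def]
    have "(\<integral>\<^sup>+x. ennreal (exp (- \<epsilon> n * (norm x)\<^sup>2) * (norm (osc g x))\<^sup>2) \<partial>lborel)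
        = ennreal (LINT x|lborel. exp (- \<epsilon> n * (norm x)\<^sup>2) * (norm (osc g x))\<^sup>2)"
      by (intro nn_integral_eq_integral W(2)) auto
    also have "\<dots> \<le> ennreal (norm (complex_of_real (LINT x|lborel. exp (- \<epsilon> n * (norm x)\<^sup>2) * (norm (osc g x))\<^sup>2)))"
      by (rule ennreal_leI) simp
    also have "complex_of_real (LINT x|lborel. exp (- \<epsilon> n * (norm x)\<^sup>2) * (norm (osc g x))\<^sup>2)
      = (LINT w|(lborel \<Otimes>\<^sub>M lborel). of_real (\<Gamma> (fst w - snd w)) * (g (fst w) * cnj (g (snd w))))"
      by (rule W(1))
    also have "ennreal (norm \<dots>) \<le> (\<integral>\<^sup>+w. ennreal (norm (of_real (\<Gamma> (fst w - snd w)) * (g (fst w) * cnj (g (snd w))))) \<partial>(lborel \<Otimes>\<^sub>M lborel))"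
      by (rule norm_integral_le_nn_integral)
    \<comment> \<open>Schur's test: the product of the amplitudes at \<open>z\<close> and
      \<open>z'\<close> is at most half the sum of their squares, and in each half the Gaussian is
      integrated over the other variable first.\<close>
    also have "\<dots> \<le> (\<integral>\<^sup>+w. ennreal (1 / 2) * (ennreal (\<Gamma> (fst w - snd w)) * ennreal ((norm (g (fst w)))\<^sup>2))
        + ennreal (1 / 2) * (ennreal (\<Gamma> (fst w - snd w)) * ennreal ((norm (g (snd w)))\<^sup>2)) \<partial>(lborel \<Otimes>\<^sub>M lborel))"
    proof (intro nn_integral_mono)
      fix w :: "'a \<times> 'a"
      have "norm (g (fst w)) * norm (g (snd w)) \<le> 1 / 2 * ((norm (g (fst w)))\<^sup>2 + (norm (g (snd w)))\<^sup>2)"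
        using sum_squares_bound[of "norm (g (fst w))" "norm (g (snd w))"] by simp
      from mult_left_mono[OF this \<Gamma>[of "fst w - snd w"]]
      have le: "norm (of_real (\<Gamma> (fst w - snd w)) * (g (fst w) * cnj (g (snd w)))) 
         \<le> 1 / 2 * (\<Gamma> (fst w - snd w) * (norm (g (fst w)))\<^sup>2) + 1 / 2 * (\<Gamma> (fst w - snd w) * (norm (g (snd w)))\<^sup>2)"
        unfolding norm_mult norm_of_real complex_mod_cnj abs_of_nonneg[OF \<Gamma>] by (simp only: algebra_simps)
      have eq: "ennreal (1 / 2 * (\<Gamma> (fst w - snd w) * (norm (g (fst w)))\<^sup>2) + 1 / 2 * (\<Gamma> (fst w - snd w) * (norm (g (snd w)))\<^sup>2)) = ennreal (1 / 2) * (ennreal (\<Gamma> (fst w - snd w)) * ennreal ((norm (g (fst w)))\<^sup>2))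
        + ennreal (1 / 2) * (ennreal (\<Gamma> (fst w - snd w)) * ennreal ((norm (g (snd w)))\<^sup>2))"
        using \<Gamma>[of "fst w - snd w"] by (subst ennreal_plus) (simp_all only: ennreal_mult[symmetric] mult_nonneg_nonneg zero_le_power2 zero_le_divide_iff zero_le_one zero_le_numeral simp_thms)
      show "ennreal (norm (of_real (\<Gamma> (fst w - snd w)) * (g (fst w) * cnj (g (snd w)))))
        \<le> ennreal (1 / 2) * (ennreal (\<Gamma> (fst w - snd w)) * ennreal ((norm (g (fst w)))\<^sup>2))
        + ennreal (1 / 2) * (ennreal (\<Gamma> (fst w - snd w)) * ennreal ((norm (g (snd w)))\<^sup>2))"
        using ennreal_leI[OF le] unfolding eq .
    qed
    also have "\<dots> = ennreal (1 / 2) * (\<integral>\<^sup>+w. ennreal (\<Gamma> (fst w - snd w)) * ennreal ((norm (g (fst w)))\<^sup>2) \<partial>(lborel \<Otimes>\<^sub>M lborel))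
        + ennreal (1 / 2) * (\<integral>\<^sup>+w. ennreal (\<Gamma> (fst w - snd w)) * ennreal ((norm (g (snd w)))\<^sup>2) \<partial>(lborel \<Otimes>\<^sub>M lborel))"
      by (simp add: nn_integral_add nn_integral_cmult)
    also have "(\<integral>\<^sup>+w. ennreal (\<Gamma> (fst w - snd w)) * ennreal ((norm (g (fst w)))\<^sup>2) \<partial>(lborel \<Otimes>\<^sub>M lborel)) = ?B"
    proof -
      have "(\<integral>\<^sup>+w. ennreal (\<Gamma> (fst w - snd w)) * ennreal ((norm (g (fst w)))\<^sup>2) \<partial>(lborel \<Otimes>\<^sub>M lborel))
        = (\<integral>\<^sup>+z. \<integral>\<^sup>+z'. ennreal (\<Gamma> (z - z')) * ennreal ((norm (g z))\<^sup>2) \<partial>lborel \<partial>lborel)"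
        by (subst lborel.nn_integral_fst[symmetric]) simp_all
      also have "\<dots> = (\<integral>\<^sup>+z. ennreal ((2 * pi) ^ DIM('a)) * ennreal ((norm (g z))\<^sup>2) \<partial>lborel)"
        by (intro nn_integral_cong) (simp add: nn_integral_multc \<Gamma>_int)
      finally show ?thesis by (simp add: nn_integral_cmult)
    qed
    also have "(\<integral>\<^sup>+w. ennreal (\<Gamma> (fst w - snd w)) * ennreal ((norm (g (snd w)))\<^sup>2) \<partial>(lborel \<Otimes>\<^sub>M lborel)) = ?B"
    proof -
      have "(\<integral>\<^sup>+w. ennreal (\<Gamma> (fst w - snd w)) * ennreal ((norm (g (snd w)))\<^sup>2) \<partial>(lborel \<Otimes>\<^sub>M lborel))
        = (\<integral>\<^sup>+z'. \<integral>\<^sup>+z. ennreal (\<Gamma> (z - z')) * ennreal ((norm (g z'))\<^sup>2) \<partial>lborel \<partial>lborel)"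
        by (subst lborel_pair.nn_integral_snd[symmetric]) simp_all
      also have "\<dots> = (\<integral>\<^sup>+z. ennreal ((2 * pi) ^ DIM('a)) * ennreal ((norm (g z))\<^sup>2) \<partial>lborel)"
        by (intro nn_integral_cong) (simp add: nn_integral_multc \<Gamma>_int)
      finally show ?thesis by (simp add: nn_integral_cmult)
    qed
    also have "ennreal (1 / 2) * ?B + ennreal (1 / 2) * ?B = ?B"
      unfolding distrib_right[symmetric] by (subst ennreal_plus[symmetric]) simp_all
    finally show ?thesis .
  qed
  show ?thesis
  proof (rule nn_integral_le_of_tendsto[OF _ bd])
    show "AE x in lborel. (\<lambda>n. ennreal (exp (- \<epsilon> n * (norm x)\<^sup>2) * (norm (osc g x))\<^sup>2)) \<longlonglongrightarrow> ennreal ((norm (osc g x))\<^sup>2)"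
    proof (intro AE_I2 tendsto_ennrealI)
      fix x :: 'a
      have "\<epsilon> \<longlonglongrightarrow> 0" unfolding \<epsilon>_def by (rule LIMSEQ_inverse_real_of_nat)
      then have "(\<lambda>n. exp (- \<epsilon> n * (norm x)\<^sup>2) * (norm (osc g x))\<^sup>2) \<longlonglongrightarrow> exp (- 0 * (norm x)\<^sup>2) * (norm (osc g x))\<^sup>2"
        by (intro tendsto_intros)
      then show "(\<lambda>n. exp (- \<epsilon> n * (norm x)\<^sup>2) * (norm (osc g x))\<^sup>2) \<longlonglongrightarrow> (norm (osc g x))\<^sup>2" by simp
    qed
  qed measurable
qed


section \<open>Sobolev embedding for oscillatory integrals with integrable amplitude\<close>

lemma ennreal_square_le_imp_le:
  fixes a b :: ennreal
  assumes "a\<^sup>2 \<le> b\<^sup>2"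
  shows "a \<le> b"
  using assms by (cases a; cases b) (auto simp: ennreal_power top_unique power2_le_iff_abs_le)

text \<open>The power of \<open>|z|\<close> is \<open>\<beta>\<close> times the integral of
  \<open>r powr (- \<beta> - 1)\<close> over \<open>r \<ge> |z|\<close>. After Tonelli only volumes
  of balls of radius \<open>min r A\<close> remain; the part \<open>r \<le> A\<close> converges
  because \<open>\<beta>\<close> is below the dimension, the part \<open>r \<ge> A\<close> because
  \<open>\<beta> > 0\<close>.\<close>

lemma nn_integral_norm_powr_ball:
  fixes \<beta> A :: real
  assumes \<beta>: "0 < \<beta>" "\<beta> < DIM('a::euclidean_space)" and A: "0 < A"
  shows "(\<integral>\<^sup>+z. ennreal (norm z powr (- \<beta>)) * indicator {z. norm z < A} z \<partial>(lborel :: 'a measure))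
    \<le> ennreal (unit_ball_vol (DIM('a)) * (\<beta> / (DIM('a) - \<beta>) + 1) * A powr (DIM('a) - \<beta>))"
proof -
  let ?n = "real DIM('a)" and ?V = "unit_ball_vol (DIM('a))"
  define J where "J z r = ennreal (\<beta> * r powr (- \<beta> - 1)) * indicator {(z::'a, r). norm z \<le> r \<and> norm z < A \<and> 0 < r} (z, r)" for z r
  have [measurable]: "case_prod J \<in> borel_measurable (lborel \<Otimes>\<^sub>M lborel)" unfolding J_def indicator_def by measurable
  have "(\<integral>\<^sup>+z. ennreal (norm z powr (- \<beta>)) * indicator {z. norm z < A} z \<partial>(lborel :: 'a measure))
     \<le> (\<integral>\<^sup>+z. \<integral>\<^sup>+r. J z r \<partial>lborel \<partial>lborel)"
  proof (intro nn_integral_mono)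
    fix z :: 'a
    show "ennreal (norm z powr (- \<beta>)) * indicator {z. norm z < A} z \<le> (\<integral>\<^sup>+r. J z r \<partial>lborel)"
    proof (cases "z \<noteq> 0 \<and> norm z < A")
      case True
      have pos: "0 < r" if "norm z \<le> r" for r using True that less_le_trans[of 0 "norm z" r] by simp
      have "ennreal (norm z powr (- \<beta>)) = ennreal \<beta> * ennreal (norm z powr (- \<beta>) / \<beta>)"
        using \<beta> by (simp flip: ennreal_mult)
      also have "\<dots> = ennreal \<beta> * (\<integral>\<^sup>+r. ennreal (r powr (- \<beta> - 1)) * indicator {norm z..} r \<partial>lborel)"
        using True \<beta> by (subst nn_integral_powr_to_infinity) auto
      also have "\<dots> = (\<integral>\<^sup>+r. J z r \<partial>lborel)"
        using True \<beta> by (subst nn_integral_cmult[symmetric], measurable)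
          (auto intro!: nn_integral_cong simp: J_def indicator_def ennreal_mult pos)
      finally show ?thesis using True by simp
    qed auto
  qed
  also have "\<dots> = (\<integral>\<^sup>+r. \<integral>\<^sup>+z. J z r \<partial>lborel \<partial>lborel)"
    by (rule lborel_pair.Fubini'[symmetric]) measurable
  also have "\<dots> \<le> (\<integral>\<^sup>+r. ennreal (\<beta> * ?V) * (ennreal (r powr ((?n - \<beta>) - 1)) * indicator {0<..A} r)
      + ennreal (\<beta> * ?V * A powr ?n) * (ennreal (r powr (- \<beta> - 1)) * indicator {A..} r) \<partial>lborel)"
  proof (intro nn_integral_mono)
    fix r :: real
    show "(\<integral>\<^sup>+z. J z r \<partial>lborel) \<le> ennreal (\<beta> * ?V) * (ennreal (r powr ((?n - \<beta>) - 1)) * indicator {0<..A} r)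
      + ennreal (\<beta> * ?V * A powr ?n) * (ennreal (r powr (- \<beta> - 1)) * indicator {A..} r)"
    proof (cases "0 < r")
      case True
      have m: "0 < min r A" using True A by simp
      have "(\<integral>\<^sup>+z. J z r \<partial>lborel) \<le> (\<integral>\<^sup>+z. ennreal (\<beta> * r powr (- \<beta> - 1)) * indicator (cball 0 (min r A)) z \<partial>(lborel :: 'a measure))"
        by (intro nn_integral_mono) (auto simp: J_def indicator_def)
      also have "\<dots> = ennreal (\<beta> * r powr (- \<beta> - 1)) * ennreal (?V * min r A ^ DIM('a))"
        using m by (subst nn_integral_cmult_indicator) (simp_all add: emeasure_cball)
      also have "\<dots> = ennreal (\<beta> * ?V * (r powr (- \<beta> - 1) * min r A powr ?n))"
        using m \<beta> by (simp add: powr_realpow mult_ac unit_ball_vol_nonneg flip: ennreal_mult)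
      also have "\<dots> \<le> ennreal (\<beta> * ?V) * (ennreal (r powr ((?n - \<beta>) - 1)) * indicator {0<..A} r)
         + ennreal (\<beta> * ?V * A powr ?n) * (ennreal (r powr (- \<beta> - 1)) * indicator {A..} r)"
      proof (cases "r \<le> A")
        case le: True
        have "r powr (- \<beta> - 1) * min r A powr ?n = r powr ((?n - \<beta>) - 1)"
          using True le by (simp add: powr_add[symmetric] algebra_simps)
        then show ?thesis using True le \<beta> by (simp add: ennreal_mult unit_ball_vol_nonneg)
      next
        case False
        then have "r powr (- \<beta> - 1) * min r A powr ?n = A powr ?n * r powr (- \<beta> - 1)" by simp
        then show ?thesis using True False \<beta> by (simp add: ennreal_mult[symmetric] unit_ball_vol_nonneg mult.assoc)
      qed
      finally show ?thesis .
    next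
      case False
      then have "(\<integral>\<^sup>+z. J z r \<partial>lborel) = (\<integral>\<^sup>+z. 0 \<partial>(lborel :: 'a measure))"
        by (intro nn_integral_cong) (simp add: J_def)
      then show ?thesis by simp
    qed
  qed
  also have "\<dots> = ennreal (\<beta> * ?V) * ennreal (A powr (?n - \<beta>) / (?n - \<beta>)) + ennreal (\<beta> * ?V * A powr ?n) * ennreal (A powr (- \<beta>) / \<beta>)"
    using \<beta> A by (simp add: nn_integral_add nn_integral_cmult nn_integral_powr_greaterThanLessThan(1) nn_integral_powr_to_infinity)
  also have "\<dots> = ennreal (\<beta> * ?V * (A powr (?n - \<beta>) / (?n - \<beta>)) + \<beta> * ?V * A powr ?n * (A powr (- \<beta>) / \<beta>))"
    using \<beta> A by (simp add: unit_ball_vol_nonneg flip: ennreal_mult ennreal_plus)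
  also have "\<beta> * ?V * (A powr (?n - \<beta>) / (?n - \<beta>)) + \<beta> * ?V * A powr ?n * (A powr (- \<beta>) / \<beta>)
     = ?V * (\<beta> / (?n - \<beta>) + 1) * A powr (?n - \<beta>)"
  proof -
    have "\<beta> * ?V * A powr ?n * (A powr (- \<beta>) / \<beta>) = ?V * (A powr ?n * A powr (- \<beta>))" using \<beta> by simp
    also have "A powr ?n * A powr (- \<beta>) = A powr (?n - \<beta>)" by (simp flip: powr_add)
    finally show ?thesis by (simp add: algebra_simps)
  qed
  finally show ?thesis .
qed

text \<open>
  Level sets with \<open>p = 2\<close>: at level \<open>l\<close> the low frequencies contribute at most \<open>l/2\<close> by Cauchy-Schwarz, and the
  rest is controlled by the Plancherel inequality.
\<close>

theorem osc_Sobolev: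
  assumes q: "2 < q"
  shows "\<exists>C\<ge>0. \<forall>g. integrable lborel g \<longrightarrow>
    (\<integral>\<^sup>+x. ennreal (norm (osc g x) powr q) \<partial>lborel)
    \<le> ennreal C * ennreal_pow (\<integral>\<^sup>+z. ennreal (norm z powr (DIM('a::euclidean_space) * (1 - 2 / q)) * (norm (g z))\<^sup>2) \<partial>(lborel :: 'a measure)) (q / 2)"
proof -
  define n where "n = real DIM('a)"
  \<comment> \<open>The threshold will be \<open>b z = K * norm z powr \<delta>\<close>, so
    \<open>b z < l\<close> is a ball of radius \<open>A = (l / K) powr (1 / \<delta>)\<close>. With
    \<open>\<delta> = n / q\<close> one has \<open>n - \<beta> = 2 * \<delta>\<close>, so that the
    low frequencies scale like \<open>l^2\<close>, and \<open>\<delta> * (q - 2) = \<beta>\<close>,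
    so that the level set lemma returns the weight of the statement.\<close>
  define \<delta> where "\<delta> = n / q"
  define \<beta> where "\<beta> = n * (1 - 2 / q)"
  have n: "0 < n" by (simp add: n_def)
  have \<beta>: "0 < \<beta>" "\<beta> < n" "n - \<beta> = 2 * \<delta>" "0 < \<delta>" "\<delta> * (q - 2) = \<beta>" "\<beta> < real DIM('a)"
    using q n by (auto simp: \<beta>_def \<delta>_def field_simps n_def)
  define c0 where "c0 = unit_ball_vol n * (\<beta> / (n - \<beta>) + 1)"
  have c0: "0 < c0" using \<beta> by (simp add: c0_def n_def unit_ball_vol_pos add_pos_pos)
  define C where "C = 4 * (2 * pi) ^ DIM('a) * q / (q - 2) * (2 * sqrt c0) powr (q - 2)"
  have C: "0 < C" using q c0 by (simp add: C_def)
  have "(\<integral>\<^sup>+x. ennreal (norm (osc g x) powr q) \<partial>lborel)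
    \<le> ennreal C * ennreal_pow (\<integral>\<^sup>+z. ennreal (norm z powr \<beta> * (norm (g z))\<^sup>2) \<partial>(lborel :: 'a measure)) (q / 2)"
    if g: "integrable lborel g" for g :: "'a \<Rightarrow> complex"
  proof -
    have [measurable]: "g \<in> borel_measurable borel" using g by auto
    define S where "S = (\<integral>\<^sup>+z. ennreal (norm z powr \<beta> * (norm (g z))\<^sup>2) \<partial>(lborel :: 'a measure))"
    consider "S = top" | "S = 0" | s where "S = ennreal s" "0 < s"
      by (metis ennreal_cases ennreal_less_zero_iff gr_zeroI infinity_ennreal_def)
    then show ?thesis
    proof cases
      case 1
      then show ?thesis using C by (simp add: S_def[symmetric] ennreal_mult_top)
    next
      case 2
      then have "AE z in lborel. norm z powr \<beta> * (norm (g z))\<^sup>2 = 0"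
        unfolding S_def by (subst (asm) nn_integral_0_iff_AE) (auto elim!: eventually_mono simp: ennreal_eq_0_iff mult_le_0_iff powr_ge_zero)
      \<comment> \<open>The weight vanishes only at the origin, a null set.\<close>
      with AE_lborel_singleton[of "0::'a"] have "AE z in lborel. g z = 0" by eventually_elim simp
      then have "osc g x = 0" for x
        unfolding osc_def by (intro integral_eq_zero_AE) (auto elim!: eventually_mono)
      then show ?thesis using q by simp
    next
      case (3 s)
      \<comment> \<open>Chosen so that Cauchy-Schwarz bounds the square of the low part by
        \<open>c0 * (l / K)^2 * s = (l / 2)^2\<close>.\<close>
      define K where "K = 2 * sqrt (c0 * s)"
      have K: "0 < K" "K\<^sup>2 = 4 * c0 * s" using c0 3 by (auto simp: K_def power_mult_distrib)
      define b where "b z = K * norm z powr \<delta>" for z :: 'a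
      have [measurable]: "b \<in> borel_measurable borel" unfolding b_def by measurable
      define h where "h z = ennreal ((norm (g z))\<^sup>2)" for z
      have [measurable]: "h \<in> borel_measurable borel" unfolding h_def by measurable
      have lev: "emeasure lborel {x\<in>space lborel. ennreal l < ennreal (norm (osc g x))}
        \<le> ennreal ((4 * (2 * pi) ^ DIM('a)) * l powr (- 2)) * ennreal_pow (\<integral>\<^sup>+z. h z * indicator {z. l \<le> b z} z \<partial>lborel) (2 / 2)"
        if l: "0 < l" for l
      proof -
        define gL where "gL z = indicator {z. b z < l} z *\<^sub>R g z" for z
        define gH where "gH z = indicator {z. l \<le> b z} z *\<^sub>R g z" for z
        have [measurable]: "{z. b z < l} \<in> sets borel" "{z. l \<le> b z} \<in> sets borel" by measurable
        have gL: "integrable lborel gL" unfolding gL_def using g by (intro integrable_mult_indicator) auto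
        have gH: "integrable lborel gH" unfolding gH_def using g by (intro integrable_mult_indicator) auto
        have "g z = gL z + gH z" for z by (auto simp: gL_def gH_def indicator_def)
        moreover have ic: "integrable lborel (\<lambda>z. cis (x \<bullet> z) * f z)" if "integrable lborel f" for x f
          using that by (rule Bochner_Integration.integrable_bound) (use that in \<open>auto simp: norm_mult\<close>)
        ultimately have split: "osc g x = osc gL x + osc gH x" for x
          unfolding osc_def using ic[OF gL] ic[OF gH] by (simp add: distrib_left)
        define A where "A = (l / K) powr (1 / \<delta>)"
        have A: "0 < A" using l K by (simp add: A_def)
        have bA: "b z < l \<longleftrightarrow> norm z < A" for z
        proof -
          have "b z < l \<longleftrightarrow> norm z powr \<delta> < A powr \<delta>"
            using K \<beta> l by (simp add: b_def A_def powr_powr field_simps)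
          also have "\<dots> \<longleftrightarrow> norm z < A" using powr_less_mono2[of \<delta> "norm z" A] powr_mono2[of \<delta> A "norm z"] A \<beta>(4)
            by (cases "norm z < A") auto
          finally show ?thesis .
        qed
        have low: "norm (osc gL x) \<le> l / 2" for x
        proof -
          let ?a = "\<integral>\<^sup>+z. ennreal (norm (gL z)) \<partial>lborel"
          have sq: "(norm z powr x)\<^sup>2 = norm z powr (2 * x)" for z :: 'a and x
            by (simp add: power2_eq_square flip: powr_add)
          let ?f = "\<lambda>z::'a. ennreal (norm z powr (- \<beta> / 2)) * indicator {z. norm z < A} z"
          have "?a = (\<integral>\<^sup>+z. ?f z * ennreal (norm z powr (\<beta> / 2) * norm (g z)) \<partial>lborel)"
          proof (intro nn_integral_cong_AE)
            show "AE z in lborel. ennreal (norm (gL z)) = ?f z * ennreal (norm z powr (\<beta> / 2) * norm (g z))"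
              using AE_lborel_singleton[of "0::'a"]
            proof eventually_elim
              case (elim z)
              have "norm z powr (- \<beta> / 2) * (norm z powr (\<beta> / 2) * norm (g z)) = norm (g z)"
                using elim by (simp add: mult.assoc[symmetric] flip: powr_add)
              then show ?case by (auto simp: gL_def indicator_def bA simp flip: ennreal_mult)
            qed
          qed
          then have "?a\<^sup>2 \<le> (\<integral>\<^sup>+z. (?f z)\<^sup>2 \<partial>lborel) * (\<integral>\<^sup>+z. (ennreal (norm z powr (\<beta> / 2) * norm (g z)))\<^sup>2 \<partial>lborel)"
            by (simp only:) (rule Cauchy_Schwarz_nn_integral; measurable)
          also have "(\<integral>\<^sup>+z. (ennreal (norm z powr (\<beta> / 2) * norm (g z)))\<^sup>2 \<partial>lborel) = ennreal s"
            unfolding 3(1)[symmetric] S_def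
            by (intro nn_integral_cong) (simp add: ennreal_power power_mult_distrib sq)
          also have "(\<integral>\<^sup>+z. (?f z)\<^sup>2 \<partial>lborel) = (\<integral>\<^sup>+z. ennreal (norm z powr (- \<beta>)) * indicator {z. norm z < A} z \<partial>(lborel :: 'a measure))"
            by (intro nn_integral_cong) (auto simp add: indicator_def ennreal_power power_mult_distrib sq)
          also have "\<dots> \<le> ennreal (c0 * A powr (n - \<beta>))"
            unfolding c0_def n_def using nn_integral_norm_powr_ball[OF \<beta>(1,6) A] by simp
          also have "A powr (n - \<beta>) = (l / K)\<^sup>2"
            using l K \<beta> by (simp add: A_def powr_powr \<beta>(3) powr_numeral)
          also have "ennreal (c0 * (l / K)\<^sup>2) * ennreal s = ennreal ((l / 2)\<^sup>2)"
            using K c0 3 by (simp add: ennreal_mult[symmetric] power_divide)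
          finally have "?a\<^sup>2 \<le> (ennreal (l / 2))\<^sup>2" using 3 l by (simp add: ennreal_power mult_right_mono)
          then have "?a \<le> ennreal (l / 2)" by (rule ennreal_square_le_imp_le)
          then have "ennreal (norm (osc gL x)) \<le> ennreal (l / 2)"
            using norm_integral_le_nn_integral[of lborel "\<lambda>z. cis (x \<bullet> z) * gL z"] by (simp add: osc_def norm_mult)
          then show ?thesis using l by simp
        qed
        \<comment> \<open>Where \<open>osc g\<close> exceeds \<open>l\<close>, its high part is at
          least \<open>l / 2\<close>, and Chebyshev's inequality applies to that part.\<close>
        have "emeasure lborel {x\<in>space lborel. ennreal l < ennreal (norm (osc g x))}
          \<le> emeasure lborel {x\<in>space lborel. 1 \<le> ennreal (4 / l\<^sup>2) * ennreal ((norm (osc gH x))\<^sup>2)}"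
        proof (intro emeasure_mono subsetI)
          fix x assume "x \<in> {x\<in>space lborel. ennreal l < ennreal (norm (osc g x))}"
          then have "l < norm (osc g x)" using l by (simp add: ennreal_less_iff)
          also have "\<dots> \<le> norm (osc gL x) + norm (osc gH x)" unfolding split by (rule norm_triangle_ineq)
          finally have "l / 2 \<le> norm (osc gH x)" using low[of x] by simp
          then have "(l / 2)\<^sup>2 \<le> (norm (osc gH x))\<^sup>2" using l by (intro power_mono) auto
          then have "1 \<le> 4 / l\<^sup>2 * (norm (osc gH x))\<^sup>2" using l by (simp add: field_simps)
          then have "1 \<le> ennreal (4 / l\<^sup>2) * ennreal ((norm (osc gH x))\<^sup>2)"
            using l by (simp flip: ennreal_mult ennreal_1)
          then show "x \<in> {x\<in>space lborel. 1 \<le> ennreal (4 / l\<^sup>2) * ennreal ((norm (osc gH x))\<^sup>2)}" by simp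
        qed (use gH in measurable)
        also have "\<dots> \<le> ennreal (4 / l\<^sup>2) * (\<integral>\<^sup>+x\<in>space lborel. ennreal ((norm (osc gH x))\<^sup>2) \<partial>lborel)"
          using gH by (intro nn_integral_Markov_inequality[where A = "space lborel"]) auto
        also have "\<dots> \<le> ennreal (4 / l\<^sup>2) * (ennreal ((2 * pi) ^ DIM('a)) * (\<integral>\<^sup>+z. ennreal ((norm (gH z))\<^sup>2) \<partial>lborel))"
          using osc_L2_bound[OF gH] by (intro mult_left_mono) auto
        also have "(\<integral>\<^sup>+z. ennreal ((norm (gH z))\<^sup>2) \<partial>lborel) = (\<integral>\<^sup>+z. h z * indicator {z. l \<le> b z} z \<partial>lborel)"
          by (intro nn_integral_cong) (auto simp: gH_def h_def indicator_def)
        also have "ennreal (4 / l\<^sup>2) * (ennreal ((2 * pi) ^ DIM('a)) * I) = ennreal ((4 * (2 * pi) ^ DIM('a)) * l powr (- 2)) * ennreal_pow I (2 / 2)" for I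
        proof -
          have "ennreal (4 / l\<^sup>2) * (ennreal ((2 * pi) ^ DIM('a)) * I) = ennreal (4 / l\<^sup>2 * (2 * pi) ^ DIM('a)) * I"
            unfolding mult.assoc[symmetric] by (subst ennreal_mult[symmetric]) simp_all
          also have "4 / l\<^sup>2 * (2 * pi) ^ DIM('a) = (4 * (2 * pi) ^ DIM('a)) * l powr (- 2)"
            using l by (simp add: powr_minus divide_inverse)
          finally show ?thesis by simp
        qed
        finally show ?thesis .
      qed
      have "(\<integral>\<^sup>+x. ennreal_pow (ennreal (norm (osc g x))) q \<partial>lborel)
        \<le> ennreal ((4 * (2 * pi) ^ DIM('a)) * q / (q - 2)) * ennreal_pow (\<integral>\<^sup>+z. h z * ennreal (b z powr (2 * (q - 2) / 2)) \<partial>lborel) (2 / 2)"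
      proof (rule nn_integral_level_sets[OF sigma_finite_lborel sigma_finite_lborel])
        show "0 \<le> b z" for z using K by (simp add: b_def)
      qed (use q lev in simp_all)
      also have "(\<integral>\<^sup>+z. h z * ennreal (b z powr (2 * (q - 2) / 2)) \<partial>lborel) = (\<integral>\<^sup>+z. ennreal (K powr (q - 2)) * ennreal (norm z powr \<beta> * (norm (g z))\<^sup>2) \<partial>lborel)"
      proof (intro nn_integral_cong)
        fix z :: 'a
        have "b z powr (2 * (q - 2) / 2) = K powr (q - 2) * (norm z powr \<delta>) powr (q - 2)"
        proof -
          have "2 * (q - 2) / 2 = q - 2" by simp
          then show ?thesis using K by (simp only: b_def powr_mult less_imp_le powr_ge_zero)
        qed
        also have "(norm z powr \<delta>) powr (q - 2) = norm z powr \<beta>" unfolding powr_powr \<beta>(5) ..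
        finally show "h z * ennreal (b z powr (2 * (q - 2) / 2)) = ennreal (K powr (q - 2)) * ennreal (norm z powr \<beta> * (norm (g z))\<^sup>2)"
          by (simp add: h_def mult_ac flip: ennreal_mult)
      qed
      also have "\<dots> = ennreal (K powr (q - 2)) * ennreal s"
        by (subst nn_integral_cmult, measurable) (simp add: S_def[symmetric] 3)
      also have "ennreal ((4 * (2 * pi) ^ DIM('a)) * q / (q - 2)) * ennreal_pow (ennreal (K powr (q - 2)) * ennreal s) (2 / 2)
         = ennreal (((4 * (2 * pi) ^ DIM('a)) * q / (q - 2)) * (K powr (q - 2) * s))"
        using q 3 by (simp flip: ennreal_mult)
      also have "K powr (q - 2) * s = (2 * sqrt c0) powr (q - 2) * s powr (q / 2)"
      proof -
        have "K powr (q - 2) = (2 * sqrt c0) powr (q - 2) * sqrt s powr (q - 2)"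
          unfolding K_def real_sqrt_mult using c0 3 by (simp add: powr_mult mult.assoc[symmetric])
        also have "sqrt s powr (q - 2) = s powr (q / 2 - 1)"
          using 3 by (simp add: powr_half_sqrt[symmetric] powr_powr diff_divide_distrib)
        finally show ?thesis using 3 by (simp add: powr_diff)
      qed
      also have "((4 * (2 * pi) ^ DIM('a)) * q / (q - 2)) * ((2 * sqrt c0) powr (q - 2) * s powr (q / 2)) = C * s powr (q / 2)"
        by (simp add: C_def)
      also have "ennreal \<dots> = ennreal C * ennreal_pow S (q / 2)"
        using C 3 by (simp add: ennreal_mult ennreal_pow_ennreal)
      finally show ?thesis by (simp add: S_def ennreal_pow_ennreal)
    qed
  qed
  then show ?thesis using C unfolding \<beta>_def n_def by (intro exI[of _ C]) auto
qed

subsection \<open>Van der Corput's lemma\<close>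

lemma has_vector_derivative_cis:
  assumes "(\<psi> has_real_derivative d) (at x within S)"
  shows "((\<lambda>x. cis (\<psi> x)) has_vector_derivative \<i> * of_real d * cis (\<psi> x)) (at x within S)"
  using assms unfolding has_vector_derivative_complex_iff
  by (auto intro!: derivative_eq_intros)

text \<open>One integration by parts. The bound \<open>V\<close> for the variation of
  \<open>1 / \<psi>a\<close> is kept apart from the endpoint terms, because the two first-derivative
  tests below estimate it differently.\<close>

lemma van_der_Corput_base:
  fixes \<psi> \<psi>a \<psi>b g :: "real \<Rightarrow> real"
  assumes ab: "a \<le> b"
    and d1: "\<And>x. x \<in> {a..b} \<Longrightarrow> (\<psi> has_real_derivative \<psi>a x) (at x)"
    and d2: "\<And>x. x \<in> {a..b} \<Longrightarrow> (\<psi>a has_real_derivative \<psi>b x) (at x)"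
    and nz: "\<And>x. x \<in> {a..b} \<Longrightarrow> \<psi>a x \<noteq> 0"
    and g: "(g has_integral V) {a..b}" "\<And>x. x \<in> {a..b} \<Longrightarrow> \<bar>\<psi>b x\<bar> / (\<psi>a x)\<^sup>2 \<le> g x"
  shows "norm (integral {a..b} (\<lambda>x. cis (\<psi> x))) \<le> 1 / \<bar>\<psi>a a\<bar> + 1 / \<bar>\<psi>a b\<bar> + V"
proof -
  \<comment> \<open>\<open>H\<close> is \<open>cis \<psi>\<close> divided by
    \<open>\<i> * \<psi>a\<close>; its derivative is the integrand plus the error
    \<open>J\<close>.\<close>
  define H where "H x = - \<i> * (cis (\<psi> x) * of_real (1 / \<psi>a x))" for x
  define J where "J x = \<i> * (cis (\<psi> x) * of_real (\<psi>b x / (\<psi>a x)\<^sup>2))" for x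
  have "((\<lambda>x. cis (\<psi> x) + J x) has_integral H b - H a) {a..b}"
  proof (rule fundamental_theorem_of_calculus[OF ab])
    fix x assume x: "x \<in> {a..b}"
    have "((\<lambda>x. 1 / \<psi>a x) has_real_derivative - (\<psi>b x / (\<psi>a x)\<^sup>2)) (at x)"
      using nz[OF x] by (auto intro!: derivative_eq_intros d2[OF x] simp: power2_eq_square)
    then have "((\<lambda>x. complex_of_real (1 / \<psi>a x)) has_vector_derivative of_real (- (\<psi>b x / (\<psi>a x)\<^sup>2))) (at x)"
      by (intro has_vector_derivative_of_real) (simp add: has_real_derivative_iff_has_vector_derivative)
    from has_vector_derivative_mult[OF has_vector_derivative_cis[OF d1[OF x]] this]
    have "((\<lambda>x. cis (\<psi> x) * complex_of_real (1 / \<psi>a x)) has_vector_derivative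
        cis (\<psi> x) * of_real (- (\<psi>b x / (\<psi>a x)\<^sup>2)) + \<i> * of_real (\<psi>a x) * cis (\<psi> x) * of_real (1 / \<psi>a x)) (at x)" .
    from has_vector_derivative_mult_right[OF this, of "- \<i>"]
    have "(H has_vector_derivative - \<i> * (cis (\<psi> x) * of_real (- (\<psi>b x / (\<psi>a x)\<^sup>2)) + \<i> * of_real (\<psi>a x) * cis (\<psi> x) * of_real (1 / \<psi>a x))) (at x)"
      unfolding H_def .
    also have "- \<i> * (cis (\<psi> x) * of_real (- (\<psi>b x / (\<psi>a x)\<^sup>2)) + \<i> * of_real (\<psi>a x) * cis (\<psi> x) * of_real (1 / \<psi>a x)) = cis (\<psi> x) + J x"
      using nz[OF x] by (simp add: J_def algebra_simps)
    finally show "(H has_vector_derivative cis (\<psi> x) + J x) (at x within {a..b})"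
      by (rule has_vector_derivative_at_within)
  qed
  moreover have c: "(\<lambda>x. cis (\<psi> x)) integrable_on {a..b}"
    by (intro integrable_continuous_interval continuous_intros)
      (auto intro!: continuous_at_imp_continuous_on DERIV_isCont d1)
  ultimately have J: "(J has_integral H b - H a - integral {a..b} (\<lambda>x. cis (\<psi> x))) {a..b}"
    using has_integral_diff[OF _ integrable_integral[OF c], of "\<lambda>x. cis (\<psi> x) + J x"] by simp
  have "norm (integral {a..b} J) \<le> integral {a..b} g"
  proof (rule integral_norm_bound_integral)
    show "J integrable_on {a..b}" "g integrable_on {a..b}" using J g by (auto simp: integrable_on_def)
    show "norm (J x) \<le> g x" if "x \<in> {a..b}" for x
      using g(2)[OF that] by (simp add: J_def norm_mult norm_divide norm_power)
  qed
  then have "norm (H b - H a - integral {a..b} (\<lambda>x. cis (\<psi> x))) \<le> V"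
    using J g by (simp add: integral_unique)
  moreover have "norm (H b) = 1 / \<bar>\<psi>a b\<bar>" "norm (H a) = 1 / \<bar>\<psi>a a\<bar>"
    by (simp_all add: H_def norm_mult norm_divide)
  moreover have "norm (integral {a..b} (\<lambda>x. cis (\<psi> x))) \<le> norm (H b) + norm (H a) + norm (H b - H a - integral {a..b} (\<lambda>x. cis (\<psi> x)))"
    using norm_triangle_ineq4[of "H b - H a" "H b - H a - integral {a..b} (\<lambda>x. cis (\<psi> x))"] norm_triangle_ineq4[of "H b" "H a"]
    by simp
  ultimately show ?thesis by simp
qed

text \<open>For monotone \<open>\<psi>a\<close> the variation of \<open>1 / \<psi>a\<close> is its
  endpoint difference, which cancels one endpoint term and doubles the other.\<close>

lemma van_der_Corput_first:
  fixes \<psi> \<psi>a \<psi>b :: "real \<Rightarrow> real"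
  assumes ab: "a \<le> b" and l: "0 < l"
    and d1: "\<And>x. x \<in> {a..b} \<Longrightarrow> (\<psi> has_real_derivative \<psi>a x) (at x)"
    and d2: "\<And>x. x \<in> {a..b} \<Longrightarrow> (\<psi>a has_real_derivative \<psi>b x) (at x)"
    and low: "(\<forall>x\<in>{a..b}. l \<le> \<psi>a x) \<or> (\<forall>x\<in>{a..b}. \<psi>a x \<le> - l)" and mono: "\<And>x. x \<in> {a..b} \<Longrightarrow> 0 \<le> \<psi>b x"
  shows "norm (integral {a..b} (\<lambda>x. cis (\<psi> x))) \<le> 2 / l"
proof -
  have nz: "\<psi>a x \<noteq> 0" if "x \<in> {a..b}" for x using low l that by fastforce
  have "((\<lambda>x. \<psi>b x / (\<psi>a x)\<^sup>2) has_integral (- 1 / \<psi>a b) - (- 1 / \<psi>a a)) {a..b}"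
  proof (rule fundamental_theorem_of_calculus[OF ab])
    fix x assume x: "x \<in> {a..b}"
    have "((\<lambda>x. 1 / \<psi>a x) has_real_derivative - (\<psi>b x / (\<psi>a x)\<^sup>2)) (at x)"
      using nz[OF x] by (auto intro!: derivative_eq_intros d2[OF x] simp: power2_eq_square)
    from DERIV_minus[OF this] have "((\<lambda>x. - 1 / \<psi>a x) has_real_derivative \<psi>b x / (\<psi>a x)\<^sup>2) (at x)"
      by simp
    from this[unfolded has_real_derivative_iff_has_vector_derivative]
    show "((\<lambda>x. - 1 / \<psi>a x) has_vector_derivative \<psi>b x / (\<psi>a x)\<^sup>2) (at x within {a..b})"
      by (rule has_vector_derivative_at_within)
  qed
  from van_der_Corput_base[OF ab d1 d2 nz this]
  have le: "norm (integral {a..b} (\<lambda>x. cis (\<psi> x))) \<le> 1 / \<bar>\<psi>a a\<bar> + 1 / \<bar>\<psi>a b\<bar> + ((- 1 / \<psi>a b) - (- 1 / \<psi>a a))"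
    using mono by (simp only: abs_of_nonneg order_refl)
  from low show ?thesis
  proof
    assume "\<forall>x\<in>{a..b}. l \<le> \<psi>a x"
    then have "l \<le> \<psi>a a" "l \<le> \<psi>a b" using ab by auto
    moreover from this have "2 / \<psi>a a \<le> 2 / l" using l by (intro divide_left_mono) auto
    ultimately show ?thesis using le l by simp
  next
    assume "\<forall>x\<in>{a..b}. \<psi>a x \<le> - l"
    then have "\<psi>a a \<le> - l" "\<psi>a b \<le> - l" using ab by auto
    moreover from this have "2 / (- \<psi>a b) \<le> 2 / l" using l by (intro frac_le) auto
    ultimately show ?thesis using le l by simp
  qed
qed

text \<open>A crude bound on the second derivative replaces monotonicity. It serves phases dominated
  by their linear term, whose second derivative may change sign but is small.\<close>

lemma van_der_Corput_first_bounded: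
  fixes \<psi> \<psi>a \<psi>b :: "real \<Rightarrow> real"
  assumes ab: "a \<le> b" and l: "0 < l"
    and d1: "\<And>x. x \<in> {a..b} \<Longrightarrow> (\<psi> has_real_derivative \<psi>a x) (at x)"
    and d2: "\<And>x. x \<in> {a..b} \<Longrightarrow> (\<psi>a has_real_derivative \<psi>b x) (at x)"
    and low: "\<And>x. x \<in> {a..b} \<Longrightarrow> l \<le> \<bar>\<psi>a x\<bar>" and bd: "\<And>x. x \<in> {a..b} \<Longrightarrow> \<bar>\<psi>b x\<bar> \<le> S"
  shows "norm (integral {a..b} (\<lambda>x. cis (\<psi> x))) \<le> 2 / l + (b - a) * S / l\<^sup>2"
proof -
  have nz: "\<psi>a x \<noteq> 0" if "x \<in> {a..b}" for x using low[OF that] l by auto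
  have "((\<lambda>x. S / l\<^sup>2) has_integral (b - a) *\<^sub>R (S / l\<^sup>2)) {a..b}"
    using has_integral_const_real[of "S / l\<^sup>2" a b] ab by simp
  moreover have "\<bar>\<psi>b x\<bar> / (\<psi>a x)\<^sup>2 \<le> S / l\<^sup>2" if "x \<in> {a..b}" for x
  proof (rule frac_le)
    have "l\<^sup>2 \<le> \<bar>\<psi>a x\<bar>\<^sup>2" using low[OF that] l by (intro power_mono) auto
    then show "l\<^sup>2 \<le> (\<psi>a x)\<^sup>2" by simp
    show "0 \<le> S" using bd[OF that] by simp
  qed (use l bd[OF that] in auto)
  ultimately have "norm (integral {a..b} (\<lambda>x. cis (\<psi> x))) \<le> 1 / \<bar>\<psi>a a\<bar> + 1 / \<bar>\<psi>a b\<bar> + (b - a) *\<^sub>R (S / l\<^sup>2)"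
    by (intro van_der_Corput_base[OF ab d1 d2 nz])
  moreover have "1 / \<bar>\<psi>a a\<bar> \<le> 1 / l" "1 / \<bar>\<psi>a b\<bar> \<le> 1 / l"
    using low[of a] low[of b] ab l by (auto intro!: divide_left_mono)
  ultimately show ?thesis by simp
qed

text \<open>The passage from one derivative to the next: a function of slope at least
  \<open>l\<close> has, away from one point \<open>c\<close>, size at least \<open>l\<close> times
  the distance to \<open>c\<close> and a known sign on either side. Without a zero in the interval,
  \<open>c\<close> is an endpoint.\<close>

lemma slope_root:
  fixes f f' :: "real \<Rightarrow> real"
  assumes ab: "a \<le> b" and d: "\<And>x. x \<in> {a..b} \<Longrightarrow> (f has_real_derivative f' x) (at x)"
    and l: "\<And>x. x \<in> {a..b} \<Longrightarrow> l \<le> f' x"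
  shows "\<exists>c\<in>{a..b}. (\<forall>x. c < x \<and> x \<le> b \<longrightarrow> l * (x - c) \<le> f x) \<and> (\<forall>x. a \<le> x \<and> x < c \<longrightarrow> f x \<le> - (l * (c - x)))"
proof -
  have mvt: "l * (y - x) \<le> f y - f x" if xy: "a \<le> x" "x \<le> y" "y \<le> b" for x y
  proof (cases "x = y")
    case False
    then obtain z where z: "x < z" "z < y" "f y - f x = (y - x) * f' z"
      using MVT2[of x y f f'] xy d by fastforce
    then show ?thesis using l[of z] xy mult_left_mono[of l "f' z" "y - x"] by (simp add: mult.commute)
  qed simp
  consider "0 \<le> f a" | "f b \<le> 0" | "f a < 0" "0 < f b" by linarith
  then show ?thesis
  proof cases
    case 1
    then have "l * (x - a) \<le> f x" if "a < x \<and> x \<le> b" for x using mvt[of a x] that by auto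
    then show ?thesis using ab by (intro bexI[of _ a]) auto
  next
    case 2
    then have "f x \<le> - (l * (b - x))" if "a \<le> x \<and> x < b" for x using mvt[of x b] that by auto
    then show ?thesis using ab by (intro bexI[of _ b]) auto
  next
    case 3
    have "\<exists>c\<ge>a. c \<le> b \<and> f c = 0"
    proof (rule IVT')
      show "continuous_on {a..b} f"
        by (intro continuous_at_imp_continuous_on ballI) (rule DERIV_isCont[OF d])
    qed (use 3 ab in auto)
    then obtain c where "a \<le> c" "c \<le> b" "f c = 0" by auto
    then have "f x \<le> - (l * (c - x))" if "a \<le> x \<and> x < c" for x using mvt[of x c] that by auto
    moreover have "l * (x - c) \<le> f x" if "c < x \<and> x \<le> b" for x
      using mvt[of c x] that \<open>a \<le> c\<close> \<open>f c = 0\<close> by auto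
    ultimately show ?thesis using \<open>a \<le> c\<close> \<open>c \<le> b\<close> by (intro bexI[of _ c]) auto
  qed
qed

text \<open>A window of half-width \<open>h\<close> about the critical point is estimated trivially;
  the oscillatory bound \<open>B\<close> is used on the two sides.\<close>

lemma norm_integral_split_near_point:
  fixes f :: "real \<Rightarrow> complex"
  assumes cont: "continuous_on {a..b} f" and f: "\<And>x. norm (f x) \<le> 1" and c: "c \<in> {a..b}" and h: "0 < h" and B: "0 \<le> B"
    and right: "\<And>x y. c + h \<le> x \<Longrightarrow> x \<le> y \<Longrightarrow> y \<le> b \<Longrightarrow> norm (integral {x..y} f) \<le> B"
    and left: "\<And>x y. a \<le> x \<Longrightarrow> x \<le> y \<Longrightarrow> y \<le> c - h \<Longrightarrow> norm (integral {x..y} f) \<le> B"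
  shows "norm (integral {a..b} f) \<le> 2 * B + 2 * h"
proof -
  define u v where "u = max a (c - h)" and "v = min b (c + h)"
  have uv: "a \<le> u" "u \<le> v" "v \<le> b" "v - u \<le> 2 * h" using c h by (auto simp: u_def v_def)
  have int: "f integrable_on {x..y}" if "a \<le> x" "y \<le> b" for x y
    using that cont by (intro integrable_continuous_interval) (auto elim: continuous_on_subset)
  have "integral {a..b} f = integral {a..u} f + integral {u..b} f"
    by (rule Henstock_Kurzweil_Integration.integral_combine[symmetric]) (use uv int in auto)
  also have "integral {u..b} f = integral {u..v} f + integral {v..b} f"
    by (rule Henstock_Kurzweil_Integration.integral_combine[symmetric]) (use uv int in auto)
  finally have "norm (integral {a..b} f) \<le> norm (integral {a..u} f) + (norm (integral {u..v} f) + norm (integral {v..b} f))"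
    using norm_triangle_ineq[of "integral {a..u} f" "integral {u..v} f + integral {v..b} f"] norm_triangle_ineq[of "integral {u..v} f" "integral {v..b} f"]
    by simp
  moreover have "norm (integral {a..u} f) \<le> B"
    by (cases "a \<le> c - h") (use left[of a u] uv B in \<open>auto simp: u_def max_def\<close>)
  moreover have "norm (integral {v..b} f) \<le> B"
    by (cases "c + h \<le> b") (use right[of v b] uv B in \<open>auto simp: v_def min_def\<close>)
  moreover have "norm (integral {u..v} f) \<le> 1 * (v - u)"
    by (rule integral_bound) (use uv f cont in \<open>auto elim: continuous_on_subset\<close>)
  ultimately show ?thesis using uv by simp
qed

lemma van_der_Corput_second:
  fixes \<psi> \<psi>a \<psi>b :: "real \<Rightarrow> real"
  assumes ab: "a \<le> b" and l: "0 < l"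
    and d1: "\<And>x. x \<in> {a..b} \<Longrightarrow> (\<psi> has_real_derivative \<psi>a x) (at x)"
    and d2: "\<And>x. x \<in> {a..b} \<Longrightarrow> (\<psi>a has_real_derivative \<psi>b x) (at x)"
    and low: "\<And>x. x \<in> {a..b} \<Longrightarrow> l \<le> \<psi>b x"
  shows "norm (integral {a..b} (\<lambda>x. cis (\<psi> x))) \<le> 6 / sqrt l"
proof -
  obtain c where c: "c \<in> {a..b}" and cr: "\<And>x. c < x \<Longrightarrow> x \<le> b \<Longrightarrow> l * (x - c) \<le> \<psi>a x"
    and cl: "\<And>x. a \<le> x \<Longrightarrow> x < c \<Longrightarrow> \<psi>a x \<le> - (l * (c - x))"
    using slope_root[OF ab d2 low] by blast
  \<comment> \<open>At distance \<open>h\<close> the first derivative has size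
    \<open>l * h = sqrt l\<close>. The side bounds \<open>2 / sqrt l\<close> and the window
    \<open>2 * h\<close> are then comparable, with total \<open>4 + 2 = 6\<close>.\<close>
  define h where "h = 1 / sqrt l"
  have h: "0 < h" "l * h = sqrt l" using l by (auto simp: h_def real_div_sqrt)
  have "norm (integral {a..b} (\<lambda>x. cis (\<psi> x))) \<le> 2 * (2 / sqrt l) + 2 * h"
  proof (rule norm_integral_split_near_point[OF _ _ c h(1)])
    show "continuous_on {a..b} (\<lambda>x. cis (\<psi> x))"
      by (intro continuous_intros) (auto intro!: continuous_at_imp_continuous_on DERIV_isCont d1)
    fix x y
    assume xy: "c + h \<le> x" "x \<le> y" "y \<le> b"
    have "sqrt l \<le> \<psi>a t" if "t \<in> {x..y}" for t
    proof -
      have "l * h \<le> l * (t - c)" using that xy l by (intro mult_left_mono) auto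
      then show ?thesis using cr[of t] that xy h by simp
    qed
    then show "norm (integral {x..y} (\<lambda>x. cis (\<psi> x))) \<le> 2 / sqrt l"
      using xy c h l order_trans[OF less_imp_le[OF l] low]
      by (intro van_der_Corput_first[where \<psi>a = \<psi>a and \<psi>b = \<psi>b] d1 d2) auto
  next
    fix x y
    assume xy: "a \<le> x" "x \<le> y" "y \<le> c - h"
    have "\<psi>a t \<le> - sqrt l" if "t \<in> {x..y}" for t
    proof -
      have "l * h \<le> l * (c - t)" using that xy l by (intro mult_left_mono) auto
      then show ?thesis using cl[of t] that xy h by simp
    qed
    then show "norm (integral {x..y} (\<lambda>x. cis (\<psi> x))) \<le> 2 / sqrt l"
      using xy c h l order_trans[OF less_imp_le[OF l] low]
      by (intro van_der_Corput_first[where \<psi>a = \<psi>a and \<psi>b = \<psi>b] d1 d2) auto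
  qed (use l in auto)
  then show ?thesis by (simp add: h_def)
qed

lemma norm_integral_cis_uminus:
  "norm (integral S (\<lambda>x. cis (- \<psi> x))) = norm (integral S (\<lambda>x. cis (\<psi> x)))"
proof -
  have "integral S (\<lambda>x. cis (- \<psi> x)) = cnj (integral S (\<lambda>x. cis (\<psi> x)))"
    by (simp add: integral_cnj cis_cnj)
  then show ?thesis by simp
qed

lemma van_der_Corput_third:
  fixes \<psi> \<psi>a \<psi>b \<psi>c :: "real \<Rightarrow> real"
  assumes ab: "a \<le> b" and l: "0 < l"
    and d1: "\<And>x. x \<in> {a..b} \<Longrightarrow> (\<psi> has_real_derivative \<psi>a x) (at x)"
    and d2: "\<And>x. x \<in> {a..b} \<Longrightarrow> (\<psi>a has_real_derivative \<psi>b x) (at x)"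
    and d3: "\<And>x. x \<in> {a..b} \<Longrightarrow> (\<psi>b has_real_derivative \<psi>c x) (at x)"
    and low: "\<And>x. x \<in> {a..b} \<Longrightarrow> l \<le> \<psi>c x"
  shows "norm (integral {a..b} (\<lambda>x. cis (\<psi> x))) \<le> 14 * l powr (- 1 / 3)"
proof -
  obtain c where c: "c \<in> {a..b}" and cr: "\<And>x. c < x \<Longrightarrow> x \<le> b \<Longrightarrow> l * (x - c) \<le> \<psi>b x"
    and cl: "\<And>x. a \<le> x \<Longrightarrow> x < c \<Longrightarrow> \<psi>b x \<le> - (l * (c - x))"
    using slope_root[OF ab d3 low] by blast
  \<comment> \<open>Balances the second-derivative bound \<open>6 / sqrt (l * h) = 6 * h\<close> on
    either side with the window \<open>2 * h\<close>; the total is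
    \<open>12 + 2 = 14\<close>.\<close>
  define h where "h = l powr (- 1 / 3)"
  have h: "0 < h" using l by (auto simp: h_def)
  have lh: "0 < l * h" using h l by simp
  have "l * h = l powr 1 * l powr (- 1 / 3)" using l by (simp add: h_def)
  also have "\<dots> = l powr (2 / 3)" unfolding powr_add[symmetric] by simp
  finally have s: "1 / sqrt (l * h) = h" using l by (simp add: h_def powr_half_sqrt[symmetric] powr_powr powr_minus_divide)
  have "norm (integral {a..b} (\<lambda>x. cis (\<psi> x))) \<le> 2 * (6 / sqrt (l * h)) + 2 * h"
  proof (rule norm_integral_split_near_point[OF _ _ c h(1)])
    show "continuous_on {a..b} (\<lambda>x. cis (\<psi> x))"
      by (intro continuous_intros) (auto intro!: continuous_at_imp_continuous_on DERIV_isCont d1)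
    fix x y
    assume xy: "c + h \<le> x" "x \<le> y" "y \<le> b"
    have "l * h \<le> \<psi>b t" if "t \<in> {x..y}" for t
    proof -
      have "l * h \<le> l * (t - c)" using that xy l by (intro mult_left_mono) auto
      then show ?thesis using cr[of t] that xy h by simp
    qed
    then show "norm (integral {x..y} (\<lambda>x. cis (\<psi> x))) \<le> 6 / sqrt (l * h)"
      using xy c h lh by (intro van_der_Corput_second[where \<psi>a = \<psi>a and \<psi>b = \<psi>b] d1 d2) auto
  next
    fix x y
    assume xy: "a \<le> x" "x \<le> y" "y \<le> c - h"
    have "l * h \<le> - \<psi>b t" if "t \<in> {x..y}" for t
    proof -
      have "l * h \<le> l * (c - t)" using that xy l by (intro mult_left_mono) auto
      then show ?thesis using cl[of t] that xy h by simp
    qed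
    \<comment> \<open>To the left of \<open>c\<close> the second derivative is negative, so the
      conjugate integral is estimated instead.\<close>
    then have "norm (integral {x..y} (\<lambda>x. cis (- \<psi> x))) \<le> 6 / sqrt (l * h)"
      using xy c h lh
      by (intro van_der_Corput_second[where \<psi>a = "\<lambda>x. - \<psi>a x" and \<psi>b = "\<lambda>x. - \<psi>b x"] DERIV_minus d1 d2) auto
    then show "norm (integral {x..y} (\<lambda>x. cis (\<psi> x))) \<le> 6 / sqrt (l * h)"
      unfolding norm_integral_cis_uminus .
  qed (use lh in auto)
  also have "2 * (6 / sqrt (l * h)) + 2 * h = 14 * h" using s by (simp add: field_simps)
  finally show ?thesis by (simp add: h_def)
qed

text \<open>Integration by parts against the primitive of \<open>f\<close>: the endpoint value
  \<open>1/b\<close> of the weight and its variation \<open>1/a - 1/b\<close> add up to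
  \<open>1/a\<close>.\<close>

lemma norm_integral_divide_le:
  fixes f :: "real \<Rightarrow> complex"
  assumes ab: "0 < a" "a \<le> b" and cont: "continuous_on {a..b} f"
    and B: "\<And>x. x \<in> {a..b} \<Longrightarrow> norm (integral {a..x} f) \<le> B"
  shows "norm (integral {a..b} (\<lambda>x. f x / of_real x)) \<le> B / a"
proof -
  define F where "F x = integral {a..x} f" for x
  have B0: "0 \<le> B" using B[of a] ab by (auto intro: order_trans[OF norm_ge_zero])
  have "((\<lambda>x. f x / of_real x - F x / of_real (x\<^sup>2)) has_integral F b / of_real b - F a / of_real a) {a..b}"
  proof (rule fundamental_theorem_of_calculus[OF ab(2)])
    fix x assume x: "x \<in> {a..b}"
    have F: "(F has_vector_derivative f x) (at x within {a..b})"
      unfolding F_def by (rule integral_has_vector_derivative[OF cont x])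
    have "((\<lambda>x. 1 / x) has_real_derivative - (1 / x\<^sup>2)) (at x within {a..b})"
      using x ab by (auto intro!: derivative_eq_intros simp: power2_eq_square)
    then have "((\<lambda>x. complex_of_real (1 / x)) has_vector_derivative of_real (- (1 / x\<^sup>2))) (at x within {a..b})"
      by (intro has_vector_derivative_of_real) (simp add: has_real_derivative_iff_has_vector_derivative)
    with F have "((\<lambda>x. F x * complex_of_real (1 / x)) has_vector_derivative F x * of_real (- (1 / x\<^sup>2)) + f x * of_real (1 / x)) (at x within {a..b})"
      by (rule has_vector_derivative_mult)
    then show "((\<lambda>x. F x / complex_of_real x) has_vector_derivative f x / of_real x - F x / of_real (x\<^sup>2)) (at x within {a..b})"
      by (simp add: divide_inverse mult.commute)
  qed
  moreover have "F a = 0" by (simp add: F_def)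
  moreover have cF: "continuous_on {a..b} F"
    unfolding F_def by (intro indefinite_integral_continuous_1 integrable_continuous_interval cont)
  then have iF: "(\<lambda>x. F x / of_real (x\<^sup>2)) integrable_on {a..b}"
    using ab by (intro integrable_continuous_interval continuous_intros) auto
  ultimately have "((\<lambda>x. f x / of_real x) has_integral F b / of_real b + integral {a..b} (\<lambda>x. F x / of_real (x\<^sup>2))) {a..b}"
    using has_integral_add[OF _ integrable_integral[OF iF], of "\<lambda>x. f x / of_real x - F x / of_real (x\<^sup>2)" "F b / of_real b"] by simp
  then have eq: "integral {a..b} (\<lambda>x. f x / of_real x) = F b / of_real b + integral {a..b} (\<lambda>x. F x / of_real (x\<^sup>2))"
    by (rule integral_unique)
  have g: "((\<lambda>x. B * (1 / x\<^sup>2)) has_integral B * (- 1 / b - - 1 / a)) {a..b}"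
    by (intro has_integral_mult_right fundamental_theorem_of_calculus[OF ab(2)])
      (use ab in \<open>auto intro!: derivative_eq_intros simp: power2_eq_square simp flip: has_real_derivative_iff_has_vector_derivative\<close>)
  have "norm (integral {a..b} (\<lambda>x. F x / of_real (x\<^sup>2))) \<le> integral {a..b} (\<lambda>x. B * (1 / x\<^sup>2))"
    by (rule integral_norm_bound_integral[OF iF])
      (use g B in \<open>auto simp: integrable_on_def F_def norm_divide norm_power divide_right_mono\<close>)
  also have "\<dots> = B * (- 1 / b - - 1 / a)" using g by (rule integral_unique)
  finally have "norm (integral {a..b} (\<lambda>x. F x / of_real (x\<^sup>2))) \<le> B * (1 / a - 1 / b)" by simp
  moreover have "norm (F b / of_real b) \<le> B / b"
    using B[of b] ab by (simp add: F_def norm_divide divide_right_mono)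
  ultimately have "norm (integral {a..b} (\<lambda>x. f x / of_real x)) \<le> B / b + B * (1 / a - 1 / b)"
    unfolding eq by (intro order_trans[OF norm_triangle_ineq] add_mono)
  then show ?thesis by (simp add: algebra_simps)
qed

text \<open>Telescoping against the bounded function \<open>H y = y / (1 + y)\<close>: up to a
  constant, \<open>min y (1 / y)\<close> is at most \<open>y / (1 + y)^2\<close>, which is
  comparable to the increment of \<open>H\<close> from \<open>y\<close> to \<open>y * r\<close>. The
  sum is thus controlled by the oscillation of \<open>H\<close>, uniformly in \<open>y\<close> and
  \<open>m\<close>, for growing and for decaying progressions.\<close>

lemma sum_min_geometric_le:
  fixes y r :: real
  assumes y: "0 \<le> y" and r: "0 < r" "r \<noteq> 1"
  shows "(\<Sum>k<m. min (y * r ^ k) (1 / (y * r ^ k))) \<le> 4 * max 1 r / \<bar>r - 1\<bar>"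
proof -
  define H :: "real \<Rightarrow> real" where "H y = y / (1 + y)" for y
  have H: "0 \<le> H y" "H y \<le> 1" if "0 \<le> y" for y using that by (auto simp: H_def field_simps)
  have step: "min y (1 / y) \<le> 4 * max 1 r / \<bar>r - 1\<bar> * (sgn (r - 1) * (H (y * r) - H y))" if y: "0 \<le> y" for y
  proof (cases "y = 0")
    case False
    then have y: "0 < y" using y by simp
    then have ry: "0 < y * r" using r by simp
    \<comment> \<open>The factor \<open>sgn (r - 1)\<close> makes the increment nonnegative and so
      treats \<open>r > 1\<close> and \<open>r < 1\<close> together.\<close>
    have e: "sgn (r - 1) * (H (y * r) - H y) = \<bar>r - 1\<bar> * (y / ((1 + y * r) * (1 + y)))"
    proof -
      have "y * r * (1 + y) - y * (1 + y * r) = (r - 1) * y" by algebra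
      then have "H (y * r) - H y = (r - 1) * (y / ((1 + y * r) * (1 + y)))"
        unfolding H_def using y ry by (subst diff_frac_eq) simp_all
      then show ?thesis by (simp add: abs_sgn mult_ac)
    qed
    have "min y (1 / y) * (1 + y) * (1 + y) \<le> 4 * y"
    proof (cases "y \<le> 1")
      case True
      have "y * ((1 + y) * (1 + y)) \<le> y * (2 * 2)" using True y by (intro mult_left_mono mult_mono) auto
      then show ?thesis using True y by (simp add: min_def field_simps)
    next
      case False
      have "(1 / y) * ((1 + y) * (1 + y)) \<le> (1 / y) * ((2 * y) * (2 * y))" using False y by (intro mult_left_mono mult_mono) auto
      moreover have "min y (1 / y) = 1 / y"
      proof (rule min_absorb2)
        have "1 / y \<le> 1" using False by simp
        then show "1 / y \<le> y" using False by linarith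
      qed
      ultimately show ?thesis using y by simp
    qed
    then have "min y (1 / y) \<le> 4 * y / ((1 + y) * (1 + y))" using y by (simp add: pos_le_divide_eq mult.assoc)
    also have "\<dots> \<le> 4 * y * max 1 r / ((1 + y * r) * (1 + y))"
    proof -
      have "1 + y * r \<le> max 1 r * (1 + y)" using y r by (auto simp: max_def algebra_simps)
      then have "(1 + y * r) * (1 + y) \<le> max 1 r * (1 + y) * (1 + y)" using y by (intro mult_right_mono) auto
      then have "max 1 r / (max 1 r * ((1 + y) * (1 + y))) \<le> max 1 r / ((1 + y * r) * (1 + y))"
        using y ry r by (intro frac_le) (auto simp: mult.assoc intro!: mult_pos_pos add_pos_pos)
      moreover have "max 1 r \<noteq> 0" by (simp add: max_def)
      ultimately have "1 / ((1 + y) * (1 + y)) \<le> max 1 r / ((1 + y * r) * (1 + y))" by simp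
      from mult_left_mono[OF this, of "4 * y"] y show ?thesis by simp
    qed
    also have "\<dots> = 4 * max 1 r / \<bar>r - 1\<bar> * (\<bar>r - 1\<bar> * (y / ((1 + y * r) * (1 + y))))"
      using r by simp
    finally show ?thesis unfolding e .
  qed (simp add: H_def)
  have "(\<Sum>k<m. min (y * r ^ k) (1 / (y * r ^ k))) \<le> (\<Sum>k<m. 4 * max 1 r / \<bar>r - 1\<bar> * (sgn (r - 1) * (H (y * r ^ Suc k) - H (y * r ^ k))))"
    using step[of "y * r ^ k" for k] y r by (intro sum_mono) (simp add: mult_ac)
  also have "\<dots> = 4 * max 1 r / \<bar>r - 1\<bar> * (sgn (r - 1) * (\<Sum>k<m. H (y * r ^ Suc k) - H (y * r ^ k)))"
    by (simp only: sum_distrib_left)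
  also have "(\<Sum>k<m. H (y * r ^ Suc k) - H (y * r ^ k)) = H (y * r ^ m) - H (y * r ^ 0)"
    by (rule sum_lessThan_telescope)
  also have "4 * max 1 r / \<bar>r - 1\<bar> * (sgn (r - 1) * (H (y * r ^ m) - H (y * r ^ 0))) \<le> 4 * max 1 r / \<bar>r - 1\<bar> * 1"
  proof (intro mult_left_mono)
    show "sgn (r - 1) * (H (y * r ^ m) - H (y * r ^ 0)) \<le> 1"
      using H[of "y * r ^ m"] H[of y] y r by (auto simp: sgn_real_def)
  qed (use r in auto)
  finally show ?thesis by simp
qed

subsection \<open>A uniformly bounded oscillatory integral\<close>

text \<open>The phase left after the transverse variables are integrated out; the term
  \<open>c / x\<close> stems from completing the squares in them. All three coefficients range over
  the reals, so constants must be uniform in them.\<close>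

definition cubic_phase :: "real \<Rightarrow> real \<Rightarrow> real \<Rightarrow> real \<Rightarrow> real" where
  "cubic_phase a b c x = a * x + b * x ^ 3 + c / x"

lemma cubic_phase_derivs:
  assumes "0 < x"
  shows "(cubic_phase a b c has_real_derivative a + 3 * b * x\<^sup>2 - c / x\<^sup>2) (at x)"
    and "((\<lambda>x. a + 3 * b * x\<^sup>2 - c / x\<^sup>2) has_real_derivative 6 * b * x + 2 * c / x ^ 3) (at x)"
    and "((\<lambda>x. 6 * b * x + 2 * c / x ^ 3) has_real_derivative 6 * b - 6 * c / x ^ 4) (at x)"
  unfolding cubic_phase_def using assms
  by (auto intro!: derivative_eq_intros simp: field_simps eval_nat_numeral)

lemma cubic_phase_uminus: "cubic_phase (- a) (- b) (- c) x = - cubic_phase a b c x"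
  by (simp add: cubic_phase_def)

text \<open>On a dyadic interval the terms of the phase have the three sizes combined in
  \<open>M\<close>. If the linear term dominates, the first derivative has no zero. Otherwise the
  signs of \<open>b\<close> and \<open>c\<close> decide: equal signs exclude cancellation in the
  second derivative \<open>6 * b * x + 2 * c / x ^ 3\<close>, opposite signs in the third derivative
  \<open>6 * b - 6 * c / x ^ 4\<close>. The assumption \<open>M \<ge> 1\<close> lets the faster
  rates be weakened to a common one.\<close>

lemma cubic_phase_dyadic_oscillation:
  assumes N: "0 < N" and y: "N \<le> y" "y \<le> 2 * N"
    and M: "M = max (\<bar>a\<bar> * N) (max (\<bar>b\<bar> * N ^ 3) (\<bar>c\<bar> / N))" "1 \<le> M"
  shows "norm (integral {N..y} (\<lambda>x. cis (cubic_phase a b c x))) \<le> 200 * N * M powr (- 1 / 3)"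
proof -
  note d = cubic_phase_derivs
  have pos: "0 < x" if "x \<in> {N..y}" for x using that N by simp
  have xN: "N \<le> x" "x \<le> 2 * N" if "x \<in> {N..y}" for x using that y by auto
  define P where "P = max (\<bar>b\<bar> * N ^ 3) (\<bar>c\<bar> / N)"
  have P: "\<bar>b\<bar> * N ^ 3 \<le> P" "\<bar>c\<bar> / N \<le> P" "0 \<le> P" using N by (auto simp: P_def le_max_iff_disj)
  have b: "\<bar>b\<bar> \<le> P / N ^ 3" and c: "\<bar>c\<bar> \<le> P * N" using P N by (simp_all add: field_simps)
  have M1: "M powr (- 1) \<le> M powr (- 1 / 3)" "M powr (- 1 / 2) \<le> M powr (- 1 / 3)"
    by (rule powr_mono; use M(2) in simp)+
  show ?thesis
  \<comment> \<open>The other two terms contribute at most \<open>12 + 1 = 13\<close> times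
    \<open>P / N\<close> to the first derivative, which is below half of
    \<open>\<bar>a\<bar>\<close> when \<open>64 * P \<le> \<bar>a\<bar> * N\<close>; to the second
    derivative at most \<open>14 * P / N^2\<close>.\<close>
  proof (cases "64 * P \<le> \<bar>a\<bar> * N")
    case True
    then have Ma: "M = \<bar>a\<bar> * N" using M P by (simp add: P_def[symmetric] max_def)
    have a: "0 < \<bar>a\<bar>" "P \<le> \<bar>a\<bar> * N / 64" using True Ma M(2) N P by (auto simp: zero_less_mult_iff)
    have "norm (integral {N..y} (\<lambda>x. cis (cubic_phase a b c x))) \<le> 2 / (\<bar>a\<bar> / 2) + (y - N) * (\<bar>a\<bar> / N) / (\<bar>a\<bar> / 2)\<^sup>2"
    proof (rule van_der_Corput_first_bounded[OF y(1) _ d(1)[OF pos] d(2)[OF pos]])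
      fix x assume x: "x \<in> {N..y}"
      note xp = pos[OF x] and xx = xN[OF x]
      have "\<bar>b\<bar> * x\<^sup>2 \<le> P / N ^ 3 * (2 * N)\<^sup>2" using b xx xp P N by (intro mult_mono power_mono) auto
      also have "\<dots> = 4 * P / N" using N by (simp add: field_simps eval_nat_numeral)
      finally have 1: "\<bar>b\<bar> * x\<^sup>2 \<le> 4 * (P / N)" by simp
      have "\<bar>c\<bar> / x\<^sup>2 \<le> P * N / N\<^sup>2" using c xx xp P N by (intro frac_le power_mono) auto
      also have "\<dots> = P / N" using N by (simp add: power2_eq_square)
      finally have 2: "\<bar>c\<bar> / x\<^sup>2 \<le> P / N" .
      have PN: "P / N \<le> \<bar>a\<bar> / 64" using a N by (simp add: field_simps)
      have "\<bar>a\<bar> \<le> \<bar>a + 3 * b * x\<^sup>2 - c / x\<^sup>2\<bar> + 3 * (\<bar>b\<bar> * x\<^sup>2) + \<bar>c\<bar> / x\<^sup>2"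
      proof -
        have "\<bar>3 * b * x\<^sup>2\<bar> = 3 * (\<bar>b\<bar> * x\<^sup>2)" "\<bar>c / x\<^sup>2\<bar> = \<bar>c\<bar> / x\<^sup>2" by (simp_all add: abs_mult)
        then show ?thesis by linarith
      qed
      then show "\<bar>a\<bar> / 2 \<le> \<bar>a + 3 * b * x\<^sup>2 - c / x\<^sup>2\<bar>" using 1 2 PN by linarith
      have "\<bar>b\<bar> * x \<le> P / N ^ 3 * (2 * N)" using b xx xp P N by (intro mult_mono) auto
      also have "\<dots> = 2 * (P / N) / N" using N by (simp add: field_simps eval_nat_numeral)
      finally have 3: "\<bar>b\<bar> * x \<le> 2 * (P / N) / N" .
      have "\<bar>c\<bar> / x ^ 3 \<le> P * N / N ^ 3" using c xx xp P N by (intro frac_le power_mono) auto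
      also have "\<dots> = P / N / N" using N by (simp add: field_simps eval_nat_numeral)
      finally have 4: "\<bar>c\<bar> / x ^ 3 \<le> P / N / N" .
      have "\<bar>6 * b * x + 2 * c / x ^ 3\<bar> \<le> 6 * (\<bar>b\<bar> * x) + 2 * (\<bar>c\<bar> / x ^ 3)"
        using xp by (intro order_trans[OF abs_triangle_ineq]) (simp add: abs_mult)
      also have "\<dots> \<le> 14 * (P / N) / N" using 3 4 by simp
      also have "\<dots> \<le> \<bar>a\<bar> / N" using PN N by (intro divide_right_mono) auto
      finally show "\<bar>6 * b * x + 2 * c / x ^ 3\<bar> \<le> \<bar>a\<bar> / N" .
    qed (use a in auto)
    also have "\<dots> \<le> 2 / (\<bar>a\<bar> / 2) + N * (\<bar>a\<bar> / N) / (\<bar>a\<bar> / 2)\<^sup>2"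
      using y N a by (intro add_left_mono divide_right_mono mult_right_mono) auto
    also have "\<dots> = 8 * N * M powr (- 1)"
      using N a by (simp add: Ma powr_minus_divide power2_eq_square field_simps)
    also have "\<dots> \<le> 200 * N * M powr (- 1 / 3)" using M1(1) N by (intro mult_mono) auto
    finally show ?thesis .
  next
    case False
    then have PM: "M \<le> 64 * P" using M P by (simp add: P_def[symmetric] max_def)
    have sec: "norm (integral {N..y} (\<lambda>x. cis (cubic_phase a b c x))) \<le> 200 * N * M powr (- 1 / 3)"
      if bc: "0 \<le> b" "0 \<le> c" and P: "P = max (b * N ^ 3) (c / N)" "M \<le> 64 * P" for a b c
    proof -
      have "norm (integral {N..y} (\<lambda>x. cis (cubic_phase a b c x))) \<le> 6 / sqrt (M / (256 * N\<^sup>2))"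
      proof (rule van_der_Corput_second[OF y(1) _ d(1)[OF pos] d(2)[OF pos]])
        show "0 < M / (256 * N\<^sup>2)" using M(2) N by simp
        fix x assume x: "x \<in> {N..y}"
        note xp = pos[OF x] and xx = xN[OF x]
        have "x ^ 3 \<le> (2 * N) ^ 3" using xx xp by (intro power_mono) auto
        then have "2 * c / (8 * N ^ 3) \<le> 2 * c / x ^ 3" using bc xp N by (intro divide_left_mono) (auto simp: power_mult_distrib)
        moreover have "6 * b * N \<le> 6 * b * x" using bc xx by (intro mult_left_mono) auto
        \<comment> \<open>From \<open>M \<le> 64 * P\<close>, \<open>M / 256\<close> is at most
          \<open>P / 4\<close>, a quarter of the sum of the two sizes.\<close>
        moreover have "M / (256 * N\<^sup>2) \<le> 6 * b * N + 2 * c / (8 * N ^ 3)"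
        proof -
          have "0 \<le> b * N ^ 3" "0 \<le> c / N" using bc N by auto
          then have "P \<le> b * N ^ 3 + c / N" using P(1) by simp
          then have "1 / 4 * P \<le> 1 / 4 * (b * N ^ 3 + c / N)" by (intro mult_left_mono) auto
          moreover have "M / 256 \<le> 1 / 4 * P" using P(2) by simp
          ultimately have "M / 256 \<le> 1 / 4 * (b * N ^ 3 + c / N)" by (rule order_trans[rotated])
          also have "\<dots> \<le> (6 * b * N + 2 * c / (8 * N ^ 3)) * N\<^sup>2" using N bc by (simp add: field_simps eval_nat_numeral)
          finally show ?thesis using N by (simp add: field_simps)
        qed
        ultimately show "M / (256 * N\<^sup>2) \<le> 6 * b * x + 2 * c / x ^ 3" by simp
      qed
      also have "sqrt (M / (256 * N\<^sup>2)) = sqrt M / (16 * N)"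
        using N by (simp add: real_sqrt_divide real_sqrt_mult)
      also have "6 / (sqrt M / (16 * N)) = 96 * N * M powr (- 1 / 2)"
        using M(2) by (simp add: powr_minus_divide powr_half_sqrt)
      also have "\<dots> \<le> 200 * N * M powr (- 1 / 3)" using M1(2) N by (intro mult_mono) auto
      finally show ?thesis .
    qed
    have thi: "norm (integral {N..y} (\<lambda>x. cis (cubic_phase a b c x))) \<le> 200 * N * M powr (- 1 / 3)"
      if bc: "0 \<le> b" "c \<le> 0" and P: "P = max (b * N ^ 3) (- c / N)" "M \<le> 64 * P" for a b c
    proof -
      have "norm (integral {N..y} (\<lambda>x. cis (cubic_phase a b c x))) \<le> 14 * (M / (256 * N ^ 3)) powr (- 1 / 3)"
      proof (rule van_der_Corput_third[OF y(1) _ d(1)[OF pos] d(2)[OF pos] d(3)[OF pos]])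
        show "0 < M / (256 * N ^ 3)" using M(2) N by simp
        fix x assume x: "x \<in> {N..y}"
        note xp = pos[OF x] and xx = xN[OF x]
        have "x ^ 4 \<le> (2 * N) ^ 4" using xx xp by (intro power_mono) auto
        then have "- 6 * c / (16 * N ^ 4) \<le> - 6 * c / x ^ 4" using bc xp N by (intro divide_left_mono) (auto simp: power_mult_distrib)
        moreover have "M / (256 * N ^ 3) \<le> 6 * b + - 6 * c / (16 * N ^ 4)"
        proof -
          have nn: "0 \<le> b * N ^ 3" "0 \<le> - c / N" using bc N by (auto simp: divide_nonpos_pos)
          have eq: "(6 * b + - 6 * c / (16 * N ^ 4)) * N ^ 3 = 6 * (b * N ^ 3) + 3 / 8 * (- c / N)"
            using N by (simp add: field_simps eval_nat_numeral)
          from nn have "P \<le> b * N ^ 3 + - c / N" using P(1) by simp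
          then have "1 / 4 * P \<le> 1 / 4 * (b * N ^ 3 + - c / N)" by (intro mult_left_mono) auto
          moreover have "M / 256 \<le> 1 / 4 * P" using P(2) by simp
          ultimately have "M / 256 \<le> 1 / 4 * (b * N ^ 3 + - c / N)" by (rule order_trans[rotated])
          also have "\<dots> \<le> (6 * b + - 6 * c / (16 * N ^ 4)) * N ^ 3"
            unfolding eq distrib_left using nn by (intro add_mono mult_right_mono) auto
          finally show ?thesis using N by (simp add: field_simps)
        qed
        ultimately show "M / (256 * N ^ 3) \<le> 6 * b - 6 * c / x ^ 4" by simp
      qed
      also have "(M / (256 * N ^ 3)) powr (- 1 / 3) = M powr (- 1 / 3) * 256 powr (1 / 3) * N"
      proof -
        have "(N ^ 3) powr (1 / 3) = N" using N by (simp add: powr_powr flip: powr_numeral)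
        then show ?thesis using M(2) N by (simp add: powr_divide powr_mult powr_minus_divide)
      qed
      also have "14 * \<dots> \<le> 14 * (M powr (- 1 / 3) * 8 * N)"
      proof -
        have "256 powr (1 / 3) \<le> (512 :: real) powr (1 / 3)" by (intro powr_mono2) auto
        also have "512 = (8 :: real) powr 3" by simp
        also have "\<dots> powr (1 / 3) = 8" by (subst powr_powr) simp
        finally show ?thesis using N by (intro mult_left_mono mult_right_mono) auto
      qed
      also have "\<dots> \<le> 200 * N * M powr (- 1 / 3)" using N by simp
      finally show ?thesis .
    qed
    \<comment> \<open>Changing all three signs conjugates the integral, which reduces the case
      \<open>b \<le> 0\<close> to \<open>b \<ge> 0\<close>.\<close>
    have neg: "norm (integral {N..y} (\<lambda>x. cis (cubic_phase a b c x))) = norm (integral {N..y} (\<lambda>x. cis (cubic_phase (- a) (- b) (- c) x)))"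
      unfolding cubic_phase_uminus norm_integral_cis_uminus ..
    consider "0 \<le> b" "0 \<le> c" | "0 \<le> b" "c \<le> 0" | "b \<le> 0" "c \<le> 0" | "b \<le> 0" "0 \<le> c" by linarith
    then show ?thesis
    proof cases
      case 1 then show ?thesis using sec[of b c a] PM by (simp add: P_def)
    next
      case 2 then show ?thesis using thi[of b c a] PM by (simp add: P_def)
    next
      case 3 then show ?thesis using sec[of "- b" "- c" "- a"] PM unfolding neg by (simp add: P_def)
    next
      case 4 then show ?thesis using thi[of "- b" "- c" "- a"] PM unfolding neg by (simp add: P_def)
    qed
  qed
qed


text \<open>
  The cube root comes from the worst case of van der Corput's lemma, where only the third derivative is
  large.
\<close>

lemma cubic_phase_dyadic:
  assumes N: "0 < N" and ya_def: "ya = (\<bar>a\<bar> * N) powr (1 / 3)"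
    and yb_def: "yb = (\<bar>b\<bar> * N ^ 3) powr (1 / 3)" and yc_def: "yc = (\<bar>c\<bar> / N) powr (1 / 3)"
  shows "\<bar>integral {N..2 * N} (\<lambda>x. sin (cubic_phase a b c x) / x)\<bar>
    \<le> 200 * (min ya (1 / ya) + min yb (1 / yb) + min yc (1 / yc))"
proof -
  define M where "M = max (\<bar>a\<bar> * N) (max (\<bar>b\<bar> * N ^ 3) (\<bar>c\<bar> / N))"
  define Y where "Y = M powr (1 / 3)"
  have M0: "0 \<le> M" using N by (auto simp: M_def le_max_iff_disj)
  have y0: "0 \<le> ya" "0 \<le> yb" "0 \<le> yc" by (simp_all add: ya_def yb_def yc_def)
  \<comment> \<open>The function \<open>min y (1 / y)\<close> is not monotone, so it matters that
    \<open>Y\<close> equals one of the three quantities and does not merely bound them.\<close>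
  have "Y = ya \<or> Y = yb \<or> Y = yc" by (auto simp: Y_def M_def ya_def yb_def yc_def max_def)
  define g :: "real \<Rightarrow> real" where "g y = min y (1 / y)" for y
  have "0 \<le> g y" if "0 \<le> y" for y using that by (simp add: g_def)
  then have "0 \<le> g ya" "0 \<le> g yb" "0 \<le> g yc" using y0 by auto
  then have "g Y \<le> g ya + g yb + g yc" using \<open>Y = ya \<or> Y = yb \<or> Y = yc\<close> by auto
  then have Ysum: "min Y (1 / Y) \<le> min ya (1 / ya) + min yb (1 / yb) + min yc (1 / yc)"
    by (simp only: g_def)
  have contphase: "continuous_on {N..2 * N} (cubic_phase a b c)"
    unfolding cubic_phase_def using N by (intro continuous_intros) auto
  then have cint: "continuous_on {N..2 * N} (\<lambda>x. sin (cubic_phase a b c x) / x)"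
    using N by (intro continuous_intros) auto
  have "\<bar>integral {N..2 * N} (\<lambda>x. sin (cubic_phase a b c x) / x)\<bar> \<le> 200 * min Y (1 / Y)"
  proof (cases "1 \<le> M")
    case True
    have ci: "continuous_on {N..2 * N} (\<lambda>x. cis (cubic_phase a b c x))" by (intro continuous_intros contphase)
    have "norm (integral {N..2 * N} (\<lambda>x. cis (cubic_phase a b c x) / of_real x)) \<le> (200 * N * M powr (- 1 / 3)) / N"
      using N by (intro norm_integral_divide_le[OF N _ ci] cubic_phase_dyadic_oscillation[OF N _ _ M_def True]) auto
    moreover have "integral {N..2 * N} (\<lambda>x. sin (cubic_phase a b c x) / x) = Im (integral {N..2 * N} (\<lambda>x. cis (cubic_phase a b c x) / of_real x))"
    proof -
      have "(\<lambda>x. cis (cubic_phase a b c x) / of_real x) integrable_on {N..2 * N}"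
        using N by (intro integrable_continuous_interval continuous_intros ci) auto
      from integral_linear[OF this bounded_linear_Im] show ?thesis by (simp add: o_def Im_divide_of_real)
    qed
    ultimately have "\<bar>integral {N..2 * N} (\<lambda>x. sin (cubic_phase a b c x) / x)\<bar> \<le> 200 * M powr (- 1 / 3)"
      using N abs_Im_le_cmod[of "integral {N..2 * N} (\<lambda>x. cis (cubic_phase a b c x) / of_real x)"] by simp
    also have "M powr (- 1 / 3) = 1 / Y" by (simp add: Y_def powr_minus_divide)
    also have "1 / Y = min Y (1 / Y)"
    proof -
      have "1 \<le> Y" unfolding Y_def using True by (intro ge_one_powr_ge_zero) auto
      then have "1 / Y \<le> Y" by (intro order_trans[of "1 / Y" 1 Y]) auto
      then show ?thesis by simp
    qed
    finally show ?thesis .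
  next
    case False
    \<comment> \<open>For \<open>M < 1\<close> the sine is estimated by its argument. Over the
      interval the three terms are at most \<open>2\<close>, \<open>8\<close> and \<open>1\<close>
      times their sizes, hence \<open>11\<close>.\<close>
    have "\<bar>integral {N..2 * N} (\<lambda>x. sin (cubic_phase a b c x) / x)\<bar> \<le> integral {N..2 * N} (\<lambda>x. 11 * M / N)"
      unfolding real_norm_def[symmetric]
    proof (rule Henstock_Kurzweil_Integration.integral_norm_bound_integral)
      fix x assume x: "x \<in> {N..2 * N}"
      then have xp: "0 < x" using N by simp
      have "\<bar>sin (cubic_phase a b c x)\<bar> \<le> \<bar>cubic_phase a b c x\<bar>" by (rule abs_sin_x_le_abs_x)
      also have "\<dots> \<le> \<bar>a\<bar> * x + \<bar>b\<bar> * x ^ 3 + \<bar>c\<bar> / x"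
      proof -
        have "\<bar>cubic_phase a b c x\<bar> \<le> \<bar>a * x\<bar> + \<bar>b * x ^ 3\<bar> + \<bar>c / x\<bar>" unfolding cubic_phase_def by linarith
        then show ?thesis using xp by (simp add: abs_mult)
      qed
      also have "\<dots> \<le> \<bar>a\<bar> * (2 * N) + \<bar>b\<bar> * (2 * N) ^ 3 + \<bar>c\<bar> / N"
        using x xp N by (intro add_mono mult_left_mono power_mono divide_left_mono) auto
      also have "\<dots> = 2 * (\<bar>a\<bar> * N) + 8 * (\<bar>b\<bar> * N ^ 3) + \<bar>c\<bar> / N" by (simp add: power_mult_distrib)
      also have "\<dots> \<le> 2 * M + 8 * M + M" by (intro add_mono mult_left_mono) (auto simp: M_def)
      finally have "\<bar>sin (cubic_phase a b c x)\<bar> \<le> 11 * M" by simp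
      then show "norm (sin (cubic_phase a b c x) / x) \<le> 11 * M / N"
        using x xp N M0 by (simp add: abs_divide frac_le)
    qed (use cint in \<open>auto intro: integrable_continuous_interval\<close>)
    also have "\<dots> = 11 * M" using N by simp
    also have "11 * M \<le> 200 * min Y (1 / Y)"
    proof -
      have Y: "0 \<le> Y" "Y \<le> 1" using False M0 by (auto simp: Y_def powr_le1)
      have "M = Y ^ 3" using M0 by (simp add: Y_def powr_powr flip: powr_numeral)
      also have "\<dots> \<le> Y ^ 1" using Y by (intro power_decreasing) auto
      finally have "M \<le> Y" by simp
      moreover have "min Y (1 / Y) = Y"
      proof (cases "Y = 0")
        case False
        then have "Y * Y \<le> 1" using Y by (simp add: mult_le_one)
        then show ?thesis using False Y by (simp add: min_absorb1 pos_le_divide_eq)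
      qed simp
      ultimately show ?thesis using M0 by simp
    qed
    finally show ?thesis .
  qed
  also have "\<dots> \<le> 200 * (min ya (1 / ya) + min yb (1 / yb) + min yc (1 / yc))"
    using Ysum by simp
  finally show ?thesis .
qed

text \<open>Along the dyadic intervals the cube roots of the three sizes are geometric progressions
  with ratios \<open>2 powr (1/3)\<close>, \<open>2\<close> and \<open>2 powr (- 1/3)\<close>. No
  ratio is 1, so each sum is bounded independently of its starting value, that is of
  \<open>a\<close>, \<open>b\<close>, \<open>c\<close> and \<open>\<delta>\<close>.\<close>

theorem cubic_phase_integral_bounded:
  "\<exists>C>0. \<forall>a b c \<delta> m. 0 < \<delta> \<longrightarrow> \<bar>integral {\<delta>..\<delta> * 2 ^ m} (\<lambda>x. sin (cubic_phase a b c x) / x)\<bar> \<le> C"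
proof -
  define r where "r = 2 powr (1 / 3 :: real)"
  define K where "K r = 4 * max 1 r / \<bar>r - 1\<bar>" for r :: real
  have "1 < r" unfolding r_def by (rule gr_one_powr) auto
  have r: "0 < r" "r \<noteq> 1" "0 < 1 / r" "1 / r \<noteq> 1" using \<open>1 < r\<close> by auto
  have r3: "r powr 3 = 2" by (simp add: r_def powr_powr)
  have r_pow: "(2 ^ k) powr (1 / 3) = r ^ k" for k
    by (simp add: r_def powr_powr mult.commute flip: powr_realpow)
  have K: "0 \<le> K r" for r by (simp add: K_def)
  define C where "C = 200 * (K r + K 2 + K (1 / r)) + 1"
  have "\<bar>integral {\<delta>..\<delta> * 2 ^ m} (\<lambda>x. sin (cubic_phase a b c x) / x)\<bar> \<le> C" if \<delta>: "0 < \<delta>" for a b c \<delta> m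
  proof -
    define I where "I k = integral {\<delta> * 2 ^ k..2 * (\<delta> * 2 ^ k)} (\<lambda>x. sin (cubic_phase a b c x) / x)" for k :: nat
    have cint: "continuous_on {x..y} (\<lambda>x. sin (cubic_phase a b c x) / x)" if "0 < x" for x y
      unfolding cubic_phase_def using that by (intro continuous_intros) auto
    have "integral {\<delta>..\<delta> * 2 ^ m} (\<lambda>x. sin (cubic_phase a b c x) / x) = (\<Sum>k<m. I k)"
    proof (induction m)
      case (Suc m)
      have "integral {\<delta>..\<delta> * 2 ^ Suc m} (\<lambda>x. sin (cubic_phase a b c x) / x)
        = integral {\<delta>..\<delta> * 2 ^ m} (\<lambda>x. sin (cubic_phase a b c x) / x) + integral {\<delta> * 2 ^ m..\<delta> * 2 ^ Suc m} (\<lambda>x. sin (cubic_phase a b c x) / x)"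
        using \<delta> by (intro Henstock_Kurzweil_Integration.integral_combine[symmetric] integrable_continuous_interval cint) auto
      then show ?case using Suc.IH by (simp add: I_def mult_ac)
    qed simp
    then have "\<bar>integral {\<delta>..\<delta> * 2 ^ m} (\<lambda>x. sin (cubic_phase a b c x) / x)\<bar> \<le> (\<Sum>k<m. \<bar>I k\<bar>)"
      by (simp add: sum_abs)
    also have "\<dots> \<le> (\<Sum>k<m. 200 * (min ((\<bar>a\<bar> * \<delta>) powr (1 / 3) * r ^ k) (1 / ((\<bar>a\<bar> * \<delta>) powr (1 / 3) * r ^ k))
       + min ((\<bar>b\<bar> * \<delta> ^ 3) powr (1 / 3) * 2 ^ k) (1 / ((\<bar>b\<bar> * \<delta> ^ 3) powr (1 / 3) * 2 ^ k))
       + min ((\<bar>c\<bar> / \<delta>) powr (1 / 3) * (1 / r) ^ k) (1 / ((\<bar>c\<bar> / \<delta>) powr (1 / 3) * (1 / r) ^ k))))"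
    proof (intro sum_mono)
      fix k
      have N: "0 < \<delta> * 2 ^ k" using \<delta> by simp
      have "(\<bar>a\<bar> * (\<delta> * 2 ^ k)) powr (1 / 3) = (\<bar>a\<bar> * \<delta>) powr (1 / 3) * r ^ k"
        unfolding mult.assoc[symmetric] using \<delta> by (simp add: powr_mult r_pow)
      moreover have "(\<bar>b\<bar> * (\<delta> * 2 ^ k) ^ 3) powr (1 / 3) = (\<bar>b\<bar> * \<delta> ^ 3) powr (1 / 3) * 2 ^ k"
      proof -
        have "((2 ^ k) ^ 3) powr (1 / 3) = (2 :: real) ^ k" by (simp add: powr_powr flip: powr_numeral)
        then show ?thesis
          unfolding power_mult_distrib mult.assoc[symmetric] using \<delta> by (subst powr_mult) auto
      qed
      moreover have "(\<bar>c\<bar> / (\<delta> * 2 ^ k)) powr (1 / 3) = (\<bar>c\<bar> / \<delta>) powr (1 / 3) * (1 / r) ^ k"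
        using \<delta> by (simp add: powr_divide powr_mult r_pow power_divide)
      ultimately show "\<bar>I k\<bar> \<le> 200 * (min ((\<bar>a\<bar> * \<delta>) powr (1 / 3) * r ^ k) (1 / ((\<bar>a\<bar> * \<delta>) powr (1 / 3) * r ^ k))
       + min ((\<bar>b\<bar> * \<delta> ^ 3) powr (1 / 3) * 2 ^ k) (1 / ((\<bar>b\<bar> * \<delta> ^ 3) powr (1 / 3) * 2 ^ k))
       + min ((\<bar>c\<bar> / \<delta>) powr (1 / 3) * (1 / r) ^ k) (1 / ((\<bar>c\<bar> / \<delta>) powr (1 / 3) * (1 / r) ^ k)))"
        using cubic_phase_dyadic[OF N refl refl refl, of a b c] unfolding I_def by (simp only:)
    qed
    also have "\<dots> \<le> 200 * (K r + K 2 + K (1 / r))"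
      unfolding sum_distrib_left[symmetric] sum.distrib K_def using r \<delta>
      by (intro mult_left_mono add_mono sum_min_geometric_le) auto
    also have "\<dots> \<le> C" by (simp add: C_def)
    finally show ?thesis .
  qed
  moreover have "0 < C" unfolding C_def by (intro add_nonneg_pos mult_nonneg_nonneg add_nonneg_nonneg K) auto
  ultimately show ?thesis by blast
qed

subsection \<open>The dispersive estimate in dimension three\<close>

text \<open>Symmetric, so that an odd phase produces a sine; with dyadic endpoints, so that the
  positive half has the form \<open>{\<delta>..\<delta> * 2 ^ m}\<close> of
  \<open>cubic_phase_integral_bounded\<close>.\<close>

definition band :: "nat \<Rightarrow> real set" where
  "band n = {\<xi>. 1 / 2 ^ n \<le> \<bar>\<xi>\<bar> \<and> \<bar>\<xi>\<bar> \<le> 2 ^ n}"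

text \<open>
  The parameter \<open>\<theta>\<close> stands for the square of the transverse frequencies that are not displayed.
\<close>

definition zk_phase :: "real \<Rightarrow> real \<times> real \<times> real \<Rightarrow> real" where
  "zk_phase \<theta> = (\<lambda>(\<xi>, \<eta>, \<kappa>). \<xi> ^ 3 + \<xi> * (\<eta>\<^sup>2 + \<kappa>\<^sup>2) + \<theta> * \<xi>)"

text \<open>
  The Gaussian makes the transverse integral converge absolutely; \<open>zk_kernel0\<close> below is the kernel in the limit
  \<open>\<epsilon> = 0\<close>. Frequencies near \<open>\<xi> = 0\<close> are removed because the transverse integral behaves like \<open>1/\<xi>\<close>.
\<close>

definition cutoff :: "nat \<Rightarrow> real \<Rightarrow> real \<times> real \<times> real \<Rightarrow> real" where
  "cutoff n \<epsilon> = (\<lambda>(\<xi>, \<eta>, \<kappa>). indicator (band n) \<xi> * (exp (- \<epsilon> * \<eta>\<^sup>2) * exp (- \<epsilon> * \<kappa>\<^sup>2)))"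

definition zk_kernel :: "real \<Rightarrow> nat \<Rightarrow> real \<Rightarrow> real \<Rightarrow> real \<times> real \<times> real \<Rightarrow> complex" where
  "zk_kernel \<theta> n \<epsilon> \<tau> v = (LINT \<zeta>|lborel. of_real (cutoff n \<epsilon> \<zeta>) * cis (v \<bullet> \<zeta> + \<tau> * zk_phase \<theta> \<zeta>))"

text \<open>The transverse integral at fixed \<open>\<xi>\<close>, evaluated by
  \<open>gaussian_fourier_complex\<close> with
  \<open>z = \<epsilon> - \<i> * \<tau> * \<xi>\<close>. For nonzero \<open>\<tau>\<close> and
  \<open>\<xi>\<close> the formula still makes sense at \<open>\<epsilon> = 0\<close>.\<close>

definition zk_kernel_slice :: "real \<Rightarrow> real \<Rightarrow> real \<Rightarrow> real \<times> real \<times> real \<Rightarrow> real \<Rightarrow> complex" where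
  "zk_kernel_slice \<theta> \<epsilon> \<tau> = (\<lambda>(x, y, w) \<xi>. cis ((x + \<theta> * \<tau>) * \<xi> + \<tau> * \<xi> ^ 3) *
     (of_real pi / Complex \<epsilon> (- (\<tau> * \<xi>)) * exp (- of_real (y\<^sup>2 + w\<^sup>2) / (4 * Complex \<epsilon> (- (\<tau> * \<xi>))))))"

lemma inverse_Suc: "0 < inverse (real (Suc n))" by simp

lemma band_borel [measurable]: "band n \<in> sets borel"
  unfolding band_def by measurable

lemma band_nonzero: "\<xi> \<in> band n \<Longrightarrow> \<xi> \<noteq> 0"
proof
  assume "\<xi> \<in> band n" "\<xi> = 0"
  then have "1 / 2 ^ n \<le> (0 :: real)" unfolding band_def by simp
  moreover have "0 < 1 / (2 :: real) ^ n" by simp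
  ultimately show False by linarith
qed

lemma zk_phase_measurable [measurable]: "zk_phase \<theta> \<in> borel_measurable borel"
  unfolding zk_phase_def by (simp add: case_prod_beta' flip: borel_prod)

lemma cutoff_measurable [measurable]: "cutoff n \<epsilon> \<in> borel_measurable borel"
  unfolding cutoff_def case_prod_beta' indicator_def by (simp flip: borel_prod)

lemma cutoff_nonneg: "0 \<le> cutoff n \<epsilon> \<zeta>"
  by (auto simp: cutoff_def split: prod.splits)

lemma cutoff_le_1: "0 \<le> \<epsilon> \<Longrightarrow> cutoff n \<epsilon> \<zeta> \<le> 1"
  by (auto simp: cutoff_def indicator_def mult_le_one split: prod.splits)

lemma integrable_indicator_band: "integrable lborel (indicator (band n) :: real \<Rightarrow> real)"
proof -
  have "emeasure lborel (band n) \<le> emeasure lborel {- (2 ^ n)..(2 ^ n :: real)}"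
    by (intro emeasure_mono) (auto simp: band_def)
  also have "\<dots> < \<infinity>" by simp
  finally show ?thesis by (simp add: integrable_indicator_iff)
qed

lemma integrable_cutoff:
  assumes "0 < \<epsilon>"
  shows "integrable lborel (cutoff n \<epsilon>)"
proof -
  have g: "integrable lborel (\<lambda>x::real. exp (- \<epsilon> * x\<^sup>2))" by (rule integrable_gaussian[OF assms])
  have g2: "integrable (lborel \<Otimes>\<^sub>M lborel) (\<lambda>(\<eta>, \<kappa>). exp (- \<epsilon> * \<eta>\<^sup>2) * exp (- \<epsilon> * \<kappa>\<^sup>2))"
    using g by (intro lborel_pair.Fubini_integrable) (auto simp: abs_mult)
  then have g3: "integrable lborel (\<lambda>p::real \<times> real. exp (- \<epsilon> * (fst p)\<^sup>2) * exp (- \<epsilon> * (snd p)\<^sup>2))"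
    by (simp add: lborel_prod case_prod_beta')
  have "integrable (lborel \<Otimes>\<^sub>M lborel) (\<lambda>(\<xi>, p::real \<times> real). indicator (band n) \<xi> * (exp (- \<epsilon> * (fst p)\<^sup>2) * exp (- \<epsilon> * (snd p)\<^sup>2)))"
    using g3 integrable_indicator_band[of n] by (intro lborel_pair.Fubini_integrable) (auto simp: abs_mult)
  then show ?thesis by (simp add: lborel_prod cutoff_def case_prod_beta')
qed

text \<open>For fixed \<open>\<xi>\<close> the phase is quadratic in the transverse variables, so
  the Gaussian and the oscillation merge into one complex Gaussian for each of them.\<close>

lemma zk_kernel_eq:
  assumes "0 < \<epsilon>"
  shows "zk_kernel \<theta> n \<epsilon> \<tau> v = (LINT \<xi>|lborel. indicator (band n) \<xi> *\<^sub>R zk_kernel_slice \<theta> \<epsilon> \<tau> v \<xi>)"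
proof -
  obtain x y w where v: "v = (x, y, w)" by (cases v) auto
  let ?f = "\<lambda>\<zeta>. of_real (cutoff n \<epsilon> \<zeta>) * cis (v \<bullet> \<zeta> + \<tau> * zk_phase \<theta> \<zeta>)"
  let ?z = "\<lambda>\<xi>. Complex \<epsilon> (- (\<tau> * \<xi>))"
  let ?G = "\<lambda>\<xi> u. (LINT t|lborel. exp (- ?z \<xi> * (complex_of_real t)\<^sup>2) * cis (t * u))"
  have fi: "integrable lborel ?f"
    by (rule Bochner_Integration.integrable_bound[OF integrable_cutoff[OF assms]]) (auto simp: norm_mult)
  then have f1: "integrable (lborel \<Otimes>\<^sub>M lborel) ?f" by (simp add: lborel_prod)
  have split: "?f (\<xi>, \<eta>, \<kappa>) = (of_real (indicator (band n) \<xi>) * cis ((x + \<theta> * \<tau>) * \<xi> + \<tau> * \<xi> ^ 3)) *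
      ((exp (- ?z \<xi> * (complex_of_real \<eta>)\<^sup>2) * cis (\<eta> * y)) * (exp (- ?z \<xi> * (complex_of_real \<kappa>)\<^sup>2) * cis (\<kappa> * w)))" for \<xi> \<eta> \<kappa>
  proof -
    have e: "exp (- ?z \<xi> * (complex_of_real t)\<^sup>2) = of_real (exp (- \<epsilon> * t\<^sup>2)) * cis (\<tau> * \<xi> * t\<^sup>2)" for t
      by (simp add: cis_conv_exp exp_of_real[symmetric] exp_add[symmetric] complex_eq_iff Complex_eq algebra_simps)
    have a: "v \<bullet> (\<xi>, \<eta>, \<kappa>) + \<tau> * zk_phase \<theta> (\<xi>, \<eta>, \<kappa>)
      = ((x + \<theta> * \<tau>) * \<xi> + \<tau> * \<xi> ^ 3) + ((\<tau> * \<xi> * \<eta>\<^sup>2 + \<eta> * y) + (\<tau> * \<xi> * \<kappa>\<^sup>2 + \<kappa> * w))"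
      by (simp add: v zk_phase_def algebra_simps)
    show ?thesis unfolding e a by (simp add: cutoff_def cis_mult[symmetric])
  qed
  have "zk_kernel \<theta> n \<epsilon> \<tau> v = (LINT \<xi>|lborel. LINT p|lborel. ?f (\<xi>, p))"
    unfolding zk_kernel_def using lborel_pair.integral_fst'[OF f1] by (simp only: lborel_prod)
  also have "\<dots> = (LINT \<xi>|lborel. indicator (band n) \<xi> *\<^sub>R zk_kernel_slice \<theta> \<epsilon> \<tau> v \<xi>)"
  proof (intro Bochner_Integration.integral_cong refl)
    fix \<xi>
    have z: "0 < Re (?z \<xi>)" using assms by simp
    let ?E = "\<lambda>u t. exp (- ?z \<xi> * (complex_of_real t)\<^sup>2) * cis (t * u)"
    have iE: "integrable lborel (?E u)" for u by (rule integrable_complex_gaussian[OF z])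
    have iEE: "integrable (lborel \<Otimes>\<^sub>M lborel) (\<lambda>(\<eta>, \<kappa>). ?E y \<eta> * ?E w \<kappa>)"
    proof (intro lborel_pair.Fubini_integrable)
      show "(\<lambda>(\<eta>, \<kappa>). ?E y \<eta> * ?E w \<kappa>) \<in> borel_measurable (lborel \<Otimes>\<^sub>M lborel)" by measurable
      show "integrable lborel (\<lambda>\<eta>. LINT \<kappa>|lborel. norm (case (\<eta>, \<kappa>) of (\<eta>, \<kappa>) \<Rightarrow> ?E y \<eta> * ?E w \<kappa>))"
        using iE by (simp only: prod.case norm_mult integral_mult_right_zero) (intro integrable_mult_left integrable_norm[OF iE, unfolded norm_mult])
      show "AE \<eta> in lborel. integrable lborel (\<lambda>\<kappa>. case (\<eta>, \<kappa>) of (\<eta>, \<kappa>) \<Rightarrow> ?E y \<eta> * ?E w \<kappa>)"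
        using iE by (simp only: prod.case) (intro AE_I2 integrable_mult_right iE)
    qed
    have "(LINT p|lborel. ?f (\<xi>, p)) = (LINT p|(lborel \<Otimes>\<^sub>M lborel). (of_real (indicator (band n) \<xi>) * cis ((x + \<theta> * \<tau>) * \<xi> + \<tau> * \<xi> ^ 3)) * (case p of (\<eta>, \<kappa>) \<Rightarrow> ?E y \<eta> * ?E w \<kappa>))"
      unfolding lborel_prod
    proof (intro Bochner_Integration.integral_cong refl)
      fix p :: "real \<times> real"
      obtain \<eta> \<kappa> where p: "p = (\<eta>, \<kappa>)" by (cases p) auto
      show "?f (\<xi>, p) = (of_real (indicator (band n) \<xi>) * cis ((x + \<theta> * \<tau>) * \<xi> + \<tau> * \<xi> ^ 3)) * (case p of (\<eta>, \<kappa>) \<Rightarrow> ?E y \<eta> * ?E w \<kappa>)"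
        unfolding p split prod.case ..
    qed
    also have "\<dots> = (of_real (indicator (band n) \<xi>) * cis ((x + \<theta> * \<tau>) * \<xi> + \<tau> * \<xi> ^ 3)) * (LINT p|(lborel \<Otimes>\<^sub>M lborel). (case p of (\<eta>, \<kappa>) \<Rightarrow> ?E y \<eta> * ?E w \<kappa>))"
      by (rule integral_mult_right_zero)
    also have "(LINT p|(lborel \<Otimes>\<^sub>M lborel). (case p of (\<eta>, \<kappa>) \<Rightarrow> ?E y \<eta> * ?E w \<kappa>)) = (LINT \<eta>|lborel. LINT \<kappa>|lborel. ?E y \<eta> * ?E w \<kappa>)"
      using lborel_pair.integral_fst'[OF iEE] by (simp only: prod.case)
    also have "\<dots> = ?G \<xi> y * ?G \<xi> w"
      by (simp only: integral_mult_right_zero integral_mult_left_zero)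
    also have "\<dots> = of_real pi / ?z \<xi> * exp (- of_real (y\<^sup>2 + w\<^sup>2) / (4 * ?z \<xi>))"
      by (rule gaussian_fourier_complex[OF z])
    finally show "(LINT p|lborel. ?f (\<xi>, p)) = indicator (band n) \<xi> *\<^sub>R zk_kernel_slice \<theta> \<epsilon> \<tau> v \<xi>"
      unfolding v zk_kernel_slice_def by (simp add: scaleR_conv_of_real mult.assoc)
  qed
  finally show ?thesis .
qed

definition zk_kernel0 :: "real \<Rightarrow> nat \<Rightarrow> real \<Rightarrow> real \<times> real \<times> real \<Rightarrow> complex" where
  "zk_kernel0 \<theta> n \<tau> v = (LINT \<xi>|lborel. indicator (band n) \<xi> *\<^sub>R zk_kernel_slice \<theta> 0 \<tau> v \<xi>)"

text \<open>The imaginary part gives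
  \<open>norm z \<ge> \<bar>\<tau>\<bar> * \<bar>\<xi>\<bar>\<close>, and the exponential has
  modulus at most 1 because \<open>Re (1 / z) \<ge> 0\<close>. The bound depends on \<open>n\<close>
  but not on \<open>\<epsilon>\<close>, as a dominating function should.\<close>

lemma norm_zk_kernel_slice_le:
  assumes "0 \<le> \<epsilon>" "\<tau> \<noteq> 0" "\<xi> \<in> band n"
  shows "norm (zk_kernel_slice \<theta> \<epsilon> \<tau> v \<xi>) \<le> pi * 2 ^ n / \<bar>\<tau>\<bar>"
proof -
  obtain x y w where v: "v = (x, y, w)" by (cases v) auto
  let ?z = "Complex \<epsilon> (- (\<tau> * \<xi>))"
  have xi: "1 / 2 ^ n \<le> \<bar>\<xi>\<bar>" using assms(3) by (simp add: band_def)
  have "\<bar>\<tau>\<bar> * (1 / 2 ^ n) \<le> \<bar>\<tau>\<bar> * \<bar>\<xi>\<bar>" using xi by (intro mult_left_mono) auto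
  also have "\<dots> \<le> norm ?z" using abs_Im_le_cmod[of ?z] by (simp add: abs_mult)
  finally have nz: "\<bar>\<tau>\<bar> / 2 ^ n \<le> norm ?z" by simp
  moreover have "0 < \<bar>\<tau>\<bar> / 2 ^ n" using assms(2) by simp
  ultimately have "pi / norm ?z \<le> pi / (\<bar>\<tau>\<bar> / 2 ^ n)" by (intro divide_left_mono mult_pos_pos) auto
  moreover have "norm (exp (- of_real r / (4 * ?z))) \<le> 1" if "0 \<le> r" for r
  proof -
    have "- of_real r / (4 * ?z) = of_real (- r / 4) * (1 / ?z)" by simp
    then have "Re (- of_real r / (4 * ?z)) = - r / 4 * Re (1 / ?z)"
      by (simp only: Re_complex_of_real Im_complex_of_real times_complex.sel mult_zero_left diff_0_right)
    moreover have "0 \<le> Re (1 / ?z)" using assms(1) by (simp add: Re_divide)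
    ultimately have "Re (- of_real r / (4 * ?z)) \<le> 0" using that by (simp only:) (intro mult_nonpos_nonneg, auto)
    then show ?thesis by simp
  qed
  from this[of "y\<^sup>2 + w\<^sup>2"] have "norm (exp (- of_real (y\<^sup>2 + w\<^sup>2) / (4 * ?z))) \<le> 1" by (simp only: sum_power2_ge_zero)
  ultimately have "pi / norm ?z * norm (exp (- of_real (y\<^sup>2 + w\<^sup>2) / (4 * ?z))) \<le> pi / (\<bar>\<tau>\<bar> / 2 ^ n) * 1"
    by (intro mult_mono) auto
  then show ?thesis by (simp add: v zk_kernel_slice_def norm_mult norm_divide)
qed

lemma zk_kernel_slice_measurable [measurable]:
  "(\<lambda>(v, \<xi>). zk_kernel_slice \<theta> \<epsilon> \<tau> v \<xi>) \<in> borel_measurable (borel \<Otimes>\<^sub>M borel)"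
proof -
  have [measurable]: "(\<lambda>x. Complex \<epsilon> (f x)) \<in> borel_measurable M" if "f \<in> borel_measurable M" for f and M :: "'b measure"
    unfolding Complex_eq using that by measurable
  show ?thesis unfolding zk_kernel_slice_def case_prod_beta' by (simp flip: borel_prod)
qed

text \<open>Dominated convergence on the band. The bound \<open>B\<close> may depend on
  \<open>n\<close> and \<open>\<tau>\<close>; the bound uniform in \<open>n\<close> holds for the
  limit kernel and comes next.\<close>

lemma
  assumes "\<tau> \<noteq> 0"
  shows zk_kernel_tendsto: "(\<lambda>j. zk_kernel \<theta> n (inverse (real (Suc j))) \<tau> v) \<longlonglongrightarrow> zk_kernel0 \<theta> n \<tau> v"
    and zk_kernel_bounded: "\<exists>B\<ge>0. \<forall>j v. norm (zk_kernel \<theta> n (inverse (real (Suc j))) \<tau> v) \<le> B"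
proof -
  let ?w = "\<lambda>\<xi>. indicator (band n) \<xi> * (pi * 2 ^ n / \<bar>\<tau>\<bar>)"
  have w: "integrable lborel ?w" using integrable_indicator_band by simp
  have le: "norm (indicator (band n) \<xi> *\<^sub>R zk_kernel_slice \<theta> \<epsilon> \<tau> v \<xi>) \<le> ?w \<xi>" if "0 \<le> \<epsilon>" for \<epsilon> v \<xi>
    using norm_zk_kernel_slice_le[OF that assms, of \<xi> n \<theta> v] by (auto simp: indicator_def)
  show "(\<lambda>j. zk_kernel \<theta> n (inverse (real (Suc j))) \<tau> v) \<longlonglongrightarrow> zk_kernel0 \<theta> n \<tau> v"
    unfolding zk_kernel0_def zk_kernel_eq[OF inverse_Suc]
  proof (rule integral_dominated_convergence[where w = ?w])
    show "AE \<xi> in lborel. (\<lambda>j. indicator (band n) \<xi> *\<^sub>R zk_kernel_slice \<theta> (inverse (real (Suc j))) \<tau> v \<xi>)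
       \<longlonglongrightarrow> indicator (band n) \<xi> *\<^sub>R zk_kernel_slice \<theta> 0 \<tau> v \<xi>"
    proof (intro AE_I2)
      fix \<xi> :: real
      obtain x y w where v: "v = (x, y, w)" by (cases v) auto
      show "(\<lambda>j. indicator (band n) \<xi> *\<^sub>R zk_kernel_slice \<theta> (inverse (real (Suc j))) \<tau> v \<xi>)
        \<longlonglongrightarrow> indicator (band n) \<xi> *\<^sub>R zk_kernel_slice \<theta> 0 \<tau> v \<xi>"
      proof (cases "\<xi> \<in> band n")
        case True
        then have "\<xi> \<noteq> 0" by (rule band_nonzero)
        then have nz: "Complex 0 (- (\<tau> * \<xi>)) \<noteq> 0" using assms by (simp add: complex_eq_iff)
        have z: "(\<lambda>j. Complex (inverse (real (Suc j))) (- (\<tau> * \<xi>))) \<longlonglongrightarrow> Complex 0 (- (\<tau> * \<xi>))"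
          by (intro tendsto_Complex tendsto_const LIMSEQ_inverse_real_of_nat)
        have cont: "isCont (\<lambda>z. c * (of_real pi / z * exp (- R / (4 * z)))) z0" if "z0 \<noteq> 0" for c R z0 :: complex
          using that by (intro continuous_intros) simp_all
        show ?thesis unfolding v zk_kernel_slice_def prod.case
          by (intro tendsto_scaleR tendsto_const isCont_tendsto_compose[OF cont[OF nz] z])
      qed simp
    qed
    show "integrable lborel ?w" by (rule w)
    show "AE \<xi> in lborel. norm (indicator (band n) \<xi> *\<^sub>R zk_kernel_slice \<theta> (inverse (real (Suc j))) \<tau> v \<xi>) \<le> ?w \<xi>" for j
      by (intro AE_I2 le less_imp_le inverse_Suc)
  qed measurable
  show "\<exists>B\<ge>0. \<forall>j v. norm (zk_kernel \<theta> n (inverse (real (Suc j))) \<tau> v) \<le> B"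
  proof (intro exI[of _ "LINT \<xi>|lborel. ?w \<xi>"] conjI allI)
    show "0 \<le> (LINT \<xi>|lborel. ?w \<xi>)" by (intro integral_nonneg_AE) auto
    fix j v
    show "norm (zk_kernel \<theta> n (inverse (real (Suc j))) \<tau> v) \<le> (LINT \<xi>|lborel. ?w \<xi>)"
      unfolding zk_kernel_eq[OF inverse_Suc]
    proof (rule Bochner_Integration.integral_norm_bound_integral[OF _ w le])
      show "integrable lborel (\<lambda>\<xi>. indicator (band n) \<xi> *\<^sub>R zk_kernel_slice \<theta> (inverse (real (Suc j))) \<tau> v \<xi>)"
      proof (rule Bochner_Integration.integrable_bound[OF w])
        show "AE \<xi> in lborel. norm (indicator (band n) \<xi> *\<^sub>R zk_kernel_slice \<theta> (inverse (real (Suc j))) \<tau> v \<xi>) \<le> norm (?w \<xi>)"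
          by (intro AE_I2 order_trans[OF le[OF less_imp_le[OF inverse_Suc]]]) simp
      qed measurable
    qed (simp del: of_nat_Suc)
  qed
qed

text \<open>At \<open>\<epsilon> = 0\<close> the slice is
  \<open>\<i> * pi / \<tau> * cis (\<psi> \<xi>) / \<xi>\<close> with \<open>\<psi>\<close> odd. The
  values at \<open>\<xi>\<close> and \<open>- \<xi>\<close> add up to
  \<open>- 2 * pi / \<tau>\<close> times \<open>sin (\<psi> \<xi>) / \<xi>\<close>, and the
  integrals of this function are bounded independently of the band.\<close>

theorem zk_kernel0_dispersive:
  "\<exists>C>0. \<forall>\<theta> n \<tau> v. \<tau> \<noteq> 0 \<longrightarrow> norm (zk_kernel0 \<theta> n \<tau> v) \<le> C / \<bar>\<tau>\<bar>"
proof -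
  obtain C where C: "0 < C" and bd: "\<And>a b c \<delta> m. 0 < \<delta> \<Longrightarrow> \<bar>integral {\<delta>..\<delta> * 2 ^ m} (\<lambda>x. sin (cubic_phase a b c x) / x)\<bar> \<le> C"
    using cubic_phase_integral_bounded by blast
  have "norm (zk_kernel0 \<theta> n \<tau> v) \<le> (2 * pi * C) / \<bar>\<tau>\<bar>" if \<tau>: "\<tau> \<noteq> 0" for \<theta> n \<tau> v
  proof -
    obtain x y w where v: "v = (x, y, w)" by (cases v) auto
    define \<psi> where "\<psi> = cubic_phase (x + \<theta> * \<tau>) \<tau> (- (y\<^sup>2 + w\<^sup>2) / (4 * \<tau>))"
    define S where "S = {1 / 2 ^ n..(2::real) ^ n}"
    have Spos: "0 < t" if "t \<in> S" for t using that by (auto simp: S_def intro: less_le_trans[rotated])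
    have slice: "zk_kernel_slice \<theta> 0 \<tau> v \<xi> = \<i> * of_real pi / of_real \<tau> * (cis (\<psi> \<xi>) / of_real \<xi>)" if "\<xi> \<noteq> 0" for \<xi>
    proof -
      have c: "Complex 0 (- (\<tau> * \<xi>)) = - \<i> * of_real (\<tau> * \<xi>)" by (simp add: complex_eq_iff)
      have "- of_real (y\<^sup>2 + w\<^sup>2) / (4 * (- \<i> * of_real (\<tau> * \<xi>))) = \<i> * of_real (- (y\<^sup>2 + w\<^sup>2) / (4 * \<tau>) / \<xi>)"
      proof -
        have "- R / (4 * (- \<i> * T)) = \<i> * (- R / (4 * T))" if "T \<noteq> 0" for R T :: complex
          using that by (simp add: field_simps)
        from this[of "of_real (\<tau> * \<xi>)" "of_real (y\<^sup>2 + w\<^sup>2)"] \<tau> that show ?thesis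
          by (simp add: mult.assoc)
      qed
      then have e1: "exp (- of_real (y\<^sup>2 + w\<^sup>2) / (4 * Complex 0 (- (\<tau> * \<xi>)))) = cis (- (y\<^sup>2 + w\<^sup>2) / (4 * \<tau>) / \<xi>)"
        unfolding c cis_conv_exp by (simp only:)
      have e2: "of_real pi / Complex 0 (- (\<tau> * \<xi>)) = \<i> * of_real pi / of_real \<tau> / of_real \<xi>"
        unfolding c using \<tau> that by (simp add: field_simps)
      have e3: "cis (\<psi> \<xi>) = cis ((x + \<theta> * \<tau>) * \<xi> + \<tau> * \<xi> ^ 3) * cis (- (y\<^sup>2 + w\<^sup>2) / (4 * \<tau>) / \<xi>)"
        by (simp add: \<psi>_def cubic_phase_def cis_mult)
      show ?thesis unfolding v zk_kernel_slice_def prod.case e1 e2 e3 by simp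
    qed
    have odd: "\<psi> (- \<xi>) = - \<psi> \<xi>" for \<xi> by (simp add: \<psi>_def cubic_phase_def)
    let ?g = "\<lambda>\<xi>. zk_kernel_slice \<theta> 0 \<tau> v \<xi>"
    let ?w = "\<lambda>\<xi>. indicator (band n) \<xi> * (pi * 2 ^ n / \<bar>\<tau>\<bar>)"
    have int: "integrable lborel (\<lambda>\<xi>. indicator (band n) \<xi> *\<^sub>R ?g \<xi>)"
    proof (rule Bochner_Integration.integrable_bound)
      show "integrable lborel ?w" using integrable_indicator_band[of n] by simp
      show "AE \<xi> in lborel. norm (indicator (band n) \<xi> *\<^sub>R ?g \<xi>) \<le> norm (?w \<xi>)"
      proof (intro AE_I2)
        fix \<xi>
        show "norm (indicator (band n) \<xi> *\<^sub>R ?g \<xi>) \<le> norm (?w \<xi>)"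
          using norm_zk_kernel_slice_le[OF order_refl \<tau>, of \<xi> n \<theta> v] by (cases "\<xi> \<in> band n") simp_all
      qed
    qed measurable
    have intp: "integrable lborel (\<lambda>\<xi>. indicator S \<xi> *\<^sub>R ?g \<xi>)"
    proof -
      have "(\<lambda>\<xi>. indicator S \<xi> *\<^sub>R ?g \<xi>) = (\<lambda>\<xi>. indicator S \<xi> *\<^sub>R (indicator (band n) \<xi> *\<^sub>R ?g \<xi>))"
      proof
        fix \<xi>
        have "\<xi> \<in> band n" if "\<xi> \<in> S" using that Spos[OF that] by (simp add: S_def band_def)
        then show "indicator S \<xi> *\<^sub>R ?g \<xi> = indicator S \<xi> *\<^sub>R (indicator (band n) \<xi> *\<^sub>R ?g \<xi>)"
          by (cases "\<xi> \<in> S") simp_all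
      qed
      then show ?thesis using integrable_mult_indicator[OF _ int, of S] by (simp add: S_def)
    qed
    have intm: "integrable lborel (\<lambda>\<xi>. indicator S (- \<xi>) *\<^sub>R ?g \<xi>)"
    proof -
      have "(\<lambda>\<xi>. indicator S (- \<xi>) *\<^sub>R ?g \<xi>) = (\<lambda>\<xi>. indicator (uminus ` S) \<xi> *\<^sub>R (indicator (band n) \<xi> *\<^sub>R ?g \<xi>))"
      proof
        fix \<xi>
        have "- \<xi> \<in> S \<longleftrightarrow> \<xi> \<in> uminus ` S" by (metis image_iff minus_minus)
        moreover have "\<xi> \<in> band n" if "- \<xi> \<in> S" using that Spos[OF that] by (auto simp: S_def band_def)
        ultimately show "indicator S (- \<xi>) *\<^sub>R ?g \<xi> = indicator (uminus ` S) \<xi> *\<^sub>R (indicator (band n) \<xi> *\<^sub>R ?g \<xi>)"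
          by (cases "- \<xi> \<in> S") simp_all
      qed
      then show ?thesis using integrable_mult_indicator[OF _ int, of "uminus ` S"] by (simp add: S_def)
    qed
    have "zk_kernel0 \<theta> n \<tau> v = (LINT \<xi>|lborel. indicator S \<xi> *\<^sub>R ?g \<xi> + indicator S (- \<xi>) *\<^sub>R ?g \<xi>)"
      unfolding zk_kernel0_def
    proof (intro Bochner_Integration.integral_cong refl)
      fix \<xi> :: real
      have "\<xi> \<in> band n \<longleftrightarrow> \<xi> \<in> S \<or> - \<xi> \<in> S"
      proof -
        have "(0 :: real) < 1 / 2 ^ n" by simp
        then show ?thesis unfolding band_def S_def mem_Collect_eq atLeastAtMost_iff by (intro iffI; linarith)
      qed
      moreover have "\<not> (\<xi> \<in> S \<and> - \<xi> \<in> S)" using Spos[of \<xi>] Spos[of "- \<xi>"] by auto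
      ultimately show "indicator (band n) \<xi> *\<^sub>R ?g \<xi> = indicator S \<xi> *\<^sub>R ?g \<xi> + indicator S (- \<xi>) *\<^sub>R ?g \<xi>"
        by (cases "\<xi> \<in> S"; cases "- \<xi> \<in> S") simp_all
    qed
    also have "\<dots> = (LINT \<xi>|lborel. indicator S \<xi> *\<^sub>R ?g \<xi>) + (LINT \<xi>|lborel. indicator S (- \<xi>) *\<^sub>R ?g \<xi>)"
      by (rule Bochner_Integration.integral_add[OF intp intm])
    also have "(LINT \<xi>|lborel. indicator S (- \<xi>) *\<^sub>R ?g \<xi>) = (LINT \<xi>|lborel. indicator S \<xi> *\<^sub>R ?g (- \<xi>))"
      using lborel_integral_real_affine[of "-1" "\<lambda>\<xi>. indicator S (- \<xi>) *\<^sub>R ?g \<xi>" 0] by simp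
    also have "(LINT \<xi>|lborel. indicator S \<xi> *\<^sub>R ?g \<xi>) + (LINT \<xi>|lborel. indicator S \<xi> *\<^sub>R ?g (- \<xi>))
       = (LINT \<xi>|lborel. indicator S \<xi> *\<^sub>R ?g \<xi> + indicator S \<xi> *\<^sub>R ?g (- \<xi>))"
    proof (rule Bochner_Integration.integral_add[symmetric, OF intp])
      show "integrable lborel (\<lambda>\<xi>. indicator S \<xi> *\<^sub>R ?g (- \<xi>))"
        using lborel_integrable_real_affine[OF intm, of "-1" 0] by simp
    qed
    also have "\<dots> = (LINT \<xi>|lborel. complex_of_real (- 2 * pi / \<tau>) * of_real (indicator S \<xi> * (sin (\<psi> \<xi>) / \<xi>)))"
    proof (intro Bochner_Integration.integral_cong refl)
      fix \<xi> :: real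
      show "indicator S \<xi> *\<^sub>R ?g \<xi> + indicator S \<xi> *\<^sub>R ?g (- \<xi>) = complex_of_real (- 2 * pi / \<tau>) * of_real (indicator S \<xi> * (sin (\<psi> \<xi>) / \<xi>))"
      proof (cases "\<xi> \<in> S")
        case True
        then have nz: "\<xi> \<noteq> 0" using Spos by auto
        have "?g \<xi> + ?g (- \<xi>) = \<i> * of_real pi / of_real \<tau> * ((cis (\<psi> \<xi>) - cis (- \<psi> \<xi>)) / of_real \<xi>)"
          using nz by (simp add: slice odd diff_divide_distrib right_diff_distrib)
        also have "cis (\<psi> \<xi>) - cis (- \<psi> \<xi>) = 2 * \<i> * of_real (sin (\<psi> \<xi>))" by (simp add: complex_eq_iff)
        finally show ?thesis using True by (simp add: field_simps)
      qed simp
    qed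
    also have "\<dots> = complex_of_real (- 2 * pi / \<tau>) * of_real (LINT \<xi>|lborel. indicator S \<xi> * (sin (\<psi> \<xi>) / \<xi>))"
      by (simp only: integral_mult_right_zero integral_complex_of_real)
    also have "(LINT \<xi>|lborel. indicator S \<xi> * (sin (\<psi> \<xi>) / \<xi>)) = integral S (\<lambda>\<xi>. sin (\<psi> \<xi>) / \<xi>)"
    proof -
      have "continuous_on S (\<lambda>\<xi>. sin (\<psi> \<xi>) / \<xi>)"
        unfolding \<psi>_def cubic_phase_def using Spos by (intro continuous_intros) force+
      then have "set_integrable lborel S (\<lambda>\<xi>. sin (\<psi> \<xi>) / \<xi>)"
        unfolding S_def by (rule borel_integrable_atLeastAtMost')
      from set_borel_integral_eq_integral(2)[OF this] show ?thesis by (simp add: set_lebesgue_integral_def)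
    qed
    finally have "norm (zk_kernel0 \<theta> n \<tau> v) = 2 * pi / \<bar>\<tau>\<bar> * \<bar>integral S (\<lambda>\<xi>. sin (\<psi> \<xi>) / \<xi>)\<bar>"
      by (simp add: norm_mult norm_divide)
    also have "\<bar>integral S (\<lambda>\<xi>. sin (\<psi> \<xi>) / \<xi>)\<bar> \<le> C"
    proof -
      \<comment> \<open>Doubling \<open>1 / 2 ^ n\<close> exactly \<open>2 * n\<close> times gives
        \<open>2 ^ n\<close>.\<close>
      have "S = {1 / 2 ^ n..1 / 2 ^ n * 2 ^ (2 * n)}" by (simp add: S_def power_add mult_2)
      then show ?thesis unfolding \<psi>_def by (simp only:) (rule bd, simp)
    qed
    finally show ?thesis by (simp add: mult_left_mono divide_right_mono)
  qed
  then show ?thesis using C by (intro exI[of _ "2 * pi * C"]) auto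
qed

subsection \<open>Interpolation\<close>

text \<open>At level \<open>l\<close> the large values of \<open>f\<close> are handled by
  \<open>inf\<close>, so that they contribute at most \<open>l / 2\<close>, and the small values by
  \<open>L2\<close> and Chebyshev's inequality. The explicit dependence on \<open>A\<close> later
  becomes the power of \<open>\<tau>\<close>.\<close>

lemma Marcinkiewicz_interpolation:
  fixes T :: "('a::euclidean_space \<Rightarrow> complex) \<Rightarrow> 'a \<Rightarrow> complex"
  assumes q: "2 < q" "q' = q / (q - 1)" and A: "0 < A" and D: "0 < D"
    and add: "\<And>f g x. integrable lborel f \<Longrightarrow> integrable lborel g \<Longrightarrow> T (\<lambda>z. f z + g z) x = T f x + T g x"
    and meas: "\<And>f. integrable lborel f \<Longrightarrow> T f \<in> borel_measurable borel"
    and inf: "\<And>f x. integrable lborel f \<Longrightarrow> ennreal (norm (T f x)) \<le> ennreal A * (\<integral>\<^sup>+z. ennreal (norm (f z)) \<partial>lborel)"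
    and L2: "\<And>f. integrable lborel f \<Longrightarrow> (\<integral>\<^sup>+x. ennreal ((norm (T f x))\<^sup>2) \<partial>lborel) \<le> ennreal D * (\<integral>\<^sup>+z. ennreal ((norm (f z))\<^sup>2) \<partial>lborel)"
    and f: "integrable lborel f"
  shows "(\<integral>\<^sup>+x. ennreal (norm (T f x) powr q) \<partial>lborel)
    \<le> ennreal (4 * D * (q / (q - 2)) * (2 * A) powr (q - 2)) * ennreal_pow (\<integral>\<^sup>+z. ennreal (norm (f z) powr q') \<partial>lborel) (q - 1)"
proof -
  have [measurable]: "f \<in> borel_measurable borel" using f by auto
  have [measurable]: "T f \<in> borel_measurable borel" using meas[OF f] .
  \<comment> \<open>The second identity turns \<open>|f|^2\<close> times the threshold weight to the
    power \<open>q - 2\<close> back into \<open>|f| powr q'\<close>.\<close>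
  have q': "1 < q'" "(1 - q') * (q - 2) + 2 = q'"
    unfolding q(2) using q(1) by (simp add: less_divide_eq, simp add: field_simps)
  define S where "S = (\<integral>\<^sup>+z. ennreal (norm (f z) powr q') \<partial>lborel)"
  consider "S = top" | "S = 0" | s where "S = ennreal s" "0 < s"
    by (metis ennreal_cases ennreal_less_zero_iff gr_zeroI infinity_ennreal_def)
  then show ?thesis
  proof cases
    case 1
    then show ?thesis using q(1) A D by (simp add: S_def[symmetric] ennreal_mult_top)
  next
    case 2
    then have "AE z in lborel. f z = 0"
      unfolding S_def by (subst (asm) nn_integral_0_iff_AE) (auto elim!: eventually_mono simp: ennreal_eq_0_iff)
    then have "(\<integral>\<^sup>+z. ennreal (norm (f z)) \<partial>lborel) = 0"
      by (subst nn_integral_0_iff_AE) auto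
    then have "T f x = 0" for x using inf[OF f, of x] by (simp add: ennreal_eq_0_iff)
    then show ?thesis using q by simp
  next
    case (3 s)
    define K where "K = 2 * A * s"
    have K: "0 < K" using A 3 by (simp add: K_def)
    \<comment> \<open>As \<open>1 - q' < 0\<close>, the condition \<open>b z < l\<close> selects the
      large values of \<open>f\<close>. There
      \<open>norm (f z) \<le> l / K * norm (f z) powr q'\<close>, and \<open>K = 2 * A * s\<close>
      turns the \<open>L^1\<close> bound into \<open>l / 2\<close>. At zeros of \<open>f\<close> the
      threshold is 0, since \<open>0 powr x = 0\<close>.\<close>
    define b where "b z = K * norm (f z) powr (1 - q')" for z
    have [measurable]: "b \<in> borel_measurable borel" unfolding b_def by measurable
    define h where "h z = ennreal ((norm (f z))\<^sup>2)" for z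
    have [measurable]: "h \<in> borel_measurable borel" unfolding h_def by measurable
    have lev: "emeasure lborel {x\<in>space lborel. ennreal l < ennreal (norm (T f x))}
      \<le> ennreal ((4 * D) * l powr (- 2)) * ennreal_pow (\<integral>\<^sup>+z. h z * indicator {z. l \<le> b z} z \<partial>lborel) (2 / 2)"
      if l: "0 < l" for l
    proof -
      define fL where "fL z = indicator {z. b z < l} z *\<^sub>R f z" for z
      define fH where "fH z = indicator {z. l \<le> b z} z *\<^sub>R f z" for z
      have [measurable]: "{z. b z < l} \<in> sets borel" "{z. l \<le> b z} \<in> sets borel" by measurable
      have fL: "integrable lborel fL" unfolding fL_def using f by (intro integrable_mult_indicator) auto
      have fH: "integrable lborel fH" unfolding fH_def using f by (intro integrable_mult_indicator) auto
      have [measurable]: "T fH \<in> borel_measurable borel" using meas[OF fH] .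
      have "f z = fL z + fH z" for z by (auto simp: fL_def fH_def indicator_def)
      then have split: "T f x = T fL x + T fH x" for x using add[OF fL fH] by presburger
      have low: "norm (T fL x) \<le> l / 2" for x
      proof -
        have pt: "norm (fL z) \<le> l / K * norm (f z) powr q'" for z
        proof (cases "b z < l \<and> f z \<noteq> 0")
          case True
          have "norm (f z) = norm (f z) powr (1 - q') * norm (f z) powr q'"
            using True by (simp flip: powr_add)
          also have "\<dots> \<le> l / K * norm (f z) powr q'"
            using True K by (intro mult_right_mono) (auto simp: b_def field_simps)
          finally show ?thesis using True by (simp add: fL_def)
        next
          case False
          then have "fL z = 0" by (auto simp: fL_def)
          then show ?thesis using l K by simp
        qed
        have "ennreal (norm (T fL x)) \<le> ennreal A * (\<integral>\<^sup>+z. ennreal (norm (fL z)) \<partial>lborel)" by (rule inf[OF fL])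
        also have "(\<integral>\<^sup>+z. ennreal (norm (fL z)) \<partial>lborel) \<le> (\<integral>\<^sup>+z. ennreal (l / K) * ennreal (norm (f z) powr q') \<partial>lborel)"
          using pt l K by (intro nn_integral_mono) (simp flip: ennreal_mult)
        also have "\<dots> = ennreal (l / K) * ennreal s" using 3 by (simp add: nn_integral_cmult S_def)
        also have "ennreal A * \<dots> = ennreal (l / 2)"
          using A l K 3 by (simp add: K_def flip: ennreal_mult)
        finally show ?thesis using l by (simp add: mult_left_mono)
      qed
      have "emeasure lborel {x\<in>space lborel. ennreal l < ennreal (norm (T f x))}
        \<le> emeasure lborel {x\<in>space lborel. 1 \<le> ennreal (4 / l\<^sup>2) * ennreal ((norm (T fH x))\<^sup>2)}"
      proof (intro emeasure_mono subsetI)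
        fix x assume "x \<in> {x\<in>space lborel. ennreal l < ennreal (norm (T f x))}"
        then have "l < norm (T f x)" using l by (simp add: ennreal_less_iff)
        also have "\<dots> \<le> norm (T fL x) + norm (T fH x)" unfolding split by (rule norm_triangle_ineq)
        finally have "l / 2 \<le> norm (T fH x)" using low[of x] by simp
        then have "(l / 2)\<^sup>2 \<le> (norm (T fH x))\<^sup>2" using l by (intro power_mono) auto
        then have "1 \<le> 4 / l\<^sup>2 * (norm (T fH x))\<^sup>2" using l by (simp add: field_simps)
        then have "1 \<le> ennreal (4 / l\<^sup>2) * ennreal ((norm (T fH x))\<^sup>2)"
          using l by (simp flip: ennreal_mult ennreal_1)
        then show "x \<in> {x\<in>space lborel. 1 \<le> ennreal (4 / l\<^sup>2) * ennreal ((norm (T fH x))\<^sup>2)}" by simp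
      qed measurable
      also have "\<dots> \<le> ennreal (4 / l\<^sup>2) * (\<integral>\<^sup>+x\<in>space lborel. ennreal ((norm (T fH x))\<^sup>2) \<partial>lborel)"
        by (intro nn_integral_Markov_inequality[where A = "space lborel"]) auto
      also have "\<dots> \<le> ennreal (4 / l\<^sup>2) * (ennreal D * (\<integral>\<^sup>+z. ennreal ((norm (fH z))\<^sup>2) \<partial>lborel))"
        using L2[OF fH] by (intro mult_left_mono) auto
      also have "(\<integral>\<^sup>+z. ennreal ((norm (fH z))\<^sup>2) \<partial>lborel) = (\<integral>\<^sup>+z. h z * indicator {z. l \<le> b z} z \<partial>lborel)"
        by (intro nn_integral_cong) (auto simp: fH_def h_def indicator_def)
      also have "ennreal (4 / l\<^sup>2) * (ennreal D * I) = ennreal ((4 * D) * l powr (- 2)) * ennreal_pow I (2 / 2)" for I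
      proof -
        have "ennreal (4 / l\<^sup>2) * (ennreal D * I) = ennreal (4 / l\<^sup>2 * D) * I"
          unfolding mult.assoc[symmetric] using D by (subst ennreal_mult[symmetric]) simp_all
        also have "4 / l\<^sup>2 * D = (4 * D) * l powr (- 2)"
          using l by (simp add: powr_minus divide_inverse)
        finally show ?thesis by simp
      qed
      finally show ?thesis .
    qed
    have "(\<integral>\<^sup>+x. ennreal_pow (ennreal (norm (T f x))) q \<partial>lborel)
      \<le> ennreal ((4 * D) * q / (q - 2)) * ennreal_pow (\<integral>\<^sup>+z. h z * ennreal (b z powr (2 * (q - 2) / 2)) \<partial>lborel) (2 / 2)"
    proof (rule nn_integral_level_sets[OF sigma_finite_lborel sigma_finite_lborel])
      show "0 \<le> b z" for z using K by (simp add: b_def)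
    qed (use q D lev in simp_all)
    also have "(\<integral>\<^sup>+z. h z * ennreal (b z powr (2 * (q - 2) / 2)) \<partial>lborel) = (\<integral>\<^sup>+z. ennreal (K powr (q - 2)) * ennreal (norm (f z) powr q') \<partial>lborel)"
    proof (intro nn_integral_cong)
      fix z :: 'a
      show "h z * ennreal (b z powr (2 * (q - 2) / 2)) = ennreal (K powr (q - 2)) * ennreal (norm (f z) powr q')"
      proof (cases "f z = 0")
        case False
        have "2 * (q - 2) / 2 = q - 2" by simp
        then have "b z powr (2 * (q - 2) / 2) = K powr (q - 2) * (norm (f z) powr (1 - q')) powr (q - 2)"
          using K by (simp only: b_def powr_mult less_imp_le powr_ge_zero)
        then have "(norm (f z))\<^sup>2 * b z powr (2 * (q - 2) / 2) = K powr (q - 2) * (norm (f z) powr ((1 - q') * (q - 2)) * norm (f z) powr 2)"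
          using False by (simp only: powr_powr) simp
        also have "norm (f z) powr ((1 - q') * (q - 2)) * norm (f z) powr 2 = norm (f z) powr q'"
          unfolding powr_add[symmetric] q'(2) ..
        finally show ?thesis by (simp add: h_def flip: ennreal_mult)
      qed (simp add: h_def)
    qed
    also have "\<dots> = ennreal (K powr (q - 2)) * ennreal s"
      by (subst nn_integral_cmult, measurable) (simp add: S_def[symmetric] 3)
    also have "ennreal ((4 * D) * q / (q - 2)) * ennreal_pow (ennreal (K powr (q - 2)) * ennreal s) (2 / 2)
       = ennreal (((4 * D) * q / (q - 2)) * (K powr (q - 2) * s))"
      using q 3 D by (simp flip: ennreal_mult)
    also have "K powr (q - 2) * s = (2 * A) powr (q - 2) * s powr (q - 1)"
    proof -
      have "s powr (q - 2) * s = s powr (q - 1)" using 3 powr_add[of s "q - 2" 1] by simp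
      then show ?thesis using A 3 by (simp add: K_def powr_mult)
    qed
    also have "((4 * D) * q / (q - 2)) * ((2 * A) powr (q - 2) * s powr (q - 1)) = (4 * D * (q / (q - 2)) * (2 * A) powr (q - 2)) * s powr (q - 1)"
      by simp
    also have "ennreal \<dots> = ennreal (4 * D * (q / (q - 2)) * (2 * A) powr (q - 2)) * ennreal_pow S (q - 1)"
      using q D A 3 by (subst ennreal_mult) (simp_all add: ennreal_pow_ennreal)
    finally show ?thesis by (simp add: S_def ennreal_pow_ennreal)
  qed
qed

section \<open>The evolution as a convolution operator between Lebesgue spaces\<close>

lemma zk_kernel_measurable [measurable]: "zk_kernel \<theta> n \<epsilon> \<tau> \<in> borel_measurable borel"
  unfolding zk_kernel_def by measurable

lemma zk_kernel0_measurable [measurable]: "zk_kernel0 \<theta> n \<tau> \<in> borel_measurable borel"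
  unfolding zk_kernel0_def by measurable

text \<open>The formula of \<open>fourier\<close>, here in the role of the adjoint of
  \<open>osc\<close>.\<close>

definition osc_adj :: "('a::euclidean_space \<Rightarrow> complex) \<Rightarrow> 'a \<Rightarrow> complex" where
  "osc_adj f \<zeta> = (LINT w|lborel. cis (- (w \<bullet> \<zeta>)) * f w)"

lemma osc_adj_eq: "osc_adj f \<zeta> = cnj (osc (\<lambda>w. cnj (f w)) \<zeta>)"
  unfolding osc_adj_def osc_def Bochner_Integration.integral_cnj[symmetric]
  by (simp add: cis_cnj inner_commute)

lemma osc_adj_measurable [measurable]:
  "f \<in> borel_measurable borel \<Longrightarrow> osc_adj f \<in> borel_measurable borel"
  unfolding osc_adj_eq[abs_def] by measurable

lemma norm_osc_adj_le: "ennreal (norm (osc_adj f x)) \<le> (\<integral>\<^sup>+z. ennreal (norm (f z)) \<partial>lborel)"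
  using norm_integral_le_nn_integral[of lborel "\<lambda>w. cis (- (w \<bullet> x)) * f w"] by (simp add: osc_adj_def norm_mult)

lemma osc_adj_L2_bound:
  fixes f :: "'a::euclidean_space \<Rightarrow> complex"
  assumes "integrable lborel f"
  shows "(\<integral>\<^sup>+x. ennreal ((norm (osc_adj f x))\<^sup>2) \<partial>lborel) \<le> ennreal ((2 * pi) ^ DIM('a)) * (\<integral>\<^sup>+z. ennreal ((norm (f z))\<^sup>2) \<partial>lborel)"
  using osc_L2_bound[of "\<lambda>w. cnj (f w)"] assms by (simp add: osc_adj_eq)

text \<open>Up to a constant, the Fourier multiplier \<open>cutoff n \<epsilon>\<close> times
  \<open>cis (\<tau> * zk_phase \<theta>)\<close>, see \<open>zk_op_eq_osc\<close>; this form gives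
  the \<open>L^2\<close> bound.\<close>

definition zk_op :: "real \<Rightarrow> nat \<Rightarrow> real \<Rightarrow> real \<Rightarrow> (real \<times> real \<times> real \<Rightarrow> complex) \<Rightarrow> real \<times> real \<times> real \<Rightarrow> complex" where
  "zk_op \<theta> n \<epsilon> \<tau> f v = (LINT w|lborel. zk_kernel \<theta> n \<epsilon> \<tau> (v - w) * f w)"

text \<open>The limit \<open>\<epsilon> = 0\<close>: the pointwise kernel bound is available here,
  while the \<open>L^2\<close> bound is inherited from \<open>\<epsilon> > 0\<close>.\<close>

definition zk_op0 :: "real \<Rightarrow> nat \<Rightarrow> real \<Rightarrow> (real \<times> real \<times> real \<Rightarrow> complex) \<Rightarrow> real \<times> real \<times> real \<Rightarrow> complex" where
  "zk_op0 \<theta> n \<tau> f v = (LINT w|lborel. zk_kernel0 \<theta> n \<tau> (v - w) * f w)"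

lemma zk_op_measurable [measurable]:
  assumes [measurable]: "f \<in> borel_measurable borel"
  shows "zk_op \<theta> n \<epsilon> \<tau> f \<in> borel_measurable borel"
  unfolding zk_op_def by measurable

lemma zk_op0_measurable [measurable]:
  assumes [measurable]: "f \<in> borel_measurable borel"
  shows "zk_op0 \<theta> n \<tau> f \<in> borel_measurable borel"
  unfolding zk_op0_def by measurable

lemma integrable_cutoff_osc_adj:
  assumes "0 < \<epsilon>" "integrable lborel f"
  shows "integrable lborel (\<lambda>\<zeta>. of_real (cutoff n \<epsilon> \<zeta>) * cis (\<tau> * zk_phase \<theta> \<zeta>) * osc_adj f \<zeta>)"
proof -
  have [measurable]: "f \<in> borel_measurable borel" using assms by auto
  have le: "norm (osc_adj f \<zeta>) \<le> (LINT z|lborel. norm (f z))" for \<zeta>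
    unfolding osc_adj_def by (rule order_trans[OF integral_norm_bound]) (simp add: norm_mult)
  show ?thesis
  proof (rule Bochner_Integration.integrable_bound)
    show "integrable lborel (\<lambda>\<zeta>. cutoff n \<epsilon> \<zeta> * (LINT z|lborel. norm (f z)))"
      using integrable_cutoff[OF assms(1)] by simp
    show "AE \<zeta> in lborel. norm (of_real (cutoff n \<epsilon> \<zeta>) * cis (\<tau> * zk_phase \<theta> \<zeta>) * osc_adj f \<zeta>) \<le> norm (cutoff n \<epsilon> \<zeta> * (LINT z|lborel. norm (f z)))"
      using le by (intro AE_I2) (simp add: norm_mult abs_mult mult_left_mono order_trans[OF le])
  qed measurable
qed

lemma zk_op_eq_osc:
  assumes \<epsilon>: "0 < \<epsilon>" and f: "integrable lborel f"
  shows "zk_op \<theta> n \<epsilon> \<tau> f v = osc (\<lambda>\<zeta>. of_real (cutoff n \<epsilon> \<zeta>) * cis (\<tau> * zk_phase \<theta> \<zeta>) * osc_adj f \<zeta>) v"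
proof -
  have [measurable]: "f \<in> borel_measurable borel" using f by auto
  let ?k = "\<lambda>w \<zeta>. of_real (cutoff n \<epsilon> \<zeta>) * cis ((v - w) \<bullet> \<zeta> + \<tau> * zk_phase \<theta> \<zeta>) * f w"
  have int: "integrable (lborel \<Otimes>\<^sub>M lborel) (\<lambda>(w, \<zeta>). ?k w \<zeta>)"
  proof (rule Bochner_Integration.integrable_bound)
    show "integrable (lborel \<Otimes>\<^sub>M lborel) (\<lambda>(w, \<zeta>). f w * of_real (cutoff n \<epsilon> \<zeta>))"
      using f integrable_cutoff[OF \<epsilon>, of n] by (intro lborel_pair.Fubini_integrable) (auto simp: norm_mult)
    show "AE z in lborel \<Otimes>\<^sub>M lborel. norm (case z of (w, \<zeta>) \<Rightarrow> ?k w \<zeta>) \<le> norm (case z of (w, \<zeta>) \<Rightarrow> f w * of_real (cutoff n \<epsilon> \<zeta>))"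
      by (intro AE_I2) (auto simp: norm_mult)
  qed measurable
  have "zk_op \<theta> n \<epsilon> \<tau> f v = (LINT w|lborel. LINT \<zeta>|lborel. ?k w \<zeta>)"
    unfolding zk_op_def zk_kernel_def by simp
  also have "\<dots> = (LINT \<zeta>|lborel. LINT w|lborel. ?k w \<zeta>)"
    using lborel_pair.Fubini_integral[OF int] by simp
  also have "\<dots> = (LINT \<zeta>|lborel. cis (v \<bullet> \<zeta>) * (of_real (cutoff n \<epsilon> \<zeta>) * cis (\<tau> * zk_phase \<theta> \<zeta>) * osc_adj f \<zeta>))"
  proof (intro Bochner_Integration.integral_cong refl)
    fix \<zeta>
    have "?k w \<zeta> = (cis (v \<bullet> \<zeta>) * (of_real (cutoff n \<epsilon> \<zeta>) * cis (\<tau> * zk_phase \<theta> \<zeta>))) * (cis (- (w \<bullet> \<zeta>)) * f w)" for w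
    proof -
      have "cis ((v - w) \<bullet> \<zeta> + \<tau> * zk_phase \<theta> \<zeta>) = cis (v \<bullet> \<zeta>) * cis (\<tau> * zk_phase \<theta> \<zeta>) * cis (- (w \<bullet> \<zeta>))"
        by (simp add: cis_mult inner_diff_left algebra_simps)
      then show ?thesis by simp
    qed
    then show "(LINT w|lborel. ?k w \<zeta>) = cis (v \<bullet> \<zeta>) * (of_real (cutoff n \<epsilon> \<zeta>) * cis (\<tau> * zk_phase \<theta> \<zeta>) * osc_adj f \<zeta>)"
      unfolding osc_adj_def by (simp only: integral_mult_right_zero mult.assoc)
  qed
  finally show ?thesis unfolding osc_def .
qed

text \<open>Two applications of Plancherel, each with the factor \<open>(2 * pi) ^ 3\<close>, and
  between them a multiplier of modulus at most 1.\<close>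

lemma zk_op_L2_bound:
  assumes \<epsilon>: "0 < \<epsilon>" and f: "integrable lborel f"
  shows "(\<integral>\<^sup>+x. ennreal ((norm (zk_op \<theta> n \<epsilon> \<tau> f x))\<^sup>2) \<partial>lborel) \<le> ennreal ((2 * pi) ^ 6) * (\<integral>\<^sup>+z. ennreal ((norm (f z))\<^sup>2) \<partial>lborel)"
proof -
  have dim: "DIM(real \<times> real \<times> real) = 3" by simp
  have "(\<integral>\<^sup>+x. ennreal ((norm (zk_op \<theta> n \<epsilon> \<tau> f x))\<^sup>2) \<partial>lborel)
    \<le> ennreal ((2 * pi) ^ 3) * (\<integral>\<^sup>+\<zeta>. ennreal ((norm (of_real (cutoff n \<epsilon> \<zeta>) * cis (\<tau> * zk_phase \<theta> \<zeta>) * osc_adj f \<zeta>))\<^sup>2) \<partial>lborel)"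
    unfolding zk_op_eq_osc[OF \<epsilon> f]
    by (rule osc_L2_bound[OF integrable_cutoff_osc_adj[OF \<epsilon> f], unfolded dim])
  also have "\<dots> \<le> ennreal ((2 * pi) ^ 3) * (\<integral>\<^sup>+\<zeta>. ennreal ((norm (osc_adj f \<zeta>))\<^sup>2) \<partial>lborel)"
    using cutoff_le_1[OF less_imp_le[OF \<epsilon>]] cutoff_nonneg
    by (intro mult_left_mono nn_integral_mono ennreal_leI power_mono) (auto simp: norm_mult mult_left_le_one_le)
  also have "\<dots> \<le> ennreal ((2 * pi) ^ 3) * (ennreal ((2 * pi) ^ 3) * (\<integral>\<^sup>+z. ennreal ((norm (f z))\<^sup>2) \<partial>lborel))"
    by (intro mult_left_mono osc_adj_L2_bound[OF f, unfolded dim]) simp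
  also have "\<dots> = ennreal ((2 * pi) ^ 6) * (\<integral>\<^sup>+z. ennreal ((norm (f z))\<^sup>2) \<partial>lborel)"
    unfolding mult.assoc[symmetric] by (subst ennreal_mult[symmetric]) (simp_all flip: power_add)
  finally show ?thesis .
qed

text \<open>For fixed \<open>\<tau>\<close> and \<open>n\<close> the kernels are bounded uniformly
  in \<open>\<epsilon>\<close>, so a multiple of \<open>norm (f w)\<close> dominates.\<close>

lemma
  assumes \<tau>: "\<tau> \<noteq> 0" and f: "integrable lborel f"
  shows zk_op_tendsto: "(\<lambda>j. zk_op \<theta> n (inverse (real (Suc j))) \<tau> f v) \<longlonglongrightarrow> zk_op0 \<theta> n \<tau> f v"
    and zk_op_bounded: "\<exists>B\<ge>0. \<forall>j v. norm (zk_op \<theta> n (inverse (real (Suc j))) \<tau> f v) \<le> B"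
    and integrable_zk_kernel0_mult: "integrable lborel (\<lambda>w. zk_kernel0 \<theta> n \<tau> (v - w) * f w)"
proof -
  have [measurable]: "f \<in> borel_measurable borel" using f by auto
  obtain B where B: "0 \<le> B" "\<And>j v. norm (zk_kernel \<theta> n (inverse (real (Suc j))) \<tau> v) \<le> B"
    using zk_kernel_bounded[OF \<tau>] by metis
  have w: "integrable lborel (\<lambda>w. B * norm (f w))" using f by simp
  have le: "norm (zk_kernel \<theta> n (inverse (real (Suc j))) \<tau> (v - w) * f w) \<le> B * norm (f w)" for j v w
    unfolding norm_mult by (intro mult_right_mono B) simp
  have lim: "AE w in lborel. (\<lambda>j. zk_kernel \<theta> n (inverse (real (Suc j))) \<tau> (v - w) * f w) \<longlonglongrightarrow> zk_kernel0 \<theta> n \<tau> (v - w) * f w" for v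
    by (intro AE_I2 tendsto_mult tendsto_const zk_kernel_tendsto \<tau>)
  show "(\<lambda>j. zk_op \<theta> n (inverse (real (Suc j))) \<tau> f v) \<longlonglongrightarrow> zk_op0 \<theta> n \<tau> f v"
    unfolding zk_op_def zk_op0_def
    by (rule integral_dominated_convergence[OF _ _ w lim AE_I2[OF le]]) measurable
  show "integrable lborel (\<lambda>w. zk_kernel0 \<theta> n \<tau> (v - w) * f w)"
    by (rule integrable_dominated_convergence[OF _ _ w lim AE_I2[OF le]]) measurable
  show "\<exists>B\<ge>0. \<forall>j v. norm (zk_op \<theta> n (inverse (real (Suc j))) \<tau> f v) \<le> B"
  proof (intro exI[of _ "LINT w|lborel. B * norm (f w)"] conjI allI)
    show "0 \<le> (LINT w|lborel. B * norm (f w))" using B by (intro integral_nonneg_AE) auto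
    fix j v
    show "norm (zk_op \<theta> n (inverse (real (Suc j))) \<tau> f v) \<le> (LINT w|lborel. B * norm (f w))"
      unfolding zk_op_def
    proof (rule Bochner_Integration.integral_norm_bound_integral[OF _ w le])
      show "integrable lborel (\<lambda>w. zk_kernel \<theta> n (inverse (real (Suc j))) \<tau> (v - w) * f w)"
        using B(1) by (intro Bochner_Integration.integrable_bound[OF w] AE_I2 order_trans[OF le]) simp_all
    qed
  qed
qed

lemma zk_op0_L2_bound:
  assumes \<tau>: "\<tau> \<noteq> 0" and f: "integrable lborel f"
  shows "(\<integral>\<^sup>+x. ennreal ((norm (zk_op0 \<theta> n \<tau> f x))\<^sup>2) \<partial>lborel) \<le> ennreal ((2 * pi) ^ 6) * (\<integral>\<^sup>+z. ennreal ((norm (f z))\<^sup>2) \<partial>lborel)"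
proof (rule nn_integral_le_of_tendsto[OF _ zk_op_L2_bound[OF inverse_Suc f]])
  have [measurable]: "f \<in> borel_measurable borel" using f by auto
  show "(\<lambda>x. ennreal ((norm (zk_op \<theta> n (inverse (real (Suc j))) \<tau> f x))\<^sup>2)) \<in> borel_measurable lborel" for j
    by measurable
  show "AE x in lborel. (\<lambda>j. ennreal ((norm (zk_op \<theta> n (inverse (real (Suc j))) \<tau> f x))\<^sup>2)) \<longlonglongrightarrow> ennreal ((norm (zk_op0 \<theta> n \<tau> f x))\<^sup>2)"
    by (intro AE_I2 tendsto_ennrealI tendsto_power tendsto_norm zk_op_tendsto \<tau> f)
qed

text \<open>The kernel bound \<open>C0 / \<bar>\<tau>\<bar>\<close> enters the interpolation to the
  power \<open>q - 2\<close>. In terms of norms the operator decays like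
  \<open>\<bar>\<tau>\<bar> powr (- (1 - 2 / q))\<close>, uniformly in \<open>\<theta>\<close> and
  \<open>n\<close>.\<close>

theorem zk_op0_Lp_bound:
  assumes q: "2 < q" "q' = q / (q - 1)"
  shows "\<exists>C>0. \<forall>\<theta> n \<tau> f. \<tau> \<noteq> 0 \<longrightarrow> integrable lborel f \<longrightarrow>
    (\<integral>\<^sup>+x. ennreal (norm (zk_op0 \<theta> n \<tau> f x) powr q) \<partial>lborel)
    \<le> ennreal (C * \<bar>\<tau>\<bar> powr (- (q - 2))) * ennreal_pow (\<integral>\<^sup>+z. ennreal (norm (f z) powr q') \<partial>lborel) (q - 1)"
proof -
  obtain C0 where C0: "0 < C0" and disp: "\<And>\<theta> n \<tau> v. \<tau> \<noteq> 0 \<Longrightarrow> norm (zk_kernel0 \<theta> n \<tau> v) \<le> C0 / \<bar>\<tau>\<bar>"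
    using zk_kernel0_dispersive by blast
  define C where "C = 4 * (2 * pi) ^ 6 * (q / (q - 2)) * (2 * C0) powr (q - 2)"
  have "(\<integral>\<^sup>+x. ennreal (norm (zk_op0 \<theta> n \<tau> f x) powr q) \<partial>lborel)
    \<le> ennreal (C * \<bar>\<tau>\<bar> powr (- (q - 2))) * ennreal_pow (\<integral>\<^sup>+z. ennreal (norm (f z) powr q') \<partial>lborel) (q - 1)"
    if \<tau>: "\<tau> \<noteq> 0" and f: "integrable lborel f" for \<theta> n \<tau> f
  proof -
    have "(\<integral>\<^sup>+x. ennreal (norm (zk_op0 \<theta> n \<tau> f x) powr q) \<partial>lborel)
      \<le> ennreal (4 * (2 * pi) ^ 6 * (q / (q - 2)) * (2 * (C0 / \<bar>\<tau>\<bar>)) powr (q - 2)) * ennreal_pow (\<integral>\<^sup>+z. ennreal (norm (f z) powr q') \<partial>lborel) (q - 1)"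
    proof (rule Marcinkiewicz_interpolation[OF q _ _ _ _ _ _ f])
      show "zk_op0 \<theta> n \<tau> (\<lambda>z. f z + g z) x = zk_op0 \<theta> n \<tau> f x + zk_op0 \<theta> n \<tau> g x"
        if "integrable lborel f" "integrable lborel g" for f g x
        unfolding zk_op0_def distrib_left
        by (rule Bochner_Integration.integral_add; rule integrable_zk_kernel0_mult[OF \<tau>]; fact)
      show "ennreal (norm (zk_op0 \<theta> n \<tau> f x)) \<le> ennreal (C0 / \<bar>\<tau>\<bar>) * (\<integral>\<^sup>+z. ennreal (norm (f z)) \<partial>lborel)"
        if f: "integrable lborel f" for f x
      proof -
        have "ennreal (norm (zk_op0 \<theta> n \<tau> f x)) \<le> (\<integral>\<^sup>+z. ennreal (norm (zk_kernel0 \<theta> n \<tau> (x - z) * f z)) \<partial>lborel)"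
          unfolding zk_op0_def by (rule norm_integral_le_nn_integral)
        also have "\<dots> \<le> (\<integral>\<^sup>+z. ennreal (C0 / \<bar>\<tau>\<bar>) * ennreal (norm (f z)) \<partial>lborel)"
        proof (intro nn_integral_mono)
          fix z
          have "norm (zk_kernel0 \<theta> n \<tau> (x - z) * f z) \<le> C0 / \<bar>\<tau>\<bar> * norm (f z)"
            unfolding norm_mult by (intro mult_right_mono disp \<tau>) simp
          then show "ennreal (norm (zk_kernel0 \<theta> n \<tau> (x - z) * f z)) \<le> ennreal (C0 / \<bar>\<tau>\<bar>) * ennreal (norm (f z))"
            using C0 by (subst ennreal_mult[symmetric]) (auto intro: ennreal_leI)
        qed
        finally show ?thesis using f by (simp add: nn_integral_cmult)
      qed
    qed (use C0 \<tau> zk_op0_L2_bound in \<open>auto intro: zk_op0_measurable\<close>)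
    also have "(2 * (C0 / \<bar>\<tau>\<bar>)) powr (q - 2) = (2 * C0) powr (q - 2) * \<bar>\<tau>\<bar> powr (- (q - 2))"
      using C0 \<tau> by (simp add: powr_divide powr_minus_divide[of _ "q - 2"] del: minus_diff_eq)
    finally show ?thesis by (simp add: C_def mult.assoc)
  qed
  moreover have "0 < C" using q C0 by (simp add: C_def)
  ultimately show ?thesis by blast
qed

lemma integral_cnj_mult_osc:
  fixes f h :: "'a::euclidean_space \<Rightarrow> complex"
  assumes f: "integrable lborel f" and h: "integrable lborel h"
  shows "(LINT v|lborel. cnj (f v) * osc h v) = (LINT \<zeta>|lborel. h \<zeta> * cnj (osc_adj f \<zeta>))"
proof -
  have [measurable]: "f \<in> borel_measurable borel" "h \<in> borel_measurable borel" using f h by auto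
  have int: "integrable (lborel \<Otimes>\<^sub>M lborel) (\<lambda>(v, \<zeta>). cnj (f v) * (cis (v \<bullet> \<zeta>) * h \<zeta>))"
  proof (rule Bochner_Integration.integrable_bound)
    show "integrable (lborel \<Otimes>\<^sub>M lborel) (\<lambda>(v, \<zeta>). f v * h \<zeta>)"
      using f h by (intro lborel_pair.Fubini_integrable) (auto simp: norm_mult)
  qed (auto simp: norm_mult)
  have "(LINT v|lborel. cnj (f v) * osc h v) = (LINT v|lborel. LINT \<zeta>|lborel. cnj (f v) * (cis (v \<bullet> \<zeta>) * h \<zeta>))"
    unfolding osc_def by simp
  also have "\<dots> = (LINT \<zeta>|lborel. LINT v|lborel. cnj (f v) * (cis (v \<bullet> \<zeta>) * h \<zeta>))"
    using lborel_pair.Fubini_integral[OF int] by simp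
  also have "\<dots> = (LINT \<zeta>|lborel. h \<zeta> * cnj (osc_adj f \<zeta>))"
  proof (intro Bochner_Integration.integral_cong refl)
    fix \<zeta>
    have "cnj (f v) * (cis (v \<bullet> \<zeta>) * h \<zeta>) = h \<zeta> * cnj (cis (- (v \<bullet> \<zeta>)) * f v)" for v
      by (simp add: cis_cnj)
    then show "(LINT v|lborel. cnj (f v) * (cis (v \<bullet> \<zeta>) * h \<zeta>)) = h \<zeta> * cnj (osc_adj f \<zeta>)"
      unfolding osc_adj_def by (simp only: integral_mult_right_zero Bochner_Integration.integral_cnj)
  qed
  finally show ?thesis .
qed

lemma ennreal_le_half_sum:
  assumes "x \<le> 1 / 2 * y + 1 / 2 * z" "0 \<le> y" "0 \<le> z"
  shows "ennreal x \<le> ennreal (1 / 2) * ennreal y + ennreal (1 / 2) * ennreal z"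
proof -
  have "ennreal x \<le> ennreal (1 / 2 * y + 1 / 2 * z)" by (rule ennreal_leI[OF assms(1)])
  also have "\<dots> = ennreal (1 / 2 * y) + ennreal (1 / 2 * z)" using assms by (intro ennreal_plus) auto
  finally show ?thesis using assms by (simp only: ennreal_mult zero_le_divide_1_iff zero_le_numeral)
qed

subsection \<open>The sharp Strichartz estimate in dimension three\<close>

text \<open>The adjoint of the flow as a map into functions on space-time; see
  \<open>zk_flow_pairing\<close>.\<close>

definition zk_adj :: "real \<Rightarrow> (real \<times> real \<times> real \<times> real \<Rightarrow> complex) \<Rightarrow> real \<times> real \<times> real \<Rightarrow> complex" where
  "zk_adj \<theta> F \<zeta> = (LINT s|lborel. cis (- (s * zk_phase \<theta> \<zeta>)) * osc_adj (\<lambda>w. F (s, w)) \<zeta>)"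

text \<open>Bounded with compact support, which makes the double integrals below absolutely
  convergent. \<open>B\<close> and \<open>R\<close> enter dominating functions; the constant of
  \<open>zk_dual_Strichartz\<close> is fixed before them.\<close>

locale test_function =
  fixes F :: "real \<times> real \<times> real \<times> real \<Rightarrow> complex" and B R :: real
  assumes F_measurable [measurable]: "F \<in> borel_measurable borel"
    and F_bound: "norm (F p) \<le> B"
    and F_supp: "F (s, w) \<noteq> 0 \<Longrightarrow> \<bar>s\<bar> \<le> R \<and> norm w \<le> R"
    and R_pos: "0 < R"
begin

lemma B_nonneg: "0 \<le> B" using F_bound[of undefined] norm_ge_zero order_trans by blast

definition V :: real where "V = measure lborel (cball (0 :: real \<times> real \<times> real) R)"

lemma V_nonneg: "0 \<le> V" by (simp add: V_def)

lemma nn_integral_slice_powr: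
  assumes "0 < p"
  shows "(\<integral>\<^sup>+w. ennreal (norm (F (s, w)) powr p) \<partial>lborel) \<le> ennreal (B powr p * V)"
proof -
  have "(\<integral>\<^sup>+w. ennreal (norm (F (s, w)) powr p) \<partial>lborel) \<le> (\<integral>\<^sup>+w. ennreal (B powr p) * indicator (cball (0 :: real \<times> real \<times> real) R) w \<partial>lborel)"
  proof (intro nn_integral_mono)
    fix w
    show "ennreal (norm (F (s, w)) powr p) \<le> ennreal (B powr p) * indicator (cball 0 R) w"
    proof (cases "F (s, w) = 0")
      case False
      then have "w \<in> cball 0 R" using F_supp by (auto simp: dist_norm)
      moreover have "norm (F (s, w)) powr p \<le> B powr p" using F_bound assms by (intro powr_mono2) auto
      ultimately show ?thesis by (simp add: ennreal_leI)
    qed (use assms in simp)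
  qed
  also have "\<dots> = ennreal (B powr p) * ennreal V"
  proof -
    have "emeasure lborel (cball (0 :: real \<times> real \<times> real) R) \<noteq> top"
      using emeasure_lborel_cball_finite[of "0 :: real \<times> real \<times> real" R] by auto
    from emeasure_eq_ennreal_measure[OF this] show ?thesis
      by (simp add: V_def nn_integral_cmult_indicator)
  qed
  also have "\<dots> = ennreal (B powr p * V)" using V_nonneg by (simp add: ennreal_mult)
  finally show ?thesis .
qed

lemma integrable_slice: "integrable lborel (\<lambda>w. F (s, w))"
proof (rule integrableI_bounded)
  show "(\<integral>\<^sup>+w. ennreal (norm (F (s, w))) \<partial>lborel) < \<infinity>"
    using nn_integral_slice_powr[of 1 s] by (simp add: order_le_less_trans[OF _ ennreal_less_top])
qed measurable

text \<open>The added 1 makes \<open>L\<close> positive, so that slices can be divided by it in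
  \<open>weighted_zk_adj_le\<close>.\<close>

definition L :: real where "L = B * V + 1"

lemma L_pos: "0 < L" using B_nonneg V_nonneg by (simp add: L_def add_nonneg_pos)

lemma norm_osc_adj_slice: "norm (osc_adj (\<lambda>w. F (s, w)) \<zeta>) \<le> L"
proof -
  have "ennreal (norm (osc_adj (\<lambda>w. F (s, w)) \<zeta>)) \<le> ennreal (B powr 1 * V)"
  proof (rule order_trans[OF norm_osc_adj_le])
    show "(\<integral>\<^sup>+w. ennreal (norm (F (s, w))) \<partial>lborel) \<le> ennreal (B powr 1 * V)"
      using nn_integral_slice_powr[of 1 s] by simp
  qed
  then have "norm (osc_adj (\<lambda>w. F (s, w)) \<zeta>) \<le> B * V"
    using B_nonneg V_nonneg by simp
  then show ?thesis by (simp add: L_def)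
qed

lemma osc_adj_slice_eq_0: "R < \<bar>s\<bar> \<Longrightarrow> osc_adj (\<lambda>w. F (s, w)) \<zeta> = 0"
proof -
  assume "R < \<bar>s\<bar>"
  then have "F (s, w) = 0" for w using F_supp[of s w] by force
  then show ?thesis by (simp add: osc_adj_def)
qed

lemma osc_adj_slice_measurable [measurable]:
  "(\<lambda>(\<zeta>, s). osc_adj (\<lambda>w. F (s, w)) \<zeta>) \<in> borel_measurable (borel \<Otimes>\<^sub>M borel)"
  unfolding osc_adj_def by measurable

lemma zk_adj_measurable [measurable]: "zk_adj \<theta> F \<in> borel_measurable borel"
  unfolding zk_adj_def by measurable

text \<open>The kernel in \<open>(s, t)\<close> of the regularised \<open>TT*\<close> form. On the
  space side, by \<open>band_form_eq\<close>, it pairs the slice of \<open>F\<close> at time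
  \<open>t\<close> with \<open>zk_op\<close> at time \<open>t - s\<close> applied to the slice at
  time \<open>s\<close>.\<close>

definition band_form :: "real \<Rightarrow> nat \<Rightarrow> nat \<Rightarrow> real \<Rightarrow> real \<Rightarrow> complex" where
  "band_form \<theta> n j s t = (LINT \<zeta>|lborel. (of_real (cutoff n (inverse (real (Suc j))) \<zeta>) * cis ((t - s) * zk_phase \<theta> \<zeta>) * osc_adj (\<lambda>w. F (s, w)) \<zeta>)
     * cnj (osc_adj (\<lambda>w. F (t, w)) \<zeta>))"

lemma band_form_measurable [measurable]: "(\<lambda>(s, t). band_form \<theta> n j s t) \<in> borel_measurable (borel \<Otimes>\<^sub>M borel)"
  unfolding band_form_def by measurable

lemma band_form_eq: "band_form \<theta> n j s t = (LINT v|lborel. cnj (F (t, v)) * zk_op \<theta> n (inverse (real (Suc j))) (t - s) (\<lambda>w. F (s, w)) v)"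
  unfolding band_form_def zk_op_eq_osc[OF inverse_Suc integrable_slice]
  by (rule integral_cnj_mult_osc[OF integrable_slice integrable_cutoff_osc_adj[OF inverse_Suc integrable_slice], symmetric])

lemma band_form_eq_0: "R < \<bar>s\<bar> \<or> R < \<bar>t\<bar> \<Longrightarrow> band_form \<theta> n j s t = 0"
  by (auto simp: band_form_def osc_adj_slice_eq_0)

definition W :: real where "W = (2 * pi) ^ 3 * (B powr 2 * V)"

text \<open>A bound uniform in \<open>j\<close>, \<open>s\<close> and \<open>t\<close>, which serves
  as the majorant when \<open>\<epsilon>\<close> tends to 0.\<close>

lemma norm_band_form_le: "ennreal (norm (band_form \<theta> n j s t)) \<le> ennreal W"
proof -
  have dim: "DIM(real \<times> real \<times> real) = 3" by simp
  let ?o = "\<lambda>s \<zeta>. norm (osc_adj (\<lambda>w. F (s, w)) \<zeta>)"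
  have sq: "(\<integral>\<^sup>+\<zeta>. ennreal ((?o s \<zeta>)\<^sup>2) \<partial>lborel) \<le> ennreal W" for s
  proof -
    have "(\<integral>\<^sup>+\<zeta>. ennreal ((?o s \<zeta>)\<^sup>2) \<partial>lborel) \<le> ennreal ((2 * pi) ^ 3) * (\<integral>\<^sup>+w. ennreal ((norm (F (s, w)))\<^sup>2) \<partial>lborel)"
      by (rule osc_adj_L2_bound[OF integrable_slice, unfolded dim])
    also have "\<dots> \<le> ennreal ((2 * pi) ^ 3) * ennreal (B powr 2 * V)"
      using nn_integral_slice_powr[of 2 s] by (intro mult_left_mono) simp_all
    also have "\<dots> = ennreal W" using V_nonneg by (simp add: W_def flip: ennreal_mult)
    finally show ?thesis .
  qed
  have "ennreal (norm (band_form \<theta> n j s t)) \<le> (\<integral>\<^sup>+\<zeta>. ennreal (1 / 2) * ennreal ((?o s \<zeta>)\<^sup>2) + ennreal (1 / 2) * ennreal ((?o t \<zeta>)\<^sup>2) \<partial>lborel)"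
    unfolding band_form_def
  proof (rule order_trans[OF norm_integral_le_nn_integral], intro nn_integral_mono)
    fix \<zeta>
    let ?c = "cutoff n (inverse (real (Suc j))) \<zeta>"
    have "?c * (?o s \<zeta> * ?o t \<zeta>) \<le> 1 * (?o s \<zeta> * ?o t \<zeta>)"
      by (intro mult_right_mono cutoff_le_1 less_imp_le[OF inverse_Suc]) auto
    also have "\<dots> \<le> 1 / 2 * (?o s \<zeta>)\<^sup>2 + 1 / 2 * (?o t \<zeta>)\<^sup>2"
      using sum_squares_bound[of "?o s \<zeta>" "?o t \<zeta>"] by simp
    finally have "?c * (?o s \<zeta> * ?o t \<zeta>) \<le> 1 / 2 * (?o s \<zeta>)\<^sup>2 + 1 / 2 * (?o t \<zeta>)\<^sup>2" .
    moreover have "norm (of_real ?c * cis ((t - s) * zk_phase \<theta> \<zeta>) * osc_adj (\<lambda>w. F (s, w)) \<zeta> * cnj (osc_adj (\<lambda>w. F (t, w)) \<zeta>)) = ?c * (?o s \<zeta> * ?o t \<zeta>)"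
      using cutoff_nonneg[of n "inverse (real (Suc j))" \<zeta>] by (simp add: norm_mult)
    ultimately show "ennreal (norm (of_real ?c * cis ((t - s) * zk_phase \<theta> \<zeta>) * osc_adj (\<lambda>w. F (s, w)) \<zeta> * cnj (osc_adj (\<lambda>w. F (t, w)) \<zeta>)))
      \<le> ennreal (1 / 2) * ennreal ((?o s \<zeta>)\<^sup>2) + ennreal (1 / 2) * ennreal ((?o t \<zeta>)\<^sup>2)"
      by (simp only:) (rule ennreal_le_half_sum, simp_all)
  qed
  also have "\<dots> = ennreal (1 / 2) * (\<integral>\<^sup>+\<zeta>. ennreal ((?o s \<zeta>)\<^sup>2) \<partial>lborel) + ennreal (1 / 2) * (\<integral>\<^sup>+\<zeta>. ennreal ((?o t \<zeta>)\<^sup>2) \<partial>lborel)"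
    by (simp add: nn_integral_add nn_integral_cmult)
  also have "\<dots> \<le> ennreal (1 / 2) * ennreal W + ennreal (1 / 2) * ennreal W"
    by (intro add_mono mult_left_mono sq) auto
  also have "\<dots> = ennreal W" unfolding distrib_right[symmetric] by (subst ennreal_plus[symmetric]) simp_all
  finally show ?thesis .
qed

text \<open>\<open>integral_weighted_norm_square\<close> with the frequency as outer and time as
  inner variable; the integrable weight is the cutoff.\<close>

lemma weighted_zk_adj_le:
  "(\<integral>\<^sup>+\<zeta>. ennreal (cutoff n (inverse (real (Suc j))) \<zeta> * (norm (zk_adj \<theta> F \<zeta>))\<^sup>2) \<partial>lborel)
    \<le> (\<integral>\<^sup>+p. ennreal (norm (band_form \<theta> n j (fst p) (snd p))) \<partial>(lborel \<Otimes>\<^sub>M lborel))"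
proof -
  let ?c = "cutoff n (inverse (real (Suc j)))"
  \<comment> \<open>That lemma asks for \<open>norm (e \<zeta> s) \<le> 1\<close> and an integrable
    \<open>g\<close>. Slices are therefore divided by \<open>L\<close>, and the factor returns in
    \<open>g\<close> on the time window.\<close>
  define e where "e \<zeta> s = cis (- (s * zk_phase \<theta> \<zeta>)) * osc_adj (\<lambda>w. F (s, w)) \<zeta> / of_real L" for \<zeta> s
  define g where "g s = complex_of_real (indicator {-R..R} s * L)" for s
  have me: "case_prod e \<in> borel_measurable (lborel \<Otimes>\<^sub>M lborel)" unfolding e_def by measurable
  have e1: "norm (e \<zeta> s) \<le> 1" for \<zeta> s
    using norm_osc_adj_slice[of s \<zeta>] L_pos by (simp add: e_def norm_mult norm_divide)
  have g: "integrable lborel g"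
    unfolding g_def complex_of_real_integrable_eq by (intro integrable_mult_left integrable_real_indicator) (auto simp: emeasure_lborel_Icc_eq)
  have eg: "e \<zeta> s * g s = cis (- (s * zk_phase \<theta> \<zeta>)) * osc_adj (\<lambda>w. F (s, w)) \<zeta>" for \<zeta> s
    using L_pos osc_adj_slice_eq_0[of s \<zeta>] by (cases "\<bar>s\<bar> \<le> R") (auto simp: e_def g_def indicator_def abs_le_iff)
  have adj: "(LINT s|lborel. e \<zeta> s * g s) = zk_adj \<theta> F \<zeta>" for \<zeta> unfolding eg zk_adj_def ..
  note I = integral_weighted_norm_square[OF sigma_finite_lborel sigma_finite_lborel me e1 integrable_cutoff[OF inverse_Suc] cutoff_nonneg g, unfolded adj]
  have k: "(LINT \<zeta>|lborel. of_real (?c \<zeta>) * (e \<zeta> s * cnj (e \<zeta> t))) * (g s * cnj (g t)) = band_form \<theta> n j s t" for s t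
  proof -
    have "(LINT \<zeta>|lborel. of_real (?c \<zeta>) * (e \<zeta> s * cnj (e \<zeta> t))) * (g s * cnj (g t))
      = (LINT \<zeta>|lborel. of_real (?c \<zeta>) * ((e \<zeta> s * g s) * cnj (e \<zeta> t * g t)))"
      unfolding integral_mult_left_zero[symmetric] by (intro Bochner_Integration.integral_cong refl) (simp add: mult_ac)
    also have "\<dots> = band_form \<theta> n j s t"
      unfolding eg band_form_def
    proof (intro Bochner_Integration.integral_cong refl)
      fix \<zeta>
      have "cis ((t - s) * zk_phase \<theta> \<zeta>) = cis (- (s * zk_phase \<theta> \<zeta>)) * cnj (cis (- (t * zk_phase \<theta> \<zeta>)))"
        by (simp add: cis_cnj cis_mult algebra_simps)
      then show "of_real (?c \<zeta>) * (cis (- (s * zk_phase \<theta> \<zeta>)) * osc_adj (\<lambda>w. F (s, w)) \<zeta> * cnj (cis (- (t * zk_phase \<theta> \<zeta>)) * osc_adj (\<lambda>w. F (t, w)) \<zeta>))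
        = of_real (?c \<zeta>) * cis ((t - s) * zk_phase \<theta> \<zeta>) * osc_adj (\<lambda>w. F (s, w)) \<zeta> * cnj (osc_adj (\<lambda>w. F (t, w)) \<zeta>)"
        by simp
    qed
    finally show ?thesis .
  qed
  have "(\<integral>\<^sup>+\<zeta>. ennreal (?c \<zeta> * (norm (zk_adj \<theta> F \<zeta>))\<^sup>2) \<partial>lborel) = ennreal (LINT \<zeta>|lborel. ?c \<zeta> * (norm (zk_adj \<theta> F \<zeta>))\<^sup>2)"
    by (intro nn_integral_eq_integral I(2) AE_I2 mult_nonneg_nonneg cutoff_nonneg) simp
  also have "\<dots> \<le> ennreal (norm (complex_of_real (LINT \<zeta>|lborel. ?c \<zeta> * (norm (zk_adj \<theta> F \<zeta>))\<^sup>2)))"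
    by (rule ennreal_leI) simp
  also have "complex_of_real (LINT \<zeta>|lborel. ?c \<zeta> * (norm (zk_adj \<theta> F \<zeta>))\<^sup>2) = (LINT p|(lborel \<Otimes>\<^sub>M lborel). band_form \<theta> n j (fst p) (snd p))"
    unfolding I(1) k ..
  also have "ennreal (norm \<dots>) \<le> (\<integral>\<^sup>+p. ennreal (norm (band_form \<theta> n j (fst p) (snd p))) \<partial>(lborel \<Otimes>\<^sub>M lborel))"
    by (rule norm_integral_le_nn_integral)
  finally show ?thesis .
qed

lemma band_form_limit:
  assumes "s \<noteq> t"
  shows "(\<lambda>j. band_form \<theta> n j s t) \<longlonglongrightarrow> (LINT v|lborel. cnj (F (t, v)) * zk_op0 \<theta> n (t - s) (\<lambda>w. F (s, w)) v)"
  unfolding band_form_eq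
proof -
  have \<tau>: "t - s \<noteq> 0" using assms by simp
  obtain K where K: "0 \<le> K" "\<And>j v. norm (zk_op \<theta> n (inverse (real (Suc j))) (t - s) (\<lambda>w. F (s, w)) v) \<le> K"
    using zk_op_bounded[OF \<tau> integrable_slice] by metis
  show "(\<lambda>j. LINT v|lborel. cnj (F (t, v)) * zk_op \<theta> n (inverse (real (Suc j))) (t - s) (\<lambda>w. F (s, w)) v)
    \<longlonglongrightarrow> (LINT v|lborel. cnj (F (t, v)) * zk_op0 \<theta> n (t - s) (\<lambda>w. F (s, w)) v)"
  proof (rule integral_dominated_convergence[where w = "\<lambda>v. norm (F (t, v)) * K"])
    show "integrable lborel (\<lambda>v. norm (F (t, v)) * K)" using integrable_slice by simp
    show "AE v in lborel. (\<lambda>j. cnj (F (t, v)) * zk_op \<theta> n (inverse (real (Suc j))) (t - s) (\<lambda>w. F (s, w)) v)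
      \<longlonglongrightarrow> cnj (F (t, v)) * zk_op0 \<theta> n (t - s) (\<lambda>w. F (s, w)) v"
      by (intro AE_I2 tendsto_mult tendsto_const zk_op_tendsto \<tau> integrable_slice)
    show "AE v in lborel. norm (cnj (F (t, v)) * zk_op \<theta> n (inverse (real (Suc j))) (t - s) (\<lambda>w. F (s, w)) v) \<le> norm (F (t, v)) * K" for j
      unfolding norm_mult complex_mod_cnj by (intro AE_I2 mult_left_mono K) simp
  qed measurable
qed

end

lemma AE_fst_neq_0: "AE \<zeta> in (lborel :: (real \<times> 'b::euclidean_space) measure). fst \<zeta> \<noteq> 0"
proof (rule AE_I)
  show "{\<zeta> \<in> space lborel. \<not> fst \<zeta> \<noteq> 0} \<subseteq> {0} \<times> (UNIV :: 'b set)" by auto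
  show "emeasure lborel ({0 :: real} \<times> (UNIV :: 'b set)) = 0"
    unfolding lborel_prod[symmetric] by (subst lborel.emeasure_pair_measure_Times) auto
  show "{0 :: real} \<times> (UNIV :: 'b set) \<in> sets lborel"
    by (simp add: borel_closed closed_Times)
qed

lemma indicator_band_tendsto: "\<xi> \<noteq> 0 \<Longrightarrow> (\<lambda>n. indicator (band n) \<xi> :: real) \<longlonglongrightarrow> 1"
proof (rule tendsto_eventually)
  assume "\<xi> \<noteq> 0"
  obtain N1 where N1: "\<bar>\<xi>\<bar> < 2 ^ N1" using real_arch_pow[of 2 "\<bar>\<xi>\<bar>"] by auto
  obtain N2 where N2: "1 / \<bar>\<xi>\<bar> < 2 ^ N2" using real_arch_pow[of 2 "1 / \<bar>\<xi>\<bar>"] by auto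
  show "\<forall>\<^sub>F n in sequentially. indicator (band n) \<xi> = (1 :: real)"
    using eventually_ge_at_top[of "max N1 N2"]
  proof eventually_elim
    case (elim n)
    have "(2 :: real) ^ N1 \<le> 2 ^ n" "(2 :: real) ^ N2 \<le> 2 ^ n" using elim by (auto intro!: power_increasing)
    then have 1: "\<bar>\<xi>\<bar> \<le> 2 ^ n" "1 / \<bar>\<xi>\<bar> \<le> 2 ^ n" using N1 N2 by linarith+
    then have "1 / 2 ^ n \<le> \<bar>\<xi>\<bar>" using \<open>\<xi> \<noteq> 0\<close> by (simp add: field_simps)
    then show ?case using 1 by (simp add: band_def)
  qed
qed

text \<open>The dispersive bound holds at \<open>\<epsilon> = 0\<close>, whereas the
  \<open>TT*\<close> identity was proved for \<open>\<epsilon> > 0\<close>. So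
  \<open>\<epsilon>\<close> tends to 0 at fixed \<open>n\<close> inside an inequality between two
  integrals, by Fatou on the frequency side and by reverse Fatou in \<open>(s, t)\<close>. The
  resulting bound is independent of \<open>n\<close>, and the band is exhausted last.\<close>

theorem zk_dual_Strichartz:
  assumes q: "2 < q" "q' = q / (q - 1)" and r: "2 < r" "r' = r / (r - 1)" and qr: "1 / q + 1 / r = 1 / 2"
  shows "\<exists>C>0. \<forall>\<theta> F B R. test_function F B R \<longrightarrow>
    (\<integral>\<^sup>+\<zeta>. ennreal ((norm (zk_adj \<theta> F \<zeta>))\<^sup>2) \<partial>lborel)
    \<le> ennreal C * ennreal_pow (\<integral>\<^sup>+s. ennreal_pow (\<integral>\<^sup>+w. ennreal (norm (F (s, w)) powr q') \<partial>lborel) (r' / q') \<partial>lborel) (2 / r')"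
proof -
  obtain C1 where C1: "0 < C1" and op: "\<And>\<theta> n \<tau> f. \<tau> \<noteq> 0 \<Longrightarrow> integrable lborel f \<Longrightarrow>
    (\<integral>\<^sup>+x. ennreal (norm (zk_op0 \<theta> n \<tau> f x) powr q) \<partial>lborel)
    \<le> ennreal (C1 * \<bar>\<tau>\<bar> powr (- (q - 2))) * ennreal_pow (\<integral>\<^sup>+z. ennreal (norm (f z) powr q') \<partial>lborel) (q - 1)"
    using zk_op0_Lp_bound[OF q] by blast
  define C2 where "C2 = C1 powr (1 / q)"
  define C where "C = C2 * (8 * r / (r - 2) + 8)"
  have C2: "0 < C2" using C1 by (simp add: C2_def)
  have Cpos: "0 < C" unfolding C_def using C2 r by (intro mult_pos_pos add_nonneg_pos) auto
  have q': "1 < q'" "1 / q' + 1 / q = 1" "(q - 1) * (1 / q) = 1 / q'"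
    unfolding q(2) using q(1) by (simp add: less_divide_eq, simp add: field_simps, simp add: field_simps)
  have r': "1 < r'" unfolding r(2) using r(1) by (simp add: less_divide_eq)
  \<comment> \<open>On the line, the \<open>q\<close>-th root of the decay
    \<open>\<bar>\<tau>\<bar> powr (- (q - 2))\<close> is exactly the Hardy-Littlewood-Sobolev
    kernel.\<close>
  have ex: "- (q - 2) * (1 / q) = - 2 / r" using qr q r by (simp add: field_simps)
  have "(\<integral>\<^sup>+\<zeta>. ennreal ((norm (zk_adj \<theta> F \<zeta>))\<^sup>2) \<partial>lborel)
    \<le> ennreal C * ennreal_pow (\<integral>\<^sup>+s. ennreal_pow (\<integral>\<^sup>+w. ennreal (norm (F (s, w)) powr q') \<partial>lborel) (r' / q') \<partial>lborel) (2 / r')"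
    (is "_ \<le> ?RHS") if "test_function F B R" for \<theta> F B R
  proof -
    interpret test_function F B R by fact
    define a where "a s = (\<integral>\<^sup>+w. ennreal (norm (F (s, w)) powr q') \<partial>lborel)" for s
    have [measurable]: "a \<in> borel_measurable borel" unfolding a_def by measurable
    have afin: "a s < top" for s
      using nn_integral_slice_powr[of q' s] q' unfolding a_def by (auto intro: order_le_less_trans[OF _ ennreal_less_top])
    \<comment> \<open>The \<open>L^q'\<close> norm of the slice at time \<open>s\<close>, finite by
      \<open>afin\<close>.\<close>
    define f where "f s = enn2real (a s) powr (1 / q')" for s
    have [measurable]: "f \<in> borel_measurable borel" unfolding f_def by measurable
    have f0: "0 \<le> f s" for s by (simp add: f_def)
    have fa: "ennreal (f s) = ennreal_pow (a s) (1 / q')" for s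
      using afin[of s] by (simp add: f_def ennreal_pow_def less_top)
    have pair: "ennreal (norm (LINT v|lborel. cnj (F (t, v)) * zk_op0 \<theta> n (t - s) (\<lambda>w. F (s, w)) v))
        \<le> ennreal (C2 * (f s * f t * \<bar>t - s\<bar> powr (- 2 / r)))" if st: "s \<noteq> t" for s t n
    proof -
      let ?T = "\<lambda>v. zk_op0 \<theta> n (t - s) (\<lambda>w. F (s, w)) v"
      have \<tau>: "t - s \<noteq> 0" using st by simp
      have "ennreal (norm (LINT v|lborel. cnj (F (t, v)) * ?T v)) \<le> (\<integral>\<^sup>+v. ennreal (norm (F (t, v))) * ennreal (norm (?T v)) \<partial>lborel)"
        using norm_integral_le_nn_integral[of lborel "\<lambda>v. cnj (F (t, v)) * ?T v"] by (simp add: norm_mult ennreal_mult)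
      also have "\<dots> \<le> ennreal_pow (\<integral>\<^sup>+v. ennreal_pow (ennreal (norm (F (t, v)))) q' \<partial>lborel) (1 / q')
         * ennreal_pow (\<integral>\<^sup>+v. ennreal_pow (ennreal (norm (?T v))) q \<partial>lborel) (1 / q)"
        using q' by (intro nn_integral_Holder) measurable
      also have "ennreal_pow (\<integral>\<^sup>+v. ennreal_pow (ennreal (norm (F (t, v)))) q' \<partial>lborel) (1 / q') = ennreal (f t)"
        unfolding fa a_def by (simp add: ennreal_pow_ennreal)
      also have "ennreal_pow (\<integral>\<^sup>+v. ennreal_pow (ennreal (norm (?T v))) q \<partial>lborel) (1 / q)
        \<le> ennreal_pow (ennreal (C1 * \<bar>t - s\<bar> powr (- (q - 2))) * ennreal_pow (a s) (q - 1)) (1 / q)"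
        using op[OF \<tau> integrable_slice, of \<theta> n s] q by (intro ennreal_pow_mono) (simp_all add: ennreal_pow_ennreal a_def)
      also have "\<dots> = ennreal (C2 * \<bar>t - s\<bar> powr (- 2 / r)) * ennreal (f s)"
      proof -
        have "(\<bar>t - s\<bar> powr (- (q - 2))) powr (1 / q) = \<bar>t - s\<bar> powr (- 2 / r)"
          unfolding powr_powr ex ..
        then have "(C1 * \<bar>t - s\<bar> powr (- (q - 2))) powr (1 / q) = C2 * \<bar>t - s\<bar> powr (- 2 / r)"
          using C1 by (simp add: C2_def powr_mult)
        moreover have "0 \<le> C1 * \<bar>t - s\<bar> powr (- (q - 2))" using C1 by simp
        ultimately have 1: "ennreal_pow (ennreal (C1 * \<bar>t - s\<bar> powr (- (q - 2)))) (1 / q) = ennreal (C2 * \<bar>t - s\<bar> powr (- 2 / r))"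
          by (simp only: ennreal_pow_ennreal)
        have "0 < q - 1" "0 < 1 / q" using q(1) by auto
        then have 2: "ennreal_pow (ennreal_pow (a s) (q - 1)) (1 / q) = ennreal (f s)"
          by (simp only: ennreal_pow_pow q'(3) fa)
        show ?thesis unfolding ennreal_pow_mult[OF \<open>0 < 1 / q\<close>] 1 2 ..
      qed
      finally have "ennreal (norm (LINT v|lborel. cnj (F (t, v)) * ?T v)) \<le> ennreal (f t) * (ennreal (C2 * \<bar>t - s\<bar> powr (- 2 / r)) * ennreal (f s))"
        by (simp add: mult_left_mono)
      also have "\<dots> = ennreal (C2 * (f s * f t * \<bar>t - s\<bar> powr (- 2 / r)))"
        using f0 C2 by (simp add: mult_ac flip: ennreal_mult)
      finally show ?thesis .
    qed
    have band_le: "(\<integral>\<^sup>+\<zeta>. ennreal (indicator (band n) (fst \<zeta>) * (norm (zk_adj \<theta> F \<zeta>))\<^sup>2) \<partial>lborel) \<le> ?RHS" for n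
    proof -
      let ?c = "\<lambda>j. cutoff n (inverse (real (Suc j)))"
      let ?b = "\<lambda>j (p :: real \<times> real). ennreal (norm (band_form \<theta> n j (fst p) (snd p)))"
      have lim: "(\<lambda>j. ennreal (?c j \<zeta> * (norm (zk_adj \<theta> F \<zeta>))\<^sup>2)) \<longlonglongrightarrow> ennreal (indicator (band n) (fst \<zeta>) * (norm (zk_adj \<theta> F \<zeta>))\<^sup>2)" for \<zeta>
      proof (intro tendsto_ennrealI tendsto_mult tendsto_const)
        obtain \<xi> \<eta> \<kappa> where \<zeta>: "\<zeta> = (\<xi>, \<eta>, \<kappa>)" by (cases \<zeta>) auto
        have i: "(\<lambda>j. inverse (real (Suc j))) \<longlonglongrightarrow> 0" by (rule LIMSEQ_inverse_real_of_nat)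
        have e: "(\<lambda>j. exp (- inverse (real (Suc j)) * x)) \<longlonglongrightarrow> 1" for x :: real
          using tendsto_exp[OF tendsto_mult[OF tendsto_minus[OF i] tendsto_const[of x]]] by simp
        have "(\<lambda>j. indicator (band n) \<xi> * (exp (- inverse (real (Suc j)) * \<eta>\<^sup>2) * exp (- inverse (real (Suc j)) * \<kappa>\<^sup>2))) \<longlonglongrightarrow> indicator (band n) \<xi> * (1 * 1)"
          by (intro tendsto_mult tendsto_const e)
        then show "(\<lambda>j. ?c j \<zeta>) \<longlonglongrightarrow> indicator (band n) (fst \<zeta>)" by (simp add: \<zeta> cutoff_def)
      qed
      have "(\<integral>\<^sup>+\<zeta>. ennreal (indicator (band n) (fst \<zeta>) * (norm (zk_adj \<theta> F \<zeta>))\<^sup>2) \<partial>lborel)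
        = (\<integral>\<^sup>+\<zeta>. liminf (\<lambda>j. ennreal (?c j \<zeta> * (norm (zk_adj \<theta> F \<zeta>))\<^sup>2)) \<partial>lborel)"
        by (intro nn_integral_cong lim_imp_Liminf[symmetric] lim) simp
      also have "\<dots> \<le> liminf (\<lambda>j. \<integral>\<^sup>+\<zeta>. ennreal (?c j \<zeta> * (norm (zk_adj \<theta> F \<zeta>))\<^sup>2) \<partial>lborel)"
        by (rule nn_integral_liminf) measurable
      \<comment> \<open>The upper limit is what reverse Fatou controls on the side of
        \<open>(s, t)\<close>; its majorant is \<open>W\<close> on the square of side
        \<open>2 * R\<close>.\<close>
      also have "\<dots> \<le> limsup (\<lambda>j. \<integral>\<^sup>+\<zeta>. ennreal (?c j \<zeta> * (norm (zk_adj \<theta> F \<zeta>))\<^sup>2) \<partial>lborel)"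
        by (rule Liminf_le_Limsup) simp
      also have "\<dots> \<le> limsup (\<lambda>j. \<integral>\<^sup>+p. ?b j p \<partial>(lborel \<Otimes>\<^sub>M lborel))"
        by (intro Limsup_mono always_eventually allI weighted_zk_adj_le)
      also have "\<dots> \<le> (\<integral>\<^sup>+p. limsup (\<lambda>j. ?b j p) \<partial>(lborel \<Otimes>\<^sub>M lborel))"
      proof (rule nn_integral_limsup)
        let ?box = "{-R..R} \<times> {-R..R}"
        show "(\<lambda>p. ennreal W * indicator ?box p) \<in> borel_measurable (lborel \<Otimes>\<^sub>M lborel)" by measurable
        show "AE p in lborel \<Otimes>\<^sub>M lborel. ?b j p \<le> ennreal W * indicator ?box p" for j
        proof (intro AE_I2)
          fix p
          show "?b j p \<le> ennreal W * indicator ?box p"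
          proof (cases "p \<in> ?box")
            case False
            then have "R < \<bar>fst p\<bar> \<or> R < \<bar>snd p\<bar>" by (cases p) (auto simp: abs_le_iff not_le)
            then show ?thesis by (simp add: band_form_eq_0)
          qed (use norm_band_form_le in simp)
        qed
        have "(\<integral>\<^sup>+p. ennreal W * indicator ?box p \<partial>(lborel \<Otimes>\<^sub>M lborel)) = ennreal W * (emeasure lborel {-R..R} * emeasure lborel {-R..R})"
          by (subst nn_integral_cmult_indicator) (simp_all add: lborel.emeasure_pair_measure_Times)
        also have "\<dots> < \<infinity>" using R_pos by (simp add: ennreal_mult_less_top flip: ennreal_mult)
        finally show "(\<integral>\<^sup>+p. ennreal W * indicator ?box p \<partial>(lborel \<Otimes>\<^sub>M lborel)) < \<infinity>" .
      qed measurable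
      also have "\<dots> = (\<integral>\<^sup>+s. \<integral>\<^sup>+t. limsup (\<lambda>j. ?b j (s, t)) \<partial>lborel \<partial>lborel)"
      proof -
        have "?b j \<in> borel_measurable (lborel \<Otimes>\<^sub>M lborel)" for j by measurable
        then have "(\<lambda>p. limsup (\<lambda>j. ?b j p)) \<in> borel_measurable (lborel \<Otimes>\<^sub>M lborel)"
          by (rule borel_measurable_limsup)
        from lborel.nn_integral_fst[OF this] show ?thesis by (simp only: fst_conv snd_conv)
      qed
      also have "\<dots> \<le> (\<integral>\<^sup>+s. \<integral>\<^sup>+t. ennreal C2 * ennreal (f s * f t * \<bar>t - s\<bar> powr (- 2 / r)) \<partial>lborel \<partial>lborel)"
      proof (rule nn_integral_mono, rule nn_integral_mono_AE)
        fix s :: real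
        \<comment> \<open>The diagonal, where the kernel bound fails, is a null set for each
          \<open>s\<close>.\<close>
        show "AE t in lborel. limsup (\<lambda>j. ?b j (s, t)) \<le> ennreal C2 * ennreal (f s * f t * \<bar>t - s\<bar> powr (- 2 / r))"
          using AE_lborel_singleton[of s]
        proof eventually_elim
          case (elim t)
          have "(\<lambda>j. ?b j (s, t)) \<longlonglongrightarrow> ennreal (norm (LINT v|lborel. cnj (F (t, v)) * zk_op0 \<theta> n (t - s) (\<lambda>w. F (s, w)) v))"
            using elim by (auto intro!: tendsto_ennrealI tendsto_norm band_form_limit)
          then have "limsup (\<lambda>j. ?b j (s, t)) = ennreal (norm (LINT v|lborel. cnj (F (t, v)) * zk_op0 \<theta> n (t - s) (\<lambda>w. F (s, w)) v))"
            by (rule lim_imp_Limsup[OF sequentially_bot])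
          also have "\<dots> \<le> ennreal (C2 * (f s * f t * \<bar>t - s\<bar> powr (- 2 / r)))" using elim by (intro pair) auto
          finally show ?case using C2 f0 by (simp add: ennreal_mult)
        qed
      qed
      also have "\<dots> = ennreal C2 * (\<integral>\<^sup>+s. \<integral>\<^sup>+t. ennreal (f s * f t * \<bar>t - s\<bar> powr (- 2 / r)) \<partial>lborel \<partial>lborel)"
        by (simp add: nn_integral_cmult)
      also have "\<dots> \<le> ennreal C2 * (ennreal (8 * r / (r - 2) + 8) * ennreal_pow (\<integral>\<^sup>+s. ennreal (f s powr r') \<partial>lborel) (2 / r'))"
        by (intro mult_left_mono Hardy_Littlewood_Sobolev_diag f0 r) auto
      also have "\<dots> = ennreal C * ennreal_pow (\<integral>\<^sup>+s. ennreal (f s powr r') \<partial>lborel) (2 / r')"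
        unfolding mult.assoc[symmetric] C_def using C2 r by (subst ennreal_mult) simp_all
      also have "(\<integral>\<^sup>+s. ennreal (f s powr r') \<partial>lborel) = (\<integral>\<^sup>+s. ennreal_pow (a s) (r' / q') \<partial>lborel)"
      proof (intro nn_integral_cong)
        fix s
        have "ennreal (f s powr r') = ennreal_pow (ennreal (f s)) r'" using f0 by (simp add: ennreal_pow_ennreal)
        then show "ennreal (f s powr r') = ennreal_pow (a s) (r' / q')" unfolding fa using q' r' by (simp add: ennreal_pow_pow)
      qed
      finally show ?thesis unfolding a_def .
    qed
    have [measurable]: "(\<lambda>\<zeta> :: real \<times> real \<times> real. fst \<zeta>) \<in> borel_measurable borel"
      by (intro borel_measurable_continuous_onI continuous_intros)
    show ?thesis
    proof (rule nn_integral_le_of_tendsto[OF _ band_le])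
      show "(\<lambda>\<zeta>. ennreal (indicator (band n) (fst \<zeta>) * (norm (zk_adj \<theta> F \<zeta>))\<^sup>2)) \<in> borel_measurable lborel" for n
        by measurable
      show "AE \<zeta> in lborel. (\<lambda>n. ennreal (indicator (band n) (fst \<zeta>) * (norm (zk_adj \<theta> F \<zeta>))\<^sup>2)) \<longlonglongrightarrow> ennreal ((norm (zk_adj \<theta> F \<zeta>))\<^sup>2)"
        using AE_fst_neq_0
      proof eventually_elim
        case (elim \<zeta>)
        show ?case using tendsto_ennrealI[OF tendsto_mult[OF indicator_band_tendsto[OF elim] tendsto_const]] by simp
      qed
    qed
  qed
  with Cpos show ?thesis by (intro exI[of _ C] conjI allI impI)
qed

section \<open>From the dual estimate to the estimate for the flow\<close>

definition zk_flow :: "real \<Rightarrow> (real \<times> real \<times> real \<Rightarrow> complex) \<Rightarrow> real \<Rightarrow> real \<times> real \<times> real \<Rightarrow> complex" where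
  "zk_flow \<theta> g t = osc (\<lambda>\<zeta>. cis (t * zk_phase \<theta> \<zeta>) * g \<zeta>)"

lemma zk_flow_measurable [measurable]:
  assumes [measurable]: "g \<in> borel_measurable borel"
  shows "(\<lambda>(t, x). zk_flow \<theta> g t x) \<in> borel_measurable (borel \<Otimes>\<^sub>M borel)"
  unfolding zk_flow_def osc_def by measurable

lemma integrable_cis_mult:
  assumes [measurable]: "f \<in> borel_measurable M" and g: "integrable M g"
  shows "integrable M (\<lambda>x. cis (f x) * g x)"
  by (rule Bochner_Integration.integrable_bound[OF g]) (use g in \<open>auto simp: norm_mult\<close>)

text \<open>Fubini's theorem applies because \<open>F\<close> lives on a bounded time window, on
  which the transforms of its slices are bounded by \<open>L\<close>.\<close>

lemma zk_flow_pairing: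
  assumes F: "test_function F B R" and g: "integrable lborel g"
  shows "(LINT t|lborel. LINT x|lborel. cnj (F (t, x)) * zk_flow \<theta> g t x) = (LINT \<zeta>|lborel. g \<zeta> * cnj (zk_adj \<theta> F \<zeta>))"
proof -
  interpret test_function F B R by fact
  have [measurable]: "g \<in> borel_measurable borel" using g by auto
  let ?k = "\<lambda>t \<zeta>. (cis (t * zk_phase \<theta> \<zeta>) * g \<zeta>) * cnj (osc_adj (\<lambda>w. F (t, w)) \<zeta>)"
  have [measurable]: "(\<lambda>(t, \<zeta>). osc_adj (\<lambda>w. F (t, w)) \<zeta>) \<in> borel_measurable (borel \<Otimes>\<^sub>M borel)"
    unfolding osc_adj_def by measurable
  have int: "integrable (lborel \<Otimes>\<^sub>M lborel) (\<lambda>(t, \<zeta>). ?k t \<zeta>)"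
  proof (rule Bochner_Integration.integrable_bound)
    have 1: "integrable lborel (\<lambda>t. indicator {-R..R} t * L)"
      by (intro integrable_mult_left integrable_real_indicator) (auto simp: emeasure_lborel_Icc_eq)
    have "integrable lborel (\<lambda>t. \<bar>indicator {-R..R} t * L\<bar> * (LINT \<zeta>|lborel. norm (g \<zeta>)))"
      using integrable_mult_left[OF integrable_abs[OF 1]] by simp
    then show "integrable (lborel \<Otimes>\<^sub>M lborel) (\<lambda>(t, \<zeta>). (indicator {-R..R} t * L) * norm (g \<zeta>))"
      using g by (intro lborel_pair.Fubini_integrable) (auto simp: abs_mult)
    show "AE p in lborel \<Otimes>\<^sub>M lborel. norm (case p of (t, \<zeta>) \<Rightarrow> ?k t \<zeta>) \<le> norm (case p of (t, \<zeta>) \<Rightarrow> indicator {-R..R} t * L * norm (g \<zeta>))"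
    proof (intro AE_I2)
      fix p :: "real \<times> real \<times> real \<times> real"
      obtain t \<zeta> where p: "p = (t, \<zeta>)" by (cases p) auto
      show "norm (case p of (t, \<zeta>) \<Rightarrow> ?k t \<zeta>) \<le> norm (case p of (t, \<zeta>) \<Rightarrow> indicator {-R..R} t * L * norm (g \<zeta>))"
      proof (cases "\<bar>t\<bar> \<le> R")
        case True
        then have "t \<in> {-R..R}" by auto
        then show ?thesis using mult_left_mono[OF norm_osc_adj_slice[of t \<zeta>], of "norm (g \<zeta>)"] L_pos
          by (simp add: p norm_mult abs_mult mult_ac)
      next
        case False
        then have "osc_adj (\<lambda>w. F (t, w)) \<zeta> = 0" by (intro osc_adj_slice_eq_0) simp
        then show ?thesis by (simp add: p)
      qed
    qed
  qed measurable
  have "(LINT t|lborel. LINT x|lborel. cnj (F (t, x)) * zk_flow \<theta> g t x) = (LINT t|lborel. LINT \<zeta>|lborel. ?k t \<zeta>)"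
    unfolding zk_flow_def
    by (intro Bochner_Integration.integral_cong refl integral_cnj_mult_osc integrable_slice integrable_cis_mult g) measurable
  also have "\<dots> = (LINT \<zeta>|lborel. LINT t|lborel. ?k t \<zeta>)"
    using lborel_pair.Fubini_integral[OF int] by simp
  also have "\<dots> = (LINT \<zeta>|lborel. g \<zeta> * cnj (zk_adj \<theta> F \<zeta>))"
  proof (intro Bochner_Integration.integral_cong refl)
    fix \<zeta>
    have "?k t \<zeta> = g \<zeta> * cnj (cis (- (t * zk_phase \<theta> \<zeta>)) * osc_adj (\<lambda>w. F (t, w)) \<zeta>)" for t
      by (simp add: cis_cnj)
    then show "(LINT t|lborel. ?k t \<zeta>) = g \<zeta> * cnj (zk_adj \<theta> F \<zeta>)"
      unfolding zk_adj_def by (simp only: integral_mult_right_zero Bochner_Integration.integral_cnj)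
  qed
  finally show ?thesis .
qed

text \<open>Duality with an extremal test function: \<open>F\<close> is
  \<open>|u| powr (q - 2) * u\<close> times a function of time for which the pairing with
  \<open>u\<close> and the \<open>r'\<close>-th power of the dual norm of \<open>F\<close> are the
  same number \<open>\<nu>\<close>. The dual estimate becomes an inequality between powers of
  \<open>\<nu>\<close> that can be solved for \<open>\<nu>\<close>; truncations keep
  \<open>\<nu>\<close> finite.\<close>

theorem zk_Strichartz_sharp:
  assumes q: "2 < q" and r: "2 < r" and qr: "1 / q + 1 / r = 1 / 2"
  shows "\<exists>C>0. \<forall>\<theta> g. integrable lborel g \<longrightarrow>
    (\<integral>\<^sup>+t. ennreal_pow (\<integral>\<^sup>+x. ennreal (norm (zk_flow \<theta> g t x) powr q) \<partial>lborel) (r / q) \<partial>lborel)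
    \<le> ennreal C * ennreal_pow (\<integral>\<^sup>+\<zeta>. ennreal ((norm (g \<zeta>))\<^sup>2) \<partial>lborel) (r / 2)"
proof -
  define q' where "q' = q / (q - 1)"
  define r' where "r' = r / (r - 1)"
  obtain C where C: "0 < C" and dual: "\<And>\<theta> F B R. test_function F B R \<Longrightarrow>
    (\<integral>\<^sup>+\<zeta>. ennreal ((norm (zk_adj \<theta> F \<zeta>))\<^sup>2) \<partial>lborel)
    \<le> ennreal C * ennreal_pow (\<integral>\<^sup>+s. ennreal_pow (\<integral>\<^sup>+w. ennreal (norm (F (s, w)) powr q') \<partial>lborel) (r' / q') \<partial>lborel) (2 / r')"
    using zk_dual_Strichartz[OF q q'_def r r'_def qr] by blast
  have q': "1 < q'" "(q - 1) * q' = q" unfolding q'_def using q by (simp add: less_divide_eq, simp)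
  have r': "1 < r'" "2 - 2 / r' = 2 / r" unfolding r'_def using r by (simp add: less_divide_eq, simp add: field_simps)
  \<comment> \<open>The exponent identity behind \<open>FN\<close>: the \<open>L^q'\<close> norm of
    a slice of \<open>F\<close>, raised to the power \<open>r'\<close>, is again
    \<open>A powr (r / q)\<close>.\<close>
  have ex: "((r / q - 1) * q' + 1) * (r' / q') = r / q"
  proof -
    have 1: "1 / q' = 1 - 1 / q" unfolding q'_def using q by (simp add: field_simps)
    have "(x * y + 1) * (z / y) = (x + 1 / y) * z" if "y \<noteq> 0" for x y z :: real
      using that by (simp add: field_simps)
    from this[of q' "r / q - 1" r'] q' have "((r / q - 1) * q' + 1) * (r' / q') = ((r / q - 1) + (1 - 1 / q)) * r'"
      unfolding 1 by simp
    also have "\<dots> = r / q" unfolding r'_def using q r by (simp add: field_simps)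
    finally show ?thesis .
  qed
  have "(\<integral>\<^sup>+t. ennreal_pow (\<integral>\<^sup>+x. ennreal (norm (zk_flow \<theta> g t x) powr q) \<partial>lborel) (r / q) \<partial>lborel)
    \<le> ennreal (C powr (r / 2)) * ennreal_pow (\<integral>\<^sup>+\<zeta>. ennreal ((norm (g \<zeta>))\<^sup>2) \<partial>lborel) (r / 2)"
    if g: "integrable lborel g" for \<theta> g
  proof (cases "(\<integral>\<^sup>+\<zeta>. ennreal ((norm (g \<zeta>))\<^sup>2) \<partial>lborel) = top")
    case True
    then show ?thesis using C by (simp add: ennreal_mult_top)
  next
    case False
    then obtain \<gamma> where \<gamma>: "(\<integral>\<^sup>+\<zeta>. ennreal ((norm (g \<zeta>))\<^sup>2) \<partial>lborel) = ennreal \<gamma>" "0 \<le> \<gamma>"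
      by (metis ennreal_cases infinity_ennreal_def)
    have [measurable]: "g \<in> borel_measurable borel" using g by auto
    define u where "u t x = zk_flow \<theta> g t x" for t x
    have [measurable]: "(\<lambda>(t, x). u t x) \<in> borel_measurable (borel \<Otimes>\<^sub>M borel)" unfolding u_def by measurable
    define M where "M = (LINT \<zeta>|lborel. norm (g \<zeta>)) + 1"
    have M: "0 < M" unfolding M_def by (intro add_nonneg_pos integral_nonneg_AE) auto
    have uM: "norm (u t x) \<le> M" for t x
    proof -
      have "norm (u t x) \<le> (LINT \<zeta>|lborel. norm (cis (x \<bullet> \<zeta>) * (cis (t * zk_phase \<theta> \<zeta>) * g \<zeta>)))"
        unfolding u_def zk_flow_def osc_def by (rule integral_norm_bound)
      then show ?thesis by (simp add: M_def norm_mult)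
    qed
    define N where "N n = real (Suc n)" for n
    have N: "0 < N n" for n by (simp add: N_def)
    define bl where "bl n = cball (0 :: real \<times> real \<times> real) (N n)" for n
    have [measurable]: "bl n \<in> sets borel" for n by (simp add: bl_def)
    define v where "v n = measure lborel (bl n)" for n
    have v: "emeasure lborel (bl n) = ennreal (v n)" "0 \<le> v n" for n
      unfolding v_def bl_def using emeasure_lborel_cball_finite[of "0 :: real \<times> real \<times> real" "N n"]
      by (auto intro!: emeasure_eq_ennreal_measure)
    define a where "a n t = (\<integral>\<^sup>+x. ennreal (norm (u t x) powr q) * indicator (bl n) x \<partial>lborel)" for n t
    have [measurable]: "a n \<in> borel_measurable borel" for n unfolding a_def by measurable
    have a_le: "a n t \<le> ennreal (M powr q * v n)" for n t
    proof -
      have "a n t \<le> (\<integral>\<^sup>+x. ennreal (M powr q) * indicator (bl n) x \<partial>lborel)"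
        unfolding a_def using uM q by (intro nn_integral_mono mult_right_mono ennreal_leI powr_mono2) auto
      also have "\<dots> = ennreal (M powr q * v n)"
        using v by (simp add: nn_integral_cmult_indicator ennreal_mult)
      finally show ?thesis .
    qed
    define A where "A n t = enn2real (a n t)" for n t
    have [measurable]: "A n \<in> borel_measurable borel" for n unfolding A_def by measurable
    have aA: "a n t = ennreal (A n t)" for n t
      using order_le_less_trans[OF a_le ennreal_less_top, of n t] by (simp add: A_def)
    have A0: "0 \<le> A n t" for n t by (simp add: A_def)
    have A_le: "A n t \<le> M powr q * v n" for n t
      using a_le[of n t] v M by (simp add: aA)
    \<comment> \<open>The lower bound on \<open>A\<close> matters for \<open>r < q\<close>: then
      \<open>A powr (r / q - 1)\<close> has a negative exponent and has to stay bounded for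
      \<open>F\<close> to be a test function.\<close>
    define E where "E n = {t. \<bar>t\<bar> \<le> N n \<and> 1 / N n \<le> A n t}" for n
    have [measurable]: "E n \<in> sets borel" for n unfolding E_def by measurable
    define c where "c n t = indicator (E n) t * A n t powr (r / q - 1)" for n t
    have [measurable]: "c n \<in> borel_measurable borel" for n unfolding c_def by measurable
    have c0: "0 \<le> c n t" for n t by (simp add: c_def)
    define F where "F n p = of_real (c n (fst p) * indicator (bl n) (snd p) * norm (u (fst p) (snd p)) powr (q - 2)) * u (fst p) (snd p)" for n p
    have nF: "norm (F n (t, x)) = c n t * (indicator (bl n) x * norm (u t x) powr (q - 1))" for n t x
    proof (cases "u t x = 0")
      case False
      then have "norm (u t x) powr (q - 2) * norm (u t x) = norm (u t x) powr (q - 1)"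
        using powr_add[of "norm (u t x)" "q - 2" 1] by simp
      then show ?thesis using c0[of n t] by (simp add: F_def norm_mult mult.assoc)
    qed (use q in \<open>simp add: F_def\<close>)
    have test: "test_function (F n) (((1 / N n) powr (r / q - 1) + (M powr q * v n) powr (r / q - 1)) * M powr (q - 1)) (N n)" for n
    proof
      have [measurable]: "(\<lambda>p. u (fst p) (snd p)) \<in> borel_measurable (borel \<Otimes>\<^sub>M borel)" by measurable
      have "F n \<in> borel_measurable (borel \<Otimes>\<^sub>M borel)" unfolding F_def by measurable
      then show "F n \<in> borel_measurable borel" by (simp add: borel_prod)
      fix p :: "real \<times> real \<times> real \<times> real"
      obtain t x where p: "p = (t, x)" by (cases p) auto
      have "c n t \<le> (1 / N n) powr (r / q - 1) + (M powr q * v n) powr (r / q - 1)"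
      proof (cases "t \<in> E n")
        case True
        then have lo: "1 / N n \<le> A n t" by (simp add: E_def)
        have "0 < 1 / N n" using N by simp
        then have pos: "0 < A n t" using lo by linarith
        show ?thesis
        proof (cases "0 \<le> r / q - 1")
          case True
          then have "A n t powr (r / q - 1) \<le> (M powr q * v n) powr (r / q - 1)"
            using A_le A0 by (intro powr_mono2) auto
          then show ?thesis by (simp add: c_def indicator_def add_increasing)
        next
          case False
          then have "A n t powr (r / q - 1) \<le> (1 / N n) powr (r / q - 1)"
            using lo N by (intro powr_mono2') auto
          then show ?thesis by (simp add: c_def indicator_def add_increasing2)
        qed
      qed (simp add: c_def)
      moreover have "indicator (bl n) x * norm (u t x) powr (q - 1) \<le> M powr (q - 1)"
        using uM[of t x] q by (auto simp: indicator_def intro!: powr_mono2)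
      ultimately show "norm (F n p) \<le> ((1 / N n) powr (r / q - 1) + (M powr q * v n) powr (r / q - 1)) * M powr (q - 1)"
        unfolding p nF using c0 by (intro mult_mono) auto
    next
      fix s x assume "F n (s, x) \<noteq> 0"
      then have "norm (F n (s, x)) \<noteq> 0" by simp
      then have "c n s \<noteq> 0" "x \<in> bl n" unfolding nF by (auto simp: indicator_def split: if_splits)
      then show "\<bar>s\<bar> \<le> N n \<and> norm x \<le> N n" by (auto simp: c_def E_def bl_def indicator_def split: if_splits)
    qed (rule N)
    \<comment> \<open>A truncation of the left side of the theorem.\<close>
    define \<nu> where "\<nu> n = (\<integral>\<^sup>+t. indicator (E n) t * ennreal (A n t powr (r / q)) \<partial>lborel)" for n
    have cA: "c n t * A n t = indicator (E n) t * A n t powr (r / q)" for n t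
    proof (cases "A n t = 0")
      case False
      then have "A n t powr (r / q - 1) * A n t = A n t powr (r / q)"
        using A0[of n t] powr_add[of "A n t" "r / q - 1" 1] by simp
      then show ?thesis by (simp add: c_def mult.assoc)
    qed simp
    have slice: "(\<integral>\<^sup>+x. ennreal (norm (F n (t, x)) powr q') \<partial>lborel) = ennreal (c n t powr q' * A n t)" for n t
    proof -
      have "(\<integral>\<^sup>+x. ennreal (norm (F n (t, x)) powr q') \<partial>lborel) = (\<integral>\<^sup>+x. ennreal (c n t powr q') * (ennreal (norm (u t x) powr q) * indicator (bl n) x) \<partial>lborel)"
      proof (intro nn_integral_cong)
        fix x
        have "(norm (u t x) powr (q - 1)) powr q' = norm (u t x) powr q" unfolding powr_powr q'(2) ..
        then have "(c n t * norm (u t x) powr (q - 1)) powr q' = c n t powr q' * norm (u t x) powr q"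
          using c0[of n t] by (simp only: powr_mult powr_ge_zero)
        then show "ennreal (norm (F n (t, x)) powr q') = ennreal (c n t powr q') * (ennreal (norm (u t x) powr q) * indicator (bl n) x)"
          unfolding nF using q' by (simp add: indicator_def ennreal_mult)
      qed
      also have "\<dots> = ennreal (c n t powr q') * a n t" unfolding a_def by (intro nn_integral_cmult) measurable
      finally show ?thesis using A0 by (simp add: aA ennreal_mult)
    qed
    have FN: "(\<integral>\<^sup>+t. ennreal_pow (\<integral>\<^sup>+x. ennreal (norm (F n (t, x)) powr q') \<partial>lborel) (r' / q') \<partial>lborel) = \<nu> n" for n
      unfolding slice \<nu>_def
    proof (intro nn_integral_cong)
      fix t
      show "ennreal_pow (ennreal (c n t powr q' * A n t)) (r' / q') = indicator (E n) t * ennreal (A n t powr (r / q))"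
      proof (cases "t \<in> E n")
        case True
        have "0 < 1 / N n" using N by simp
        also have "1 / N n \<le> A n t" using True by (simp add: E_def)
        finally have pos: "0 < A n t" .
        have "c n t powr q' * A n t = A n t powr ((r / q - 1) * q' + 1)"
          using True pos by (simp add: c_def powr_powr powr_add)
        then have "ennreal_pow (ennreal (c n t powr q' * A n t)) (r' / q') = ennreal (A n t powr (((r / q - 1) * q' + 1) * (r' / q')))"
          by (simp only: ennreal_pow_ennreal powr_ge_zero powr_powr)
        then show ?thesis using True unfolding ex by simp
      qed (simp add: c_def)
    qed
    have \<nu>_fin: "\<nu> n < top" for n
    proof -
      have "\<nu> n \<le> (\<integral>\<^sup>+t. ennreal ((M powr q * v n) powr (r / q)) * indicator {- N n..N n} t \<partial>lborel)"
        unfolding \<nu>_def using A_le A0 q r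
        by (intro nn_integral_mono) (auto simp: indicator_def E_def abs_le_iff intro!: ennreal_leI powr_mono2)
      also have "\<dots> < top"
        using N[of n] by (simp add: nn_integral_cmult_indicator ennreal_mult_less_top)
      finally show ?thesis .
    qed
    have \<nu>_bound: "\<nu> n \<le> ennreal ((C * \<gamma>) powr (r / 2))" for n
    proof -
      obtain m where m: "\<nu> n = ennreal m" "0 \<le> m" using \<nu>_fin[of n] by (cases "\<nu> n") auto
      have inner: "(LINT x|lborel. cnj (F n (t, x)) * u t x) = of_real (indicator (E n) t * A n t powr (r / q))" for t
      proof -
        have "(LINT x|lborel. cnj (F n (t, x)) * u t x) = (LINT x|lborel. of_real (c n t * (norm (u t x) powr q * indicator (bl n) x)))"
        proof (intro Bochner_Integration.integral_cong refl)
          fix x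
          have 1: "norm (u t x) powr (q - 2) * (norm (u t x))\<^sup>2 = norm (u t x) powr q"
          proof (cases "u t x = 0")
            case False
            then show ?thesis using powr_add[of "norm (u t x)" "q - 2" 2] by simp
          qed (use q in simp)
          have "cnj (F n (t, x)) * u t x = of_real (c n t * indicator (bl n) x * norm (u t x) powr (q - 2)) * (u t x * cnj (u t x))"
            by (simp add: F_def)
          also have "\<dots> = of_real (c n t * indicator (bl n) x * norm (u t x) powr (q - 2) * (norm (u t x))\<^sup>2)"
            by (simp only: complex_norm_square[symmetric] of_real_mult)
          finally show "cnj (F n (t, x)) * u t x = of_real (c n t * (norm (u t x) powr q * indicator (bl n) x))"
            unfolding 1[symmetric] by (simp add: mult_ac)
        qed
        also have "\<dots> = of_real (c n t * (LINT x|lborel. norm (u t x) powr q * indicator (bl n) x))"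
          by (simp only: integral_complex_of_real integral_mult_right_zero)
        also have "(LINT x|lborel. norm (u t x) powr q * indicator (bl n) x) = A n t"
          unfolding A_def a_def by (subst integral_eq_nn_integral) (auto intro!: arg_cong[where f = enn2real] nn_integral_cong simp: indicator_def)
        finally show ?thesis unfolding cA .
      qed
      have "complex_of_real m = (LINT t|lborel. complex_of_real (indicator (E n) t * A n t powr (r / q)))"
      proof -
        have "(LINT t|lborel. indicator (E n) t * A n t powr (r / q)) = enn2real (\<nu> n)"
          unfolding \<nu>_def by (subst integral_eq_nn_integral) (auto intro!: arg_cong[where f = enn2real] nn_integral_cong simp: indicator_def)
        then show ?thesis unfolding integral_complex_of_real using m by simp
      qed
      also have "\<dots> = (LINT \<zeta>|lborel. g \<zeta> * cnj (zk_adj \<theta> (F n) \<zeta>))"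
        unfolding inner[symmetric] u_def by (rule zk_flow_pairing[OF test g])
      finally have "m \<le> norm (LINT \<zeta>|lborel. g \<zeta> * cnj (zk_adj \<theta> (F n) \<zeta>))"
        using m by (metis abs_of_nonneg norm_of_real order_refl)
      then have "ennreal m \<le> ennreal (norm (LINT \<zeta>|lborel. g \<zeta> * cnj (zk_adj \<theta> (F n) \<zeta>)))" by (rule ennreal_leI)
      also have "\<dots> \<le> (\<integral>\<^sup>+\<zeta>. ennreal (norm (g \<zeta>)) * ennreal (norm (zk_adj \<theta> (F n) \<zeta>)) \<partial>lborel)"
        using norm_integral_le_nn_integral[of lborel "\<lambda>\<zeta>. g \<zeta> * cnj (zk_adj \<theta> (F n) \<zeta>)"] by (simp add: norm_mult ennreal_mult)
      finally have "(ennreal m)\<^sup>2 \<le> (\<integral>\<^sup>+\<zeta>. ennreal (norm (g \<zeta>)) * ennreal (norm (zk_adj \<theta> (F n) \<zeta>)) \<partial>lborel)\<^sup>2"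
        by (rule power_mono) simp
      also have "\<dots> \<le> (\<integral>\<^sup>+\<zeta>. (ennreal (norm (g \<zeta>)))\<^sup>2 \<partial>lborel) * (\<integral>\<^sup>+\<zeta>. (ennreal (norm (zk_adj \<theta> (F n) \<zeta>)))\<^sup>2 \<partial>lborel)"
        using test_function.zk_adj_measurable[OF test] by (intro Cauchy_Schwarz_nn_integral) measurable
      also have "\<dots> \<le> ennreal \<gamma> * (ennreal C * ennreal_pow (\<nu> n) (2 / r'))"
        using dual[OF test, of \<theta> n] \<gamma> by (simp add: ennreal_power mult_left_mono FN)
      also have "\<dots> = ennreal (C * \<gamma> * m powr (2 / r'))"
        using \<gamma> C m by (simp add: ennreal_pow_ennreal mult_ac flip: ennreal_mult)
      finally have le: "m\<^sup>2 \<le> C * \<gamma> * m powr (2 / r')"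
        using C \<gamma> m by (simp add: ennreal_power)
      \<comment> \<open>A power of \<open>m\<close> is cancelled, leaving
        \<open>m powr (2 / r) \<le> C * \<gamma>\<close> because \<open>2 - 2 / r' = 2 / r\<close>;
        this is where the finiteness of \<open>\<nu> n\<close> enters.\<close>
      have "m \<le> (C * \<gamma>) powr (r / 2)"
      proof (cases "m = 0")
        case False
        then have mp: "0 < m" using m by simp
        have "m powr (2 / r) * m powr (2 / r') = m powr 2"
        proof -
          have "2 / r + 2 / r' = 2" using r'(2) by linarith
          then show ?thesis unfolding powr_add[symmetric] by (rule arg_cong)
        qed
        then have "m powr (2 / r) * m powr (2 / r') \<le> C * \<gamma> * m powr (2 / r')" using le mp by simp
        then have "m powr (2 / r) \<le> C * \<gamma>" using mp by simp
        then have "(m powr (2 / r)) powr (r / 2) \<le> (C * \<gamma>) powr (r / 2)" using r by (intro powr_mono2) auto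
        then show ?thesis using mp r by (simp add: powr_powr)
      qed simp
      then show ?thesis unfolding m(1) by (rule ennreal_leI)
    qed
    define h where "h n t = a n t * indicator (E n) t" for n t
    have [measurable]: "h n \<in> borel_measurable borel" for n unfolding h_def by measurable
    have hpow: "(\<integral>\<^sup>+t. ennreal_pow (h n t) (r / q) \<partial>lborel) = \<nu> n" for n
      unfolding \<nu>_def h_def by (intro nn_integral_cong) (simp add: aA indicator_def ennreal_pow_ennreal A0)
    have Nmono: "N n \<le> N m" if "n \<le> m" for n m using that by (simp add: N_def)
    have amono: "a n t \<le> a m t" if "n \<le> m" for n m t
      unfolding a_def using Nmono[OF that] by (intro nn_integral_mono) (auto simp: bl_def indicator_def)
    have Emono: "t \<in> E n \<Longrightarrow> t \<in> E m" if nm: "n \<le> m" for n m t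
    proof -
      assume t: "t \<in> E n"
      have "1 / N m \<le> 1 / N n" using Nmono[OF nm] N by (intro divide_left_mono) auto
      moreover have "A n t \<le> A m t" using amono[OF nm, of t] A0 by (simp add: aA)
      ultimately show "t \<in> E m" using t Nmono[OF nm] by (simp add: E_def)
    qed
    have hmono: "h n t \<le> h m t" if "n \<le> m" for n m t
      using amono[OF that, of t] Emono[OF that, of t] by (auto simp: h_def indicator_def)
    have SUP_h: "(\<integral>\<^sup>+x. ennreal (norm (u t x) powr q) \<partial>lborel) \<le> (SUP n. h n t)" for t
    proof -
      have "(\<integral>\<^sup>+x. ennreal (norm (u t x) powr q) \<partial>lborel) = (\<integral>\<^sup>+x. (SUP n. ennreal (norm (u t x) powr q) * indicator (bl n) x) \<partial>lborel)"
      proof (intro nn_integral_cong antisym SUP_least)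
        fix x :: "real \<times> real \<times> real"
        obtain n where "norm x \<le> real n" using real_arch_simple by blast
        then have "x \<in> bl n" by (simp add: bl_def N_def)
        then show "ennreal (norm (u t x) powr q) \<le> (SUP n. ennreal (norm (u t x) powr q) * indicator (bl n) x)"
          by (intro SUP_upper2[of n]) auto
      qed (auto simp: indicator_def)
      also have "\<dots> = (SUP n. a n t)"
        unfolding a_def using Nmono
        by (intro nn_integral_monotone_convergence_SUP) (auto simp: incseq_def le_fun_def bl_def indicator_def intro: order_trans)
      also have "\<dots> \<le> (SUP n. h n t)"
      proof (rule SUP_least)
        fix n
        \<comment> \<open>If \<open>a n t\<close> is positive, then \<open>t\<close> lies in
          \<open>E m\<close> for all large \<open>m\<close>, since both restrictions in
          \<open>E m\<close> weaken as \<open>m\<close> grows.\<close>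
        show "a n t \<le> (SUP n. h n t)"
        proof (cases "a n t = 0")
          case False
          then have Ap: "0 < A n t" using A0[of n t] by (simp add: aA less_le)
          obtain k where k: "max \<bar>t\<bar> (1 / A n t) \<le> real k" using real_arch_simple by blast
          define m where "m = max n k"
          have km: "real k \<le> N m" by (simp add: N_def m_def)
          have nm: "n \<le> m" by (simp add: m_def)
          have "1 / A n t \<le> N m" using k km by simp
          then have "1 / N m \<le> A n t" using Ap N[of m] by (simp add: field_simps)
          also have "A n t \<le> A m t" using amono[OF nm, of t] A0 by (simp add: aA)
          finally have "t \<in> E m" using k km by (simp add: E_def)
          then have "h m t = a m t" by (simp add: h_def)
          then show ?thesis using amono[OF nm, of t] by (intro SUP_upper2[of m]) auto
        qed simp
      qed
      finally show ?thesis .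
    qed
    have "(\<integral>\<^sup>+t. ennreal_pow (\<integral>\<^sup>+x. ennreal (norm (u t x) powr q) \<partial>lborel) (r / q) \<partial>lborel)
      \<le> (\<integral>\<^sup>+t. (SUP n. ennreal_pow (h n t) (r / q)) \<partial>lborel)"
    proof (intro nn_integral_mono)
      fix t
      have rq: "0 < r / q" using q r by simp
      have "ennreal_pow (\<integral>\<^sup>+x. ennreal (norm (u t x) powr q) \<partial>lborel) (r / q) \<le> ennreal_pow (SUP n. h n t) (r / q)"
        using rq by (intro ennreal_pow_mono SUP_h) simp
      also have "\<dots> \<le> (SUP n. ennreal_pow (h n t) (r / q))" by (rule ennreal_pow_SUP_le[OF rq])
      finally show "ennreal_pow (\<integral>\<^sup>+x. ennreal (norm (u t x) powr q) \<partial>lborel) (r / q) \<le> (SUP n. ennreal_pow (h n t) (r / q))" .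
    qed
    also have "\<dots> = (SUP n. \<integral>\<^sup>+t. ennreal_pow (h n t) (r / q) \<partial>lborel)"
      using hmono q r by (intro nn_integral_monotone_convergence_SUP) (auto simp: incseq_def le_fun_def intro!: ennreal_pow_mono)
    also have "\<dots> \<le> ennreal ((C * \<gamma>) powr (r / 2))" unfolding hpow by (intro SUP_least \<nu>_bound)
    also have "\<dots> = ennreal (C powr (r / 2)) * ennreal_pow (ennreal \<gamma>) (r / 2)"
      using C \<gamma> by (simp add: ennreal_pow_ennreal powr_mult ennreal_mult)
    finally show ?thesis unfolding u_def \<gamma>(1) .
  qed
  moreover have "0 < C powr (r / 2)" using C by simp
  ultimately show ?thesis by (intro exI[of _ "C powr (r / 2)"] conjI allI impI)
qed

subsection \<open>Adding transverse variables\<close>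

text \<open>\<open>H\<close> carries the frequencies, \<open>Y\<close> the positions,
  \<open>\<psi>\<close> is their pairing and \<open>\<xi>\<close> the first frequency. Abstract
  measure spaces are used because the induction on the number of variables runs through products
  that are not Euclidean spaces.\<close>

definition flow_on :: "'h measure \<Rightarrow> ('y \<Rightarrow> 'h \<Rightarrow> real) \<Rightarrow> ('h \<Rightarrow> real) \<Rightarrow> ('h \<Rightarrow> real) \<Rightarrow> real \<Rightarrow> ('h \<Rightarrow> complex) \<Rightarrow> real \<Rightarrow> 'y \<Rightarrow> complex" where
  "flow_on H \<psi> \<xi> \<phi> \<theta> g t y = (LINT h|H. cis (\<psi> y h + t * (\<phi> h + \<theta> * \<xi> h)) * g h)"

text \<open>\<open>K\<close> is quantified before \<open>\<theta>\<close>, which is the uniformity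
  required for adding a variable. Sigma-finiteness and measurability are bundled in for Tonelli and
  Minkowski.\<close>

definition strichartz_system :: "real \<Rightarrow> real \<Rightarrow> 'y measure \<Rightarrow> 'h measure \<Rightarrow> ('y \<Rightarrow> 'h \<Rightarrow> real) \<Rightarrow> ('h \<Rightarrow> real) \<Rightarrow> ('h \<Rightarrow> real) \<Rightarrow> ('h \<Rightarrow> real) \<Rightarrow> bool" where
  "strichartz_system r q Y H \<psi> \<xi> \<phi> w \<longleftrightarrow>
     sigma_finite_measure Y \<and> sigma_finite_measure H \<and> case_prod \<psi> \<in> borel_measurable (Y \<Otimes>\<^sub>M H) \<and>
     \<xi> \<in> borel_measurable H \<and> \<phi> \<in> borel_measurable H \<and> w \<in> borel_measurable H \<and> (\<forall>h. 0 \<le> w h) \<and>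
     (\<exists>K>0. \<forall>\<theta> g. integrable H g \<longrightarrow>
       (\<integral>\<^sup>+t. ennreal_pow (\<integral>\<^sup>+y. ennreal (norm (flow_on H \<psi> \<xi> \<phi> \<theta> g t y) powr q) \<partial>Y) (r / q) \<partial>lborel)
       \<le> ennreal K * ennreal_pow (\<integral>\<^sup>+h. ennreal (w h * (norm (g h))\<^sup>2) \<partial>H) (r / 2))"

text \<open>Transport to image measures. It is used to pass from triples to functions on two
  indices, to insert a coordinate, and to pass from functions to vectors.\<close>

lemma strichartz_system_distr:
  assumes sys: "strichartz_system r q Y H \<psi> \<xi> \<phi> w"
    and T: "T \<in> Y \<rightarrow>\<^sub>M Y'" and S: "S \<in> H \<rightarrow>\<^sub>M H'"
    and Y': "sigma_finite_measure Y'" "Y' = distr Y Y' T" and H': "sigma_finite_measure H'" "H' = distr H H' S"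
    and meas: "case_prod \<psi>' \<in> borel_measurable (Y' \<Otimes>\<^sub>M H')" "\<xi>' \<in> borel_measurable H'" "\<phi>' \<in> borel_measurable H'" "w' \<in> borel_measurable H'"
    and w': "\<And>h. 0 \<le> w' h"
    and eqs: "\<And>y h. \<psi>' (T y) (S h) = \<psi> y h" "\<And>h. \<xi>' (S h) = \<xi> h" "\<And>h. \<phi>' (S h) = \<phi> h" "\<And>h. w' (S h) = w h"
  shows "strichartz_system r q Y' H' \<psi>' \<xi>' \<phi>' w'"
proof -
  interpret H': sigma_finite_measure H' by fact
  note [measurable] = meas T S
  obtain K where K: "0 < K" and bd: "\<And>\<theta> g. integrable H g \<Longrightarrow>
       (\<integral>\<^sup>+t. ennreal_pow (\<integral>\<^sup>+y. ennreal (norm (flow_on H \<psi> \<xi> \<phi> \<theta> g t y) powr q) \<partial>Y) (r / q) \<partial>lborel)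
       \<le> ennreal K * ennreal_pow (\<integral>\<^sup>+h. ennreal (w h * (norm (g h))\<^sup>2) \<partial>H) (r / 2)"
    using sys unfolding strichartz_system_def by (elim conjE exE, intro that) (assumption, elim allE impE, assumption+)
  have "(\<integral>\<^sup>+t. ennreal_pow (\<integral>\<^sup>+y. ennreal (norm (flow_on H' \<psi>' \<xi>' \<phi>' \<theta> g t y) powr q) \<partial>Y') (r / q) \<partial>lborel)
       \<le> ennreal K * ennreal_pow (\<integral>\<^sup>+h. ennreal (w' h * (norm (g h))\<^sup>2) \<partial>H') (r / 2)"
    if g: "integrable H' g" for \<theta> g
  proof -
    have [measurable]: "g \<in> borel_measurable H'" using g by auto
    have gS: "integrable H (\<lambda>h. g (S h))"
      using g by (subst (asm) H'(2)) (simp add: integrable_distr_eq)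
    have flow: "flow_on H' \<psi>' \<xi>' \<phi>' \<theta> g t (T y) = flow_on H \<psi> \<xi> \<phi> \<theta> (\<lambda>h. g (S h)) t y" if y: "y \<in> space Y" for t y
    proof -
      have [measurable]: "\<psi>' (T y) \<in> borel_measurable H'"
        using measurable_Pair2[OF meas(1), of "T y"] measurable_space[OF T y] by simp
      have "(LINT h|H'. cis (\<psi>' (T y) h + t * (\<phi>' h + \<theta> * \<xi>' h)) * g h)
        = (LINT h|H. cis (\<psi>' (T y) (S h) + t * (\<phi>' (S h) + \<theta> * \<xi>' (S h))) * g (S h))"
        by (subst H'(2), subst integral_distr) measurable
      then show ?thesis unfolding flow_on_def eqs .
    qed
    have "(\<integral>\<^sup>+y. ennreal (norm (flow_on H' \<psi>' \<xi>' \<phi>' \<theta> g t y) powr q) \<partial>Y')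
        = (\<integral>\<^sup>+y. ennreal (norm (flow_on H \<psi> \<xi> \<phi> \<theta> (\<lambda>h. g (S h)) t y) powr q) \<partial>Y)" for t
    proof -
      have m: "(\<lambda>y. ennreal (norm (flow_on H' \<psi>' \<xi>' \<phi>' \<theta> g t y) powr q)) \<in> borel_measurable Y'"
        unfolding flow_on_def by measurable
      then have m': "(\<lambda>y. ennreal (norm (flow_on H' \<psi>' \<xi>' \<phi>' \<theta> g t y) powr q)) \<in> borel_measurable (distr Y Y' T)"
        by simp
      show ?thesis
        by (subst Y'(2), subst nn_integral_distr[OF T m']) (intro nn_integral_cong, simp add: flow)
    qed
    moreover have "(\<integral>\<^sup>+h. ennreal (w' h * (norm (g h))\<^sup>2) \<partial>H') = (\<integral>\<^sup>+h. ennreal (w h * (norm (g (S h)))\<^sup>2) \<partial>H)"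
      by (subst H'(2), subst nn_integral_distr) (simp_all add: eqs)
    ultimately show ?thesis using bd[OF gS, of \<theta>] by simp
  qed
  then show ?thesis
    unfolding strichartz_system_def using K Y'(1) H'(1) meas w' by (intro conjI allI exI[of _ K] impI)
qed

text \<open>
  Uniformity in \<open>\<theta>\<close> is what makes the induction work: for fixed \<open>\<kappa> = snd k\<close> the new phase is the old one
  with \<open>\<theta> + \<kappa>\<^sup>2\<close> in place of \<open>\<theta>\<close>.
\<close>

lemma strichartz_system_tensor:
  assumes sys: "strichartz_system r q Y H \<psi> \<xi> \<phi> w" and q: "2 < q" and r: "2 < r"
  shows "strichartz_system r q (Y \<Otimes>\<^sub>M (lborel :: real measure)) (H \<Otimes>\<^sub>M (lborel :: real measure))
    (\<lambda>p k. \<psi> (fst p) (fst k) + snd p * snd k) (\<lambda>k. \<xi> (fst k)) (\<lambda>k. \<phi> (fst k) + (snd k)\<^sup>2 * \<xi> (fst k))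
    (\<lambda>k. w (fst k) * \<bar>snd k\<bar> powr (1 - 2 / q))"
proof -
  from sys have Y: "sigma_finite_measure Y" and H: "sigma_finite_measure H"
    and [measurable]: "case_prod \<psi> \<in> borel_measurable (Y \<Otimes>\<^sub>M H)" "\<xi> \<in> borel_measurable H" "\<phi> \<in> borel_measurable H" "w \<in> borel_measurable H"
    and w: "\<And>h. 0 \<le> w h"
    unfolding strichartz_system_def by simp_all
  obtain K where K: "0 < K" and bd: "\<And>\<theta> g. integrable H g \<Longrightarrow>
       (\<integral>\<^sup>+t. ennreal_pow (\<integral>\<^sup>+y. ennreal (norm (flow_on H \<psi> \<xi> \<phi> \<theta> g t y) powr q) \<partial>Y) (r / q) \<partial>lborel)
       \<le> ennreal K * ennreal_pow (\<integral>\<^sup>+h. ennreal (w h * (norm (g h))\<^sup>2) \<partial>H) (r / 2)"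
    using sys unfolding strichartz_system_def by (elim conjE exE, intro that) (assumption, elim allE impE, assumption+)
  interpret Y: sigma_finite_measure Y by fact
  interpret H: sigma_finite_measure H by fact
  interpret YL: pair_sigma_finite Y "lborel :: real measure" ..
  interpret HL: pair_sigma_finite H "lborel :: real measure" ..
  define \<beta> where "\<beta> = 1 - 2 / q"
  obtain C where C: "0 \<le> C" and sob: "\<And>g :: real \<Rightarrow> complex. integrable lborel g \<Longrightarrow>
    (\<integral>\<^sup>+x. ennreal (norm (osc g x) powr q) \<partial>lborel) \<le> ennreal C * ennreal_pow (\<integral>\<^sup>+z. ennreal (\<bar>z\<bar> powr \<beta> * (norm (g z))\<^sup>2) \<partial>lborel) (q / 2)"
    using osc_Sobolev[OF q, where 'a = real] by (auto simp: \<beta>_def)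
  have rq: "0 < r / q" "0 < q / 2" "0 < r / 2" "0 < 2 / r" "0 < 2 / q" "0 < 1 / (q / 2)" "0 < 1 / (r / 2)" using q r by auto
  \<comment> \<open>\<open>C + 1\<close>, because the Sobolev constant is only known to be
    nonnegative while \<open>K'\<close> has to be positive.\<close>
  define K' where "K' = (C + 1) powr (r / q) * K"
  have "(\<integral>\<^sup>+t. ennreal_pow (\<integral>\<^sup>+p. ennreal (norm (flow_on (H \<Otimes>\<^sub>M lborel) (\<lambda>p k. \<psi> (fst p) (fst k) + snd p * snd k) (\<lambda>k. \<xi> (fst k)) (\<lambda>k. \<phi> (fst k) + (snd k)\<^sup>2 * \<xi> (fst k)) \<theta> g t p) powr q) \<partial>(Y \<Otimes>\<^sub>M lborel)) (r / q) \<partial>lborel)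
       \<le> ennreal K' * ennreal_pow (\<integral>\<^sup>+k. ennreal (w (fst k) * \<bar>snd k\<bar> powr \<beta> * (norm (g k))\<^sup>2) \<partial>(H \<Otimes>\<^sub>M lborel)) (r / 2)"
    if g: "integrable (H \<Otimes>\<^sub>M (lborel :: real measure)) g" for \<theta> g
  proof -
    have [measurable]: "g \<in> borel_measurable (H \<Otimes>\<^sub>M lborel)" using g by auto
    define \<Gamma> where "\<Gamma> t y \<kappa> = flow_on H \<psi> \<xi> \<phi> (\<theta> + \<kappa>\<^sup>2) (\<lambda>h. g (h, \<kappa>)) t y" for t y \<kappa>
    have \<Gamma>m [measurable]: "(\<lambda>p. \<Gamma> (fst (fst p)) (snd (fst p)) (snd p)) \<in> borel_measurable ((lborel \<Otimes>\<^sub>M Y) \<Otimes>\<^sub>M lborel)"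
      unfolding \<Gamma>_def flow_on_def by measurable
    let ?U = "\<lambda>t p. flow_on (H \<Otimes>\<^sub>M lborel) (\<lambda>p k. \<psi> (fst p) (fst k) + snd p * snd k) (\<lambda>k. \<xi> (fst k)) (\<lambda>k. \<phi> (fst k) + (snd k)\<^sup>2 * \<xi> (fst k)) \<theta> g t p"
    have Um: "(\<lambda>p. ennreal (norm (?U t p) powr q)) \<in> borel_measurable (Y \<Otimes>\<^sub>M lborel)" for t
      unfolding flow_on_def by measurable
    have U: "?U t (y, z) = osc (\<Gamma> t y) z" and \<Gamma>int: "integrable lborel (\<Gamma> t y)" if y [measurable]: "y \<in> space Y" for t y z
    proof -
      let ?f = "\<lambda>z h \<kappa>. cis (z * \<kappa>) * (cis (\<psi> y h + t * (\<phi> h + (\<theta> + \<kappa>\<^sup>2) * \<xi> h)) * g (h, \<kappa>))"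
      have [measurable]: "\<psi> y \<in> borel_measurable H" using y by measurable
      have fint: "integrable (H \<Otimes>\<^sub>M lborel) (\<lambda>(h, \<kappa>). ?f z h \<kappa>)" for z
        by (rule Bochner_Integration.integrable_bound[OF g]) (auto simp: norm_mult)
      have "?U t (y, z) = (LINT k|(H \<Otimes>\<^sub>M lborel). (case k of (h, \<kappa>) \<Rightarrow> ?f z h \<kappa>))"
        unfolding flow_on_def
      proof (intro Bochner_Integration.integral_cong refl)
        fix k :: "_ \<times> real"
        have "\<psi> y (fst k) + z * snd k + t * (\<phi> (fst k) + (snd k)\<^sup>2 * \<xi> (fst k) + \<theta> * \<xi> (fst k))
          = z * snd k + (\<psi> y (fst k) + t * (\<phi> (fst k) + (\<theta> + (snd k)\<^sup>2) * \<xi> (fst k)))"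
          by (simp add: algebra_simps)
        then show "cis (\<psi> (fst (y, z)) (fst k) + snd (y, z) * snd k + t * (\<phi> (fst k) + (snd k)\<^sup>2 * \<xi> (fst k) + \<theta> * \<xi> (fst k))) * g k
          = (case k of (h, \<kappa>) \<Rightarrow> ?f z h \<kappa>)"
          by (simp only: cis_mult[symmetric] mult.assoc fst_conv snd_conv case_prod_beta prod.collapse)
      qed
      also have "\<dots> = (LINT \<kappa>|lborel. LINT h|H. ?f z h \<kappa>)"
        by (rule HL.integral_snd[OF fint, symmetric])
      also have "\<dots> = osc (\<Gamma> t y) z"
        unfolding osc_def \<Gamma>_def flow_on_def by simp
      finally show "?U t (y, z) = osc (\<Gamma> t y) z" .
      have "integrable lborel (\<lambda>\<kappa>. LINT h|H. ?f 0 h \<kappa>)" by (rule HL.integrable_snd[OF fint])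
      then show "integrable lborel (\<Gamma> t y)" unfolding \<Gamma>_def flow_on_def by simp
    qed
    \<comment> \<open>Sobolev embedding and the given estimate are both quadratic in the amplitude.
      Minkowski's inequality therefore applies with the exponents \<open>q / 2\<close> and
      \<open>r / 2\<close>, both at least 1, and moves the integral over \<open>\<kappa>\<close>
      outside twice.\<close>
    define G where "G t y \<kappa> = ennreal (\<bar>\<kappa>\<bar> powr \<beta> * (norm (\<Gamma> t y \<kappa>))\<^sup>2)" for t y \<kappa>
    have Gm [measurable]: "(\<lambda>p. G (fst (fst p)) (snd (fst p)) (snd p)) \<in> borel_measurable ((lborel \<Otimes>\<^sub>M Y) \<Otimes>\<^sub>M lborel)"
      unfolding G_def by measurable
    have Gm2 [measurable]: "(\<lambda>(y, \<kappa>). G t y \<kappa>) \<in> borel_measurable (Y \<Otimes>\<^sub>M lborel)" for t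
      using measurable_compose[of "\<lambda>p. ((t, fst p), snd p)" "Y \<Otimes>\<^sub>M lborel" "(lborel \<Otimes>\<^sub>M Y) \<Otimes>\<^sub>M lborel", OF _ Gm] by (simp add: case_prod_beta')
    define a where "a t \<kappa> = ennreal_pow (\<integral>\<^sup>+y. ennreal_pow (G t y \<kappa>) (q / 2) \<partial>Y) (1 / (q / 2))" for t \<kappa>
    have Gm3: "(\<lambda>p. G (fst (fst p)) (snd p) (snd (fst p))) \<in> borel_measurable ((lborel \<Otimes>\<^sub>M lborel) \<Otimes>\<^sub>M Y)"
      using measurable_compose[of "\<lambda>p. ((fst (fst p), snd p), snd (fst p))" "(lborel \<Otimes>\<^sub>M lborel) \<Otimes>\<^sub>M Y" "(lborel \<Otimes>\<^sub>M Y) \<Otimes>\<^sub>M lborel", OF _ Gm] by simp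
    have am [measurable]: "(\<lambda>(t, \<kappa>). a t \<kappa>) \<in> borel_measurable (lborel \<Otimes>\<^sub>M lborel)"
    proof -
      have "(\<lambda>p. \<integral>\<^sup>+y. ennreal_pow (G (fst p) y (snd p)) (q / 2) \<partial>Y) \<in> borel_measurable (lborel \<Otimes>\<^sub>M lborel)"
        using Gm3 by (intro Y.borel_measurable_nn_integral) (simp add: case_prod_beta' measurable_ennreal_pow)
      then show ?thesis unfolding a_def case_prod_beta' by (rule measurable_ennreal_pow)
    qed
    \<comment> \<open>Sobolev embedding in the new variable for fixed \<open>t\<close> and
      \<open>y\<close>, then Minkowski between \<open>y\<close> and \<open>\<kappa>\<close>.\<close>
    have step1: "ennreal_pow (\<integral>\<^sup>+p. ennreal (norm (?U t p) powr q) \<partial>(Y \<Otimes>\<^sub>M lborel)) (r / q)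
      \<le> ennreal ((C + 1) powr (r / q)) * ennreal_pow (\<integral>\<^sup>+\<kappa>. a t \<kappa> \<partial>lborel) (r / 2)" for t
    proof -
      have "(\<integral>\<^sup>+p. ennreal (norm (?U t p) powr q) \<partial>(Y \<Otimes>\<^sub>M lborel)) = (\<integral>\<^sup>+y. \<integral>\<^sup>+z. ennreal (norm (?U t (y, z)) powr q) \<partial>lborel \<partial>Y)"
        by (rule lborel.nn_integral_fst[OF Um, symmetric])
      also have "\<dots> \<le> (\<integral>\<^sup>+y. ennreal (C + 1) * ennreal_pow (\<integral>\<^sup>+\<kappa>. G t y \<kappa> \<partial>lborel) (q / 2) \<partial>Y)"
      proof (intro nn_integral_mono)
        fix y assume y: "y \<in> space Y"
        have "(\<integral>\<^sup>+z. ennreal (norm (?U t (y, z)) powr q) \<partial>lborel) \<le> ennreal C * ennreal_pow (\<integral>\<^sup>+\<kappa>. G t y \<kappa> \<partial>lborel) (q / 2)"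
          unfolding U[OF y] G_def by (rule sob[OF \<Gamma>int[OF y]])
        also have "\<dots> \<le> ennreal (C + 1) * ennreal_pow (\<integral>\<^sup>+\<kappa>. G t y \<kappa> \<partial>lborel) (q / 2)"
          by (intro mult_right_mono ennreal_leI) auto
        finally show "(\<integral>\<^sup>+z. ennreal (norm (?U t (y, z)) powr q) \<partial>lborel) \<le> ennreal (C + 1) * ennreal_pow (\<integral>\<^sup>+\<kappa>. G t y \<kappa> \<partial>lborel) (q / 2)" .
      qed
      also have "\<dots> = ennreal (C + 1) * (\<integral>\<^sup>+y. ennreal_pow (\<integral>\<^sup>+\<kappa>. G t y \<kappa> \<partial>lborel) (q / 2) \<partial>Y)"
        by (intro nn_integral_cmult) measurable
      also have "\<dots> \<le> ennreal (C + 1) * ennreal_pow (\<integral>\<^sup>+\<kappa>. a t \<kappa> \<partial>lborel) (q / 2)"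
        unfolding a_def using q by (intro mult_left_mono nn_integral_Minkowski Y sigma_finite_lborel Gm2) auto
      finally have "ennreal_pow (\<integral>\<^sup>+p. ennreal (norm (?U t p) powr q) \<partial>(Y \<Otimes>\<^sub>M lborel)) (r / q)
        \<le> ennreal_pow (ennreal (C + 1) * ennreal_pow (\<integral>\<^sup>+\<kappa>. a t \<kappa> \<partial>lborel) (q / 2)) (r / q)"
        using rq by (intro ennreal_pow_mono) auto
      also have "\<dots> = ennreal ((C + 1) powr (r / q)) * ennreal_pow (\<integral>\<^sup>+\<kappa>. a t \<kappa> \<partial>lborel) (q / 2 * (r / q))"
        using rq C by (simp only: ennreal_pow_mult ennreal_pow_pow ennreal_pow_ennreal[of "C + 1"] add_nonneg_nonneg zero_le_one)
      also have "q / 2 * (r / q) = r / 2" using q by simp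
      finally show ?thesis .
    qed
    \<comment> \<open>The given estimate at the parameter \<open>\<theta> + \<kappa>^2\<close>, for
      those \<open>\<kappa>\<close> whose slice of \<open>g\<close> is integrable; by Fubini these
      are almost all.\<close>
    have step2: "ennreal_pow (\<integral>\<^sup>+t. ennreal_pow (a t \<kappa>) (r / 2) \<partial>lborel) (1 / (r / 2))
      \<le> ennreal (K powr (2 / r)) * (\<integral>\<^sup>+h. ennreal (w h * \<bar>\<kappa>\<bar> powr \<beta> * (norm (g (h, \<kappa>)))\<^sup>2) \<partial>H)"
      if gk: "integrable H (\<lambda>h. g (h, \<kappa>))" for \<kappa>
    proof -
      have [measurable]: "(\<lambda>h. g (h, \<kappa>)) \<in> borel_measurable H" using gk by auto
      have \<Gamma>k [measurable]: "(\<lambda>p. \<Gamma> (fst p) (snd p) \<kappa>) \<in> borel_measurable (lborel \<Otimes>\<^sub>M Y)"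
        using measurable_compose[of "\<lambda>p. (p, \<kappa>)" "lborel \<Otimes>\<^sub>M Y" "(lborel \<Otimes>\<^sub>M Y) \<Otimes>\<^sub>M lborel", OF _ \<Gamma>m] by simp
      have \<Gamma>t [measurable]: "(\<lambda>y. \<Gamma> t y \<kappa>) \<in> borel_measurable Y" for t
        using measurable_compose[of "\<lambda>y. (t, y)" Y "lborel \<Otimes>\<^sub>M Y", OF _ \<Gamma>k] by simp
      let ?c = "\<bar>\<kappa>\<bar> powr (\<beta> * (q / 2))" and ?J = "\<lambda>t. \<integral>\<^sup>+y. ennreal (norm (\<Gamma> t y \<kappa>) powr q) \<partial>Y"
      have Jm [measurable]: "?J \<in> borel_measurable lborel"
        by (rule Y.borel_measurable_nn_integral) (simp add: case_prod_beta', measurable)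
      have Gp: "ennreal_pow (G t y \<kappa>) (q / 2) = ennreal ?c * ennreal (norm (\<Gamma> t y \<kappa>) powr q)" for t y
      proof -
        have "((norm (\<Gamma> t y \<kappa>))\<^sup>2) powr (q / 2) = norm (\<Gamma> t y \<kappa>) powr q"
          by (cases "\<Gamma> t y \<kappa> = 0") (use q in \<open>simp_all add: powr_powr flip: powr_numeral\<close>)
        then show ?thesis
          using q by (simp add: G_def ennreal_mult ennreal_pow_mult) (simp add: ennreal_pow_ennreal powr_powr)
      qed
      have a_pow: "ennreal_pow (a t \<kappa>) (r / 2) = ennreal (\<bar>\<kappa>\<bar> powr (\<beta> * (r / 2))) * ennreal_pow (?J t) (r / q)" for t
      proof -
        have e: "1 / (q / 2) * (r / 2) = r / q" "\<beta> * (q / 2) * (r / q) = \<beta> * (r / 2)" using q by auto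
        have "ennreal_pow (a t \<kappa>) (r / 2) = ennreal_pow (\<integral>\<^sup>+y. ennreal ?c * ennreal (norm (\<Gamma> t y \<kappa>) powr q) \<partial>Y) (1 / (q / 2) * (r / 2))"
          unfolding a_def Gp using rq by (intro ennreal_pow_pow) auto
        also have "(\<integral>\<^sup>+y. ennreal ?c * ennreal (norm (\<Gamma> t y \<kappa>) powr q) \<partial>Y) = ennreal ?c * ?J t"
          by (intro nn_integral_cmult) measurable
        also have "ennreal_pow (ennreal ?c * ?J t) (1 / (q / 2) * (r / 2)) = ennreal (?c powr (r / q)) * ennreal_pow (?J t) (r / q)"
          unfolding e(1) using rq by (simp add: ennreal_pow_mult ennreal_pow_ennreal)
        also have "?c powr (r / q) = \<bar>\<kappa>\<bar> powr (\<beta> * (r / 2))" unfolding powr_powr e(2) ..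
        finally show ?thesis .
      qed
      have "(\<integral>\<^sup>+t. ennreal_pow (a t \<kappa>) (r / 2) \<partial>lborel) = ennreal (\<bar>\<kappa>\<bar> powr (\<beta> * (r / 2))) * (\<integral>\<^sup>+t. ennreal_pow (?J t) (r / q) \<partial>lborel)"
        unfolding a_pow by (intro nn_integral_cmult) measurable
      also have "\<dots> \<le> ennreal (\<bar>\<kappa>\<bar> powr (\<beta> * (r / 2))) * (ennreal K * ennreal_pow (\<integral>\<^sup>+h. ennreal (w h * (norm (g (h, \<kappa>)))\<^sup>2) \<partial>H) (r / 2))"
        unfolding \<Gamma>_def by (intro mult_left_mono bd gk) auto
      finally have "ennreal_pow (\<integral>\<^sup>+t. ennreal_pow (a t \<kappa>) (r / 2) \<partial>lborel) (1 / (r / 2))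
        \<le> ennreal_pow (ennreal (\<bar>\<kappa>\<bar> powr (\<beta> * (r / 2))) * (ennreal K * ennreal_pow (\<integral>\<^sup>+h. ennreal (w h * (norm (g (h, \<kappa>)))\<^sup>2) \<partial>H) (r / 2))) (1 / (r / 2))"
        using rq by (intro ennreal_pow_mono) auto
      also have "\<dots> = ennreal (\<bar>\<kappa>\<bar> powr \<beta>) * (ennreal (K powr (2 / r)) * (\<integral>\<^sup>+h. ennreal (w h * (norm (g (h, \<kappa>)))\<^sup>2) \<partial>H))"
      proof -
        have "(\<bar>\<kappa>\<bar> powr (\<beta> * (r / 2))) powr (1 / (r / 2)) = \<bar>\<kappa>\<bar> powr \<beta>"
          unfolding powr_powr using r by simp
        moreover have "1 / (r / 2) = 2 / r" by simp
        ultimately show ?thesis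
          unfolding ennreal_pow_mult[OF rq(7)] ennreal_pow_inverse(1)[OF rq(3)] using K
          by (simp only: ennreal_pow_ennreal powr_ge_zero less_imp_le)
      qed
      also have "\<dots> = ennreal (K powr (2 / r)) * (\<integral>\<^sup>+h. ennreal (\<bar>\<kappa>\<bar> powr \<beta>) * ennreal (w h * (norm (g (h, \<kappa>)))\<^sup>2) \<partial>H)"
        by (subst nn_integral_cmult) (measurable, simp add: mult.left_commute)
      also have "(\<integral>\<^sup>+h. ennreal (\<bar>\<kappa>\<bar> powr \<beta>) * ennreal (w h * (norm (g (h, \<kappa>)))\<^sup>2) \<partial>H) = (\<integral>\<^sup>+h. ennreal (w h * \<bar>\<kappa>\<bar> powr \<beta> * (norm (g (h, \<kappa>)))\<^sup>2) \<partial>H)"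
        using w by (intro nn_integral_cong) (simp add: mult_ac flip: ennreal_mult)
      finally show ?thesis .
    qed
    have "(\<integral>\<^sup>+t. ennreal_pow (\<integral>\<^sup>+p. ennreal (norm (?U t p) powr q) \<partial>(Y \<Otimes>\<^sub>M lborel)) (r / q) \<partial>lborel)
      \<le> (\<integral>\<^sup>+t. ennreal ((C + 1) powr (r / q)) * ennreal_pow (\<integral>\<^sup>+\<kappa>. a t \<kappa> \<partial>lborel) (r / 2) \<partial>lborel)"
      by (intro nn_integral_mono step1)
    also have "\<dots> = ennreal ((C + 1) powr (r / q)) * (\<integral>\<^sup>+t. ennreal_pow (\<integral>\<^sup>+\<kappa>. a t \<kappa> \<partial>lborel) (r / 2) \<partial>lborel)"
      by (intro nn_integral_cmult) measurable
    also have "\<dots> \<le> ennreal ((C + 1) powr (r / q)) * ennreal_pow (\<integral>\<^sup>+\<kappa>. ennreal_pow (\<integral>\<^sup>+t. ennreal_pow (a t \<kappa>) (r / 2) \<partial>lborel) (1 / (r / 2)) \<partial>lborel) (r / 2)"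
      using r am by (intro mult_left_mono nn_integral_Minkowski sigma_finite_lborel) auto
    also have "\<dots> \<le> ennreal ((C + 1) powr (r / q)) * ennreal_pow (\<integral>\<^sup>+\<kappa>. ennreal (K powr (2 / r)) * (\<integral>\<^sup>+h. ennreal (w h * \<bar>\<kappa>\<bar> powr \<beta> * (norm (g (h, \<kappa>)))\<^sup>2) \<partial>H) \<partial>lborel) (r / 2)"
    proof (intro mult_left_mono ennreal_pow_mono nn_integral_mono_AE)
      have "AE \<kappa> in lborel. integrable H (\<lambda>h. g (h, \<kappa>))"
        using HL.AE_integrable_snd[of "\<lambda>h \<kappa>. g (h, \<kappa>)"] g by simp
      then show "AE \<kappa> in lborel. ennreal_pow (\<integral>\<^sup>+t. ennreal_pow (a t \<kappa>) (r / 2) \<partial>lborel) (1 / (r / 2))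
        \<le> ennreal (K powr (2 / r)) * (\<integral>\<^sup>+h. ennreal (w h * \<bar>\<kappa>\<bar> powr \<beta> * (norm (g (h, \<kappa>)))\<^sup>2) \<partial>H)"
        by eventually_elim (rule step2)
    qed (use r in auto)
    also have "(\<integral>\<^sup>+\<kappa>. ennreal (K powr (2 / r)) * (\<integral>\<^sup>+h. ennreal (w h * \<bar>\<kappa>\<bar> powr \<beta> * (norm (g (h, \<kappa>)))\<^sup>2) \<partial>H) \<partial>lborel)
      = ennreal (K powr (2 / r)) * (\<integral>\<^sup>+\<kappa>. \<integral>\<^sup>+h. ennreal (w h * \<bar>\<kappa>\<bar> powr \<beta> * (norm (g (h, \<kappa>)))\<^sup>2) \<partial>H \<partial>lborel)"
      by (intro nn_integral_cmult) measurable
    also have "(\<integral>\<^sup>+\<kappa>. \<integral>\<^sup>+h. ennreal (w h * \<bar>\<kappa>\<bar> powr \<beta> * (norm (g (h, \<kappa>)))\<^sup>2) \<partial>H \<partial>lborel)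
      = (\<integral>\<^sup>+k. ennreal (w (fst k) * \<bar>snd k\<bar> powr \<beta> * (norm (g k))\<^sup>2) \<partial>(H \<Otimes>\<^sub>M lborel))"
    proof -
      have "(\<lambda>k. ennreal (w (fst k) * \<bar>snd k\<bar> powr \<beta> * (norm (g k))\<^sup>2)) \<in> borel_measurable (H \<Otimes>\<^sub>M lborel)"
        by measurable
      from HL.nn_integral_snd[OF this] show ?thesis by (simp only: fst_conv snd_conv)
    qed
    also have "ennreal ((C + 1) powr (r / q)) * ennreal_pow (ennreal (K powr (2 / r)) * I) (r / 2) = ennreal K' * ennreal_pow I (r / 2)" for I
    proof -
      have "(K powr (2 / r)) powr (r / 2) = K" unfolding powr_powr using r K by simp
      then have "ennreal_pow (ennreal (K powr (2 / r)) * I) (r / 2) = ennreal K * ennreal_pow I (r / 2)"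
        unfolding ennreal_pow_mult[OF rq(3)] by (simp only: ennreal_pow_ennreal powr_ge_zero)
      then show ?thesis using K C by (simp add: K'_def ennreal_mult mult.assoc)
    qed
    finally show ?thesis .
  qed
  moreover have "0 < K'" using K C by (simp add: K'_def)
  moreover have "sigma_finite_measure (Y \<Otimes>\<^sub>M (lborel :: real measure))" "sigma_finite_measure (H \<Otimes>\<^sub>M (lborel :: real measure))"
    by (rule YL.sigma_finite_measure_axioms HL.sigma_finite_measure_axioms)+
  moreover have "(\<lambda>(p, k). \<psi> (fst p) (fst k) + snd p * snd k) \<in> borel_measurable ((Y \<Otimes>\<^sub>M lborel) \<Otimes>\<^sub>M (H \<Otimes>\<^sub>M lborel))"
    by measurable
  moreover have "(\<lambda>k. \<xi> (fst k)) \<in> borel_measurable (H \<Otimes>\<^sub>M (lborel :: real measure))"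
    "(\<lambda>k. \<phi> (fst k) + (snd k)\<^sup>2 * \<xi> (fst k)) \<in> borel_measurable (H \<Otimes>\<^sub>M lborel)"
    "(\<lambda>k. w (fst k) * \<bar>snd k\<bar> powr (1 - 2 / q)) \<in> borel_measurable (H \<Otimes>\<^sub>M lborel)" by measurable
  ultimately show ?thesis
    unfolding strichartz_system_def \<beta>_def using w
    by (intro conjI allI mult_nonneg_nonneg exI[of _ K'] impI) auto
qed

text \<open>Transverse coordinates are functions on an index set, so that their number can vary
  within an induction, which a fixed type \<open>real ^ 'm\<close> does not permit.\<close>

abbreviation line_space :: "'i set \<Rightarrow> (real \<times> ('i \<Rightarrow> real)) measure" where
  "line_space I \<equiv> lborel \<Otimes>\<^sub>M (\<Pi>\<^sub>M i\<in>I. lborel)"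

abbreviation line_pairing :: "'i set \<Rightarrow> real \<times> ('i \<Rightarrow> real) \<Rightarrow> real \<times> ('i \<Rightarrow> real) \<Rightarrow> real" where
  "line_pairing I \<equiv> (\<lambda>p k. fst p * fst k + (\<Sum>i\<in>I. snd p i * snd k i))"

abbreviation line_phase :: "'i set \<Rightarrow> real \<times> ('i \<Rightarrow> real) \<Rightarrow> real" where
  "line_phase I \<equiv> (\<lambda>k. fst k ^ 3 + fst k * (\<Sum>i\<in>I. (snd k i)\<^sup>2))"

abbreviation line_weight :: "'i set \<Rightarrow> real \<Rightarrow> real \<times> ('i \<Rightarrow> real) \<Rightarrow> real" where
  "line_weight J \<beta> \<equiv> (\<lambda>k. \<Prod>i\<in>J. \<bar>snd k i\<bar> powr \<beta>)"

interpretation lborel_PiM: product_sigma_finite "\<lambda>_ :: 'i. lborel :: real measure" ..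

lemma sigma_finite_line_space:
  assumes "finite I" shows "sigma_finite_measure (line_space I)"
proof -
  interpret pair_sigma_finite "lborel :: real measure" "\<Pi>\<^sub>M i\<in>I. (lborel :: real measure)"
    using lborel_PiM.sigma_finite[OF assms] by (simp add: pair_sigma_finite_def sigma_finite_lborel)
  show ?thesis by (rule sigma_finite_measure_axioms)
qed

lemma measurable_line:
  assumes "finite I" "J \<subseteq> I"
  shows "case_prod (line_pairing I) \<in> borel_measurable (line_space I \<Otimes>\<^sub>M line_space I)"
    "line_phase I \<in> borel_measurable (line_space I)"
    "line_weight J \<beta> \<in> borel_measurable (line_space I)"
    "fst \<in> borel_measurable (line_space I)"
proof -
  have c: "(\<lambda>k. snd k i) \<in> borel_measurable (line_space I)" if "i \<in> I" for i
  proof -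
    have "(\<lambda>f. f i) \<in> borel_measurable (\<Pi>\<^sub>M i\<in>I. (lborel :: real measure))"
      using measurable_component_singleton[OF that, of "\<lambda>_. lborel :: real measure"] by simp
    then show ?thesis by (rule measurable_compose[OF measurable_snd])
  qed
  have 1: "(\<lambda>x. snd (fst x) i) \<in> borel_measurable (line_space I \<Otimes>\<^sub>M line_space I)"
    "(\<lambda>x. snd (snd x) i) \<in> borel_measurable (line_space I \<Otimes>\<^sub>M line_space I)" if "i \<in> I" for i
    by (rule measurable_compose[OF measurable_fst c[OF that]], rule measurable_compose[OF measurable_snd c[OF that]])
  have f: "fst \<in> borel_measurable (line_space I)"
    using measurable_fst[of "lborel :: real measure"] by simp
  then show "fst \<in> borel_measurable (line_space I)" .
  have ff: "(\<lambda>x. fst (fst x)) \<in> borel_measurable (line_space I \<Otimes>\<^sub>M line_space I)"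
    "(\<lambda>x. fst (snd x)) \<in> borel_measurable (line_space I \<Otimes>\<^sub>M line_space I)"
    by (rule measurable_compose[OF measurable_fst f], rule measurable_compose[OF measurable_snd f])
  show "case_prod (line_pairing I) \<in> borel_measurable (line_space I \<Otimes>\<^sub>M line_space I)"
    unfolding case_prod_beta' by (intro borel_measurable_add borel_measurable_times borel_measurable_sum ff 1)
  show "line_phase I \<in> borel_measurable (line_space I)"
    by (intro borel_measurable_add borel_measurable_times borel_measurable_sum borel_measurable_power f c)
  show "line_weight J \<beta> \<in> borel_measurable (line_space I)"
    by (intro borel_measurable_prod powr_real_measurable borel_measurable_abs c borel_measurable_const) (use assms in auto)
qed

lemma line_space_insert:
  assumes I: "finite I" "i \<notin> I"
  shows "(\<lambda>p. (fst (fst p), (snd (fst p))(i := snd p))) \<in> line_space I \<Otimes>\<^sub>M lborel \<rightarrow>\<^sub>M line_space (insert i I)" (is "?T \<in> _")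
    and "line_space (insert i I) = distr (line_space I \<Otimes>\<^sub>M lborel) (line_space (insert i I)) (\<lambda>p. (fst (fst p), (snd (fst p))(i := snd p)))"
proof -
  show T: "?T \<in> line_space I \<Otimes>\<^sub>M lborel \<rightarrow>\<^sub>M line_space (insert i I)"
    by (intro measurable_Pair measurable_fun_upd[where J = I] measurable_compose[OF measurable_fst measurable_fst] measurable_compose[OF measurable_fst measurable_snd] measurable_snd) auto
  interpret P: sigma_finite_measure "\<Pi>\<^sub>M i\<in>I. (lborel :: real measure)" by (rule lborel_PiM.sigma_finite[OF I(1)])
  interpret Q: sigma_finite_measure "\<Pi>\<^sub>M i\<in>insert i I. (lborel :: real measure)" by (rule lborel_PiM.sigma_finite) (use I in simp)
  show "line_space (insert i I) = distr (line_space I \<Otimes>\<^sub>M lborel) (line_space (insert i I)) ?T"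
  proof (rule measure_eqI)
    fix A assume A: "A \<in> sets (line_space (insert i I))"
    have ind: "indicator A \<in> borel_measurable (line_space (insert i I))" "indicator A \<in> borel_measurable (distr (line_space I \<Otimes>\<^sub>M lborel) (line_space (insert i I)) ?T)"
      using A by auto
    have ind': "(\<lambda>p. indicator A (?T p) :: ennreal) \<in> borel_measurable (line_space I \<Otimes>\<^sub>M lborel)"
      by (rule measurable_compose[OF T ind(1)])
    have m1: "(\<lambda>p. \<integral>\<^sup>+z. indicator A (?T (p, z)) \<partial>lborel) \<in> borel_measurable (line_space I)"
      by (rule lborel.borel_measurable_nn_integral_fst[OF ind'])
    have ind_x: "(\<lambda>f. indicator A (x, f) :: ennreal) \<in> borel_measurable (\<Pi>\<^sub>M i\<in>insert i I. lborel)" for x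
      by (rule measurable_compose[OF _ ind(1)]) measurable
    have "emeasure (line_space (insert i I)) A = (\<integral>\<^sup>+p. indicator A p \<partial>line_space (insert i I))"
      using A by simp
    also have "\<dots> = (\<integral>\<^sup>+x. \<integral>\<^sup>+f. indicator A (x, f) \<partial>(\<Pi>\<^sub>M i\<in>insert i I. lborel) \<partial>lborel)"
      by (rule Q.nn_integral_fst[OF ind(1), symmetric])
    also have "\<dots> = (\<integral>\<^sup>+x. \<integral>\<^sup>+f. \<integral>\<^sup>+z. indicator A (x, f(i := z)) \<partial>lborel \<partial>(\<Pi>\<^sub>M i\<in>I. lborel) \<partial>lborel)"
      by (intro nn_integral_cong lborel_PiM.product_nn_integral_insert I ind_x)
    also have "\<dots> = (\<integral>\<^sup>+p. \<integral>\<^sup>+z. indicator A (?T (p, z)) \<partial>lborel \<partial>line_space I)"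
      using P.nn_integral_fst[OF m1] by simp
    also have "\<dots> = (\<integral>\<^sup>+p. indicator A (?T p) \<partial>(line_space I \<Otimes>\<^sub>M lborel))"
      by (rule lborel.nn_integral_fst[OF ind'])
    also have "\<dots> = (\<integral>\<^sup>+p. indicator A p \<partial>distr (line_space I \<Otimes>\<^sub>M lborel) (line_space (insert i I)) ?T)"
      by (rule nn_integral_distr[OF T ind(2), symmetric])
    also have "\<dots> = emeasure (distr (line_space I \<Otimes>\<^sub>M lborel) (line_space (insert i I)) ?T) A"
      using A by simp
    finally show "emeasure (line_space (insert i I)) A = emeasure (distr (line_space I \<Otimes>\<^sub>M lborel) (line_space (insert i I)) ?T) A" .
  qed simp
qed

text \<open>Points of the product over \<open>{i, j}\<close> are extensional functions, hence the
  base value \<open>undefined\<close> at all other indices.\<close>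

lemma line_space_pair:
  assumes ij: "i \<noteq> j"
  shows "(\<lambda>(x, y, z). (x, (\<lambda>_. undefined)(i := y, j := z))) \<in> lborel \<rightarrow>\<^sub>M line_space {i, j}" (is "?T \<in> _")
    and "line_space {i, j} = distr lborel (line_space {i, j}) (\<lambda>(x, y, z). (x, (\<lambda>_. undefined)(i := y, j := z)))"
proof -
  have "(\<lambda>_ _. undefined) \<in> lborel \<Otimes>\<^sub>M (lborel \<Otimes>\<^sub>M lborel) \<rightarrow>\<^sub>M (\<Pi>\<^sub>M i\<in>{}. lborel)"
    by (rule measurable_const) (simp add: space_PiM)
  then have "(\<lambda>p. (\<lambda>_. undefined)(i := fst (snd p))) \<in> lborel \<Otimes>\<^sub>M (lborel \<Otimes>\<^sub>M lborel) \<rightarrow>\<^sub>M (\<Pi>\<^sub>M i\<in>{i}. lborel)"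
    by (rule measurable_fun_upd[where J = "{}", rotated]) auto
  then have "(\<lambda>p. (\<lambda>_. undefined)(i := fst (snd p), j := snd (snd p))) \<in> lborel \<Otimes>\<^sub>M (lborel \<Otimes>\<^sub>M lborel) \<rightarrow>\<^sub>M (\<Pi>\<^sub>M i\<in>{i, j}. lborel)"
    by (rule measurable_fun_upd[where J = "{i}", rotated]) auto
  then have T': "?T \<in> lborel \<Otimes>\<^sub>M (lborel \<Otimes>\<^sub>M lborel) \<rightarrow>\<^sub>M line_space {i, j}"
    unfolding case_prod_beta' by (intro measurable_Pair measurable_fst)
  then show T: "?T \<in> lborel \<rightarrow>\<^sub>M line_space {i, j}" by (simp only: lborel_prod)
  interpret Q: sigma_finite_measure "\<Pi>\<^sub>M i\<in>{i, j}. (lborel :: real measure)" by (rule lborel_PiM.sigma_finite) simp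
  have L2: "sigma_finite_measure (lborel \<Otimes>\<^sub>M (lborel :: real measure))" unfolding lborel_prod by (rule sigma_finite_lborel)
  show "line_space {i, j} = distr lborel (line_space {i, j}) ?T"
  proof (rule measure_eqI)
    fix A assume A: "A \<in> sets (line_space {i, j})"
    have ind: "indicator A \<in> borel_measurable (line_space {i, j})" "indicator A \<in> borel_measurable (distr lborel (line_space {i, j}) ?T)"
      using A by auto
    have ind': "(\<lambda>p. indicator A (?T p) :: ennreal) \<in> borel_measurable (lborel \<Otimes>\<^sub>M (lborel \<Otimes>\<^sub>M lborel))"
      by (rule measurable_compose[OF T' ind(1)])
    have ind'_x: "(\<lambda>p. indicator A (?T (x, p)) :: ennreal) \<in> borel_measurable (lborel \<Otimes>\<^sub>M lborel)" for x
      by (rule measurable_compose[OF _ ind', where f = "\<lambda>p. (x, p)"]) simp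
    have ind_x: "(\<lambda>f. indicator A (x, f) :: ennreal) \<in> borel_measurable (\<Pi>\<^sub>M i\<in>{i, j}. lborel)" for x
      by (rule measurable_compose[OF _ ind(1)]) measurable
    have in_x: "(\<integral>\<^sup>+f. indicator A (x, f) \<partial>(\<Pi>\<^sub>M i\<in>{i, j}. lborel)) = (\<integral>\<^sup>+p. indicator A (?T (x, p)) \<partial>(lborel \<Otimes>\<^sub>M lborel))" for x
    proof -
      have s: "{i, j} = insert j {i}" by auto
      have m: "(\<lambda>f. indicator A (x, f) :: ennreal) \<in> borel_measurable (\<Pi>\<^sub>M i\<in>insert j {i}. lborel)"
        using ind_x by (simp only: s)
      have u: "(\<lambda>(f, z). f(j := z)) \<in> (\<Pi>\<^sub>M i\<in>{i}. (lborel :: real measure)) \<Otimes>\<^sub>M lborel \<rightarrow>\<^sub>M (\<Pi>\<^sub>M i\<in>insert j {i}. (lborel :: real measure))"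
        by (rule measurable_add_dim)
      have m2: "(\<lambda>f. \<integral>\<^sup>+z. indicator A (x, f(j := z)) \<partial>lborel) \<in> borel_measurable (\<Pi>\<^sub>M i\<in>insert i {}. (lborel :: real measure))"
        using lborel.borel_measurable_nn_integral_fst[OF measurable_compose[OF u m]] by simp
      have "(\<integral>\<^sup>+f. indicator A (x, f) \<partial>(\<Pi>\<^sub>M i\<in>{i, j}. lborel)) = (\<integral>\<^sup>+f. \<integral>\<^sup>+z. indicator A (x, f(j := z)) \<partial>lborel \<partial>(\<Pi>\<^sub>M i\<in>{i}. lborel))"
        unfolding s using ij by (intro lborel_PiM.product_nn_integral_insert m) auto
      also have "\<dots> = (\<integral>\<^sup>+f. \<integral>\<^sup>+y. \<integral>\<^sup>+z. indicator A (x, f(i := y, j := z)) \<partial>lborel \<partial>lborel \<partial>(\<Pi>\<^sub>M i\<in>{}. lborel))"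
        by (intro lborel_PiM.product_nn_integral_insert m2) auto
      also have "\<dots> = (\<integral>\<^sup>+y. \<integral>\<^sup>+z. indicator A (x, (\<lambda>_. undefined)(i := y, j := z)) \<partial>lborel \<partial>lborel)"
        by (rule lborel_PiM.nn_integral_empty) simp
      also have "\<dots> = (\<integral>\<^sup>+p. indicator A (?T (x, p)) \<partial>(lborel \<Otimes>\<^sub>M lborel))"
        using lborel.nn_integral_fst[OF ind'_x[of x]] by simp
      finally show ?thesis .
    qed
    have "emeasure (line_space {i, j}) A = (\<integral>\<^sup>+p. indicator A p \<partial>line_space {i, j})"
      using A by simp
    also have "\<dots> = (\<integral>\<^sup>+x. \<integral>\<^sup>+f. indicator A (x, f) \<partial>(\<Pi>\<^sub>M i\<in>{i, j}. lborel) \<partial>lborel)"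
      by (rule Q.nn_integral_fst[OF ind(1), symmetric])
    also have "\<dots> = (\<integral>\<^sup>+p. indicator A (?T p) \<partial>(lborel \<Otimes>\<^sub>M (lborel \<Otimes>\<^sub>M lborel)))"
      unfolding in_x by (rule sigma_finite_measure.nn_integral_fst[OF L2 ind'])
    also have "\<dots> = (\<integral>\<^sup>+p. indicator A (?T p) \<partial>lborel)" by (simp only: lborel_prod)
    also have "\<dots> = (\<integral>\<^sup>+p. indicator A p \<partial>distr lborel (line_space {i, j}) ?T)"
      by (rule nn_integral_distr[OF T ind(2), symmetric])
    also have "\<dots> = emeasure (distr lborel (line_space {i, j}) ?T) A"
      using A by simp
    finally show "emeasure (line_space {i, j}) A = emeasure (distr lborel (line_space {i, j}) ?T) A" .
  qed simp
qed

text \<open>Both measures agree on boxes, which determine \<open>lborel\<close>.\<close>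

lemma lborel_vec_eq_distr_PiM:
  shows "vec_lambda \<in> (\<Pi>\<^sub>M i\<in>UNIV. (lborel :: real measure)) \<rightarrow>\<^sub>M (borel :: (real ^ 'm) measure)"
    and "(lborel :: (real ^ 'm) measure) = distr (\<Pi>\<^sub>M i\<in>UNIV. lborel) borel vec_lambda"
proof -
  have c: "(\<lambda>f. f i) \<in> borel_measurable (\<Pi>\<^sub>M i\<in>UNIV. (lborel :: real measure))" for i :: 'm
    using measurable_component_singleton[of i UNIV "\<lambda>_. lborel :: real measure"] by simp
  show V: "vec_lambda \<in> (\<Pi>\<^sub>M i\<in>UNIV. (lborel :: real measure)) \<rightarrow>\<^sub>M (borel :: (real ^ 'm) measure)"
    unfolding borel_measurable_euclidean_space[where f = vec_lambda]
    by (auto simp: Basis_vec_def inner_axis c)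
  show "(lborel :: (real ^ 'm) measure) = distr (\<Pi>\<^sub>M i\<in>UNIV. lborel) borel vec_lambda"
  proof (rule lborel_eqI)
    fix l u :: "real ^ 'm" assume le: "\<And>b. b \<in> Basis \<Longrightarrow> l \<bullet> b \<le> u \<bullet> b"
    have le': "l $ i \<le> u $ i" for i
      using le[of "axis i 1"] by (auto simp: Basis_vec_def inner_axis)
    have "vec_lambda -` box l u \<inter> space (\<Pi>\<^sub>M i\<in>UNIV. (lborel :: real measure)) = (\<Pi>\<^sub>E i\<in>UNIV. {l $ i<..<u $ i})"
      by (auto simp: space_PiM mem_box_cart PiE_iff)
    then have "emeasure (distr (\<Pi>\<^sub>M i\<in>UNIV. lborel) borel vec_lambda) (box l u) = emeasure (\<Pi>\<^sub>M i\<in>UNIV. lborel) (\<Pi>\<^sub>E i\<in>UNIV. {l $ i<..<u $ i})"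
      using V by (subst emeasure_distr) auto
    also have "\<dots> = (\<Prod>i\<in>UNIV. emeasure lborel {l $ i<..<u $ i})"
      by (rule lborel_PiM.emeasure_PiM) auto
    also have "\<dots> = ennreal (\<Prod>i\<in>UNIV. u $ i - l $ i)"
      using le' by (simp add: prod_ennreal)
    also have "(\<Prod>i\<in>UNIV. u $ i - l $ i) = (\<Prod>b\<in>Basis. (u - l) \<bullet> b)"
    proof -
      have B: "(Basis :: (real ^ 'm) set) = (\<lambda>i. axis i 1) ` UNIV" by (auto simp: Basis_vec_def)
      have "inj (\<lambda>i :: 'm. axis i (1 :: real))" by (auto intro!: injI simp: axis_eq_axis)
      then show ?thesis unfolding B by (simp add: prod.reindex inner_axis)
    qed
    finally show "emeasure (distr (\<Pi>\<^sub>M i\<in>UNIV. lborel) borel vec_lambda) (box l u) = ennreal (\<Prod>b\<in>Basis. (u - l) \<bullet> b)" .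
  qed simp
qed

lemma lborel_eq_distr_line_space:
  shows "map_prod id vec_lambda \<in> line_space UNIV \<rightarrow>\<^sub>M (lborel :: (real \<times> (real ^ 'm)) measure)"
    and "(lborel :: (real \<times> (real ^ 'm)) measure) = distr (line_space UNIV) lborel (map_prod id vec_lambda)"
proof -
  note V = lborel_vec_eq_distr_PiM[where 'm = 'm]
  have V1: "vec_lambda \<in> (\<Pi>\<^sub>M i\<in>UNIV. (lborel :: real measure)) \<rightarrow>\<^sub>M (lborel :: (real ^ 'm) measure)" using V(1) by simp
  have s: "sets (lborel \<Otimes>\<^sub>M (lborel :: (real ^ 'm) measure)) = sets (lborel :: (real \<times> (real ^ 'm)) measure)" by (simp only: lborel_prod)
  show "map_prod id vec_lambda \<in> line_space UNIV \<rightarrow>\<^sub>M (lborel :: (real \<times> (real ^ 'm)) measure)"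
    unfolding map_prod_def case_prod_beta' id_def measurable_cong_sets[OF refl s[symmetric]]
    by (intro measurable_Pair measurable_fst measurable_compose[OF measurable_snd V1])
  have V2: "(lborel :: (real ^ 'm) measure) = distr (\<Pi>\<^sub>M i\<in>UNIV. lborel) lborel vec_lambda"
    using V(2) by (metis distr_cong sets_lborel)
  have "(lborel :: (real \<times> (real ^ 'm)) measure) = lborel \<Otimes>\<^sub>M lborel" by (simp only: lborel_prod)
  also have "\<dots> = distr lborel lborel id \<Otimes>\<^sub>M distr (\<Pi>\<^sub>M i\<in>UNIV. lborel) (lborel :: (real ^ 'm) measure) vec_lambda"
    by (simp only: V2[symmetric] id_def distr_id)
  also have "\<dots> = distr (line_space UNIV) (lborel \<Otimes>\<^sub>M lborel) (\<lambda>(x, y). (id x, vec_lambda y))"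
  proof (rule pair_measure_distr)
    show "sigma_finite_measure (distr (\<Pi>\<^sub>M i\<in>UNIV. lborel) (lborel :: (real ^ 'm) measure) vec_lambda)"
      by (simp only: V2[symmetric] sigma_finite_lborel)
  qed (use V1 in auto)
  also have "\<dots> = distr (line_space UNIV) lborel (map_prod id vec_lambda)"
    by (simp only: lborel_prod map_prod_def)
  finally show "(lborel :: (real \<times> (real ^ 'm)) measure) = distr (line_space UNIV) lborel (map_prod id vec_lambda)" .
qed

text \<open>
  The coordinates \<open>i, j\<close> are the transverse variables of the three-dimensional estimate and carry no weight.
\<close>

lemma strichartz_system_line_space:
  assumes q: "2 < q" and r: "2 < r" and qr: "1 / q + 1 / r = 1 / 2" and ij: "i \<noteq> j"
    and J: "finite J" "i \<notin> J" "j \<notin> J"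
  shows "strichartz_system r q (line_space (J \<union> {i, j})) (line_space (J \<union> {i, j}))
    (line_pairing (J \<union> {i, j})) fst (line_phase (J \<union> {i, j})) (line_weight J (1 - 2 / q))"
  using J
proof (induction J rule: finite_induct)
  case empty
  \<comment> \<open>The parameter of \<open>zk_Strichartz_sharp\<close> becomes that of
    \<open>flow_on\<close>, so the phase of the system is taken at
    \<open>\<theta> = 0\<close>.\<close>
  have sys: "strichartz_system r q lborel lborel (\<bullet>) fst (zk_phase 0) (\<lambda>_. 1)"
  proof -
    obtain K where K: "0 < K" and bd: "\<And>\<theta> g. integrable lborel g \<Longrightarrow>
       (\<integral>\<^sup>+t. ennreal_pow (\<integral>\<^sup>+x. ennreal (norm (zk_flow \<theta> g t x) powr q) \<partial>lborel) (r / q) \<partial>lborel)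
       \<le> ennreal K * ennreal_pow (\<integral>\<^sup>+\<zeta>. ennreal ((norm (g \<zeta>))\<^sup>2) \<partial>lborel) (r / 2)"
      using zk_Strichartz_sharp[OF q r qr] by auto
    have ph: "zk_phase 0 \<zeta> + \<theta> * fst \<zeta> = zk_phase \<theta> \<zeta>" for \<theta> \<zeta> by (simp add: zk_phase_def case_prod_beta)
    have fl: "flow_on lborel (\<bullet>) fst (zk_phase 0) \<theta> g t x = zk_flow \<theta> g t x" for \<theta> g t x
      unfolding flow_on_def zk_flow_def osc_def ph by (simp add: cis_mult mult.assoc[symmetric])
    have "case_prod (\<bullet>) \<in> borel_measurable (lborel \<Otimes>\<^sub>M (lborel :: (real \<times> real \<times> real) measure))"
      unfolding case_prod_beta' by measurable
    moreover have "zk_phase 0 \<in> borel_measurable lborel" "fst \<in> borel_measurable (lborel :: (real \<times> real \<times> real) measure)"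
      by (simp_all add: borel_measurable_continuous_onI continuous_on_fst)
    ultimately show ?thesis
      unfolding strichartz_system_def fl mult_1 using K bd sigma_finite_lborel
      by (intro conjI allI exI[of _ K] impI) simp_all
  qed
  have U: "{} \<union> {i, j} = {i, j}" by simp
  show ?case unfolding U
  proof (rule strichartz_system_distr[OF sys line_space_pair(1)[OF ij] line_space_pair(1)[OF ij] _ line_space_pair(2)[OF ij] _ line_space_pair(2)[OF ij]])
    show "sigma_finite_measure (line_space {i, j})" "sigma_finite_measure (line_space {i, j})"
      by (rule sigma_finite_line_space, simp)+
  qed (use ij in \<open>auto intro!: measurable_line simp: zk_phase_def\<close>)
next
  case (insert m J)
  have m: "m \<notin> J \<union> {i, j}" and f: "finite (J \<union> {i, j})" using insert by auto
  have U: "insert m J \<union> {i, j} = insert m (J \<union> {i, j})" by auto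
  have sys: "strichartz_system r q (line_space (J \<union> {i, j})) (line_space (J \<union> {i, j}))
    (line_pairing (J \<union> {i, j})) fst (line_phase (J \<union> {i, j})) (line_weight J (1 - 2 / q))"
    using insert by simp
  note T = line_space_insert[OF f m]
  have e: "(\<Sum>l\<in>J \<union> {i, j}. (if l = m then a else x l) * (if l = m then b else y l)) = (\<Sum>l\<in>J \<union> {i, j}. x l * y l)"
    "(\<Sum>l\<in>J \<union> {i, j}. (if l = m then a else x l)\<^sup>2) = (\<Sum>l\<in>J \<union> {i, j}. (x l)\<^sup>2)"
    "(\<Prod>l\<in>J. \<bar>if l = m then a else x l\<bar> powr \<beta>) = (\<Prod>l\<in>J. \<bar>x l\<bar> powr \<beta>)" for a b \<beta> :: real and x y
    using m by (auto intro!: sum.cong prod.cong)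
  show ?case unfolding U
  proof (rule strichartz_system_distr[OF strichartz_system_tensor[OF sys q r] T(1) T(1) _ T(2) _ T(2)])
    show "sigma_finite_measure (line_space (insert m (J \<union> {i, j})))" "sigma_finite_measure (line_space (insert m (J \<union> {i, j})))"
      by (rule sigma_finite_line_space, use f in simp)+
  next
    fix y h :: "(real \<times> ('a \<Rightarrow> real)) \<times> real"
    show "line_pairing (insert m (J \<union> {i, j})) (fst (fst y), (snd (fst y))(m := snd y)) (fst (fst h), (snd (fst h))(m := snd h))
      = line_pairing (J \<union> {i, j}) (fst y) (fst h) + snd y * snd h"
      using m f by (simp only: sum.insert fun_upd_apply e fst_conv snd_conv simp_thms if_True not_False_eq_True)
    show "line_phase (insert m (J \<union> {i, j})) (fst (fst h), (snd (fst h))(m := snd h))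
      = line_phase (J \<union> {i, j}) (fst h) + (snd h)\<^sup>2 * fst (fst h)"
      using m f by (simp only: sum.insert fun_upd_apply e fst_conv snd_conv simp_thms if_True not_False_eq_True) (simp add: algebra_simps)
    show "line_weight (insert m J) (1 - 2 / q) (fst (fst h), (snd (fst h))(m := snd h))
      = line_weight J (1 - 2 / q) (fst h) * \<bar>snd h\<bar> powr (1 - 2 / q)"
      using insert.hyps by (simp only: prod.insert fun_upd_apply e fst_conv snd_conv simp_thms if_True not_False_eq_True) simp
  qed (use f in \<open>auto intro!: measurable_line prod_nonneg\<close>)
qed

subsection \<open>Interpolation with Sobolev embedding\<close>

text \<open>
  Here \<open>\<Phi> g t\<close> is the \<open>q\<close>-th power of the \<open>L\<^sup>q\<close> norm in space at time \<open>t\<close>.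
\<close>

lemma interpolate_endpoint_estimates:
  fixes \<Phi> :: "('z \<Rightarrow> complex) \<Rightarrow> 't \<Rightarrow> ennreal" and m :: "'z \<Rightarrow> real"
  assumes T: "sigma_finite_measure T" and Z: "sigma_finite_measure Z"
    and m [measurable]: "m \<in> borel_measurable Z" and m0: "\<And>z. 0 \<le> m z"
    and q: "2 < q" and r: "2 \<le> r\<^sub>0" "r\<^sub>0 < r" and Cs: "0 \<le> Cs" and K: "0 < K"
    and a: "a = \<sigma> + 2 * \<kappa>" and c: "\<sigma> = c + \<kappa> * (2 * (r - r\<^sub>0) / r\<^sub>0)"
    and meas: "\<And>g. integrable Z g \<Longrightarrow> \<Phi> g \<in> borel_measurable T"
    and tri: "\<And>f g t. integrable Z f \<Longrightarrow> integrable Z g \<Longrightarrow> \<Phi> (\<lambda>z. f z + g z) t \<le> ennreal (2 powr q) * (\<Phi> f t + \<Phi> g t)"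
    and sup: "\<And>g t. integrable Z g \<Longrightarrow> \<Phi> g t \<le> ennreal Cs * ennreal_pow (\<integral>\<^sup>+z. ennreal (m z powr a * (norm (g z))\<^sup>2) \<partial>Z) (q / 2)"
    and endp: "\<And>g. integrable Z g \<Longrightarrow> (\<integral>\<^sup>+t. ennreal_pow (\<Phi> g t) (r\<^sub>0 / q) \<partial>T)
      \<le> ennreal K * ennreal_pow (\<integral>\<^sup>+z. ennreal (m z powr c * (norm (g z))\<^sup>2) \<partial>Z) (r\<^sub>0 / 2)"
  shows "\<exists>C>0. \<forall>g. integrable Z g \<longrightarrow> (\<integral>\<^sup>+t. ennreal_pow (\<Phi> g t) (r / q) \<partial>T)
      \<le> ennreal C * ennreal_pow (\<integral>\<^sup>+z. ennreal (m z powr \<sigma> * (norm (g z))\<^sup>2) \<partial>Z) (r / 2)"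
proof -
  \<comment> \<open>On the level set, \<open>\<Phi>\<close> of the high part is at least
    \<open>l powr q * 2 powr (- (q + 1))\<close>; \<open>C0\<close> compensates the factor of 2
    after raising this to the power \<open>r\<^sub>0 / q\<close>.\<close>
  define C0 where "C0 = 2 powr ((q + 1) * (r\<^sub>0 / q))"
  \<comment> \<open>\<open>c1 powr q\<close> absorbs the constant \<open>2 powr q\<close> of the
    triangle inequality and the Sobolev constant, so that the low part accounts for at most half of
    \<open>l powr q\<close>.\<close>
  define c1 where "c1 = 2 * (2 * (Cs + 1)) powr (1 / q)"
  define C where "C = C0 * K * r / (r - r\<^sub>0) * c1 powr (r - r\<^sub>0)"
  have c1: "0 < c1" "c1 powr q = 2 powr q * (2 * (Cs + 1))"
    using Cs q by (simp_all add: c1_def powr_mult powr_powr)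
  have C0: "0 < C0" by (simp add: C0_def)
  have C: "0 < C" using C0 K r c1 by (simp add: C_def)
  have "(\<integral>\<^sup>+t. ennreal_pow (\<Phi> g t) (r / q) \<partial>T)
      \<le> ennreal C * ennreal_pow (\<integral>\<^sup>+z. ennreal (m z powr \<sigma> * (norm (g z))\<^sup>2) \<partial>Z) (r / 2)" (is "?L \<le> _ * ennreal_pow ?S _")
    if g: "integrable Z g" for g
  proof -
    have [measurable]: "g \<in> borel_measurable Z" using g by auto
    consider "?S = 0" | "?S = top" | S' where "0 < S'" "?S = ennreal S'"
      by (cases ?S) (force simp: less_eq_real_def)+
    then show ?thesis
    proof cases
      case 1
      have "AE z in Z. ennreal (m z powr \<sigma> * (norm (g z))\<^sup>2) = 0"
        using 1 by (subst (asm) nn_integral_0_iff_AE) auto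
      \<comment> \<open>Since \<open>a = \<sigma> + 2 * \<kappa>\<close>, the weight
        \<open>m powr a\<close> vanishes wherever \<open>m powr \<sigma>\<close> does; then
        \<open>sup\<close> forces \<open>\<Phi> g\<close> to vanish.\<close>
      then have "AE z in Z. ennreal (m z powr a * (norm (g z))\<^sup>2) = 0"
        by eventually_elim (auto simp: a powr_add)
      then have "(\<integral>\<^sup>+z. ennreal (m z powr a * (norm (g z))\<^sup>2) \<partial>Z) = 0"
        by (subst nn_integral_0_iff_AE) auto
      then have "\<Phi> g t = 0" for t using sup[OF g, of t] by simp
      then show ?thesis by simp
    next
      case 2
      then show ?thesis using C by (simp add: ennreal_mult_top)
    next
      case (3 S')
      \<comment> \<open>On low frequencies \<open>m z powr \<kappa> \<le> l / Kc\<close>, and the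
        hypothesis on \<open>a\<close> exchanges two such factors for \<open>(l / Kc)^2\<close>. The
        hypothesis on \<open>c\<close> makes \<open>m powr c\<close> times the weight returned by
        the level set lemma a multiple of \<open>m powr \<sigma>\<close>.\<close>
      define Kc where "Kc = c1 * sqrt S'"
      define b where "b z = Kc * m z powr \<kappa>" for z
      define h where "h z = ennreal (m z powr c * (norm (g z))\<^sup>2)" for z
      have Kc: "0 < Kc" "Kc\<^sup>2 = c1\<^sup>2 * S'" using 3 c1 by (simp_all add: Kc_def power_mult_distrib)
      have [measurable]: "b \<in> borel_measurable Z" "h \<in> borel_measurable Z" unfolding b_def h_def by measurable
      have lev: "emeasure T {t \<in> space T. ennreal l < ennreal_pow (\<Phi> g t) (1 / q)}
        \<le> ennreal (C0 * K * l powr (- r\<^sub>0)) * ennreal_pow (\<integral>\<^sup>+z. h z * indicator {z. l \<le> b z} z \<partial>Z) (r\<^sub>0 / 2)" if l: "0 < l" for l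
      proof -
        define lo where "lo z = (if l \<le> b z then 0 else g z)" for z
        define hi where "hi z = (if l \<le> b z then g z else 0)" for z
        have [measurable]: "lo \<in> borel_measurable Z" "hi \<in> borel_measurable Z" unfolding lo_def hi_def by measurable
        have lo: "integrable Z lo" and hi: "integrable Z hi"
          by (rule Bochner_Integration.integrable_bound[OF g]; simp add: lo_def hi_def)+
        have gs: "g = (\<lambda>z. lo z + hi z)" by (auto simp: lo_def hi_def)
        have "(\<integral>\<^sup>+z. ennreal (m z powr a * (norm (lo z))\<^sup>2) \<partial>Z) \<le> (\<integral>\<^sup>+z. ennreal ((l / Kc)\<^sup>2) * ennreal (m z powr \<sigma> * (norm (g z))\<^sup>2) \<partial>Z)"
        proof (rule nn_integral_mono)
          fix z
          show "ennreal (m z powr a * (norm (lo z))\<^sup>2) \<le> ennreal ((l / Kc)\<^sup>2) * ennreal (m z powr \<sigma> * (norm (g z))\<^sup>2)"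
          proof (cases "l \<le> b z")
            case False
            then have "m z powr \<kappa> \<le> l / Kc" using Kc(1) by (simp add: b_def field_simps)
            then have "(m z powr \<kappa>)\<^sup>2 \<le> (l / Kc)\<^sup>2" by (intro power_mono) auto
            moreover have "m z powr a = m z powr \<sigma> * (m z powr \<kappa>)\<^sup>2"
              unfolding a mult_2 powr_add power2_eq_square ..
            ultimately have "m z powr a * (norm (lo z))\<^sup>2 \<le> (m z powr \<sigma> * (l / Kc)\<^sup>2) * (norm (g z))\<^sup>2"
              using False by (simp add: lo_def mult_left_mono mult_right_mono)
            then show ?thesis by (subst ennreal_mult[symmetric]) (auto intro!: ennreal_leI simp: mult_ac)
          qed (simp add: lo_def)
        qed
        also have "\<dots> = ennreal ((l / Kc)\<^sup>2) * ennreal S'"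
          unfolding 3(2)[symmetric] by (rule nn_integral_cmult) measurable
        also have "\<dots> = ennreal ((l / c1)\<^sup>2)"
          using 3(1) c1 by (simp add: Kc power_divide flip: ennreal_mult)
        finally have "ennreal_pow (\<integral>\<^sup>+z. ennreal (m z powr a * (norm (lo z))\<^sup>2) \<partial>Z) (q / 2) \<le> ennreal_pow (ennreal ((l / c1)\<^sup>2)) (q / 2)"
          using q by (intro ennreal_pow_mono) auto
        also have "\<dots> = ennreal ((l / c1) powr q)"
          using l c1 q by (simp add: ennreal_pow_ennreal powr_powr flip: powr_numeral)
        finally have lo_q: "ennreal_pow (\<integral>\<^sup>+z. ennreal (m z powr a * (norm (lo z))\<^sup>2) \<partial>Z) (q / 2) \<le> ennreal ((l / c1) powr q)" .
        have \<Phi>lo: "\<Phi> lo t \<le> ennreal (Cs * (l / c1) powr q)" for t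
          using order_trans[OF sup[OF lo, of t] mult_left_mono[OF lo_q]] Cs by (simp add: ennreal_mult)
        have small: "2 powr q * (Cs * (l / c1) powr q) \<le> l powr q / 2"
        proof -
          have "(l / c1) powr q = l powr q / (2 powr q * (2 * (Cs + 1)))"
            using l c1 by (simp add: powr_divide)
          then have "2 powr q * (Cs * (l / c1) powr q) = Cs / (Cs + 1) * (l powr q / 2)" by simp
          also have "\<dots> \<le> 1 * (l powr q / 2)" using Cs by (intro mult_right_mono) auto
          finally show ?thesis by simp
        qed
        have \<Phi>hi: "1 \<le> ennreal (C0 * l powr (- r\<^sub>0)) * ennreal_pow (\<Phi> hi t) (r\<^sub>0 / q)" if t: "ennreal l < ennreal_pow (\<Phi> g t) (1 / q)" for t
        proof -
          have "\<not> \<Phi> g t \<le> ennreal_pow (ennreal l) q"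
          proof
            assume "\<Phi> g t \<le> ennreal_pow (ennreal l) q"
            then have "ennreal_pow (\<Phi> g t) (1 / q) \<le> ennreal l"
              using q by (subst ennreal_pow_le_iff) auto
            with t show False by simp
          qed
          then have "ennreal (l powr q) < \<Phi> g t" using l by (simp add: ennreal_pow_ennreal not_le)
          also have "\<dots> \<le> ennreal (2 powr q) * (\<Phi> lo t + \<Phi> hi t)"
            using tri[OF lo hi, of t] by (simp only: gs[symmetric])
          also have "\<dots> \<le> ennreal (2 powr q) * (ennreal (Cs * (l / c1) powr q) + \<Phi> hi t)"
            by (intro mult_left_mono add_right_mono \<Phi>lo) auto
          finally have *: "ennreal (l powr q) < ennreal (2 powr q) * (ennreal (Cs * (l / c1) powr q) + \<Phi> hi t)" .
          have **: "ennreal (l powr q * 2 powr (- (q + 1))) \<le> \<Phi> hi t"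
          proof (cases "\<Phi> hi t")
            case (real x)
            have "l powr q < 2 powr q * (Cs * (l / c1) powr q + x)"
              using * real Cs by (simp add: ennreal_less_iff flip: ennreal_plus ennreal_mult)
            also have "\<dots> \<le> l powr q / 2 + 2 powr q * x" using small by (simp add: distrib_left)
            finally have "l powr q / 2 / 2 powr q \<le> x" by (simp add: field_simps)
            moreover have "(2::real) powr (- (q + 1)) = inverse (2 powr q * 2)"
              unfolding powr_minus powr_add by simp
            then have "l powr q * 2 powr (- (q + 1)) = l powr q / 2 / 2 powr q"
              by (simp add: field_simps)
            ultimately show ?thesis using real by (simp add: ennreal_leI)
          qed simp
          have "q * (r\<^sub>0 / q) = r\<^sub>0" "- (q + 1) * (r\<^sub>0 / q) = - ((q + 1) * (r\<^sub>0 / q))"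
            using q by (simp, intro mult_minus_left)
          then have "(l powr q * 2 powr (- (q + 1))) powr (r\<^sub>0 / q) = l powr r\<^sub>0 * inverse C0"
            by (simp only: powr_mult powr_powr C0_def powr_minus[symmetric])
          then have "ennreal (l powr r\<^sub>0 * inverse C0) = ennreal_pow (ennreal (l powr q * 2 powr (- (q + 1)))) (r\<^sub>0 / q)"
            by (simp add: ennreal_pow_ennreal)
          also have "\<dots> \<le> ennreal_pow (\<Phi> hi t) (r\<^sub>0 / q)"
            using ** q r by (intro ennreal_pow_mono) auto
          finally have "ennreal (C0 * l powr (- r\<^sub>0)) * ennreal (l powr r\<^sub>0 * inverse C0) \<le> ennreal (C0 * l powr (- r\<^sub>0)) * ennreal_pow (\<Phi> hi t) (r\<^sub>0 / q)"
            by (rule mult_left_mono) simp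
          moreover have "C0 * l powr (- r\<^sub>0) * (l powr r\<^sub>0 * inverse C0) = 1"
            using C0 l by (simp add: powr_minus field_simps)
          ultimately show ?thesis using C0 by (simp flip: ennreal_mult)
        qed
        have [measurable]: "\<Phi> hi \<in> borel_measurable T" "\<Phi> g \<in> borel_measurable T" using meas g hi by auto
        have "emeasure T {t \<in> space T. ennreal l < ennreal_pow (\<Phi> g t) (1 / q)}
          \<le> emeasure T {t \<in> space T. 1 \<le> ennreal (C0 * l powr (- r\<^sub>0)) * ennreal_pow (\<Phi> hi t) (r\<^sub>0 / q)}"
          by (rule emeasure_mono) (use \<Phi>hi in auto)
        also have "\<dots> \<le> ennreal (C0 * l powr (- r\<^sub>0)) * (\<integral>\<^sup>+t. ennreal_pow (\<Phi> hi t) (r\<^sub>0 / q) * indicator (space T) t \<partial>T)"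
          by (rule nn_integral_Markov_inequality) measurable
        also have "(\<integral>\<^sup>+t. ennreal_pow (\<Phi> hi t) (r\<^sub>0 / q) * indicator (space T) t \<partial>T) = (\<integral>\<^sup>+t. ennreal_pow (\<Phi> hi t) (r\<^sub>0 / q) \<partial>T)"
          by (rule nn_integral_cong) simp
        also have "ennreal (C0 * l powr (- r\<^sub>0)) * \<dots> \<le> ennreal (C0 * l powr (- r\<^sub>0)) * (ennreal K * ennreal_pow (\<integral>\<^sup>+z. ennreal (m z powr c * (norm (hi z))\<^sup>2) \<partial>Z) (r\<^sub>0 / 2))"
          by (intro mult_left_mono endp hi) simp
        also have "(\<integral>\<^sup>+z. ennreal (m z powr c * (norm (hi z))\<^sup>2) \<partial>Z) = (\<integral>\<^sup>+z. h z * indicator {z. l \<le> b z} z \<partial>Z)"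
          by (rule nn_integral_cong) (simp add: hi_def h_def)
        also have "ennreal (C0 * l powr (- r\<^sub>0)) * (ennreal K * I) = ennreal (C0 * K * l powr (- r\<^sub>0)) * I" for I
          using K C0 by (simp add: ennreal_mult mult_ac)
        finally show ?thesis .
      qed
      define e where "e = 2 * (r - r\<^sub>0) / r\<^sub>0"
      \<comment> \<open>The level set lemma is applied to the norm itself, with
        \<open>r\<^sub>0\<close> and \<open>r\<close> in the places of \<open>p\<close> and
        \<open>q\<close>.\<close>
      have "?L = (\<integral>\<^sup>+t. ennreal_pow (ennreal_pow (\<Phi> g t) (1 / q)) r \<partial>T)"
        using q r by (simp add: ennreal_pow_pow)
      also have "\<dots> \<le> ennreal (C0 * K * r / (r - r\<^sub>0)) * ennreal_pow (\<integral>\<^sup>+z. h z * ennreal (b z powr e) \<partial>Z) (r\<^sub>0 / 2)"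
        unfolding e_def
        by (rule nn_integral_level_sets[OF T Z _ _ _ r _ _ lev])
          (use C0 K Kc(1) meas[OF g] in \<open>auto simp: b_def\<close>)
      also have "(\<integral>\<^sup>+z. h z * ennreal (b z powr e) \<partial>Z) = (\<integral>\<^sup>+z. ennreal (Kc powr e) * ennreal (m z powr \<sigma> * (norm (g z))\<^sup>2) \<partial>Z)"
      proof (rule nn_integral_cong)
        fix z
        have "\<sigma> = c + \<kappa> * e" unfolding c e_def ..
        then have "m z powr c * (norm (g z))\<^sup>2 * b z powr e = Kc powr e * (m z powr \<sigma> * (norm (g z))\<^sup>2)"
          using Kc(1) by (simp add: b_def powr_add powr_mult powr_powr)
        then show "h z * ennreal (b z powr e) = ennreal (Kc powr e) * ennreal (m z powr \<sigma> * (norm (g z))\<^sup>2)"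
          unfolding h_def by (simp only: ennreal_mult[symmetric] mult_nonneg_nonneg powr_ge_zero zero_le_power2)
      qed
      also have "\<dots> = ennreal (Kc powr e) * ennreal S'"
        unfolding 3(2)[symmetric] by (rule nn_integral_cmult) measurable
      also have "ennreal (C0 * K * r / (r - r\<^sub>0)) * ennreal_pow (ennreal (Kc powr e) * ennreal S') (r\<^sub>0 / 2) = ennreal C * ennreal_pow (ennreal S') (r / 2)"
      proof -
        have e2: "e * (r\<^sub>0 / 2) = r - r\<^sub>0" using r by (simp add: e_def)
        have s2: "S' powr (r / 2) = S' powr ((r - r\<^sub>0) / 2) * S' powr (r\<^sub>0 / 2)"
          unfolding powr_add[symmetric] by (simp add: field_simps)
        have "sqrt S' = S' powr (1 / 2)" using 3(1) by (simp add: powr_half_sqrt)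
        then have "Kc powr (r - r\<^sub>0) = c1 powr (r - r\<^sub>0) * S' powr ((r - r\<^sub>0) / 2)"
          using 3(1) c1 by (simp add: Kc_def powr_mult powr_powr)
        then have "C0 * K * r / (r - r\<^sub>0) * (Kc powr e * S') powr (r\<^sub>0 / 2) = C * S' powr (r / 2)"
          unfolding powr_mult powr_powr e2 C_def s2 by simp
        then show ?thesis
          using 3(1) C C0 K r by (simp add: ennreal_pow_ennreal flip: ennreal_mult)
      qed
      also have "ennreal C * ennreal_pow (ennreal S') (r / 2) = ennreal C * ennreal_pow ?S (r / 2)" using 3 by simp
      finally show ?thesis .
    qed
  qed
  then show ?thesis using C by auto
qed

subsection \<open>The Strichartz estimate in all dimensions\<close>

definition zk_symbol :: "real \<times> (real ^ 'm) \<Rightarrow> real" where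
  "zk_symbol \<zeta> = fst \<zeta> * ((fst \<zeta>)\<^sup>2 + (norm (snd \<zeta>))\<^sup>2)"

definition zk_evolution :: "(real \<times> (real ^ 'm) \<Rightarrow> complex) \<Rightarrow> real \<Rightarrow> real \<times> (real ^ 'm) \<Rightarrow> complex" where
  "zk_evolution g t = osc (\<lambda>\<zeta>. cis (t * zk_symbol \<zeta>) * g \<zeta>)"

lemma zk_symbol_measurable [measurable]: "zk_symbol \<in> borel_measurable borel"
  unfolding zk_symbol_def by (intro borel_measurable_continuous_onI continuous_intros)

lemma zk_evolution_power_measurable:
  assumes [measurable]: "g \<in> borel_measurable borel"
  shows "(\<lambda>t. \<integral>\<^sup>+x. ennreal (norm (zk_evolution g t x) powr q) \<partial>lborel) \<in> borel_measurable lborel"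
  unfolding zk_evolution_def osc_def by measurable

text \<open>Two transverse coordinates take the part of \<open>\<eta>\<close> and
  \<open>\<kappa>\<close> of the three-dimensional estimate. The other \<open>CARD('m) - 2\<close>
  carry a weight each, and every coordinate is bounded by the norm.\<close>

lemma zk_Strichartz_line:
  assumes q: "2 < q" and r: "2 < r" and qr: "1 / q + 1 / r = 1 / 2" and card: "2 \<le> CARD('m::finite)"
  shows "\<exists>K>0. \<forall>g. integrable lborel g \<longrightarrow>
    (\<integral>\<^sup>+t. ennreal_pow (\<integral>\<^sup>+x. ennreal (norm (zk_evolution g t x) powr q) \<partial>lborel) (r / q) \<partial>lborel)
    \<le> ennreal K * ennreal_pow (\<integral>\<^sup>+\<zeta>. ennreal (norm \<zeta> powr ((real CARD('m) - 2) * (1 - 2 / q)) * (norm (g \<zeta>))\<^sup>2) \<partial>(lborel :: (real \<times> (real ^ 'm)) measure)) (r / 2)"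
proof -
  let ?L = "lborel :: (real \<times> (real ^ 'm)) measure"
  define \<beta> where "\<beta> = 1 - 2 / q"
  have \<beta>: "0 < \<beta>" using q by (simp add: \<beta>_def)
  obtain i j :: 'm where ij: "i \<noteq> j"
    using card card_le_Suc0_iff_eq[of "UNIV :: 'm set"] by auto
  define J where "J = UNIV - {i, j}"
  have J: "finite J" "i \<notin> J" "j \<notin> J" "J \<union> {i, j} = UNIV" by (auto simp: J_def)
  have cJ: "card J = CARD('m) - 2" using ij by (simp add: J_def card_Diff_subset)
  let ?w = "\<lambda>\<zeta> :: real \<times> (real ^ 'm). \<Prod>l\<in>J. \<bar>snd \<zeta> $ l\<bar> powr \<beta>"
  note sys = strichartz_system_line_space[OF q r qr ij J(1-3), unfolded J(4)]
  note V = lborel_eq_distr_line_space[where 'm = 'm]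
  have wm [measurable]: "?w \<in> borel_measurable borel"
    by (intro borel_measurable_prod powr_real_measurable borel_measurable_abs borel_measurable_continuous_onI continuous_intros)
  have "strichartz_system r q ?L ?L (\<bullet>) fst zk_symbol ?w"
  proof (rule strichartz_system_distr[OF sys V(1) V(1) sigma_finite_lborel V(2) sigma_finite_lborel V(2)])
    show "case_prod (\<bullet>) \<in> borel_measurable (?L \<Otimes>\<^sub>M ?L)" unfolding case_prod_beta' by measurable
    show "fst \<in> borel_measurable ?L" by (simp add: borel_measurable_continuous_onI continuous_on_fst)
    show "0 \<le> ?w \<zeta>" for \<zeta> by (simp add: prod_nonneg)
    fix y h :: "real \<times> ('m \<Rightarrow> real)"
    show "map_prod id vec_lambda y \<bullet> (map_prod id vec_lambda h :: real \<times> (real ^ 'm)) = line_pairing UNIV y h"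
      by (simp add: inner_prod_def inner_vec_def)
    show "fst (map_prod id vec_lambda h :: real \<times> (real ^ 'm)) = fst h" by simp
    show "zk_symbol (map_prod id vec_lambda h :: real \<times> (real ^ 'm)) = line_phase UNIV h"
    proof -
      have "(norm (vec_lambda (snd h) :: real ^ 'm))\<^sup>2 = (\<Sum>i\<in>UNIV. (snd h i)\<^sup>2)"
        unfolding power2_norm_eq_inner by (simp add: inner_vec_def power2_eq_square)
      then show ?thesis by (simp add: zk_symbol_def algebra_simps power3_eq_cube power2_eq_square)
    qed
    show "?w (map_prod id vec_lambda h) = line_weight J (1 - 2 / q) h" by (simp add: \<beta>_def)
  qed (use wm in simp_all)
  then obtain K where K: "0 < K" and bd: "\<And>\<theta> g. integrable ?L g \<Longrightarrow>
       (\<integral>\<^sup>+t. ennreal_pow (\<integral>\<^sup>+y. ennreal (norm (flow_on ?L (\<bullet>) fst zk_symbol \<theta> g t y) powr q) \<partial>?L) (r / q) \<partial>lborel)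
       \<le> ennreal K * ennreal_pow (\<integral>\<^sup>+h. ennreal (?w h * (norm (g h))\<^sup>2) \<partial>?L) (r / 2)"
    unfolding strichartz_system_def by (elim conjE exE, intro that) (assumption, elim allE impE, assumption+)
  have fl: "flow_on ?L (\<bullet>) fst zk_symbol 0 g t x = zk_evolution g t x" for g t x
    unfolding flow_on_def zk_evolution_def osc_def by (simp add: mult.assoc[symmetric] cis_mult)
  \<comment> \<open>The origin is excluded: for \<open>CARD('m) = 2\<close> the empty product is 1,
    whereas \<open>0 powr 0 = 0\<close>.\<close>
  have w_le: "AE \<zeta> in ?L. ?w \<zeta> \<le> norm \<zeta> powr ((real CARD('m) - 2) * \<beta>)"
    using AE_lborel_singleton[of "0 :: real \<times> (real ^ 'm)"]
  proof eventually_elim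
    case (elim \<zeta>)
    have "?w \<zeta> \<le> (\<Prod>l\<in>J. norm \<zeta> powr \<beta>)"
    proof (intro prod_mono conjI powr_mono2)
      fix l
      have "\<bar>snd \<zeta> $ l\<bar> \<le> norm (snd \<zeta>)" by (rule component_le_norm_cart)
      also have "\<dots> \<le> norm \<zeta>" using norm_snd_le[of "snd \<zeta>" "fst \<zeta>"] by simp
      finally show "\<bar>snd \<zeta> $ l\<bar> \<le> norm \<zeta>" .
    qed (use \<beta> in auto)
    also have "\<dots> = norm \<zeta> powr ((real CARD('m) - 2) * \<beta>)"
      using elim card by (simp add: cJ powr_power of_nat_diff)
    finally show ?case .
  qed
  have "(\<integral>\<^sup>+t. ennreal_pow (\<integral>\<^sup>+x. ennreal (norm (zk_evolution g t x) powr q) \<partial>lborel) (r / q) \<partial>lborel)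
    \<le> ennreal K * ennreal_pow (\<integral>\<^sup>+\<zeta>. ennreal (norm \<zeta> powr ((real CARD('m) - 2) * \<beta>) * (norm (g \<zeta>))\<^sup>2) \<partial>?L) (r / 2)"
    if g: "integrable lborel g" for g
  proof -
    have "(\<integral>\<^sup>+h. ennreal (?w h * (norm (g h))\<^sup>2) \<partial>?L) \<le> (\<integral>\<^sup>+\<zeta>. ennreal (norm \<zeta> powr ((real CARD('m) - 2) * \<beta>) * (norm (g \<zeta>))\<^sup>2) \<partial>?L)"
    proof (rule nn_integral_mono_AE)
      show "AE h in ?L. ennreal (?w h * (norm (g h))\<^sup>2) \<le> ennreal (norm h powr ((real CARD('m) - 2) * \<beta>) * (norm (g h))\<^sup>2)"
        using w_le by eventually_elim (intro ennreal_leI mult_right_mono, simp_all)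
    qed
    then have "ennreal K * ennreal_pow (\<integral>\<^sup>+h. ennreal (?w h * (norm (g h))\<^sup>2) \<partial>?L) (r / 2)
      \<le> ennreal K * ennreal_pow (\<integral>\<^sup>+\<zeta>. ennreal (norm \<zeta> powr ((real CARD('m) - 2) * \<beta>) * (norm (g \<zeta>))\<^sup>2) \<partial>?L) (r / 2)"
      using r by (intro mult_left_mono ennreal_pow_mono) auto
    with bd[OF g, of 0] show ?thesis unfolding fl by (rule order_trans)
  qed
  then show ?thesis using K unfolding \<beta>_def by (intro exI[of _ K] conjI allI impI)
qed

lemma powr_norm_add_le:
  fixes a b :: "'a :: real_normed_vector"
  assumes "0 \<le> q"
  shows "norm (a + b) powr q \<le> 2 powr q * (norm a powr q + norm b powr q)"
proof -
  have "norm (a + b) \<le> 2 * max (norm a) (norm b)" using norm_triangle_ineq[of a b] by simp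
  then have "norm (a + b) powr q \<le> (2 * max (norm a) (norm b)) powr q"
    using assms by (intro powr_mono2) auto
  also have "\<dots> = 2 powr q * max (norm a) (norm b) powr q" by (simp add: powr_mult)
  also have "\<dots> \<le> 2 powr q * (norm a powr q + norm b powr q)"
    by (intro mult_left_mono) (auto simp: max_def)
  finally show ?thesis .
qed

text \<open>For the same \<open>q\<close>, \<open>r\<^sub>0\<close> is the time exponent on the
  line. If \<open>r\<close> exceeds it, the estimate lies between the one on the line and Sobolev
  embedding at fixed time, which is the end \<open>r = \<infinity>\<close>.\<close>

theorem zk_Strichartz:
  assumes q: "2 < q" and r: "2 < r" and qr: "1 / q + 1 / r \<le> 1 / 2" and card: "2 \<le> CARD('m::finite)"
    and \<sigma>: "\<sigma> = (real CARD('m) + 1) * (1 - 2 / q) - 6 / r"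
  shows "\<exists>C>0. \<forall>g. integrable lborel g \<longrightarrow>
    (\<integral>\<^sup>+t. ennreal_pow (\<integral>\<^sup>+x. ennreal (norm (zk_evolution g t x) powr q) \<partial>lborel) (r / q) \<partial>lborel)
    \<le> ennreal C * ennreal_pow (\<integral>\<^sup>+\<zeta>. ennreal (norm \<zeta> powr \<sigma> * (norm (g \<zeta>))\<^sup>2) \<partial>(lborel :: (real \<times> (real ^ 'm)) measure)) (r / 2)"
proof -
  let ?L = "lborel :: (real \<times> (real ^ 'm)) measure"
  define r\<^sub>0 where "r\<^sub>0 = 1 / (1 / 2 - 1 / q)"
  have d: "0 < 1 / 2 - 1 / q" "1 / 2 - 1 / q < 1 / 2" using q by (simp_all add: field_simps)
  have r0: "2 < r\<^sub>0" "1 / q + 1 / r\<^sub>0 = 1 / 2" "1 / r\<^sub>0 = 1 / 2 - 1 / q"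
    using d q by (simp_all add: r\<^sub>0_def less_divide_eq)
  have "1 / r \<le> 1 / r\<^sub>0" using qr r0(3) by simp
  then have "r\<^sub>0 \<le> r" using r r0(1) by (simp add: divide_le_eq_1 field_simps)
  define c where "c = (real CARD('m) - 2) * (1 - 2 / q)"
  obtain K where K: "0 < K" and line: "\<And>g. integrable ?L g \<Longrightarrow>
    (\<integral>\<^sup>+t. ennreal_pow (\<integral>\<^sup>+x. ennreal (norm (zk_evolution g t x) powr q) \<partial>lborel) (r\<^sub>0 / q) \<partial>lborel)
    \<le> ennreal K * ennreal_pow (\<integral>\<^sup>+\<zeta>. ennreal (norm \<zeta> powr c * (norm (g \<zeta>))\<^sup>2) \<partial>?L) (r\<^sub>0 / 2)"
    using zk_Strichartz_line[OF q r0(1,2) card, folded c_def] by (elim exE conjE, intro that) (assumption, elim allE impE, assumption+)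
  define y where "y = 2 / r\<^sub>0"
  have y: "1 - 2 / q = y" "6 / r\<^sub>0 = 3 * y" using r0(3) by (simp_all add: y_def algebra_simps)
  show ?thesis
  proof (cases "r\<^sub>0 = r")
    case True
    have "\<sigma> = c" unfolding \<sigma> c_def True[symmetric] y by (simp add: algebra_simps)
    then show ?thesis using K line True by (intro exI[of _ K] conjI allI impI) auto
  next
    case False
    with \<open>r\<^sub>0 \<le> r\<close> have lt: "r\<^sub>0 < r" by simp
    define a where "a = DIM(real \<times> (real ^ 'm)) * (1 - 2 / q)"
    obtain Cs where Cs: "0 \<le> Cs" and sob: "\<And>g. integrable ?L g \<Longrightarrow>
      (\<integral>\<^sup>+x. ennreal (norm (osc g x) powr q) \<partial>lborel) \<le> ennreal Cs * ennreal_pow (\<integral>\<^sup>+z. ennreal (norm z powr a * (norm (g z))\<^sup>2) \<partial>?L) (q / 2)"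
      using osc_Sobolev[OF q, where 'a = "real \<times> (real ^ 'm)", folded a_def]
      by (elim exE conjE, intro that) (assumption, elim allE impE, assumption+)
    have cis_int: "integrable ?L (\<lambda>\<zeta>. cis (t * zk_symbol \<zeta>) * g \<zeta>)" if "integrable ?L g" for g t
      by (rule integrable_cis_mult) (use that in simp_all)
    have ev_meas: "zk_evolution g t \<in> borel_measurable borel" if "integrable ?L g" for g t
      using cis_int[OF that, of t] unfolding zk_evolution_def by (intro borel_measurable_osc) auto
    show ?thesis
    \<comment> \<open>Here \<open>a = \<sigma> + 6 / r\<close> and
      \<open>\<sigma> - c = 6 / r\<^sub>0 - 6 / r\<close>; both relations required by the
      interpolation hold with \<open>\<kappa> = 3 / r\<close>.\<close>
    proof (rule interpolate_endpoint_estimates[where m = norm and \<kappa> = "3 / r" and a = a and c = c and r\<^sub>0 = r\<^sub>0 and Cs = Cs and K = K])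
      show "sigma_finite_measure (lborel :: real measure)" "sigma_finite_measure ?L" by (rule sigma_finite_lborel)+
      have "a = (real CARD('m) + 1) * (1 - 2 / q)" by (simp add: a_def algebra_simps)
      then show "a = \<sigma> + 2 * (3 / r)" by (simp add: \<sigma>)
      have "3 / r * (2 * (r - r\<^sub>0) / r\<^sub>0) = 6 / r\<^sub>0 - 6 / r"
        using r r0(1) by (simp add: field_simps)
      then have e: "3 / r * (2 * (r - r\<^sub>0) / r\<^sub>0) = 3 * y - 6 / r" unfolding y .
      show "\<sigma> = c + 3 / r * (2 * (r - r\<^sub>0) / r\<^sub>0)"
        unfolding \<sigma> c_def y e by (simp add: algebra_simps)
      show "2 \<le> r\<^sub>0" using r0(1) by simp
      fix g :: "real \<times> (real ^ 'm) \<Rightarrow> complex" assume g: "integrable ?L g"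
      show "(\<lambda>t. \<integral>\<^sup>+x. ennreal (norm (zk_evolution g t x) powr q) \<partial>lborel) \<in> borel_measurable lborel"
        by (rule zk_evolution_power_measurable) (use g in auto)
      show "(\<integral>\<^sup>+x. ennreal (norm (zk_evolution g t x) powr q) \<partial>lborel) \<le> ennreal Cs * ennreal_pow (\<integral>\<^sup>+z. ennreal (norm z powr a * (norm (g z))\<^sup>2) \<partial>?L) (q / 2)" for t
        using sob[OF cis_int[OF g, of t]] unfolding zk_evolution_def by (simp add: norm_mult)
      fix f :: "real \<times> (real ^ 'm) \<Rightarrow> complex" and t assume f: "integrable ?L f"
      have [measurable]: "zk_evolution f t \<in> borel_measurable borel" "zk_evolution g t \<in> borel_measurable borel"
        using ev_meas f g by auto
      have sum: "zk_evolution (\<lambda>z. f z + g z) t x = zk_evolution f t x + zk_evolution g t x" for x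
      proof -
        have "integrable ?L (\<lambda>\<zeta>. cis (x \<bullet> \<zeta>) * (cis (t * zk_symbol \<zeta>) * f \<zeta>))" "integrable ?L (\<lambda>\<zeta>. cis (x \<bullet> \<zeta>) * (cis (t * zk_symbol \<zeta>) * g \<zeta>))"
          by (rule integrable_cis_mult[OF _ cis_int]; use f g in measurable)+
        then show ?thesis unfolding zk_evolution_def osc_def distrib_left by (rule Bochner_Integration.integral_add)
      qed
      have "(\<integral>\<^sup>+x. ennreal (norm (zk_evolution (\<lambda>z. f z + g z) t x) powr q) \<partial>lborel)
        \<le> (\<integral>\<^sup>+x. ennreal (2 powr q) * (ennreal (norm (zk_evolution f t x) powr q) + ennreal (norm (zk_evolution g t x) powr q)) \<partial>lborel)"
        unfolding sum using powr_norm_add_le[of q] q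
        by (intro nn_integral_mono) (simp add: ennreal_leI flip: ennreal_plus ennreal_mult)
      also have "\<dots> = ennreal (2 powr q) * ((\<integral>\<^sup>+x. ennreal (norm (zk_evolution f t x) powr q) \<partial>lborel) + (\<integral>\<^sup>+x. ennreal (norm (zk_evolution g t x) powr q) \<partial>lborel))"
        by (subst nn_integral_cmult, measurable, subst nn_integral_add) measurable
      finally show "(\<integral>\<^sup>+x. ennreal (norm (zk_evolution (\<lambda>z. f z + g z) t x) powr q) \<partial>lborel)
        \<le> ennreal (2 powr q) * ((\<integral>\<^sup>+x. ennreal (norm (zk_evolution f t x) powr q) \<partial>lborel) + (\<integral>\<^sup>+x. ennreal (norm (zk_evolution g t x) powr q) \<partial>lborel))" .
    qed (use q lt Cs K line in auto)
  qed
qed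

theorem proposition1p3:
  fixes d :: nat and q r s :: real
  assumes "d \<ge> 3" and "d = CARD('m::finite) + 1"
    and "q \<ge> 2" and "r \<ge> 2" and "2 / q + 2 / r \<le> 1"
    and "s = real d * (1 / 2 - 1 / q) - 3 / r"
  shows "\<exists>C::real. C \<ge> 0 \<and>
    (\<forall>u0 \<in> (schwartz :: (real \<times> (real ^ 'm) \<Rightarrow> complex) set).
       mixed_norm r q (\<lambda>t. U t u0) \<le> ennreal C * sobolev_norm s u0)"
proof -
  let ?L = "lborel :: (real \<times> (real ^ 'm)) measure"
  have q: "2 < q" and r: "2 < r"
  proof -
    have "0 < 2 / q" "0 < 2 / r" using assms(3,4) by auto
    then have "2 / q < 1" "2 / r < 1" using assms(5) by linarith+
    then show "2 < q" "2 < r" using assms(3,4) by (simp_all add: divide_less_eq_1)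
  qed
  have card: "2 \<le> CARD('m)" using assms(1,2) by simp
  have qr: "1 / q + 1 / r \<le> 1 / 2" using assms(5) by simp
  \<comment> \<open>The index is doubled because the weight multiplies the squared
    amplitude.\<close>
  have s2: "2 * s = (real CARD('m) + 1) * (1 - 2 / q) - 6 / r"
  proof -
    define e where "e = 1 / 2 - 1 / q"
    have e: "1 - 2 / q = 2 * e" by (simp add: e_def)
    show ?thesis unfolding e using assms(6) unfolding e_def[symmetric] assms(2) by (simp add: algebra_simps)
  qed
  \<comment> \<open>Follows from \<open>1/r \<le> 1/2 - 1/q\<close> and \<open>d \<ge> 3\<close>. A
    nonnegative index makes the homogeneous weight at most the inhomogeneous one, see
    \<open>IS\<close>.\<close>
  have s0: "0 \<le> s"
  proof -
    have "3 / r \<le> 3 * (1 / 2 - 1 / q)" using qr by simp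
    also have "\<dots> \<le> real d * (1 / 2 - 1 / q)"
      using assms(1) q by (intro mult_right_mono) (simp_all add: field_simps)
    finally show ?thesis using assms(6) by simp
  qed
  obtain C where C: "0 < C" and bd: "\<And>g. integrable ?L g \<Longrightarrow>
    (\<integral>\<^sup>+t. ennreal_pow (\<integral>\<^sup>+x. ennreal (norm (zk_evolution g t x) powr q) \<partial>lborel) (r / q) \<partial>lborel)
    \<le> ennreal C * ennreal_pow (\<integral>\<^sup>+\<zeta>. ennreal (norm \<zeta> powr (2 * s) * (norm (g \<zeta>))\<^sup>2) \<partial>?L) (r / 2)"
    using zk_Strichartz[OF q r qr card s2] by (elim exE conjE, intro that) (assumption, elim allE impE, assumption+)
  have "mixed_norm r q (\<lambda>t. U t u0) \<le> ennreal (C powr (1 / r)) * sobolev_norm s u0" for u0 :: "real \<times> (real ^ 'm) \<Rightarrow> complex"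
  proof -
    let ?g = "fourier u0"
    define k :: real where "k = 1 / (2 * pi) ^ DIM(real \<times> (real ^ 'm))"
    have "1 \<le> (2 * pi) ^ DIM(real \<times> (real ^ 'm))" using pi_gt3 by (intro one_le_power) simp
    then have k: "0 \<le> k" "k \<le> 1" unfolding k_def by (simp_all only: divide_le_eq_1_pos zero_le_divide_1_iff)
    have U: "U t u0 x = k *\<^sub>R zk_evolution ?g t x" for t x
      unfolding U_def inv_fourier_def zk_evolution_def osc_def k_def zk_symbol_def
      by (simp add: scaleR_conv_of_real case_prod_beta mult.assoc)
    have mono: "mixed_norm r q (\<lambda>t. U t u0)
      \<le> ennreal_pow (\<integral>\<^sup>+t. ennreal_pow (\<integral>\<^sup>+x. ennreal (norm (zk_evolution ?g t x) powr q) \<partial>lborel) (r / q) \<partial>lborel) (1 / r)"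
      unfolding mixed_norm_def
    proof (intro ennreal_pow_mono nn_integral_mono)
      fix t
      have "norm (U t u0 x) powr q \<le> norm (zk_evolution ?g t x) powr q" for x
        unfolding U using k q by (intro powr_mono2) (auto intro: mult_left_le_one_le)
      then have "ennreal_pow (\<integral>\<^sup>+x. ennreal (norm (U t u0 x) powr q) \<partial>lborel) (r / q)
        \<le> ennreal_pow (\<integral>\<^sup>+x. ennreal (norm (zk_evolution ?g t x) powr q) \<partial>lborel) (r / q)"
        using q r by (intro ennreal_pow_mono nn_integral_mono ennreal_leI) auto
      moreover have "ennreal_pow (Lp_norm q (U t u0)) r = ennreal_pow (\<integral>\<^sup>+x. ennreal (norm (U t u0 x) powr q) \<partial>lborel) (r / q)"
        using q r by (simp add: Lp_norm_def ennreal_pow_pow)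
      \<comment> \<open>The time interval is enlarged to the whole line.\<close>
      ultimately show "ennreal_pow (Lp_norm q (U t u0)) r * indicator {0..1} t
        \<le> ennreal_pow (\<integral>\<^sup>+x. ennreal (norm (zk_evolution ?g t x) powr q) \<partial>lborel) (r / q)"
        by (simp split: split_indicator)
    qed (use r in auto)
    show ?thesis
    proof (cases "integrable ?L ?g")
      case False
      have "zk_evolution ?g t x = 0" for t x
      proof -
        \<comment> \<open>Unimodular factors can be undone, so the integrand of the flow is not
          integrable either, and its Bochner integral is 0 by convention.\<close>
        have "\<not> integrable ?L (\<lambda>\<zeta>. cis (x \<bullet> \<zeta>) * (cis (t * zk_symbol \<zeta>) * ?g \<zeta>))"
        proof
          assume *: "integrable ?L (\<lambda>\<zeta>. cis (x \<bullet> \<zeta>) * (cis (t * zk_symbol \<zeta>) * ?g \<zeta>))"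
          have "integrable ?L (\<lambda>\<zeta>. cis (- (x \<bullet> \<zeta>) - t * zk_symbol \<zeta>) * (cis (x \<bullet> \<zeta>) * (cis (t * zk_symbol \<zeta>) * ?g \<zeta>)))"
            by (rule integrable_cis_mult[OF _ *]) measurable
          then have "integrable ?L ?g" by (simp add: mult.assoc[symmetric] cis_mult)
          with False show False ..
        qed
        then show ?thesis unfolding zk_evolution_def osc_def by (rule not_integrable_integral_eq)
      qed
      then show ?thesis using mono q r by (simp add: top_unique)
    next
      case True
      let ?I = "\<integral>\<^sup>+\<zeta>. ennreal (norm \<zeta> powr (2 * s) * (norm (?g \<zeta>))\<^sup>2) \<partial>?L"
      let ?S = "\<integral>\<^sup>+\<zeta>. ennreal ((1 + (norm \<zeta>)\<^sup>2) powr s * (norm (?g \<zeta>))\<^sup>2) \<partial>?L"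
      have IS: "?I \<le> ?S"
      proof (rule nn_integral_mono)
        fix \<zeta> :: "real \<times> (real ^ 'm)"
        have "norm \<zeta> powr (2 * s) = ((norm \<zeta>)\<^sup>2) powr s"
          by (cases "\<zeta> = 0") (simp_all add: powr_powr flip: powr_numeral)
        also have "\<dots> \<le> (1 + (norm \<zeta>)\<^sup>2) powr s" using s0 by (intro powr_mono2) auto
        finally show "ennreal (norm \<zeta> powr (2 * s) * (norm (?g \<zeta>))\<^sup>2) \<le> ennreal ((1 + (norm \<zeta>)\<^sup>2) powr s * (norm (?g \<zeta>))\<^sup>2)"
          by (intro ennreal_leI mult_right_mono) auto
      qed
      note mono
      also have "ennreal_pow (\<integral>\<^sup>+t. ennreal_pow (\<integral>\<^sup>+x. ennreal (norm (zk_evolution ?g t x) powr q) \<partial>lborel) (r / q) \<partial>lborel) (1 / r)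
        \<le> ennreal_pow (ennreal C * ennreal_pow ?I (r / 2)) (1 / r)"
        using r by (intro ennreal_pow_mono bd True) auto
      also have "\<dots> = ennreal (C powr (1 / r)) * ennreal_pow ?I (1 / 2)"
        using r C by (simp add: ennreal_pow_mult ennreal_pow_pow ennreal_pow_ennreal)
      also have "\<dots> \<le> ennreal (C powr (1 / r)) * ennreal_pow ?S (1 / 2)"
        by (intro mult_left_mono ennreal_pow_mono IS) auto
      finally show ?thesis unfolding sobolev_norm_def .
    qed
  qed
  then show ?thesis by (intro exI[of _ "C powr (1 / r)"]) simp
qed

end
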